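(* Let $m_1,m_2\in\mathbb{N}$, $m=m_1+m_2$. (Direct part.) Suppose $v\in\big[C^1([0,\infty))\big]^{m_1\times m_2}$, and let $\mathcal{A}(x,\ell)$, $(x,\ell)\in\mathbb{R}^2_{+,+}:=\{(x,\ell)\in\mathbb{R}^2 : x\ge 0,\ \ell\ge 0\}$, be the $\mathcal{A}$-function of the Dirac-type system with potential $v$ (see context). Then $\mathcal{A}(\cdot,\cdot)\in\big[C^1(\mathbb{R}^2_{+,+})\big]^{m_2\times m_1}$ and for all $(x,\ell)\in\mathbb{R}^2_{+,+}$ \[ \frac{\partial}{\partial \ell}\mathcal{A}(x,\ell)=\frac{\partial}{\partial x}\mathcal{A}(x,\ell)+\int_0^x \mathcal{A}(x-t,\ell)\,\mathcal{A}(0,\ell)^*\,\mathcal{A}(t,\ell)\,dt. \tag{$*$} \] (Inverse part.) Conversely, let $\mathcal{A}_0\in\big[C^1([0,\infty))\big]^{m_2\times m_1}$ be such that for every $T\in(0,\infty)$ the operator $S_T$ on $\big[L^2((0,T))\big]^{m_2}$, \[ (S_Tf)(x)=f(x)-\int_0^T s(x,t)f(t)\,dt,\qquad s(x,t)=\int_0^{\min(x,t)}\mathcal{A}_0(x-\xi)\mathcal{A}_0(t-\xi)^*\,d\xi, \] is strictly positive definite (i.e., $S_T\ge \varepsilon I$ for some $\varepsilon>0$). Then the integro-differential equation $( * )$ with initial condition $\mathcal{A}(x,0)=\mathcal{A}_0(x)$, $x\ge 0$, has a unique solution $\mathcal{A}(\cdot,\cdot)\in\big[C^1(\mathbb{R}^2_{+,+})\big]^{m_2\times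 m_1}$; moreover there exists a potential $v\in\big[C^1([0,\infty))\big]^{m_1\times m_2}$ whose $\mathcal{A}$-function is this solution, and this potential is given by $v(\ell)=-i\,\mathcal{A}(0,\ell)^*$ for $\ell\ge 0$.
   Context: Dirac-type system: $y'(x,z)=i\big(zJ+JV(x)\big)y(x,z)$, $x\ge 0$, with $J=\begin{bmatrix}I_{m_1}&0\\0&-I_{m_2}\end{bmatrix}$, $V=\begin{bmatrix}0_{m_1}&v\\ v^*&0_{m_2}\end{bmatrix}$, where $v$ is an $m_1\times m_2$ matrix function with locally integrable entries. For $\ell\ge0$, $u_\ell(x,z)$ denotes the $m\times m$ fundamental solution with $u_\ell(\ell,z)=I_m$. The Weyl–Titchmarsh function $\varphi_\ell(z)$ on $[\ell,\infty)$ is the (unique, existing) $m_2\times m_1$ matrix function holomorphic in $\mathbb{C}_+=\{\Im z>0\}$ such that $u_\ell(\cdot,z)\begin{bmatrix}I_{m_1}\\ \varphi_\ell(z)\end{bmatrix}$ has entries in $L^2((\ell,\infty))$. For $v\in C^1$, for each $\ell\ge 0$ there is a unique function $\Phi(\cdot,\ell)\in\big[C^2([0,\infty))\big]^{m_2\times m_1}$ with $\varphi_\ell(z)=2iz\int_0^\infty e^{2ixz}\Phi(x,\ell)\,dx$ for $\Im z>0$; the $\mathcal{A}$-function is $\mathcal{A}(x,\ell):=\frac{\partial}{\partial x}\Phi(x,\ell)$, and $\mathcal{A}(x):=\mathcal{A}(x,0)$. *)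

theory Defs
  imports "HOL-Analysis.Analysis"
begin

text \<open>Matrices are HOL-Analysis matrices: a p x q complex matrix with row index type 'r
  and column index type 'c has type complex^'c^'r.  The block size m1 (resp. m2) is the
  cardinality of the finite type 'm1 (resp. 'm2); the full index type is 'm1 + 'm2,
  with Inl indices forming the first block.\<close>

definition madj :: "complex^'c^'r \<Rightarrow> complex^'r^'c" where
  "madj M = (\<chi> i j. cnj (M $ j $ i))"

definition mscale :: "complex \<Rightarrow> complex^'c^'r \<Rightarrow> complex^'c^'r" where
  "mscale c M = (\<chi> i j. c * M $ i $ j)"

definition Jmat :: "complex^('m1::finite + 'm2::finite)^('m1 + 'm2)" where
  "Jmat = (\<chi> i j. if i = j then (case i of Inl _ \<Rightarrow> 1 | Inr _ \<Rightarrow> -1) else 0)"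

definition Vmat :: "complex^'m2^'m1 \<Rightarrow> complex^('m1::finite + 'm2::finite)^('m1 + 'm2)" where
  "Vmat w = (\<chi> i j. case i of
       Inl a \<Rightarrow> (case j of Inl _ \<Rightarrow> 0 | Inr b \<Rightarrow> w $ a $ b)
     | Inr a \<Rightarrow> (case j of Inl b \<Rightarrow> cnj (w $ b $ a) | Inr _ \<Rightarrow> 0))"

definition dirac_coeff :: "(real \<Rightarrow> complex^'m2^'m1) \<Rightarrow> complex \<Rightarrow> real
     \<Rightarrow> complex^('m1::finite + 'm2::finite)^('m1 + 'm2)" where
  "dirac_coeff v z x = mscale \<i> (mscale z Jmat + Jmat ** Vmat (v x))"

text \<open>Fundamental solution u_l(.,z) on [0,oo), normalized u_l(l,z) = I; set to 0 for x<0
  (only to make the defining description unique as a HOL function).\<close>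
definition is_fund_sol :: "(real \<Rightarrow> complex^'m2^'m1) \<Rightarrow> real \<Rightarrow> complex
     \<Rightarrow> (real \<Rightarrow> complex^('m1::finite + 'm2::finite)^('m1 + 'm2)) \<Rightarrow> bool" where
  "is_fund_sol v l z u \<longleftrightarrow>
     (\<forall>x\<ge>0. (u has_vector_derivative (dirac_coeff v z x ** u x)) (at x within {0..}))
     \<and> u l = mat 1 \<and> (\<forall>x<0. u x = 0)"

definition fund_sol :: "(real \<Rightarrow> complex^'m2^'m1) \<Rightarrow> real \<Rightarrow> complex
     \<Rightarrow> real \<Rightarrow> complex^('m1::finite + 'm2::finite)^('m1 + 'm2)" where
  "fund_sol v l z = (THE u. is_fund_sol v l z u)"

definition stack_I :: "complex^'m1^'m2 \<Rightarrow> complex^'m1^('m1::finite + 'm2::finite)" where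
  "stack_I p = (\<chi> i j. case i of Inl a \<Rightarrow> (if a = j then 1 else 0) | Inr b \<Rightarrow> p $ b $ j)"

definition is_weyl :: "(real \<Rightarrow> complex^'m2^'m1) \<Rightarrow> real
     \<Rightarrow> (complex \<Rightarrow> complex^'m1^'m2) \<Rightarrow> bool" where
  "is_weyl v l \<phi> \<longleftrightarrow>
     (\<forall>i j. (\<lambda>z. \<phi> z $ i $ j) holomorphic_on {z. Im z > 0})
     \<and> (\<forall>z. Im z > 0 \<longrightarrow> (\<forall>i j.
          (\<lambda>x. (cmod ((fund_sol v l z x ** stack_I (\<phi> z)) $ i $ j))\<^sup>2) integrable_on {l<..}))
     \<and> (\<forall>z. Im z \<le> 0 \<longrightarrow> \<phi> z = 0)"

definition weyl :: "(real \<Rightarrow> complex^'m2^'m1) \<Rightarrow> real \<Rightarrow> complex \<Rightarrow> complex^'m1^'m2::finite"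
  where "weyl v l = (THE \<phi>. is_weyl v l \<phi>)"

definition C1_nonneg :: "(real \<Rightarrow> 'a::real_normed_vector) \<Rightarrow> bool" where
  "C1_nonneg f \<longleftrightarrow> (\<exists>D. (\<forall>x\<ge>0. (f has_vector_derivative D x) (at x within {0..}))
                        \<and> continuous_on {0..} D)"

definition C2_nonneg :: "(real \<Rightarrow> 'a::real_normed_vector) \<Rightarrow> bool" where
  "C2_nonneg f \<longleftrightarrow> (\<exists>D1 D2. (\<forall>x\<ge>0. (f has_vector_derivative D1 x) (at x within {0..})
                        \<and> (D1 has_vector_derivative D2 x) (at x within {0..}))
                        \<and> continuous_on {0..} D2)"

definition is_Phi :: "(real \<Rightarrow> complex^'m2^'m1) \<Rightarrow> real
     \<Rightarrow> (real \<Rightarrow> complex^'m1^'m2::finite) \<Rightarrow> bool" where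
  "is_Phi v l \<Phi> \<longleftrightarrow> C2_nonneg \<Phi>
     \<and> (\<forall>z. Im z > 0 \<longrightarrow> (\<forall>i j. \<exists>I.
          ((\<lambda>x. exp (2 * \<i> * complex_of_real x * z) * \<Phi> x $ i $ j) has_integral I) {0..}
          \<and> weyl v l z $ i $ j = 2 * \<i> * z * I))
     \<and> (\<forall>x<0. \<Phi> x = 0)"

definition Phi :: "(real \<Rightarrow> complex^'m2^'m1) \<Rightarrow> real \<Rightarrow> real \<Rightarrow> complex^'m1^'m2::finite"
  where "Phi v l = (THE \<Phi>. is_Phi v l \<Phi>)"

definition A_fun :: "(real \<Rightarrow> complex^'m2^'m1::finite) \<Rightarrow> real \<Rightarrow> real \<Rightarrow> complex^'m1^'m2::finite"
  where "A_fun v x l = vector_derivative (Phi v l) (at x within {0..})"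

definition quadrant :: "(real \<times> real) set" where
  "quadrant = {p. fst p \<ge> 0 \<and> snd p \<ge> 0}"

definition C1_quadrant_with :: "(real \<times> real \<Rightarrow> 'a::real_normed_vector)
     \<Rightarrow> (real \<times> real \<Rightarrow> 'a) \<Rightarrow> (real \<times> real \<Rightarrow> 'a) \<Rightarrow> bool" where
  "C1_quadrant_with f Dx Dl \<longleftrightarrow> continuous_on quadrant Dx \<and> continuous_on quadrant Dl
     \<and> (\<forall>p\<in>quadrant. (f has_derivative (\<lambda>h. fst h *\<^sub>R Dx p + snd h *\<^sub>R Dl p)) (at p within quadrant))"

definition A_equation_solution :: "(real \<times> real \<Rightarrow> complex^'m1^'m2::finite) \<Rightarrow> bool" where
  "A_equation_solution A \<longleftrightarrow> (\<exists>Dx Dl. C1_quadrant_with A Dx Dl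
     \<and> (\<forall>x l. x \<ge> 0 \<longrightarrow> l \<ge> 0 \<longrightarrow>
          Dl (x, l) = Dx (x, l) + integral {0..x} (\<lambda>t. A (x - t, l) ** madj (A (0, l)) ** A (t, l))))"

definition s_kernel :: "(real \<Rightarrow> complex^'m1^'m2) \<Rightarrow> real \<Rightarrow> real \<Rightarrow> complex^'m2^'m2::finite" where
  "s_kernel A0 x t = integral {0..min x t} (\<lambda>\<xi>. A0 (x - \<xi>) ** madj (A0 (t - \<xi>)))"

definition S_op :: "(real \<Rightarrow> complex^'m1^'m2) \<Rightarrow> real \<Rightarrow> (real \<Rightarrow> complex^'m2::finite) \<Rightarrow> real \<Rightarrow> complex^'m2"
  where "S_op A0 T f x = f x - (LINT t:{0..T}|lborel. s_kernel A0 x t *v f t)"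

definition cinner :: "complex^'n::finite \<Rightarrow> complex^'n \<Rightarrow> complex" where
  "cinner u w = (\<Sum>i\<in>UNIV. u $ i * cnj (w $ i))"

definition L2_on :: "real \<Rightarrow> (real \<Rightarrow> complex^'n::finite) \<Rightarrow> bool" where
  "L2_on T f \<longleftrightarrow> f \<in> borel_measurable lborel \<and> set_integrable lborel {0..T} (\<lambda>x. (norm (f x))\<^sup>2)"

definition S_strictly_positive :: "(real \<Rightarrow> complex^'m1^'m2::finite) \<Rightarrow> bool" where
  "S_strictly_positive A0 \<longleftrightarrow> (\<forall>T>0. \<exists>\<epsilon>>0. \<forall>f. L2_on T f \<longrightarrow>
      Re (LINT x:{0..T}|lborel. cinner (S_op A0 T f x) (f x))
        \<ge> \<epsilon> * (LINT x:{0..T}|lborel. (norm (f x))\<^sup>2))"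

end

theory Submission
  imports Defs "HOL-Complex_Analysis.Complex_Analysis"
begin

unbundle no fps_syntax

text \<open>Along the characteristics \<open>x + l = const\<close> the equation for \<open>A\<close> becomes the integral equation
  \<open>A(x, l) = a(x + l) - \<integral>\<^sub>0\<^sup>x Q(u, x + l - u) du\<close> with \<open>a(l) = A(0, l)\<close>. It is uniquely solvable
  for every \<open>a \<in> C\<^sup>1\<close>, by a contraction in an exponentially weighted norm applied to the pair
  of \<open>A\<close> and its derivative in \<open>l\<close>.

  Put \<open>a = - i v\<^sup>*\<close>. The solution \<open>A(\<cdot>, l)\<close> is the impulse response at depth \<open>l\<close> of the
  time-dependent Dirac system, whose waves obey a conservation law of energy. Their Laplace transforms in time
  solve the Dirac system up to a small error, which gives
  \<open>\<phi>\<^sub>l(z) = 2 i z \<integral> exp (2 i x z) \<Phi>(x, l) dx\<close> with \<open>\<partial>\<^sub>x \<Phi> = A\<close>;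
  by uniqueness of the Weyl function and Lerch's theorem \<open>A\<close> is the \<open>A\<close>-function of \<open>v\<close>. The
  energy identity shows in addition that the solution \<open>g\<close> of \<open>S\<^sub>l g = A(\<cdot>, 0)\<close> on \<open>[0, l]\<close>
  satisfies \<open>g(l) = a(l)\<close>.

  Conversely, positivity of \<open>S\<^sub>l\<close> makes \<open>S\<^sub>l g\<^sub>l = A\<^sub>0\<close> uniquely solvable, and
  \<open>a(l) := g\<^sub>l(l)\<close> is \<open>C\<^sup>1\<close>. For the solution \<open>A\<close> belonging to this \<open>a\<close>, the equations with right-hand
  sides \<open>A\<^sub>0\<close> and \<open>A(\<cdot>, 0)\<close> have the same end values \<open>a(l)\<close>, and Gronwall's inequality
  gives \<open>A(\<cdot>, 0) = A\<^sub>0\<close>. Uniqueness holds because \<open>A(0, l) = g\<^sub>l(l)\<close> is determined by \<open>A\<^sub>0\<close>.\<close>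

section \<open>Matrices and iterated integrals\<close>

text \<open>The convolution tames the quadratic term: since exp (k (u - t)) exp (k t) = exp (k u), a
  product of two functions of growth exp (k x) keeps this growth, and the integration along the
  characteristic gains a factor 1/k. Hence the solution is global although the equation is
  nonlinear.

  The kernel s is that of K K*, where K is convolution with A_0 on [0, T]. So \<open>S_op\<close> is
  I - K K*, and strict positivity means that K is a strict contraction. The energy law gives the
  weak inequality for every v in C^1, with no bound on its size; it takes the place of spectral
  theory and puts the Laplace transforms of the waves into L^2, uniformly in the recording time T.
  The input there is a unit step, not an impulse: its waves are continuous with energy growing only
  linearly in T, and its response is Phi itself.

  The inverse part rests on one sup-norm bound for the inverses of all S_l with l <= T. It comes
  from the positivity of S_T alone, tested on functions that vanish beyond l, and it yields
  existence, differentiability in l and the comparison of two right-hand sides.\<close>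

lemma norm_vec_power2: "(norm (x :: 'a::real_normed_vector ^'n))\<^sup>2 = (\<Sum>i\<in>UNIV. (norm (x $ i))\<^sup>2)"
  by (simp add: norm_vec_def L2_set_def sum_nonneg)

lemma norm_mat_power2: "(norm (M :: complex^'c^'r))\<^sup>2 = (\<Sum>i\<in>UNIV. \<Sum>j\<in>UNIV. (cmod (M $ i $ j))\<^sup>2)"
  by (simp add: norm_vec_power2)

text \<open>The norm of the nested vector type is the Frobenius norm, so this is Cauchy-Schwarz in
  every entry of the product, summed over the entries.\<close>

lemma norm_matrix_mult: "norm ((A :: complex^'c^'r) ** (B :: complex^'d^'c)) \<le> norm A * norm B"
proof -
  have "(norm (A ** B))\<^sup>2 \<le> (norm A * norm B)\<^sup>2"
  proof -
    have entry: "(cmod ((A ** B) $ i $ j))\<^sup>2 \<le> (\<Sum>k\<in>UNIV. (cmod (A $ i $ k))\<^sup>2) * (\<Sum>k\<in>UNIV. (cmod (B $ k $ j))\<^sup>2)" for i j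
    proof -
      have "cmod ((A ** B) $ i $ j) \<le> (\<Sum>k\<in>UNIV. cmod (A $ i $ k) * cmod (B $ k $ j))"
        unfolding matrix_matrix_mult_def by (simp add: norm_mult[symmetric] sum_norm_le)
      then have "(cmod ((A ** B) $ i $ j))\<^sup>2 \<le> (\<Sum>k\<in>UNIV. cmod (A $ i $ k) * cmod (B $ k $ j))\<^sup>2"
        by (simp add: power_mono)
      also have "\<dots> \<le> (\<Sum>k\<in>UNIV. (cmod (A $ i $ k))\<^sup>2) * (\<Sum>k\<in>UNIV. (cmod (B $ k $ j))\<^sup>2)"
        by (rule Cauchy_Schwarz_ineq_sum)
      finally show ?thesis .
    qed
    have "(norm (A ** B))\<^sup>2 \<le> (\<Sum>i\<in>UNIV. \<Sum>j\<in>UNIV. (\<Sum>k\<in>UNIV. (cmod (A $ i $ k))\<^sup>2) * (\<Sum>k\<in>UNIV. (cmod (B $ k $ j))\<^sup>2))"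
      unfolding norm_mat_power2 by (intro sum_mono entry)
    also have "\<dots> = (\<Sum>i\<in>UNIV. \<Sum>k\<in>UNIV. (cmod (A $ i $ k))\<^sup>2) * (\<Sum>j\<in>UNIV. \<Sum>k\<in>UNIV. (cmod (B $ k $ j))\<^sup>2)"
      by (simp add: sum_product)
    also have "\<dots> = (norm A * norm B)\<^sup>2"
      unfolding power_mult_distrib norm_mat_power2 by (subst (2) sum.swap) simp
    finally show ?thesis .
  qed
  then show ?thesis by (rule power2_le_imp_le) simp
qed

lemma bounded_bilinear_matrix_mult: "bounded_bilinear ((**) :: complex^'c^'r \<Rightarrow> complex^'d^'c \<Rightarrow> complex^'d^'r)"
proof (rule bounded_bilinear.intro)
  show "\<exists>K. \<forall>a b. norm ((a :: complex^'c^'r) ** (b :: complex^'d^'c)) \<le> norm a * norm b * K"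
    by (rule exI[of _ 1]) (simp add: norm_matrix_mult)
qed (auto simp: matrix_matrix_mult_def vec_eq_iff sum.distrib algebra_simps scaleR_sum_right)

interpretation mm: bounded_bilinear "(**) :: complex^'c^'r \<Rightarrow> complex^'d^'c \<Rightarrow> complex^'d^'r"
  by (rule bounded_bilinear_matrix_mult)

lemma madj_nth [simp]: "madj M $ i $ j = cnj (M $ j $ i)"
  by (simp add: madj_def)

lemma madj_madj [simp]: "madj (madj M) = M"
  by (simp add: vec_eq_iff)

lemma norm_madj [simp]: "norm (madj (M :: complex^'c^'r)) = norm M"
proof -
  have "(norm (madj M))\<^sup>2 = (norm M)\<^sup>2"
    unfolding norm_mat_power2 by (subst sum.swap) simp
  then show ?thesis by simp
qed

lemma bounded_linear_madj: "bounded_linear (madj :: complex^'c^'r \<Rightarrow> _)"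
  by (rule bounded_linear_intro[of _ 1]) (auto simp: vec_eq_iff)

lemmas continuous_on_madj [continuous_intros] = bounded_linear.continuous_on[OF bounded_linear_madj]

lemma madj_diff: "madj (A - B) = madj A - madj B"
  by (simp add: vec_eq_iff)

lemma mscale_nth [simp]: "mscale c M $ i $ j = c * M $ i $ j"
  by (simp add: mscale_def)

lemma norm_mscale: "norm (mscale c (M :: complex^'c^'r)) = cmod c * norm M"
proof -
  have "(norm (mscale c M))\<^sup>2 = (cmod c * norm M)\<^sup>2"
    unfolding power_mult_distrib norm_mat_power2 by (simp add: norm_mult power_mult_distrib sum_distrib_left)
  then show ?thesis by simp
qed

lemma bounded_bilinear_mscale: "bounded_bilinear (mscale :: complex \<Rightarrow> complex^'c^'r \<Rightarrow> _)"
proof (rule bounded_bilinear.intro)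
  show "\<exists>K. \<forall>a b. norm (mscale a (b :: complex^'c^'r)) \<le> norm a * norm b * K"
    by (rule exI[of _ 1]) (simp add: norm_mscale)
qed (auto simp: vec_eq_iff algebra_simps)

interpretation ms: bounded_bilinear "mscale :: complex \<Rightarrow> complex^'c^'r \<Rightarrow> complex^'c^'r"
  by (rule bounded_bilinear_mscale)

lemma mscale_mult_left: "mscale c A ** B = mscale c (A ** B)"
  and mscale_mult_right: "A ** mscale c B = mscale c (A ** B)"
  by (simp_all add: vec_eq_iff matrix_matrix_mult_def sum_distrib_left mult_ac)

lemma mscale_mscale [simp]: "mscale c (mscale d A) = mscale (c * d) A"
  and mscale_one [simp]: "mscale 1 A = A"
  by (simp_all add: vec_eq_iff mult_ac)

lemma inner_mat: "(M :: complex^'c^'r) \<bullet> N = Re (\<Sum>i\<in>UNIV. \<Sum>j\<in>UNIV. M $ i $ j * cnj (N $ i $ j))"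
  by (simp add: inner_vec_def inner_complex_def)

text \<open>The real inner product of matrices is the real part of the trace form, for which left
  multiplication by \<open>madj a\<close> is adjoint to left multiplication by \<open>a\<close>.
  This duality makes the coupling terms of two waves cancel in the energy identity.\<close>

lemma inner_madj_left: "((madj a ** R) :: complex^'k^'c) \<bullet> P = R \<bullet> ((a :: complex^'c^'r) ** P)"
proof -
  have "(\<Sum>i\<in>UNIV. \<Sum>j\<in>UNIV. (madj a ** R) $ i $ j * cnj (P $ i $ j)) =
     (\<Sum>i\<in>UNIV. \<Sum>j\<in>UNIV. \<Sum>k\<in>UNIV. cnj (a $ k $ i) * R $ k $ j * cnj (P $ i $ j))"
    by (simp add: matrix_matrix_mult_def sum_distrib_right)
  also have "\<dots> = (\<Sum>i\<in>UNIV. \<Sum>k\<in>UNIV. \<Sum>j\<in>UNIV. cnj (a $ k $ i) * R $ k $ j * cnj (P $ i $ j))"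
    by (rule sum.cong[OF refl], rule sum.swap)
  also have "\<dots> = (\<Sum>k\<in>UNIV. \<Sum>i\<in>UNIV. \<Sum>j\<in>UNIV. cnj (a $ k $ i) * R $ k $ j * cnj (P $ i $ j))"
    by (rule sum.swap)
  also have "\<dots> = (\<Sum>k\<in>UNIV. \<Sum>j\<in>UNIV. \<Sum>i\<in>UNIV. cnj (a $ k $ i) * R $ k $ j * cnj (P $ i $ j))"
    by (rule sum.cong[OF refl], rule sum.swap)
  also have "\<dots> = (\<Sum>k\<in>UNIV. \<Sum>j\<in>UNIV. R $ k $ j * cnj ((a ** P) $ k $ j))"
    by (simp add: matrix_matrix_mult_def sum_distrib_left mult_ac)
  finally show ?thesis unfolding inner_mat by simp
qed

lemma inner_madj_right: "P \<bullet> ((madj a ** R) :: complex^'k^'c) = ((a :: complex^'c^'r) ** P) \<bullet> R"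
  using inner_madj_left[of a R P] by (simp add: inner_commute)

section \<open>Integrals with variable limits: continuity, Fubini, differentiation\<close>

lemma continuous_on_uncurry:
  assumes "continuous_on UNIV (\<lambda>p. F (fst p) (snd p))" "continuous_on S f" "continuous_on S g"
  shows "continuous_on S (\<lambda>x. F (f x) (g x))"
  using continuous_on_compose2[OF assms(1) continuous_on_Pair[OF assms(2,3)]] by simp

lemma integrable_cont: "continuous_on UNIV f \<Longrightarrow> f integrable_on {a..b::real}"
  for f :: "real \<Rightarrow> 'a::banach"
  by (rule integrable_continuous_real) (rule continuous_on_subset, auto)

lemma integral_scale:
  fixes f :: "real \<Rightarrow> 'a::banach"
  assumes "continuous_on {0..b} f" "b \<ge> 0"
  shows "integral {0..b} f = b *\<^sub>R integral {0..1} (\<lambda>t. f (b * t))"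
proof (cases "b = 0")
  case False
  then have b: "b > 0" using assms by simp
  have "(f has_integral integral {0..b} f) (cbox 0 b)"
    using integrable_continuous_real[OF assms(1)] by (simp add: integrable_integral)
  from has_integral_affinity'[OF this b, of 0]
  have "((\<lambda>t. f (b * t)) has_integral (integral {0..b} f /\<^sub>R b)) {0..1}"
    using b by simp
  then have "integral {0..1} (\<lambda>t. f (b * t)) = integral {0..b} f /\<^sub>R b" by (rule integral_unique)
  then show ?thesis using b by simp
qed simp

lemma integral_shift_real:
  fixes f :: "real \<Rightarrow> 'a::banach"
  assumes "continuous_on UNIV f"
  shows "integral {a..b} (\<lambda>t. f (t + c)) = integral {a+c..b+c} f"
proof -
  have "(f has_integral integral {a+c..b+c} f) (cbox (a+c) (b+c))"
    using integrable_cont[OF assms] by (simp add: integrable_integral)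
  from has_integral_affinity'[OF this zero_less_one, of c]
  show ?thesis by (simp add: integral_unique)
qed

lemma integral_flip:
  fixes f :: "real \<Rightarrow> 'a::banach"
  assumes "continuous_on UNIV f"
  shows "integral {0..b} (\<lambda>t. f (b - t)) = integral {0..b} f"
proof -
  have "integral {0..b} f = integral {-b..-0} (\<lambda>t. f (-t))"
    using integral_reflect[of b 0 f] by simp
  also have "\<dots> = integral {-b+b..0+b} (\<lambda>t. f (b - t))"
    using integral_shift_real[of "\<lambda>t. f (b - t)" "-b" 0 b] assms
    by (simp add: continuous_on_compose2[OF assms] continuous_intros)
  finally show ?thesis by simp
qed

text \<open>Rescaling to the fixed interval [0, 1] moves the variable limit into the integrand. The
  factor \<open>max 0 (b p)\<close> reproduces the value 0 of an integral over an empty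
  interval.\<close>

lemma continuous_integral_upto:
  fixes F :: "'a::topological_space \<Rightarrow> real \<Rightarrow> 'b::banach"
  assumes F: "continuous_on (U \<times> UNIV) (\<lambda>p. F (fst p) (snd p))" and b: "continuous_on U b"
  shows "continuous_on U (\<lambda>p. integral {0..b p} (F p))"
proof -
  have FU: "continuous_on UNIV (F p)" if "p \<in> U" for p
  proof -
    have "continuous_on UNIV (\<lambda>t. (p, t))" by (intro continuous_intros)
    from continuous_on_compose2[OF F this] that show ?thesis by auto
  qed
  have eq: "integral {0..b p} (F p) = max 0 (b p) *\<^sub>R integral (cbox 0 1) (\<lambda>t. F p (max 0 (b p) * t))"
    if "p \<in> U" for p
  proof (cases "b p \<ge> 0")
    case True
    then show ?thesis
      using integral_scale[of "b p" "F p"] continuous_on_subset[OF FU[OF that], of "{0..b p}"] by (simp add: max_def)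
  qed simp
  have "continuous_on U (\<lambda>p. max 0 (b p) *\<^sub>R integral (cbox 0 1) (\<lambda>t. F p (max 0 (b p) * t)))"
  proof (intro continuous_intros b integral_continuous_on_param)
    have "continuous_on (U \<times> cbox 0 (1::real)) (\<lambda>x. b (fst x))"
      by (rule continuous_on_compose2[OF b]) (auto intro!: continuous_intros)
    then have "continuous_on (U \<times> cbox 0 (1::real)) (\<lambda>x. (fst x, max 0 (b (fst x)) * snd x))"
      by (intro continuous_intros) auto
    from continuous_on_compose2[OF F this]
    have "continuous_on (U \<times> cbox 0 (1::real)) (\<lambda>x. F (fst x) (max 0 (b (fst x)) * snd x))" by force
    then show "continuous_on (U \<times> cbox 0 (1::real)) (\<lambda>(x, t). F x (max 0 (b x) * t))"
      by (simp add: split_beta)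
  qed
  then show ?thesis by (rule continuous_on_eq) (simp add: eq)
qed

lemma continuous_integral_upto' [continuous_intros]:
  fixes F :: "'a::topological_space \<Rightarrow> real \<Rightarrow> 'b::banach"
  assumes F: "continuous_on UNIV (\<lambda>p. F (fst p) (snd p))" and b: "continuous_on UNIV b"
  shows "continuous_on UNIV (\<lambda>p. integral {0..b p} (F p))"
  using continuous_integral_upto[of UNIV F b] assms by simp

text \<open>The indicator of the closed triangle replaces the variable limits by an integrand on the
  plane; compactness of the triangle supplies the absolute integrability that Fubini's theorem
  demands.\<close>

lemma fubini_triangle:
  fixes F :: "real \<Rightarrow> real \<Rightarrow> 'a::euclidean_space"
  assumes F: "continuous_on UNIV (\<lambda>p. F (fst p) (snd p))"
  shows "integral {0..T} (\<lambda>u. integral {0..u} (F u)) = integral {0..T} (\<lambda>t. integral {t..T} (\<lambda>u. F u t))"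
proof -
  define S where "S = {p::real\<times>real. 0 \<le> snd p \<and> snd p \<le> fst p \<and> fst p \<le> T}"
  have "closed S" unfolding S_def
    by (intro closed_Collect_conj closed_Collect_le continuous_intros)
  moreover have "S \<subseteq> cbox (0,0) (T,T)" unfolding S_def by (auto simp: cbox_Pair_eq)
  ultimately have "compact S"
    by (meson bounded_cbox bounded_subset compact_eq_bounded_closed)
  then have int: "integrable lborel (\<lambda>p. indicator S p *\<^sub>R F (fst p) (snd p))"
    by (intro borel_integrable_compact continuous_on_subset[OF F]) auto
  define f where "f u t = indicator S (u,t) *\<^sub>R F u t" for u t
  have int': "integrable (lborel \<Otimes>\<^sub>M lborel) (case_prod f)"
    using int unfolding lborel_prod f_def by (simp add: split_beta')
  have F1: "continuous_on X (F u)" for X u by (intro continuous_on_uncurry[OF F] continuous_intros)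
  have F2: "continuous_on X (\<lambda>u. F u t)" for X t by (intro continuous_on_uncurry[OF F] continuous_intros)
  have seti: "set_integrable lborel {a..b} g" "(LINT x:{a..b}|lborel. g x) = integral {a..b} g"
    if "continuous_on {a..b} g" for a b and g :: "real \<Rightarrow> 'a"
  proof -
    show "set_integrable lborel {a..b} g" unfolding set_integrable_def
      by (intro borel_integrable_compact that) simp
    then show "(LINT x:{a..b}|lborel. g x) = integral {a..b} g" by (rule set_borel_integral_eq_integral)
  qed
  have c1: "continuous_on UNIV (\<lambda>u. integral {0..u} (F u))"
    by (intro continuous_intros F)
  have e2: "integral {t..T} (\<lambda>u. F u t) = integral {0..T-t} (\<lambda>u. F (u+t) t)" for t
    using integral_shift_real[OF F2, of 0 "T-t" t t] by simp
  have c2: "continuous_on UNIV (\<lambda>t. integral {t..T} (\<lambda>u. F u t))"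
    unfolding e2 by (intro continuous_intros continuous_on_uncurry[OF F])
  have a1: "(\<integral>t. f u t \<partial>lborel) = indicator {0..T} u *\<^sub>R integral {0..u} (F u)" for u
  proof -
    have "(\<integral>t. f u t \<partial>lborel) = (\<integral>t. indicator {0..T} u *\<^sub>R (indicator {0..u} t *\<^sub>R F u t) \<partial>lborel)"
      by (rule Bochner_Integration.integral_cong) (auto simp: f_def S_def indicator_def)
    also have "\<dots> = indicator {0..T} u *\<^sub>R (LINT t:{0..u}|lborel. F u t)"
      unfolding set_lebesgue_integral_def by (rule integral_scaleR_right)
    finally show ?thesis using seti(2)[OF F1] by simp
  qed
  have a2: "(\<integral>u. f u t \<partial>lborel) = indicator {0..T} t *\<^sub>R integral {t..T} (\<lambda>u. F u t)" for t
  proof -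
    have "(\<integral>u. f u t \<partial>lborel) = (\<integral>u. indicator {0..T} t *\<^sub>R (indicator {t..T} u *\<^sub>R F u t) \<partial>lborel)"
      by (rule Bochner_Integration.integral_cong) (auto simp: f_def S_def indicator_def)
    also have "\<dots> = indicator {0..T} t *\<^sub>R (LINT u:{t..T}|lborel. F u t)"
      unfolding set_lebesgue_integral_def by (rule integral_scaleR_right)
    finally show ?thesis using seti(2)[OF F2] by simp
  qed
  have "integral {0..T} (\<lambda>u. integral {0..u} (F u)) = (LINT u:{0..T}|lborel. integral {0..u} (F u))"
    by (rule seti(2)[symmetric], rule continuous_on_subset[OF c1]) simp
  also have "\<dots> = (\<integral>u. (\<integral>t. f u t \<partial>lborel) \<partial>lborel)"
    by (simp add: set_lebesgue_integral_def a1)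
  also have "\<dots> = (\<integral>t. (\<integral>u. f u t \<partial>lborel) \<partial>lborel)"
    using lborel_pair.Fubini_integral[OF int'] by simp
  also have "\<dots> = (LINT t:{0..T}|lborel. integral {t..T} (\<lambda>u. F u t))"
    by (simp add: set_lebesgue_integral_def a2)
  also have "\<dots> = integral {0..T} (\<lambda>t. integral {t..T} (\<lambda>u. F u t))"
    by (rule seti(2), rule continuous_on_subset[OF c2]) simp
  finally show ?thesis .
qed

lemma FTC_within:
  fixes f :: "real \<Rightarrow> 'a::banach"
  assumes "continuous_on UNIV f" "x \<in> S" "S \<subseteq> {0..}"
  shows "((\<lambda>x. integral {0..x} f) has_vector_derivative f x) (at x within S)"
proof -
  have x: "x \<ge> 0" using assms by auto
  \<comment> \<open>With the lower limit -1 the point \<open>x\<close> is interior even when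
    \<open>x = 0\<close>, so a two-sided derivative is available and can be restricted to any
    \<open>S\<close>.\<close>
  have "((\<lambda>x. integral {-1..x} f) has_vector_derivative f x) (at x within {-1..x+1})"
    by (rule integral_has_vector_derivative) (use x continuous_on_subset[OF assms(1) subset_UNIV] in simp_all)
  moreover have "at x within {-1..x+1} = at x" by (rule at_within_interior) (use x in simp)
  ultimately have "((\<lambda>x. integral {-1..x} f) has_vector_derivative f x) (at x)" by simp
  then have "((\<lambda>x. integral {-1..x} f) has_vector_derivative f x) (at x within S)"
    by (rule has_vector_derivative_at_within)
  from has_vector_derivative_diff[OF this has_vector_derivative_const[of "integral {-1..0} f"]]
  have "((\<lambda>x. integral {-1..x} f - integral {-1..0} f) has_vector_derivative f x) (at x within S)" by simp
  then show ?thesis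
  proof (rule has_vector_derivative_transform[rotated 2])
    fix y assume "y \<in> S"
    then have "y \<ge> 0" using assms by auto
    have "integral {-1..0} f + integral {0..y} f = integral {-1..y} f"
      by (rule Henstock_Kurzweil_Integration.integral_combine) (use \<open>y \<ge> 0\<close> integrable_cont[OF assms(1)] in auto)
    then show "integral {0..y} f = integral {-1..y} f - integral {-1..0} f" by (simp add: algebra_simps)
  qed (use assms in auto)
qed

text \<open>The Leibniz rule in integrated form is the triangle version of Fubini's theorem
  applied to the derivative of the integrand.\<close>

lemma leibniz_upto:
  fixes k k' :: "real \<Rightarrow> real \<Rightarrow> 'a::euclidean_space"
  assumes k: "continuous_on UNIV (\<lambda>p. k (fst p) (snd p))" and k': "continuous_on UNIV (\<lambda>p. k' (fst p) (snd p))"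
    and d: "\<And>u x. 0 \<le> u \<Longrightarrow> u \<le> x \<Longrightarrow> x \<le> y \<Longrightarrow> ((\<lambda>x. k x u) has_vector_derivative k' x u) (at x within {u..y})"
    and x: "x \<in> {0..y}"
  shows "((\<lambda>x. integral {0..x} (k x)) has_vector_derivative k x x + integral {0..x} (k' x)) (at x within {0..y})"
proof -
  define h where "h x = k x x + integral {0..x} (k' x)" for x
  have ck: "continuous_on UNIV (\<lambda>x. k x x)" by (intro continuous_on_uncurry[OF k] continuous_intros)
  have ck': "continuous_on UNIV (\<lambda>x. integral {0..x} (k' x))" by (intro continuous_intros k')
  have h: "continuous_on UNIV h" unfolding h_def by (intro continuous_intros ck ck')
  have "integral {0..X} (k X) = integral {0..X} h" if X: "X \<in> {0..y}" for X
  proof -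
    have "integral {0..X} h = integral {0..X} (\<lambda>x. k x x) + integral {0..X} (\<lambda>x. integral {0..x} (k' x))"
      unfolding h_def by (intro integral_add integrable_cont ck ck')
    also have "integral {0..X} (\<lambda>x. integral {0..x} (k' x)) = integral {0..X} (\<lambda>t. integral {t..X} (\<lambda>u. k' u t))"
      by (rule fubini_triangle[OF k'])
    also have "\<dots> = integral {0..X} (\<lambda>t. k X t - k t t)"
    proof (rule integral_cong)
      fix t assume t: "t \<in> {0..X}"
      have "((\<lambda>u. k' u t) has_integral k X t - k t t) {t..X}"
      proof (rule fundamental_theorem_of_calculus)
        fix z assume "z \<in> {t..X}"
        then have "((\<lambda>x. k x t) has_vector_derivative k' z t) (at z within {t..y})" using t X by (intro d) auto
        then show "((\<lambda>x. k x t) has_vector_derivative k' z t) (at z within {t..X})"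
          by (rule has_vector_derivative_within_subset) (use X in auto)
      qed (use t in auto)
      then show "integral {t..X} (\<lambda>u. k' u t) = k X t - k t t" by (rule integral_unique)
    qed
    also have "\<dots> = integral {0..X} (k X) - integral {0..X} (\<lambda>x. k x x)"
      by (intro integral_diff integrable_cont continuous_on_uncurry[OF k] continuous_intros)
    finally show ?thesis by simp
  qed
  then show ?thesis
    using has_vector_derivative_transform[OF x _ FTC_within[OF h x], of "\<lambda>x. integral {0..x} (k x)"]
    unfolding h_def[of x] by auto
qed

section \<open>Contractions in weighted sup norms, stated pointwise\<close>

lemma halving_zero:
  fixes d w :: "'a \<Rightarrow> real"
  assumes step: "\<And>c. c \<ge> 0 \<Longrightarrow> (\<And>p. p \<in> S \<Longrightarrow> d p \<le> c * w p) \<Longrightarrow> (\<And>p. p \<in> S \<Longrightarrow> d p \<le> c / 2 * w p)"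
    and init: "\<And>p. p \<in> S \<Longrightarrow> d p \<le> c0 * w p" "c0 \<ge> 0" and p: "p \<in> S"
  shows "d p \<le> 0"
proof -
  have "\<forall>p\<in>S. d p \<le> c0 * (1/2)^n * w p" for n
  proof (induction n)
    case (Suc n)
    show ?case
    proof
      fix q assume "q \<in> S"
      have "d q \<le> (c0 * (1/2)^n) / 2 * w q"
        by (rule step) (use Suc \<open>q \<in> S\<close> init(2) in simp_all)
      then show "d q \<le> c0 * (1/2)^Suc n * w q" by simp
    qed
  qed (use init in auto)
  then have b: "d p \<le> c0 * (1/2)^n * w p" for n using p by auto
  have "(\<lambda>n. c0 * (1/2::real)^n * w p) \<longlonglongrightarrow> c0 * 0 * w p"
    by (intro tendsto_intros LIMSEQ_power_zero) auto
  then show ?thesis using LIMSEQ_le_const[of _ "c0 * 0 * w p" "d p"] b by auto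
qed

text \<open>Banach's fixed point theorem without a metric space: the weight \<open>w\<close> may be
  unbounded on \<open>S\<close>, and closedness of \<open>G\<close> is asked only for sequences
  converging geometrically in the weighted sense. The iterates started at \<open>f0\<close> have
  increments of size \<open>c0 * (1/2)^n * w p\<close>, hence form a Cauchy sequence at every
  point.\<close>

lemma weighted_fixpoint:
  fixes F :: "('a \<Rightarrow> 'b::banach) \<Rightarrow> 'a \<Rightarrow> 'b"
  assumes F: "\<And>f. f \<in> G \<Longrightarrow> F f \<in> G"
    and contr: "\<And>f g c p. f \<in> G \<Longrightarrow> g \<in> G \<Longrightarrow> c \<ge> 0 \<Longrightarrow> (\<And>p. p \<in> S \<Longrightarrow> norm (f p - g p) \<le> c * w p)
       \<Longrightarrow> p \<in> S \<Longrightarrow> norm (F f p - F g p) \<le> c / 2 * w p"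
    and f0: "f0 \<in> G" "\<And>p. p \<in> S \<Longrightarrow> norm (F f0 p - f0 p) \<le> c0 * w p" "c0 \<ge> 0"
    and closed: "\<And>h f C. (\<And>n::nat. h n \<in> G) \<Longrightarrow> (\<And>n p. p \<in> S \<Longrightarrow> norm (h n p - f p) \<le> C * (1/2)^n * w p) \<Longrightarrow> f \<in> G"
    and w: "\<And>p. p \<in> S \<Longrightarrow> w p \<ge> 0"
  obtains f where "f \<in> G" "\<And>p. p \<in> S \<Longrightarrow> F f p = f p"
proof -
  define h where "h n = (F ^^ n) f0" for n
  have hS: "h (Suc n) = F (h n)" for n by (simp add: h_def)
  have hG: "h n \<in> G" for n by (induction n) (auto simp: h_def intro: F f0)
  have d: "norm (h (Suc n) p - h n p) \<le> c0 * (1/2)^n * w p" if "p \<in> S" for n p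
    using that
  proof (induction n arbitrary: p)
    case 0 then show ?case using f0 by (simp add: h_def)
  next
    case (Suc n)
    have "norm (F (h (Suc n)) p - F (h n) p) \<le> (c0 * (1/2)^n) / 2 * w p"
      by (rule contr[OF hG hG _ Suc.IH]) (use Suc.prems f0 in auto)
    then show ?case by (simp add: hS)
  qed
  \<comment> \<open>The bracket is the exact sum of the geometric increments from \<open>n\<close>
    to \<open>n + k\<close>, which lets the induction on \<open>k\<close> close without
    loss.\<close>
  have dk: "norm (h (n + k) p - h n p) \<le> c0 * w p * (2 * (1/2)^n - 2 * (1/2)^(n+k))" if p: "p \<in> S" for n k p
  proof (induction k)
    case (Suc k)
    have "norm (h (n + Suc k) p - h n p) \<le> norm (h (Suc (n + k)) p - h (n+k) p) + norm (h (n + k) p - h n p)"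
      using norm_triangle_ineq[of "h (Suc (n + k)) p - h (n+k) p" "h (n + k) p - h n p"] by simp
    also have "\<dots> \<le> c0 * (1/2)^(n+k) * w p + c0 * w p * (2 * (1/2)^n - 2 * (1/2)^(n+k))"
      using d[OF p, of "n+k"] Suc by linarith
    also have "\<dots> = c0 * w p * (2 * (1/2)^n - 2 * (1/2)^(n+Suc k))" by (simp add: algebra_simps)
    finally show ?case .
  qed simp
  have dk': "norm (h (n + k) p - h n p) \<le> 2 * c0 * (1/2)^n * w p" if p: "p \<in> S" for n k p
  proof -
    have "c0 * w p * (2 * (1/2)^n - 2 * (1/2)^(n+k)) \<le> c0 * w p * (2 * (1/2)^n)"
      by (rule mult_left_mono) (use w[OF p] f0 in auto)
    then show ?thesis using dk[OF p, of n k] by (simp add: algebra_simps)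
  qed
  have conv: "convergent (\<lambda>n. h n p)" if p: "p \<in> S" for p
  proof -
    have "Cauchy (\<lambda>n. h n p)"
    proof (rule CauchyI')
      fix e :: real assume e: "e > 0"
      have "(\<lambda>n. 2 * c0 * (1/2::real)^n * w p) \<longlonglongrightarrow> 2 * c0 * 0 * w p"
        by (intro tendsto_intros LIMSEQ_power_zero) auto
      then have "\<forall>\<^sub>F n in sequentially. 2 * c0 * (1/2)^n * w p < e"
        using e by (auto dest: order_tendstoD(2))
      then obtain N where N: "\<And>n. n \<ge> N \<Longrightarrow> 2 * c0 * (1/2)^n * w p < e" by (auto simp: eventually_sequentially)
      have "dist (h m p) (h n p) < e" if "m \<ge> N" "n > m" for m n
        using dk'[OF p, of m "n - m"] N[of m] that by (simp add: dist_norm norm_minus_commute)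
      then show "\<exists>M. \<forall>m\<ge>M. \<forall>n>m. dist (h m p) (h n p) < e" by blast
    qed
    then show ?thesis by (simp add: Cauchy_convergent_iff)
  qed
  define f where "f p = (if p \<in> S then lim (\<lambda>n. h n p) else f0 p)" for p
  have lim: "(\<lambda>n. h n p) \<longlonglongrightarrow> f p" if "p \<in> S" for p
    using conv[OF that] that by (simp add: f_def convergent_LIMSEQ_iff)
  have hf: "norm (h n p - f p) \<le> 2 * c0 * (1/2)^n * w p" if p: "p \<in> S" for n p
  proof -
    have "(\<lambda>k. norm (h (k + n) p - h n p)) \<longlonglongrightarrow> norm (f p - h n p)"
      by (intro tendsto_intros LIMSEQ_ignore_initial_segment lim p)
    then have "norm (f p - h n p) \<le> 2 * c0 * (1/2)^n * w p"
      by (rule LIMSEQ_le_const2) (use dk'[OF p, of n] in \<open>simp add: add.commute[of _ n]\<close>)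
    then show ?thesis by (simp add: norm_minus_commute)
  qed
  have fG: "f \<in> G" by (rule closed[OF hG hf])
  have "F f p = f p" if p: "p \<in> S" for p
  proof -
    have "norm (F f p - h (Suc n) p) \<le> (2 * c0 * (1/2)^n) / 2 * w p" for n
      unfolding hS
    proof (rule contr[OF fG hG _ _ p])
      show "norm (f q - h n q) \<le> 2 * c0 * (1/2)^n * w q" if "q \<in> S" for q
        using hf[OF that, of n] by (simp only: norm_minus_commute)
    qed (use f0(3) in simp)
    moreover have "(\<lambda>n. (2 * c0 * (1/2)^n) / 2 * w p) \<longlonglongrightarrow> (2 * c0 * 0) / 2 * w p"
      by (intro tendsto_intros LIMSEQ_power_zero) auto
    ultimately have "(\<lambda>n. F f p - h (Suc n) p) \<longlonglongrightarrow> 0"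
      using Lim_null_comparison[of "\<lambda>n. F f p - h (Suc n) p" "\<lambda>n. (2 * c0 * (1/2)^n) / 2 * w p" sequentially]
      by (simp only: always_eventually mult_zero_right mult_zero_left div_0 simp_thms)
    moreover have "(\<lambda>n. F f p - h (Suc n) p) \<longlonglongrightarrow> F f p - f p"
      by (intro tendsto_intros LIMSEQ_Suc lim p)
    ultimately show ?thesis using LIMSEQ_unique by fastforce
  qed
  with fG that show ?thesis by blast
qed

text \<open>A weight that is locally bounded turns weighted convergence into locally uniform
  convergence, which preserves continuity.\<close>

lemma continuous_weighted_limit:
  fixes f :: "'a::t2_space \<Rightarrow> 'c::real_normed_vector"
  assumes h: "\<And>n. continuous_on S (h n)"
    and b: "\<And>n p. p \<in> S \<Longrightarrow> norm (h n p - f p) \<le> C * (1/2)^n * w p"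
    and lb: "\<And>p. p \<in> S \<Longrightarrow> \<exists>U W. open U \<and> p \<in> U \<and> (\<forall>q\<in>U \<inter> S. w q \<le> W)"
    and w: "\<And>p. p \<in> S \<Longrightarrow> w p \<ge> 0"
  shows "continuous_on S f"
proof -
  have "continuous (at p within S) f" if p: "p \<in> S" for p
  proof -
    obtain U W where U: "open U" "p \<in> U" "\<And>q. q \<in> U \<inter> S \<Longrightarrow> w q \<le> W" using lb[OF p] by blast
    have "uniform_limit (U \<inter> S) h f sequentially"
    proof (rule uniform_limitI)
      fix e :: real assume e: "e > 0"
      have "(\<lambda>n. \<bar>C\<bar> * (1/2::real)^n * \<bar>W\<bar>) \<longlonglongrightarrow> \<bar>C\<bar> * 0 * \<bar>W\<bar>"
        by (intro tendsto_intros LIMSEQ_power_zero) auto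
      then have "\<forall>\<^sub>F n in sequentially. \<bar>C\<bar> * (1/2)^n * \<bar>W\<bar> < e"
        using e by (auto dest: order_tendstoD(2))
      then show "\<forall>\<^sub>F n in sequentially. \<forall>q\<in>U \<inter> S. dist (h n q) (f q) < e"
      proof eventually_elim
        case (elim n)
        show ?case
        proof
          fix q assume q: "q \<in> U \<inter> S"
          have "dist (h n q) (f q) \<le> C * (1/2)^n * w q" using b q by (simp add: dist_norm)
          also have "\<dots> \<le> \<bar>C\<bar> * (1/2)^n * \<bar>W\<bar>"
            using U(3)[OF q] w[of q] q by (intro mult_mono) auto
          finally show "dist (h n q) (f q) < e" using elim by linarith
        qed
      qed
    qed
    then have "continuous_on (U \<inter> S) f"
      by (rule uniform_limit_theorem[rotated]) (auto intro!: always_eventually continuous_on_subset[OF h])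
    moreover have "at p within (U \<inter> S) = at p within S" by (rule at_within_nhd[OF U(2,1)]) auto
    ultimately show ?thesis using U p by (metis IntI continuous_on_eq_continuous_within)
  qed
  then show ?thesis by (simp add: continuous_on_eq_continuous_within)
qed

lemma integral_exp_real:
  assumes "k \<noteq> (0::real)" "x \<ge> 0"
  shows "integral {0..x} (\<lambda>t. exp (k * t)) = (exp (k * x) - 1) / k"
proof -
  have "((\<lambda>t. exp (k * t)) has_integral exp (k * x) / k - exp (k * 0) / k) {0..x}"
  proof (rule fundamental_theorem_of_calculus)
    fix t assume "t \<in> {0..x}"
    have "((\<lambda>t. exp (k * t) / k) has_real_derivative exp (k * t)) (at t within {0..x})"
      using assms by (auto intro!: derivative_eq_intros)
    then show "((\<lambda>t. exp (k * t) / k) has_vector_derivative exp (k * t)) (at t within {0..x})"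
      by (simp add: has_real_derivative_iff_has_vector_derivative)
  qed (use assms in auto)
  then show ?thesis by (simp add: integral_unique diff_divide_distrib)
qed

lemma gronwall:
  fixes \<phi> :: "real \<Rightarrow> real"
  assumes c: "continuous_on UNIV \<phi>" and b: "\<And>l. 0 \<le> l \<Longrightarrow> l \<le> T \<Longrightarrow> \<phi> l \<le> \<delta> + C * integral {0..l} \<phi>"
    and C: "C > 0" and l: "0 \<le> l" "l \<le> T"
  shows "\<phi> l \<le> \<delta> * exp (C * l)"
proof -
  define J where "J l = integral {0..l} \<phi>" for l
  \<comment> \<open>Integrating factor: the derivative of \<open>m\<close> is exp (-C t) times the
    defect \<phi> - C J - \<delta>, which the hypothesis makes nonpositive, so \<open>m\<close>
    decreases.\<close>
  define m where "m l = exp (- (C * l)) * (J l + \<delta> / C)" for l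
  have "((\<lambda>t. exp (- (C * t)) * (\<phi> t - C * J t - \<delta>)) has_integral m l - m 0) {0..l}"
  proof (rule fundamental_theorem_of_calculus)
    fix t assume t: "t \<in> {0..l}"
    have J: "(J has_real_derivative \<phi> t) (at t within {0..l})"
      using FTC_within[OF c t] unfolding J_def by (simp add: has_real_derivative_iff_has_vector_derivative)
    have "(m has_real_derivative exp (- (C * t)) * (\<phi> t - C * J t - \<delta>)) (at t within {0..l})"
      unfolding m_def using C by (auto intro!: derivative_eq_intros J simp: field_simps)
    then show "(m has_vector_derivative exp (- (C * t)) * (\<phi> t - C * J t - \<delta>)) (at t within {0..l})"
      by (simp add: has_real_derivative_iff_has_vector_derivative)
  qed (use l in auto)
  then have "m l - m 0 \<le> 0"
    by (rule has_integral_le[OF _ has_integral_0]) (use b l in \<open>fastforce simp: J_def mult_le_0_iff diff_le_eq add.commute\<close>)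
  then have "exp (- (C * l)) * (J l + \<delta> / C) \<le> \<delta> / C" by (simp add: m_def J_def)
  then have "exp (C * l) * (exp (- (C * l)) * (J l + \<delta> / C)) \<le> exp (C * l) * (\<delta> / C)"
    by (rule mult_left_mono) simp
  then have "J l + \<delta> / C \<le> exp (C * l) * (\<delta> / C)" by (simp add: mult.assoc[symmetric] exp_add[symmetric])
  then have "C * (J l + \<delta> / C) \<le> C * (exp (C * l) * (\<delta> / C))" using C by (intro mult_left_mono) auto
  moreover have "C * (J l + \<delta> / C) = C * J l + \<delta>" "C * (exp (C * l) * (\<delta> / C)) = \<delta> * exp (C * l)"
    using C by (simp_all add: distrib_left)
  ultimately have "C * J l + \<delta> \<le> \<delta> * exp (C * l)" by simp
  with b[OF l] show ?thesis by (simp add: J_def)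
qed

text \<open>The integral of w (f - y)^2 is a quadratic polynomial in y that is never negative. For W
  > 0 its minimum at y = I/W gives the inequality; for W = 0 it is affine, and y = (K + 1) / (2 I)
  would give it the value -1, so I = 0.\<close>

lemma integral_Cauchy_Schwarz:
  fixes f w :: "real \<Rightarrow> real"
  assumes f: "continuous_on {a..b} f" and w: "continuous_on {a..b} w" and w0: "\<And>x. x \<in> {a..b} \<Longrightarrow> w x \<ge> 0"
  shows "(integral {a..b} (\<lambda>x. w x * f x))\<^sup>2 \<le> integral {a..b} w * integral {a..b} (\<lambda>x. w x * (f x)\<^sup>2)"
proof -
  define W I K where "W = integral {a..b} w" and "I = integral {a..b} (\<lambda>x. w x * f x)"
    and "K = integral {a..b} (\<lambda>x. w x * (f x)\<^sup>2)"
  have q: "0 \<le> K - 2 * y * I + y\<^sup>2 * W" for y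
  proof -
    have iw: "w integrable_on {a..b}" and iwf: "(\<lambda>x. w x * f x) integrable_on {a..b}"
      and iwff: "(\<lambda>x. w x * (f x)\<^sup>2) integrable_on {a..b}"
      by (intro integrable_continuous_real continuous_intros f w)+
    have "0 \<le> integral {a..b} (\<lambda>x. w x * (f x - y)\<^sup>2)"
      by (rule integral_nonneg) (auto intro!: integrable_continuous_real continuous_intros f w w0 mult_nonneg_nonneg)
    also have "(\<lambda>x. w x * (f x - y)\<^sup>2) = (\<lambda>x. w x * (f x)\<^sup>2 - (2 * y) * (w x * f x) + y\<^sup>2 * w x)"
      by (auto simp: power2_eq_square algebra_simps)
    also have "integral {a..b} \<dots> = K - 2 * y * I + y\<^sup>2 * W"
      unfolding W_def I_def K_def
      by (subst integral_add integral_diff integral_mult_right; (intro integrable_diff integrable_on_mult_right iw iwf iwff)?)+ simp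
    finally show ?thesis .
  qed
  have W: "W \<ge> 0" unfolding W_def by (rule integral_nonneg[OF integrable_continuous_real[OF w] w0])
  show ?thesis unfolding W_def[symmetric] I_def[symmetric] K_def[symmetric]
  proof (cases "W = 0")
    case True
    have "I = 0"
    proof (rule ccontr)
      assume "I \<noteq> 0"
      then show False using q[of "(K + 1) / (2 * I)"] True by (simp add: field_simps)
    qed
    then show "I\<^sup>2 \<le> W * K" using True by simp
  next
    case False
    then have "W > 0" using W by simp
    have "0 \<le> W * (K - 2 * (I / W) * I + (I / W)\<^sup>2 * W)" using q[of "I / W"] W by simp
    also have "\<dots> = W * K - I\<^sup>2" using \<open>W > 0\<close> by (simp add: field_simps power2_eq_square)
    finally show "I\<^sup>2 \<le> W * K" by simp
  qed
qed

section \<open>Convolution of matrix functions\<close>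

definition conv :: "(real \<Rightarrow> complex^'c^'r) \<Rightarrow> (real \<Rightarrow> complex^'d^'c) \<Rightarrow> real \<Rightarrow> complex^'d^'r" where
  "conv F G x = integral {0..x} (\<lambda>t. F (x - t) ** G t)"

lemmas integral_mult_mat_right = integral_linear[OF _ mm.bounded_linear_left, unfolded o_def]
lemmas integral_mult_mat_left = integral_linear[OF _ mm.bounded_linear_right, unfolded o_def]

lemmas continuous_mm [continuous_intros] = mm.continuous_on
lemmas continuous_ms [continuous_intros] = ms.continuous_on

lemma continuous_conv [continuous_intros]:
  assumes "continuous_on UNIV F" "continuous_on UNIV G"
  shows "continuous_on UNIV (conv F G)"
  unfolding conv_def
  by (intro continuous_intros continuous_on_compose2[OF assms(1)] continuous_on_compose2[OF assms(2)]) auto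

text \<open>Both sides integrate F (x - u) G (u - t) H t over the triangle 0 <= t <= u <= x, in the
  two possible orders.\<close>

lemma conv_assoc:
  assumes F: "continuous_on UNIV F" and G: "continuous_on UNIV G" and H: "continuous_on UNIV H"
  shows "conv (conv F G) H x = conv F (conv G H) x"
proof -
  note ci = continuous_intros continuous_on_compose2[OF F] continuous_on_compose2[OF G] continuous_on_compose2[OF H]
  have inner: "conv F G (x - t) ** H t = integral {t..x} (\<lambda>u. F (x - u) ** (G (u - t) ** H t))" for t
  proof -
    have "conv F G (x - t) ** H t = integral {0..x-t} (\<lambda>u. F (x - (u + t)) ** (G (u + t - t) ** H t))"
      unfolding conv_def
      by (subst integral_mult_mat_right[symmetric]; (intro integrable_cont ci; auto)?)
         (simp add: matrix_mul_assoc algebra_simps)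
    also have "\<dots> = integral {0+t..x-t+t} (\<lambda>u. F (x - u) ** (G (u - t) ** H t))"
      by (rule integral_shift_real) (intro ci; auto)
    finally show ?thesis by simp
  qed
  have "conv (conv F G) H x = integral {0..x} (\<lambda>t. integral {t..x} (\<lambda>u. F (x - u) ** (G (u - t) ** H t)))"
    unfolding conv_def[of "conv F G"] inner ..
  also have "\<dots> = integral {0..x} (\<lambda>u. integral {0..u} (\<lambda>t. F (x - u) ** (G (u - t) ** H t)))"
    by (rule fubini_triangle[symmetric]) (intro ci; auto)
  also have "\<dots> = conv F (conv G H) x"
    unfolding conv_def by (subst integral_mult_mat_left; (intro integrable_cont ci; auto)?) simp
  finally show ?thesis .
qed

section \<open>The characteristic integral equation\<close>

text \<open>The quadratic term at abscissa \<open>u\<close> on the characteristic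
  \<open>x + l = y\<close>. The product \<open>m\<close> is kept abstract so that one theory covers
  both the equation for A and the equation for the pair (A, D).\<close>

definition goursat_quad :: "(real \<Rightarrow> 'b \<Rightarrow> 'b \<Rightarrow> 'b::banach) \<Rightarrow> (real \<times> real \<Rightarrow> 'b) \<Rightarrow> real \<Rightarrow> real \<Rightarrow> 'b" where
  "goursat_quad m f u y = integral {0..u} (\<lambda>t. m (y - u) (f (u - t, y - u)) (f (t, y - u)))"

text \<open>The maxima with 0 extend the map from the quadrant to the whole plane as a function of
  the nearest point of the quadrant. All continuity statements can then be made on
  \<open>UNIV\<close>.\<close>

definition goursat_map :: "(real \<Rightarrow> 'b) \<Rightarrow> (real \<Rightarrow> 'b \<Rightarrow> 'b \<Rightarrow> 'b::banach) \<Rightarrow> (real \<times> real \<Rightarrow> 'b) \<Rightarrow> real \<times> real \<Rightarrow> 'b" where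
  "goursat_map \<alpha> m f p = \<alpha> (max 0 (fst p) + max 0 (snd p))
     - integral {0..max 0 (fst p)} (\<lambda>u. goursat_quad m f u (max 0 (fst p) + max 0 (snd p)))"

lemma continuous_goursat_quad:
  assumes mc: "continuous_on UNIV (\<lambda>q. m (fst q) (fst (snd q)) (snd (snd q)))" and f: "continuous_on UNIV f"
    and a: "continuous_on UNIV a" and b: "continuous_on UNIV b"
  shows "continuous_on UNIV (\<lambda>p. goursat_quad m f (a p) (b p))"
proof -
  have "continuous_on UNIV (\<lambda>q. (b (fst q) - a (fst q), f (a (fst q) - snd q, b (fst q) - a (fst q)), f (snd q, b (fst q) - a (fst q))))"
    by (intro continuous_intros continuous_on_compose2[OF f] continuous_on_compose2[OF a] continuous_on_compose2[OF b]) auto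
  from continuous_on_compose2[OF mc this]
  show ?thesis unfolding goursat_quad_def by (intro continuous_intros a) auto
qed

lemma continuous_goursat_map:
  assumes mc: "continuous_on UNIV (\<lambda>q. m (fst q) (fst (snd q)) (snd (snd q)))" and f: "continuous_on UNIV f"
    and a: "continuous_on UNIV \<alpha>"
  shows "continuous_on UNIV (goursat_map \<alpha> m f)"
  unfolding goursat_map_def
  by (intro continuous_intros continuous_goursat_quad[OF mc f] continuous_on_compose2[OF a]) auto

text \<open>A value at (x, l) depends only on the triangle below its characteristic, so bounds on
  \<open>u + v \<le> y\<close> are enough. Each of the two terms of the bilinear difference carries
  exp (k (u - t)) exp (k t) = exp (k u), and integrating this over u gains 1/k. The condition
  \<open>4 * K * B * y \<le> k\<close> turns the resulting constant 2 K B c y / k into c/2.\<close>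

lemma goursat_map_diff:
  assumes mc: "continuous_on UNIV (\<lambda>q. m (fst q) (fst (snd q)) (snd (snd q)))"
    and bl: "\<And>l. bounded_bilinear (m l)"
    and f: "continuous_on UNIV f" and g: "continuous_on UNIV g"
    and x: "x \<ge> 0" and l: "l \<ge> 0" and y: "x + l \<le> y"
    and K: "K \<ge> 0" "B \<ge> 0" "c \<ge> 0" "k > 0" "4 * K * B * y \<le> k"
    and mb: "\<And>l e e'. 0 \<le> l \<Longrightarrow> l \<le> y \<Longrightarrow> norm (m l e e') \<le> K * norm e * norm e'"
    and fb: "\<And>u v. 0 \<le> u \<Longrightarrow> 0 \<le> v \<Longrightarrow> u + v \<le> y \<Longrightarrow> norm (f (u,v)) \<le> B * exp (k * u)"
    and gb: "\<And>u v. 0 \<le> u \<Longrightarrow> 0 \<le> v \<Longrightarrow> u + v \<le> y \<Longrightarrow> norm (g (u,v)) \<le> B * exp (k * u)"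
    and fg: "\<And>u v. 0 \<le> u \<Longrightarrow> 0 \<le> v \<Longrightarrow> u + v \<le> y \<Longrightarrow> norm (f (u,v) - g (u,v)) \<le> c * exp (k * u)"
  shows "norm (goursat_map \<alpha> m f (x,l) - goursat_map \<alpha> m g (x,l)) \<le> c / 2 * exp (k * x)"
proof -
  have mcomp: "continuous_on UNIV (\<lambda>t. m r (f1 t) (f2 t))" if "continuous_on UNIV f1" "continuous_on UNIV f2" for r f1 f2
    using continuous_on_compose2[OF mc continuous_on_Pair[OF continuous_on_const[of UNIV r] continuous_on_Pair[OF that]]] by auto
  have gqd: "norm (goursat_quad m g u (x+l) - goursat_quad m f u (x+l)) \<le> 2 * K * B * c * y * exp (k * u)" if u: "u \<in> {0..x}" for u
  proof -
    define r where "r = x + l - u"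
    have r: "0 \<le> r" "r \<le> y" "u + r \<le> y" using u x l y by (auto simp: r_def)
    have cf: "continuous_on UNIV (\<lambda>t. m r (f (u - t, r)) (f (t, r)))"
      by (intro mcomp continuous_on_compose2[OF f] continuous_intros) auto
    have cg: "continuous_on UNIV (\<lambda>t. m r (g (u - t, r)) (g (t, r)))"
      by (intro mcomp continuous_on_compose2[OF g] continuous_intros) auto
    have "norm (goursat_quad m g u (x+l) - goursat_quad m f u (x+l))
       = norm (integral {0..u} (\<lambda>t. m r (g (u - t, r)) (g (t, r)) - m r (f (u - t, r)) (f (t, r))))"
      unfolding goursat_quad_def r_def[symmetric] by (subst integral_diff) (auto intro: integrable_cont cf cg)
    also have "\<dots> \<le> (2 * K * B * c * exp (k * u)) * (u - 0)"
    proof (rule integral_bound)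
      show "continuous_on {0..u} (\<lambda>t. m r (g (u - t, r)) (g (t, r)) - m r (f (u - t, r)) (f (t, r)))"
        by (rule continuous_on_subset[OF continuous_on_diff[OF cg cf]]) simp
      fix t assume t: "t \<in> {0..u}"
      have split: "m r (g (u - t, r)) (g (t, r)) - m r (f (u - t, r)) (f (t, r))
         = - (m r (f (u - t, r) - g (u - t, r)) (g (t, r))) - m r (f (u - t, r)) (f (t, r) - g (t, r))"
        by (simp add: bounded_bilinear.diff_left[OF bl] bounded_bilinear.diff_right[OF bl])
      have e: "exp (k * (u - t)) * exp (k * t) = exp (k * u)"
        by (simp add: exp_add[symmetric] algebra_simps)
      have "norm (m r (f (u - t, r) - g (u - t, r)) (g (t, r))) \<le> K * norm (f (u - t, r) - g (u - t, r)) * norm (g (t, r))"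
        using mb r by blast
      also have "\<dots> \<le> K * (c * exp (k * (u - t))) * (B * exp (k * t))"
        by (intro mult_mono fg gb mult_nonneg_nonneg) (use t r K in auto)
      also have "\<dots> = K * B * c * exp (k * u)" using e by (simp add: mult_ac)
      finally have 1: "norm (m r (f (u - t, r) - g (u - t, r)) (g (t, r))) \<le> K * B * c * exp (k * u)" .
      have "norm (m r (f (u - t, r)) (f (t, r) - g (t, r))) \<le> K * norm (f (u - t, r)) * norm (f (t, r) - g (t, r))"
        using mb r by blast
      also have "\<dots> \<le> K * (B * exp (k * (u - t))) * (c * exp (k * t))"
        by (intro mult_mono fg fb mult_nonneg_nonneg) (use t r K in auto)
      also have "\<dots> = K * B * c * exp (k * u)" using e by (simp add: mult_ac)
      finally have 2: "norm (m r (f (u - t, r)) (f (t, r) - g (t, r))) \<le> K * B * c * exp (k * u)" .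
      show "norm (m r (g (u - t, r)) (g (t, r)) - m r (f (u - t, r)) (f (t, r))) \<le> 2 * K * B * c * exp (k * u)"
        unfolding split using norm_triangle_ineq4[of "- (m r (f (u - t, r) - g (u - t, r)) (g (t, r)))" "m r (f (u - t, r)) (f (t, r) - g (t, r))"] 1 2
        by simp
    qed (use u in auto)
    also have "\<dots> \<le> (2 * K * B * c * exp (k * u)) * y"
      by (rule mult_left_mono) (use u K r x l y in auto)
    finally show ?thesis by (simp add: mult_ac)
  qed
  have y0: "y \<ge> 0" using x l y by simp
  have cgq: "continuous_on UNIV (\<lambda>u. goursat_quad m h u (x+l))" if "continuous_on UNIV h" for h
    by (intro continuous_goursat_quad[OF mc that] continuous_intros)
  have "norm (goursat_map \<alpha> m f (x,l) - goursat_map \<alpha> m g (x,l)) = norm (integral {0..x} (\<lambda>u. goursat_quad m g u (x+l) - goursat_quad m f u (x+l)))"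
    using x l by (subst integral_diff) (auto simp: goursat_map_def intro!: integrable_cont cgq f g)
  also have "\<dots> \<le> integral {0..x} (\<lambda>u. 2 * K * B * c * y * exp (k * u))"
    by (rule integral_norm_bound_integral) (intro integrable_cont continuous_intros cgq f g gqd; assumption)+
  also have "\<dots> = 2 * K * B * c * y * ((exp (k * x) - 1) / k)"
    using integral_exp_real[of k x] K x by simp
  also have "\<dots> = (4 * K * B * y) / k * (c / 2 * (exp (k * x) - 1))" by simp
  also have "\<dots> \<le> 1 * (c / 2 * (exp (k * x) - 1))"
    by (rule mult_right_mono) (use K x in auto)
  also have "\<dots> \<le> c / 2 * exp (k * x)" using K by (simp add: algebra_simps)
  finally show ?thesis .
qed

text \<open>An increasing majorant allows constants that depend on the characteristic through
  \<open>y\<close> alone, so that one weight serves the whole quadrant and no continuation from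
  bounded triangles is required.\<close>

lemma continuous_majorant:
  fixes \<phi> :: "real \<Rightarrow> real"
  assumes "continuous_on {0..} \<phi>"
  obtains M where "\<And>y. M y \<ge> 1" "\<And>y y'. 0 \<le> y \<Longrightarrow> y \<le> y' \<Longrightarrow> M y \<le> M y'" "\<And>t y. 0 \<le> t \<Longrightarrow> t \<le> y \<Longrightarrow> \<phi> t \<le> M y"
proof -
  define M where "M y = 1 + Sup (insert 0 ((\<lambda>t. \<bar>\<phi> t\<bar>) ` {0..y}))" for y
  have bd: "bdd_above (insert 0 ((\<lambda>t. \<bar>\<phi> t\<bar>) ` {0..y}))" for y
  proof -
    have "compact ((\<lambda>t. \<bar>\<phi> t\<bar>) ` {0..y})"
      by (intro compact_continuous_image continuous_intros continuous_on_subset[OF assms]) auto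
    then show ?thesis by (simp add: bounded_imp_bdd_above compact_imp_bounded)
  qed
  show ?thesis
  proof
    show "M y \<ge> 1" for y unfolding M_def using cSup_upper[OF _ bd, of 0 y] by simp
    show "M y \<le> M y'" if "0 \<le> y" "y \<le> y'" for y y'
      unfolding M_def using that by (intro add_left_mono cSup_subset_mono bd) auto
    show "\<phi> t \<le> M y" if "0 \<le> t" "t \<le> y" for t y
      unfolding M_def using cSup_upper[OF _ bd, of "\<bar>\<phi> t\<bar>" y] that by auto
  qed
qed

text \<open>The predicate \<open>R\<close> carries an extra property through the iteration: it holds
  for the zero function, is preserved by the map and survives limits that are uniform on quadrants
  bounded above. It will express that one component is the derivative of the other.\<close>

lemma goursat_fixpoint:
  fixes m :: "real \<Rightarrow> 'b \<Rightarrow> 'b \<Rightarrow> 'b::banach"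
  assumes mc: "continuous_on UNIV (\<lambda>q. m (fst q) (fst (snd q)) (snd (snd q)))"
    and bl: "\<And>l. bounded_bilinear (m l)" and a: "continuous_on UNIV \<alpha>"
    and M1: "\<And>y. M y \<ge> 1" and Mm: "\<And>y y'. 0 \<le> y \<Longrightarrow> y \<le> y' \<Longrightarrow> M y \<le> M y'"
    and Ma: "\<And>y. 0 \<le> y \<Longrightarrow> norm (\<alpha> y) \<le> M y"
    and Mb: "\<And>l e e'. 0 \<le> l \<Longrightarrow> norm (m l e e') \<le> M l * norm e * norm e'"
    and R0: "(\<lambda>p. 0) \<in> R" and RF: "\<And>f. continuous_on UNIV f \<Longrightarrow> f \<in> R \<Longrightarrow> goursat_map \<alpha> m f \<in> R"
    and Rc: "\<And>h f. (\<And>n::nat. h n \<in> R) \<Longrightarrow> (\<And>n. continuous_on UNIV (h n)) \<Longrightarrow> continuous_on UNIV f \<Longrightarrow>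
        (\<And>x l. \<exists>W. \<forall>n u v. u \<le> x \<longrightarrow> v \<le> l \<longrightarrow> norm (h n (u,v) - f (u,v)) \<le> W * (1/2)^n) \<Longrightarrow> f \<in> R"
  obtains f where "continuous_on UNIV f" "f \<in> R" "\<And>p. goursat_map \<alpha> m f p = f p"
proof -
  \<comment> \<open>\<open>goursat_map_diff\<close> is used with K = M y and B = 2 M y, so it asks
    for 8 (M y)^2 y <= k; writing 1 + y instead of y keeps the rate positive at y = 0.\<close>
  define kk where "kk y = 8 * (M y)\<^sup>2 * (1 + y)" for y
  define X Y where "X p = max 0 (fst p)" and "Y p = max 0 (fst p) + max 0 (snd p)" for p :: "real \<times> real"
  define w where "w p = M (Y p) * exp (kk (Y p) * X p)" for p
  have M0: "M y \<ge> 0" for y using M1[of y] by linarith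
  have kkm: "kk y \<le> kk y'" if "0 \<le> y" "y \<le> y'" for y y'
    unfolding kk_def using that Mm[OF that] M0 by (intro mult_mono power_mono) auto
  have kkp: "kk y > 0" if "0 \<le> y" for y unfolding kk_def using M1[of y] that by simp
  have wmono: "M y * exp (kk y * u) \<le> M y' * exp (kk y' * u')" if "0 \<le> y" "y \<le> y'" "0 \<le> u" "u \<le> u'" for y y' u u'
    using that Mm[OF that(1,2)] kkm[OF that(1,2)] M0 kkp[of y] kkp[of y']
    by (intro mult_mono) (auto intro!: mult_mono)
  have w0: "w p \<ge> 0" for p unfolding w_def using M0 by simp
  have wuv: "w (u,v) \<le> M y * exp (kk y * u)" if "0 \<le> u" "0 \<le> v" "u + v \<le> y" for u v y
    unfolding w_def X_def Y_def using that by (auto intro!: wmono)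
  have wloc: "w (u,v) \<le> M (max 0 x + max 0 l) * exp (kk (max 0 x + max 0 l) * max 0 x)" if "u \<le> x" "v \<le> l" for u v x l
    unfolding w_def X_def Y_def using that by (intro wmono) auto
  \<comment> \<open>The quadratic map is Lipschitz only on bounded sets. The image of 0 is bounded
    by \<open>w\<close>, and the Lipschitz constant 1/2 on the ball of radius \<open>2 * w\<close>
    adds at most another \<open>w\<close>, so the ball is mapped into itself.\<close>
  define G where "G = {f. continuous_on UNIV f \<and> f \<in> R \<and> (\<forall>p. norm (f p) \<le> 2 * w p)}"
  have Fc: "continuous_on UNIV (goursat_map \<alpha> m f)" if "continuous_on UNIV f" for f
    by (rule continuous_goursat_map[OF mc that a])
  have Fmax: "goursat_map \<alpha> m f p = goursat_map \<alpha> m f (X p, max 0 (snd p))" for f p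
    by (simp add: goursat_map_def X_def)
  have est: "norm (goursat_map \<alpha> m f p - goursat_map \<alpha> m g p) \<le> c / 2 * w p"
    if f: "continuous_on UNIV f" "\<forall>p. norm (f p) \<le> 2 * w p" and g: "continuous_on UNIV g" "\<forall>p. norm (g p) \<le> 2 * w p"
      and c: "c \<ge> 0" and fg: "\<And>p. norm (f p - g p) \<le> c * w p" for f g c p
  proof -
    let ?y = "Y p"
    have Y0: "?y \<ge> 0" by (simp add: Y_def)
    have "norm (goursat_map \<alpha> m f (X p, max 0 (snd p)) - goursat_map \<alpha> m g (X p, max 0 (snd p))) \<le> (c * M ?y) / 2 * exp (kk ?y * X p)"
    proof (rule goursat_map_diff[OF mc bl f(1) g(1), where K = "M ?y" and B = "2 * M ?y" and y = ?y])
      show "4 * M ?y * (2 * M ?y) * ?y \<le> kk ?y"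
        unfolding kk_def using Y0 M0[of ?y] by (simp add: power2_eq_square algebra_simps)
      show "norm (m l e e') \<le> M ?y * norm e * norm e'" if "0 \<le> l" "l \<le> ?y" for l e e'
        by (rule order_trans[OF Mb[OF that(1)]]) (intro mult_right_mono Mm that norm_ge_zero)
      fix u v :: real assume uv: "0 \<le> u" "0 \<le> v" "u + v \<le> ?y"
      note W = wuv[OF uv]
      show "norm (f (u,v)) \<le> 2 * M ?y * exp (kk ?y * u)" using f(2)[rule_format, of "(u,v)"] W unfolding mult.assoc by linarith
      show "norm (g (u,v)) \<le> 2 * M ?y * exp (kk ?y * u)" using g(2)[rule_format, of "(u,v)"] W unfolding mult.assoc by linarith
      show "norm (f (u,v) - g (u,v)) \<le> c * M ?y * exp (kk ?y * u)"
        using fg[of "(u,v)"] mult_left_mono[OF W c] by (simp add: mult.assoc)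
    qed (use M0[of ?y] c kkp[OF Y0] in \<open>auto simp: X_def Y_def\<close>)
    then show ?thesis by (simp add: Fmax[symmetric] w_def)
  qed
  have F0: "norm (goursat_map \<alpha> m (\<lambda>p. 0) p) \<le> w p" for p
  proof -
    have "goursat_map \<alpha> m (\<lambda>p. 0) p = \<alpha> (Y p)"
      by (simp add: goursat_map_def goursat_quad_def Y_def bounded_bilinear.zero_left[OF bl])
    also have "norm \<dots> \<le> M (Y p) * 1" using Ma[of "Y p"] by (simp add: Y_def)
    also have "\<dots> \<le> w p" unfolding w_def
      by (intro mult_left_mono M0) (use kkp[of "Y p"] in \<open>simp add: X_def Y_def\<close>)
    finally show ?thesis .
  qed
  have c0: "continuous_on UNIV (\<lambda>p::real\<times>real. 0::'b)" by simp
  obtain f where f: "f \<in> G" "\<And>p. p \<in> UNIV \<Longrightarrow> goursat_map \<alpha> m f p = f p"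
  proof (rule weighted_fixpoint[where F = "goursat_map \<alpha> m" and G = G and S = UNIV and w = w and ?f0.0 = "\<lambda>p. 0" and ?c0.0 = 1])
    fix f assume fG: "f \<in> G"
    have "norm (goursat_map \<alpha> m f p) \<le> 2 * w p" for p
    proof -
      have "norm (goursat_map \<alpha> m f p - goursat_map \<alpha> m (\<lambda>p. 0) p) \<le> 2 / 2 * w p"
        by (rule est) (use fG w0 in \<open>auto simp: G_def\<close>)
      then show ?thesis using F0[of p] norm_triangle_ineq2[of "goursat_map \<alpha> m f p" "goursat_map \<alpha> m (\<lambda>p. 0) p"] by simp
    qed
    then show "goursat_map \<alpha> m f \<in> G" using fG Fc RF by (simp add: G_def)
  next
    fix f g c p assume "f \<in> G" "g \<in> G" "c \<ge> 0" "\<And>p. p \<in> UNIV \<Longrightarrow> norm (f p - g p) \<le> c * w p"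
    then show "norm (goursat_map \<alpha> m f p - goursat_map \<alpha> m g p) \<le> c / 2 * w p"
      by (intro est) (simp_all add: G_def)
  next
    show "(\<lambda>p. 0) \<in> G" using R0 w0 by (simp add: G_def)
    show "norm (goursat_map \<alpha> m (\<lambda>p. 0) p - 0) \<le> 1 * w p" for p using F0 by simp
  next
    fix h f and C :: real assume h: "\<And>n::nat. h n \<in> G" and b: "\<And>n p. p \<in> UNIV \<Longrightarrow> norm (h n p - f p) \<le> C * (1/2)^n * w p"
    have hc: "continuous_on UNIV (h n)" for n using h by (simp add: G_def)
    have fc: "continuous_on UNIV f"
    proof (rule continuous_weighted_limit[OF hc b])
      fix p :: "real \<times> real"
      have "open ({..<fst p + 1} \<times> {..<snd p + 1})" by (intro open_Times) auto
      moreover have "p \<in> {..<fst p + 1} \<times> {..<snd p + 1}" by (cases p) auto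
      moreover have "\<forall>q\<in>({..<fst p + 1} \<times> {..<snd p + 1}) \<inter> UNIV. w q \<le> M (max 0 (fst p + 1) + max 0 (snd p + 1)) * exp (kk (max 0 (fst p + 1) + max 0 (snd p + 1)) * max 0 (fst p + 1))"
        using wloc[of _ "fst p + 1" _ "snd p + 1"] by auto
      ultimately show "\<exists>U W. open U \<and> p \<in> U \<and> (\<forall>q\<in>U \<inter> UNIV. w q \<le> W)" by blast
    qed (use w0 in auto)
    moreover have "f \<in> R"
    proof (rule Rc[OF _ hc fc])
      show "h n \<in> R" for n using h by (simp add: G_def)
      fix x l :: real
      let ?W = "M (max 0 x + max 0 l) * exp (kk (max 0 x + max 0 l) * max 0 x)"
      have "norm (h n (u,v) - f (u,v)) \<le> (\<bar>C\<bar> * ?W) * (1/2)^n" if "u \<le> x" "v \<le> l" for n u v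
      proof -
        have "norm (h n (u,v) - f (u,v)) \<le> C * (1/2)^n * w (u,v)" using b by simp
        also have "\<dots> \<le> \<bar>C\<bar> * (1/2)^n * ?W"
          using wloc[OF that] w0 by (intro mult_mono) auto
        finally show ?thesis by (simp add: mult_ac)
      qed
      then show "\<exists>W. \<forall>n u v. u \<le> x \<longrightarrow> v \<le> l \<longrightarrow> norm (h n (u,v) - f (u,v)) \<le> W * (1/2)^n" by blast
    qed
    moreover have "norm (f p) \<le> 2 * w p" for p
    proof -
      have "norm (f p) \<le> 2 * w p + C * (1/2)^n * w p" for n
      proof -
        have "norm (h n p) \<le> 2 * w p" using h[of n] unfolding G_def by blast
        then show ?thesis using norm_triangle_ineq3[of "h n p" "f p"] b[of p n] by simp
      qed
      moreover have "(\<lambda>n. 2 * w p + C * (1/2)^n * w p) \<longlonglongrightarrow> 2 * w p + C * 0 * w p"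
        by (intro tendsto_intros LIMSEQ_power_zero) auto
      ultimately have "norm (f p) \<le> 2 * w p + C * 0 * w p" by (intro LIMSEQ_le_const[of _ "2 * w p + C * 0 * w p"]) auto
      then show ?thesis by simp
    qed
    ultimately show "f \<in> G" by (simp add: G_def)
  qed (use w0 in auto)
  then show ?thesis using that by (auto simp: G_def)
qed

text \<open>On the compact triangle below the characteristic \<open>y\<close> both solutions have a
  common bound \<open>B\<close>, from which the rate of the weight is chosen; the contraction
  estimate then halves their weighted distance without end.\<close>

lemma goursat_unique:
  fixes m :: "real \<Rightarrow> 'b \<Rightarrow> 'b \<Rightarrow> 'b::banach"
  assumes mc: "continuous_on UNIV (\<lambda>q. m (fst q) (fst (snd q)) (snd (snd q)))"
    and bl: "\<And>l. bounded_bilinear (m l)"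
    and mb: "\<And>l e e'. 0 \<le> l \<Longrightarrow> l \<le> y \<Longrightarrow> norm (m l e e') \<le> K * norm e * norm e'"
    and f: "continuous_on UNIV f" "\<And>u v. 0 \<le> u \<Longrightarrow> 0 \<le> v \<Longrightarrow> u + v \<le> y \<Longrightarrow> goursat_map \<alpha> m f (u,v) = f (u,v)"
    and g: "continuous_on UNIV g" "\<And>u v. 0 \<le> u \<Longrightarrow> 0 \<le> v \<Longrightarrow> u + v \<le> y \<Longrightarrow> goursat_map \<alpha> m g (u,v) = g (u,v)"
    and xl: "0 \<le> x" "0 \<le> l" "x + l \<le> y"
  shows "f (x,l) = g (x,l)"
proof -
  define S where "S = {p::real\<times>real. 0 \<le> fst p \<and> 0 \<le> snd p \<and> fst p + snd p \<le> y}"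
  have "closed S" unfolding S_def
    by (intro closed_Collect_conj closed_Collect_le continuous_intros)
  moreover have "S \<subseteq> cbox (0,0) (y,y)" unfolding S_def by (auto simp: cbox_Pair_eq)
  ultimately have S: "compact S"
    by (meson bounded_cbox bounded_subset compact_eq_bounded_closed)
  have "bounded (f ` S \<union> g ` S)"
    by (intro compact_imp_bounded compact_Un compact_continuous_image S continuous_on_subset[OF f(1)] continuous_on_subset[OF g(1)]) auto
  then obtain B where B: "B > 0" "\<And>p. p \<in> S \<Longrightarrow> norm (f p) \<le> B" "\<And>p. p \<in> S \<Longrightarrow> norm (g p) \<le> B"
    by (metis (no_types, lifting) bounded_pos image_eqI UnI1 UnI2)
  define k where "k = 4 * \<bar>K\<bar> * B * y + 1"
  have y0: "y \<ge> 0" using xl by simp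
  have k: "k > 0" unfolding k_def using B y0 by (intro add_nonneg_pos mult_nonneg_nonneg) auto
  have Bexp: "B \<le> B * exp (k * u)" if "0 \<le> u" for u using B k that by simp
  have "norm (f (x,l) - g (x,l)) \<le> 0"
  proof (rule halving_zero[where S = S and d = "\<lambda>p. norm (f p - g p)" and w = "\<lambda>p. exp (k * fst p)" and ?c0.0 = "2 * B" and p = "(x,l)"])
    fix c p assume c: "c \<ge> 0" and d: "\<And>p. p \<in> S \<Longrightarrow> norm (f p - g p) \<le> c * exp (k * fst p)" and p: "p \<in> S"
    obtain u v where uv: "p = (u,v)" "0 \<le> u" "0 \<le> v" "u + v \<le> y" using p by (cases p) (auto simp: S_def)
    have "norm (goursat_map \<alpha> m f (u,v) - goursat_map \<alpha> m g (u,v)) \<le> c / 2 * exp (k * u)"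
    proof (rule goursat_map_diff[OF mc bl f(1) g(1) uv(2,3,4), where K = "\<bar>K\<bar>" and B = B])
      show "norm (m l e e') \<le> \<bar>K\<bar> * norm e * norm e'" if "0 \<le> l" "l \<le> y" for l e e'
        by (rule order_trans[OF mb[OF that]]) (intro mult_right_mono norm_ge_zero abs_ge_self)
      fix u v :: real assume uv: "0 \<le> u" "0 \<le> v" "u + v \<le> y"
      then have S: "(u,v) \<in> S" by (simp add: S_def)
      show "norm (f (u,v)) \<le> B * exp (k * u)" "norm (g (u,v)) \<le> B * exp (k * u)"
        using B(2,3)[OF S] Bexp[OF uv(1)] by linarith+
      show "norm (f (u,v) - g (u,v)) \<le> c * exp (k * u)" using d[OF S] by simp
    qed (use B k c in \<open>auto simp: k_def\<close>)
    then show "norm (f p - g p) \<le> c / 2 * exp (k * fst p)" using f(2) g(2) uv by simp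
  next
    fix p assume p: "p \<in> S"
    have "norm (f p - g p) \<le> 2 * B" using norm_triangle_ineq4[of "f p" "g p"] B(2,3)[OF p] by linarith
    also have "\<dots> \<le> 2 * B * exp (k * fst p)" using Bexp[of "fst p"] p by (auto simp: S_def)
    finally show "norm (f p - g p) \<le> 2 * B * exp (k * fst p)" .
  qed (use B xl in \<open>auto simp: S_def\<close>)
  then show ?thesis by simp
qed

text \<open>The boundary value A (0, l) is replaced by a prescribed function \<open>a\<close>. This
  makes the cubic term of the equation bilinear in the unknown.\<close>

definition triple_prod :: "(real \<Rightarrow> complex^'c^'r) \<Rightarrow> real \<Rightarrow> complex^'c^'r \<Rightarrow> complex^'c^'r \<Rightarrow> complex^'c^'r" where
  "triple_prod a l X Y = X ** madj (a l) ** Y"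

text \<open>The pair \<open>(A, D)\<close> of a solution and its derivative in \<open>\<ell>\<close> solves an equation of the same shape
  as the solution itself, with this trilinear form.\<close>

definition triple_prod2 :: "(real \<Rightarrow> complex^'c^'r) \<Rightarrow> (real \<Rightarrow> complex^'c^'r) \<Rightarrow> real \<Rightarrow> (complex^'c^'r) \<times> (complex^'c^'r)
    \<Rightarrow> (complex^'c^'r) \<times> (complex^'c^'r) \<Rightarrow> (complex^'c^'r) \<times> (complex^'c^'r)" where
  "triple_prod2 a a' l X Y = (fst X ** madj (a l) ** fst Y,
     fst X ** madj (a l) ** snd Y + (fst X ** madj (a' l) + snd X ** madj (a l)) ** fst Y)"

lemma norm_triple_prod: "norm (triple_prod a l X Y) \<le> norm (a l) * norm X * norm Y"
proof -
  have "norm (triple_prod a l X Y) \<le> norm (X ** madj (a l)) * norm Y"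
    unfolding triple_prod_def by (rule norm_matrix_mult)
  also have "\<dots> \<le> (norm X * norm (madj (a l))) * norm Y"
    by (intro mult_right_mono norm_matrix_mult norm_ge_zero)
  finally show ?thesis by (simp add: mult_ac)
qed

lemma bilinear_triple_prod: "bounded_bilinear (triple_prod a l)"
proof (rule bounded_bilinear.intro)
  show "\<exists>K. \<forall>X Y. norm (triple_prod a l X Y) \<le> norm X * norm Y * K"
    by (rule exI[of _ "norm (a l)"]) (use norm_triple_prod[of a l] in \<open>simp add: mult_ac\<close>)
qed (auto simp: triple_prod_def mm.add_left mm.add_right mm.scaleR_left mm.scaleR_right)

text \<open>The two components contain four triple products in all, three with \<open>a\<close> and
  one with \<open>a'\<close>.\<close>

lemma norm_triple_prod2: "norm (triple_prod2 a a' l X Y) \<le> (3 * norm (a l) + norm (a' l)) * norm X * norm Y"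
proof -
  have p: "norm (U ** madj C ** V) \<le> norm C * norm X * norm Y"
    if "norm U \<le> norm X" "norm V \<le> norm Y" for U V :: "complex^'c^'r" and C :: "complex^'c^'r"
  proof -
    have "norm (U ** madj C ** V) \<le> norm C * norm U * norm V"
      using norm_triple_prod[of "\<lambda>_. C" l U V] by (simp add: triple_prod_def)
    also have "\<dots> \<le> norm C * norm X * norm Y" by (intro mult_mono that) auto
    finally show ?thesis .
  qed
  have n: "norm (fst Z) \<le> norm Z" "norm (snd Z) \<le> norm Z" for Z :: "(complex^'c^'r) \<times> (complex^'c^'r)"
    by (metis norm_fst_le prod.collapse) (metis norm_snd_le prod.collapse)
  have "norm (triple_prod2 a a' l X Y) \<le> norm (fst X ** madj (a l) ** fst Y) + norm (fst X ** madj (a l) ** snd Y + (fst X ** madj (a' l) + snd X ** madj (a l)) ** fst Y)"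
    unfolding triple_prod2_def by (rule norm_Pair_le)
  also have "\<dots> \<le> norm (fst X ** madj (a l) ** fst Y) + (norm (fst X ** madj (a l) ** snd Y) + (norm (fst X ** madj (a' l) ** fst Y) + norm (snd X ** madj (a l) ** fst Y)))"
    unfolding mm.add_left by (intro add_left_mono norm_triangle_mono order_refl norm_triangle_ineq)
  also have "\<dots> \<le> norm (a l) * norm X * norm Y + (norm (a l) * norm X * norm Y + (norm (a' l) * norm X * norm Y + norm (a l) * norm X * norm Y))"
    by (intro add_mono p n)
  finally show ?thesis by (simp add: algebra_simps)
qed

lemma bilinear_triple_prod2: "bounded_bilinear (triple_prod2 a a' l)"
proof (rule bounded_bilinear.intro)
  show "\<exists>K. \<forall>X Y. norm (triple_prod2 a a' l X Y) \<le> norm X * norm Y * K"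
    by (rule exI[of _ "3 * norm (a l) + norm (a' l)"]) (use norm_triple_prod2[of a a' l] in \<open>simp add: mult_ac\<close>)
qed (auto simp: triple_prod2_def mm.add_left mm.add_right mm.scaleR_left mm.scaleR_right algebra_simps)

definition quad_term :: "(real \<times> real \<Rightarrow> complex^'c^'r) \<Rightarrow> real \<Rightarrow> real \<Rightarrow> complex^'c^'r" where
  "quad_term A x l = integral {0..x} (\<lambda>t. A (x - t, l) ** madj (A (0, l)) ** A (t, l))"

text \<open>The equation integrated along the characteristics \<open>x + \<ell> = const\<close>.\<close>

definition mild :: "(real \<times> real \<Rightarrow> complex^'c^'r) \<Rightarrow> bool" where
  "mild A \<longleftrightarrow> continuous_on UNIV A \<and>
     (\<forall>x\<ge>0. \<forall>l\<ge>0. A (x, l) = A (0, x + l) - integral {0..x} (\<lambda>u. quad_term A u (x + l - u)))"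

lemma continuous_triple_prod:
  assumes "continuous_on UNIV a"
  shows "continuous_on UNIV (\<lambda>q. triple_prod a (fst q) (fst (snd q)) (snd (snd q)))"
  unfolding triple_prod_def by (intro continuous_intros continuous_on_compose2[OF assms]) auto

lemma continuous_triple_prod2:
  assumes "continuous_on UNIV a" "continuous_on UNIV a'"
  shows "continuous_on UNIV (\<lambda>q. triple_prod2 a a' (fst q) (fst (snd q)) (snd (snd q)))"
  unfolding triple_prod2_def
  by (intro continuous_intros continuous_on_compose2[OF assms(1)] continuous_on_compose2[OF assms(2)]) auto

lemma continuous_quad_term:
  assumes A: "continuous_on UNIV A" and "continuous_on UNIV f" "continuous_on UNIV g"
  shows "continuous_on UNIV (\<lambda>p. quad_term A (f p) (g p))"
  unfolding quad_term_def
  by (intro continuous_intros continuous_on_compose2[OF A] continuous_on_compose2[OF assms(2)] continuous_on_compose2[OF assms(3)]) auto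

lemma has_vector_derivative_shift:
  assumes "(g has_vector_derivative g') (at (x + c) within T)" "\<And>z. z \<in> S \<Longrightarrow> z + c \<in> T"
  shows "((\<lambda>x. g (x + c)) has_vector_derivative g') (at (x::real) within S)"
proof -
  have "((\<lambda>x. x + c) has_vector_derivative 1) (at x within S)"
    by (auto intro!: derivative_eq_intros)
  moreover have "(g has_vector_derivative g') (at (x + c) within (\<lambda>x. x + c) ` S)"
    by (rule has_vector_derivative_within_subset[OF assms(1)]) (use assms(2) in auto)
  ultimately have "(g \<circ> (\<lambda>x. x + c) has_vector_derivative 1 *\<^sub>R g') (at x within S)"
    by (rule vector_diff_chain_within)
  then show ?thesis by (simp add: o_def)
qed

lemma fst_integral: "f integrable_on S \<Longrightarrow> fst (integral S f) = integral S (\<lambda>t. fst (f t))"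
  and snd_integral: "f integrable_on S \<Longrightarrow> snd (integral S f) = integral S (\<lambda>t. snd (f t))"
  for f :: "real \<Rightarrow> ('a::euclidean_space) \<times> ('b::euclidean_space)"
  using integral_linear[OF _ bounded_linear_fst, of f S] integral_linear[OF _ bounded_linear_snd, of f S]
  by (simp_all add: o_def)

text \<open>A fixed point for A alone would be merely continuous. The pair with the candidate
  derivative D is therefore iterated, and the relation between the two components is carried along
  as the invariant \<open>R\<close>. The derivative in x then follows from the equation, without a
  second iteration.\<close>

lemma goursat_C1:
  fixes a a' :: "real \<Rightarrow> complex^'c^'r"
  assumes da: "\<And>x. x \<ge> 0 \<Longrightarrow> (a has_vector_derivative a' x) (at x within {0..})"
    and ca': "continuous_on {0..} a'"
  obtains A D where "mild A" "continuous_on UNIV D" "\<And>l. l \<ge> 0 \<Longrightarrow> A (0,l) = a l"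
    "\<And>x l. x \<ge> 0 \<Longrightarrow> l \<ge> 0 \<Longrightarrow> ((\<lambda>l. A (x,l)) has_vector_derivative D (x,l)) (at l within {0..})"
    "\<And>x l. x \<ge> 0 \<Longrightarrow> l \<ge> 0 \<Longrightarrow> ((\<lambda>x. A (x,l)) has_vector_derivative D (x,l) - quad_term A x l) (at x within {0..})"
proof -
  \<comment> \<open>Constant continuation to negative arguments gives functions continuous on the
    whole line.\<close>
  define b b' where "b l = a (max 0 l)" and "b' l = a' (max 0 l)" for l
  have ca: "continuous_on {0..} a"
    using da by (meson atLeast_iff continuous_on_eq_continuous_within has_vector_derivative_continuous)
  have cb: "continuous_on UNIV b" unfolding b_def
    by (intro continuous_on_compose2[OF ca] continuous_intros) auto
  have cb': "continuous_on UNIV b'" unfolding b'_def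
    by (intro continuous_on_compose2[OF ca'] continuous_intros) auto
  have db: "(b has_vector_derivative b' l) (at l within {0..})" if "l \<ge> 0" for l
  proof -
    have "(b has_vector_derivative a' l) (at l within {0..})"
      by (rule has_vector_derivative_transform[OF _ _ da[OF that]]) (use that in \<open>auto simp: b_def\<close>)
    then show ?thesis using that by (simp add: b'_def)
  qed
  define m where "m = triple_prod2 b b'"
  define \<alpha> where "\<alpha> l = (b l, b' l)" for l
  have mc: "continuous_on UNIV (\<lambda>q. m (fst q) (fst (snd q)) (snd (snd q)))"
    unfolding m_def by (rule continuous_triple_prod2[OF cb cb'])
  have bl: "bounded_bilinear (m l)" for l unfolding m_def by (rule bilinear_triple_prod2)
  have c\<alpha>: "continuous_on UNIV \<alpha>" unfolding \<alpha>_def by (intro continuous_intros cb cb')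
  have "continuous_on {0..} (\<lambda>l. 3 * norm (b l) + norm (b' l))"
    by (intro continuous_intros continuous_on_subset[OF cb] continuous_on_subset[OF cb']) auto
  then obtain M where M1: "\<And>y. M y \<ge> 1" and Mm: "\<And>y y'. 0 \<le> y \<Longrightarrow> y \<le> y' \<Longrightarrow> M y \<le> M y'"
    and Mb: "\<And>t y. 0 \<le> t \<Longrightarrow> t \<le> y \<Longrightarrow> 3 * norm (b t) + norm (b' t) \<le> M y"
    using continuous_majorant by blast
  define q1 where "q1 f u l = integral {0..u} (\<lambda>t. fst (f (u - t, l)) ** madj (b l) ** fst (f (t, l)))"
    for f :: "real \<times> real \<Rightarrow> (complex^'c^'r) \<times> (complex^'c^'r)" and u l
  define q2 where "q2 f u l = integral {0..u} (\<lambda>t. snd (m l (f (u - t, l)) (f (t, l))))"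
    for f :: "real \<times> real \<Rightarrow> (complex^'c^'r) \<times> (complex^'c^'r)" and u l
  have mcomp: "continuous_on U (\<lambda>t. m (r t) (f1 t) (f2 t))"
    if "continuous_on U r" "continuous_on U f1" "continuous_on U f2"
    for r f1 f2 and U :: "'z::topological_space set"
    using continuous_on_compose2[OF mc continuous_on_Pair[OF that(1) continuous_on_Pair[OF that(2,3)]]] by auto
  have gq12: "goursat_quad m f u y = (q1 f u (y - u), q2 f u (y - u))" if f: "continuous_on UNIV f" for f u y
  proof -
    have "(\<lambda>t. m (y - u) (f (u - t, y - u)) (f (t, y - u))) integrable_on {0..u}"
      by (intro integrable_cont mcomp continuous_on_compose2[OF f] continuous_intros) auto
    then show ?thesis
      by (intro prod_eqI) (simp_all add: goursat_quad_def q1_def q2_def fst_integral snd_integral, simp add: m_def triple_prod2_def)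
  qed
  have cq1: "continuous_on UNIV (\<lambda>p. q1 f (F p) (H p))" if f: "continuous_on UNIV f" and FH: "continuous_on UNIV F" "continuous_on UNIV H"
    for f H and F :: "'z::t2_space \<Rightarrow> real"
    unfolding q1_def
    by (intro continuous_intros continuous_on_compose2[OF f] continuous_on_compose2[OF cb] continuous_on_compose2[OF FH(1)] continuous_on_compose2[OF FH(2)]) auto
  have cq2: "continuous_on UNIV (\<lambda>p. q2 f (F p) (H p))" if f: "continuous_on UNIV f" and FH: "continuous_on UNIV F" "continuous_on UNIV H"
    for f H and F :: "'z::t2_space \<Rightarrow> real"
    unfolding q2_def
    by (intro continuous_intros mcomp continuous_on_compose2[OF f] continuous_on_compose2[OF FH(1)] continuous_on_compose2[OF FH(2)]) auto
  \<comment> \<open>The relation D = dA/dl in integrated form: it passes to locally uniform limits,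
    whereas the derivative itself would not.\<close>
  define R where "R = {f :: real \<times> real \<Rightarrow> (complex^'c^'r) \<times> (complex^'c^'r). \<forall>x\<ge>0. \<forall>l\<ge>0. fst (f (x,l)) - fst (f (x,0)) = integral {0..l} (\<lambda>s. snd (f (x,s)))}"
  have Rd: "((\<lambda>l. fst (f (x,l))) has_vector_derivative snd (f (x,l))) (at l within {0..})"
    if f: "continuous_on UNIV f" "f \<in> R" and xl: "x \<ge> 0" "l \<ge> 0" for f x l
  proof -
    have "continuous_on UNIV (\<lambda>s. snd (f (x,s)))" by (intro continuous_intros continuous_on_compose2[OF f(1)]) auto
    then have "((\<lambda>l. integral {0..l} (\<lambda>s. snd (f (x,s)))) has_vector_derivative snd (f (x,l))) (at l within {0..})"
      by (rule FTC_within) (use xl in auto)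
    from has_vector_derivative_add[OF has_vector_derivative_const[of "fst (f (x,0))"] this]
    have "((\<lambda>l. fst (f (x,0)) + integral {0..l} (\<lambda>s. snd (f (x,s)))) has_vector_derivative snd (f (x,l))) (at l within {0..})"
      by simp
    then show ?thesis
    proof (rule has_vector_derivative_transform[rotated 2])
      fix s :: real assume "s \<in> {0..}"
      then have "fst (f (x,s)) - fst (f (x,0)) = integral {0..s} (\<lambda>s. snd (f (x,s)))"
        using f(2) xl unfolding R_def by blast
      then show "fst (f (x,s)) = fst (f (x,0)) + integral {0..s} (\<lambda>s. snd (f (x,s)))"
        by (metis add.commute diff_eq_eq)
    qed (use xl in auto)
  qed
  \<comment> \<open>The product rule for the three factors under the integral yields exactly the
    second component of \<open>triple_prod2\<close>; this is where the shape of that product comes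
    from.\<close>
  have q1d: "((\<lambda>l. q1 f u l) has_vector_derivative q2 f u l) (at l within {0..})"
    if f: "continuous_on UNIV f" "f \<in> R" and ul: "l \<ge> 0" for f u l
  proof -
    have "((\<lambda>l. integral (cbox 0 u) (\<lambda>t. fst (f (u - t, l)) ** madj (b l) ** fst (f (t, l)))) has_vector_derivative
       integral (cbox 0 u) (\<lambda>t. snd (m l (f (u - t, l)) (f (t, l))))) (at l within {0..})"
    proof (rule leibniz_rule_vector_derivative)
      fix l t :: real assume l: "l \<in> {0..}" and t: "t \<in> cbox 0 u"
      show "((\<lambda>l. fst (f (u - t, l)) ** madj (b l) ** fst (f (t, l))) has_vector_derivative snd (m l (f (u - t, l)) (f (t, l)))) (at l within {0..})"
        unfolding m_def triple_prod2_def snd_conv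
        by (intro mm.has_vector_derivative bounded_linear.has_vector_derivative[OF bounded_linear_madj] Rd f db) (use l t in auto)
    next
      fix l :: real
      show "(\<lambda>t. fst (f (u - t, l)) ** madj (b l) ** fst (f (t, l))) integrable_on cbox 0 u"
        unfolding interval_cbox[symmetric]
        by (intro integrable_cont continuous_intros continuous_on_compose2[OF f(1)]) auto
    next
      show "continuous_on ({0..} \<times> cbox 0 u) (\<lambda>(l, t). snd (m l (f (u - t, l)) (f (t, l))))"
        unfolding split_beta by (intro continuous_intros mcomp continuous_on_compose2[OF f(1)]) auto
    qed (use ul in auto)
    then show ?thesis by (simp add: q1_def q2_def)
  qed
  define I1 I2 where "I1 f x l = integral {0..x} (\<lambda>u. q1 f u (x + l - u))" and "I2 f x l = integral {0..x} (\<lambda>u. q2 f u (x + l - u))"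
    for f x l
  have map12: "goursat_map \<alpha> m f (x,l) = (b (x + l) - I1 f x l, b' (x + l) - I2 f x l)" if f: "continuous_on UNIV f" and xl: "x \<ge> 0" "l \<ge> 0" for f x l
  proof -
    have "(\<lambda>u. (q1 f u (x + l - u), q2 f u (x + l - u))) integrable_on {0..x}"
      by (intro integrable_cont continuous_intros cq1 cq2 f)
    then show ?thesis using xl
      by (intro prod_eqI) (simp_all add: goursat_map_def gq12[OF f] fst_integral snd_integral \<alpha>_def I1_def I2_def)
  qed
  have I1d: "((\<lambda>l. I1 f x l) has_vector_derivative I2 f x l) (at l within {0..})"
    if f: "continuous_on UNIV f" "f \<in> R" and xl: "x \<ge> 0" "l \<ge> 0" for f x l
  proof -
    have "((\<lambda>l. integral (cbox 0 x) (\<lambda>u. q1 f u (x + l - u))) has_vector_derivative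
       integral (cbox 0 x) (\<lambda>u. q2 f u (x + l - u))) (at l within {0..})"
    proof (rule leibniz_rule_vector_derivative)
      fix l u :: real assume l: "l \<in> {0..}" and u: "u \<in> cbox 0 x"
      have "((\<lambda>l. q1 f u (l + (x - u))) has_vector_derivative q2 f u (l + (x - u))) (at l within {0..})"
        by (rule has_vector_derivative_shift[OF q1d[OF f]]) (use l u in auto)
      then show "((\<lambda>l. q1 f u (x + l - u)) has_vector_derivative q2 f u (x + l - u)) (at l within {0..})"
        by (simp add: algebra_simps)
    next
      fix l :: real
      show "(\<lambda>u. q1 f u (x + l - u)) integrable_on cbox 0 x"
        unfolding interval_cbox[symmetric]
        by (intro integrable_cont continuous_intros cq1 f)
    next
      show "continuous_on ({0..} \<times> cbox 0 x) (\<lambda>(l, u). q2 f u (x + l - u))"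
        unfolding split_beta by (rule continuous_on_subset[OF _ subset_UNIV]) (intro continuous_intros cq2 f)
    qed (use xl in auto)
    then show ?thesis by (simp add: I1_def I2_def)
  qed
  obtain f where f: "continuous_on UNIV f" "f \<in> R" "\<And>p. goursat_map \<alpha> m f p = f p"
  proof (rule goursat_fixpoint[OF mc bl c\<alpha> M1 Mm])
    show "norm (\<alpha> y) \<le> M y" if "0 \<le> y" for y
    proof -
      have "norm (\<alpha> y) \<le> norm (b y) + norm (b' y)" unfolding \<alpha>_def by (rule norm_Pair_le)
      then show ?thesis using Mb[OF that order_refl] norm_ge_zero[of "b y"] by linarith
    qed
    show "norm (m l e e') \<le> M l * norm e * norm e'" if "0 \<le> l" for l e e'
      unfolding m_def by (rule order_trans[OF norm_triple_prod2]) (intro mult_right_mono Mb that norm_ge_zero order_refl)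
    show "(\<lambda>p. 0) \<in> R" by (simp add: R_def)
  next
    fix f assume f: "continuous_on UNIV f" "f \<in> R"
    show "goursat_map \<alpha> m f \<in> R" unfolding R_def
    proof (intro CollectI allI impI)
      fix x l :: real assume xl: "x \<ge> 0" "l \<ge> 0"
      have "((\<lambda>s. snd (goursat_map \<alpha> m f (x,s))) has_integral fst (goursat_map \<alpha> m f (x,l)) - fst (goursat_map \<alpha> m f (x,0))) {0..l}"
      proof (rule fundamental_theorem_of_calculus)
        fix s assume s: "s \<in> {0..l}"
        have "((\<lambda>s. b (s + x)) has_vector_derivative b' (s + x)) (at s within {0..})"
          by (rule has_vector_derivative_shift[OF db]) (use s xl in auto)
        then have "((\<lambda>s. b (x + s) - I1 f x s) has_vector_derivative b' (x + s) - I2 f x s) (at s within {0..})"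
          by (intro has_vector_derivative_diff I1d f) (use s xl in \<open>auto simp: add.commute\<close>)
        then have "((\<lambda>s. b (x + s) - I1 f x s) has_vector_derivative b' (x + s) - I2 f x s) (at s within {0..l})"
          by (rule has_vector_derivative_within_subset) auto
        then show "((\<lambda>s. fst (goursat_map \<alpha> m f (x,s))) has_vector_derivative snd (goursat_map \<alpha> m f (x,s))) (at s within {0..l})"
          using has_vector_derivative_transform[OF s, of "\<lambda>s. fst (goursat_map \<alpha> m f (x,s))" "\<lambda>s. b (x + s) - I1 f x s"] s xl
          by (simp add: map12[OF f(1)])
      qed (use xl in auto)
      then show "fst (goursat_map \<alpha> m f (x,l)) - fst (goursat_map \<alpha> m f (x,0)) = integral {0..l} (\<lambda>s. snd (goursat_map \<alpha> m f (x,s)))"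
        by (simp add: integral_unique)
    qed
  next
    fix h f assume h: "\<And>n::nat. h n \<in> R" "\<And>n. continuous_on UNIV (h n)" and f: "continuous_on UNIV f"
      and u: "\<And>x l. \<exists>W. \<forall>n u v. u \<le> x \<longrightarrow> v \<le> l \<longrightarrow> norm (h n (u,v) - f (u,v)) \<le> W * (1/2)^n"
    show "f \<in> R" unfolding R_def
    proof (intro CollectI allI impI)
      fix x l :: real assume xl: "x \<ge> 0" "l \<ge> 0"
      obtain W where W: "\<And>n u v. u \<le> x \<Longrightarrow> v \<le> l \<Longrightarrow> norm (h n (u,v) - f (u,v)) \<le> W * (1/2)^n" using u by blast
      have lim0: "(\<lambda>n. W * (1/2::real)^n) \<longlonglongrightarrow> 0"
        using tendsto_mult[OF tendsto_const[of W] LIMSEQ_power_zero[of "1/2::real"]] by simp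
      have pt: "(\<lambda>n. h n (x,v)) \<longlonglongrightarrow> f (x,v)" if "v \<le> l" for v
        using Lim_null_comparison[of "\<lambda>n. h n (x,v) - f (x,v)" "\<lambda>n. W * (1/2)^n" sequentially] W[of x v] that lim0
        by (simp add: LIM_zero_iff)
      have ul: "uniform_limit {0..l} (\<lambda>n s. snd (h n (x,s))) (\<lambda>s. snd (f (x,s))) sequentially"
      proof (rule uniform_limitI)
        fix e :: real assume "e > 0"
        then have "\<forall>\<^sub>F n in sequentially. W * (1/2)^n < e" using lim0 by (auto dest: order_tendstoD(2))
        then show "\<forall>\<^sub>F n in sequentially. \<forall>s\<in>{0..l}. dist (snd (h n (x,s))) (snd (f (x,s))) < e"
        proof eventually_elim
          case (elim n)
          show ?case
          proof
            fix s assume "s \<in> {0..l}"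
            then have "norm (h n (x,s) - f (x,s)) < e" using W[of x s n] elim by auto
            then show "dist (snd (h n (x,s))) (snd (f (x,s))) < e"
              using dist_snd_le[of "h n (x,s)" "f (x,s)"] by (simp add: dist_norm)
          qed
        qed
      qed
      have "continuous_on {0..l} (\<lambda>s. snd (h n (x,s)))" for n
        by (intro continuous_intros continuous_on_compose2[OF h(2)]) auto
      from uniform_limit_integral[OF ul this] obtain I J where IJ: "\<And>n. ((\<lambda>s. snd (h n (x,s))) has_integral I n) {0..l}"
        "((\<lambda>s. snd (f (x,s))) has_integral J) {0..l}" "I \<longlonglongrightarrow> J" by auto
      have "I n = fst (h n (x,l)) - fst (h n (x,0))" for n
        using h(1)[of n] xl integral_unique[OF IJ(1)[of n]] unfolding R_def by simp
      then have "I = (\<lambda>n. fst (h n (x,l)) - fst (h n (x,0)))" by (rule ext)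
      then have "I \<longlonglongrightarrow> fst (f (x,l)) - fst (f (x,0))"
        using tendsto_diff[OF tendsto_fst[OF pt[of l]] tendsto_fst[OF pt[of 0]]] xl by simp
      then have "J = fst (f (x,l)) - fst (f (x,0))" using IJ(3) LIMSEQ_unique by blast
      then show "fst (f (x,l)) - fst (f (x,0)) = integral {0..l} (\<lambda>s. snd (f (x,s)))"
        using integral_unique[OF IJ(2)] by simp
    qed
  next
    fix f assume "continuous_on UNIV f" "f \<in> R" "\<And>p. goursat_map \<alpha> m f p = f p"
    then show thesis by (rule that)
  qed
  define A D where "A p = fst (f p)" and "D p = snd (f p)" for p
  have cA: "continuous_on UNIV A" and cD: "continuous_on UNIV D"
    unfolding A_def D_def by (intro continuous_intros f)+
  have feq: "f (x,l) = (b (x + l) - I1 f x l, b' (x + l) - I2 f x l)" if "x \<ge> 0" "l \<ge> 0" for x l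
    using map12[OF f(1) that] f(3)[of "(x,l)"] by simp
  have Aeq: "A (x,l) = b (x + l) - I1 f x l" and Deq: "D (x,l) = b' (x + l) - I2 f x l" if "x \<ge> 0" "l \<ge> 0" for x l
    unfolding A_def D_def feq[OF that] by simp_all
  have A0: "A (0,l) = b l" if "l \<ge> 0" for l using Aeq[of 0 l] that by (simp add: I1_def)
  have q1Q: "q1 f u l = quad_term A u l" if "l \<ge> 0" for u l
    unfolding q1_def quad_term_def A0[OF that] by (simp add: A_def)
  have "mild A" unfolding mild_def
  proof (intro conjI cA allI impI)
    fix x l :: real assume xl: "x \<ge> 0" "l \<ge> 0"
    have "I1 f x l = integral {0..x} (\<lambda>u. quad_term A u (x + l - u))"
      unfolding I1_def by (rule integral_cong) (use xl q1Q in auto)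
    then show "A (x,l) = A (0, x + l) - integral {0..x} (\<lambda>u. quad_term A u (x + l - u))"
      using Aeq[OF xl] A0[of "x + l"] xl by simp
  qed
  moreover note cD
  moreover have "A (0,l) = a l" if "l \<ge> 0" for l using A0[OF that] that by (simp add: b_def)
  moreover have "((\<lambda>l. A (x,l)) has_vector_derivative D (x,l)) (at l within {0..})" if "x \<ge> 0" "l \<ge> 0" for x l
    unfolding A_def D_def by (rule Rd[OF f(1,2) that])
  moreover have "((\<lambda>x. A (x,l)) has_vector_derivative D (x,l) - quad_term A x l) (at x within {0..})" if xl: "x \<ge> 0" "l \<ge> 0" for x l
  proof -
    \<comment> \<open>In x the upper limit moves in addition to the shift of the argument. The
      boundary term is the quadratic term at (x, l), whence the x-derivative is D minus
      \<open>quad_term\<close>. The interval is prolonged to x + 1 so that x is not its right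
      end.\<close>
    have "((\<lambda>x. integral {0..x} (\<lambda>u. q1 f u (x + l - u))) has_vector_derivative
        q1 f x (x + l - x) + integral {0..x} (\<lambda>u. q2 f u (x + l - u))) (at x within {0..x+1})"
    proof (rule leibniz_upto)
      fix u z assume uz: "0 \<le> u" "u \<le> z" "z \<le> x + 1"
      have "((\<lambda>z. q1 f u (z + (l - u))) has_vector_derivative q2 f u (z + (l - u))) (at z within {u..x+1})"
        by (rule has_vector_derivative_shift[OF q1d[OF f(1,2)]]) (use uz xl in auto)
      then show "((\<lambda>x. q1 f u (x + l - u)) has_vector_derivative q2 f u (z + l - u)) (at z within {u..x+1})"
        by (simp add: algebra_simps)
    qed (intro continuous_intros cq1 cq2 f | use xl in simp)+
    then have "((\<lambda>x. I1 f x l) has_vector_derivative q1 f x l + I2 f x l) (at x within {0..x+1})"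
      by (simp add: I1_def I2_def)
    moreover have "((\<lambda>x. b (x + l)) has_vector_derivative b' (x + l)) (at x within {0..x+1})"
      by (rule has_vector_derivative_shift[OF db]) (use xl in auto)
    ultimately have "((\<lambda>x. b (x + l) - I1 f x l) has_vector_derivative b' (x + l) - (q1 f x l + I2 f x l)) (at x within {0..x+1})"
      by (intro has_vector_derivative_diff)
    moreover have "at x within {0..x+1} = at x within {0..}" by (rule at_within_nhd[of x "{..<x+1}"]) auto
    moreover have "b' (x + l) - (q1 f x l + I2 f x l) = D (x,l) - quad_term A x l"
      using Deq[OF xl] q1Q[OF xl(2)] by simp
    ultimately have "((\<lambda>x. b (x + l) - I1 f x l) has_vector_derivative D (x,l) - quad_term A x l) (at x within {0..})"
      by simp
    then show ?thesis
      by (rule has_vector_derivative_transform[rotated 2]) (use Aeq xl in auto)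
  qed
  ultimately show ?thesis using that by blast
qed

lemma goursat_map_triple_prod:
  assumes "x \<ge> 0" "l \<ge> 0" and a: "\<And>s. 0 \<le> s \<Longrightarrow> s \<le> x + l \<Longrightarrow> a s = A (0, s)"
  shows "goursat_map a (triple_prod a) A (x,l) = A (0, x + l) - integral {0..x} (\<lambda>u. quad_term A u (x + l - u))"
proof -
  have "integral {0..x} (\<lambda>u. goursat_quad (triple_prod a) A u (x + l)) = integral {0..x} (\<lambda>u. quad_term A u (x + l - u))"
    by (rule integral_cong) (use assms in \<open>simp add: goursat_quad_def triple_prod_def quad_term_def\<close>)
  then show ?thesis using assms by (simp add: goursat_map_def)
qed

text \<open>With a = A (0, .) frozen, both functions are fixed points of the same map
  \<open>goursat_map a\<close> below the characteristic \<open>y\<close>, because their boundary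
  values agree there.\<close>

lemma mild_unique:
  assumes A: "mild A" and B: "mild B" and eq: "\<And>s. 0 \<le> s \<Longrightarrow> s \<le> y \<Longrightarrow> A (0, s) = B (0, s)"
    and xl: "x \<ge> 0" "l \<ge> 0" "x + l \<le> y"
  shows "A (x,l) = B (x,l)"
proof -
  define a where "a s = A (0, s)" for s
  have cA: "continuous_on UNIV A" and cB: "continuous_on UNIV B" using A B by (simp_all add: mild_def)
  have ca: "continuous_on UNIV a" unfolding a_def by (intro continuous_on_compose2[OF cA] continuous_intros) auto
  have "compact (a ` {0..y})"
    by (intro compact_continuous_image continuous_on_subset[OF ca]) auto
  then have "bounded (a ` {0..y})" by (rule compact_imp_bounded)
  then obtain K where K: "\<And>s. s \<in> {0..y} \<Longrightarrow> norm (a s) \<le> K"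
    unfolding bounded_iff by blast
  show ?thesis
  proof (rule goursat_unique[OF continuous_triple_prod[OF ca] bilinear_triple_prod _ cA _ cB _ xl])
    show "norm (triple_prod a l e e') \<le> K * norm e * norm e'" if "0 \<le> l" "l \<le> y" for l e e'
      by (rule order_trans[OF norm_triple_prod]) (intro mult_right_mono K norm_ge_zero, use that in auto)
    show "goursat_map a (triple_prod a) A (u, v) = A (u, v)" if "0 \<le> u" "0 \<le> v" "u + v \<le> y" for u v
    proof -
      have "goursat_map a (triple_prod a) A (u, v) = A (0, u + v) - integral {0..u} (\<lambda>x. quad_term A x (u + v - x))"
        by (rule goursat_map_triple_prod) (use that in \<open>simp_all add: a_def\<close>)
      moreover have "A (u, v) = A (0, u + v) - integral {0..u} (\<lambda>x. quad_term A x (u + v - x))"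
        using A that unfolding mild_def by blast
      ultimately show ?thesis by (rule trans[OF _ sym])
    qed
    show "goursat_map a (triple_prod a) B (u, v) = B (u, v)" if "0 \<le> u" "0 \<le> v" "u + v \<le> y" for u v
    proof -
      have "goursat_map a (triple_prod a) B (u, v) = B (0, u + v) - integral {0..u} (\<lambda>x. quad_term B x (u + v - x))"
        by (rule goursat_map_triple_prod) (use that eq in \<open>simp_all add: a_def\<close>)
      moreover have "B (u, v) = B (0, u + v) - integral {0..u} (\<lambda>x. quad_term B x (u + v - x))"
        using B that unfolding mild_def by blast
      ultimately show ?thesis by (rule trans[OF _ sym])
    qed
  qed
qed

section \<open>Passage between the integral equation and the integro-differential equation\<close>

lemma quadrant_Times: "quadrant = {0..} \<times> {0..}"
  by (auto simp: quadrant_def)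

lemma A_equation_solution_cong:
  assumes A: "A_equation_solution A" and eq: "\<And>p. p \<in> quadrant \<Longrightarrow> B p = A p"
  shows "A_equation_solution B"
proof -
  obtain Dx Dl where D: "C1_quadrant_with A Dx Dl"
    and e: "\<And>x l. x \<ge> 0 \<Longrightarrow> l \<ge> 0 \<Longrightarrow> Dl (x, l) = Dx (x, l) + integral {0..x} (\<lambda>t. A (x - t, l) ** madj (A (0, l)) ** A (t, l))"
    using A unfolding A_equation_solution_def by blast
  have "C1_quadrant_with B Dx Dl"
    using D unfolding C1_quadrant_with_def
    by (auto intro: has_derivative_transform[OF _ eq])
  moreover have "Dl (x, l) = Dx (x, l) + integral {0..x} (\<lambda>t. B (x - t, l) ** madj (B (0, l)) ** B (t, l))"
    if "x \<ge> 0" "l \<ge> 0" for x l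
  proof -
    have "integral {0..x} (\<lambda>t. B (x - t, l) ** madj (B (0, l)) ** B (t, l)) = integral {0..x} (\<lambda>t. A (x - t, l) ** madj (A (0, l)) ** A (t, l))"
      by (rule integral_cong) (use that in \<open>simp add: eq quadrant_def\<close>)
    then show ?thesis using e[OF that] by simp
  qed
  ultimately show ?thesis unfolding A_equation_solution_def by blast
qed

lemma mild_solution_exists:
  fixes a :: "real \<Rightarrow> complex^'m1^'m2"
  assumes "C1_nonneg a"
  obtains A where "mild A" "A_equation_solution A" "\<And>l. l \<ge> 0 \<Longrightarrow> A (0, l) = a l"
proof -
  obtain a' where a': "\<And>x. x \<ge> 0 \<Longrightarrow> (a has_vector_derivative a' x) (at x within {0..})" "continuous_on {0..} a'"
    using assms unfolding C1_nonneg_def by blast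
  obtain A D where A: "mild A" and cD: "continuous_on UNIV D" and A0: "\<And>l. l \<ge> 0 \<Longrightarrow> A (0,l) = a l"
    and dl: "\<And>x l. x \<ge> 0 \<Longrightarrow> l \<ge> 0 \<Longrightarrow> ((\<lambda>l. A (x,l)) has_vector_derivative D (x,l)) (at l within {0..})"
    and dx: "\<And>x l. x \<ge> 0 \<Longrightarrow> l \<ge> 0 \<Longrightarrow> ((\<lambda>x. A (x,l)) has_vector_derivative D (x,l) - quad_term A x l) (at x within {0..})"
    by (rule goursat_C1[OF a']) blast+
  define Dx where "Dx p = D p - quad_term A (fst p) (snd p)" for p
  have cA: "continuous_on UNIV A" using A by (simp add: mild_def)
  have "C1_quadrant_with A Dx D" unfolding C1_quadrant_with_def
  proof (intro conjI ballI)
    show "continuous_on quadrant Dx" unfolding Dx_def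
      by (rule continuous_on_subset[OF _ subset_UNIV]) (intro continuous_intros cD continuous_quad_term[OF cA])
    show "continuous_on quadrant D" by (rule continuous_on_subset[OF cD subset_UNIV])
    fix p :: "real \<times> real" assume "p \<in> quadrant"
    then obtain x l where p: "p = (x,l)" "x \<ge> 0" "l \<ge> 0" by (cases p) (auto simp: quadrant_def)
    \<comment> \<open>Both partial derivatives exist and the one in l is continuous, which gives the
      total derivative on the convex set {0..} x {0..}, its edges included.\<close>
    have "((\<lambda>(x, l). A (x,l)) has_derivative (\<lambda>(tx, ty). tx *\<^sub>R Dx (x,l) + blinfun_scaleR_left (D (x,l)) ty)) (at (x, l) within {0..} \<times> {0..})"
    proof (rule has_derivative_partialsI)
      show "((\<lambda>x. A (x, l)) has_derivative (\<lambda>h. h *\<^sub>R Dx (x, l))) (at x within {0..})"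
        using dx[OF p(2,3)] by (simp add: has_vector_derivative_def Dx_def)
      show "((\<lambda>y. A (u, y)) has_derivative blinfun_apply (blinfun_scaleR_left (D (u, y)))) (at y within {0..})"
        if "u \<in> {0..}" "y \<in> {0..}" for u y
        using dl[of u y] that by (simp add: has_vector_derivative_def)
      have "continuous_on ({0..} \<times> {0..}) (\<lambda>q. blinfun_scaleR_left (D q))"
        by (rule continuous_on_subset[OF _ subset_UNIV]) (intro continuous_intros cD)
      then have "continuous (at (x, l) within {0..} \<times> {0..}) (\<lambda>q. blinfun_scaleR_left (D q))"
        using p unfolding continuous_on_eq_continuous_within by blast
      then show "continuous (at (x, l) within {0..} \<times> {0..}) (\<lambda>(x, y). blinfun_scaleR_left (D (x, y)))"
        by (metis (no_types, lifting) case_prod_eta cond_case_prod_eta)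
    qed (use p in auto)
    then show "(A has_derivative (\<lambda>h. fst h *\<^sub>R Dx p + snd h *\<^sub>R D p)) (at p within quadrant)"
      unfolding quadrant_Times p(1) by (simp add: split_beta')
  qed
  then have "A_equation_solution A"
    unfolding A_equation_solution_def by (intro exI[of _ Dx] exI[of _ D]) (auto simp: Dx_def quad_term_def)
  with A A0 that show ?thesis by blast
qed

text \<open>Along u -> (u, x + l - u) the chain rule gives the derivative Dx - Dl, which the
  equation identifies with minus the quadratic term; integrating over [0, x] yields the mild
  form.\<close>

lemma solution_imp_mild:
  assumes B: "A_equation_solution (B :: real \<times> real \<Rightarrow> complex^'m1^'m2)"
  obtains A where "mild A" "\<And>p. p \<in> quadrant \<Longrightarrow> A p = B p" "C1_nonneg (\<lambda>l. B (0, l))" "C1_nonneg (\<lambda>x. B (x, 0))"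
proof -
  obtain Dx Dl where D: "C1_quadrant_with B Dx Dl"
    and e: "\<And>x l. x \<ge> 0 \<Longrightarrow> l \<ge> 0 \<Longrightarrow> Dl (x, l) = Dx (x, l) + integral {0..x} (\<lambda>t. B (x - t, l) ** madj (B (0, l)) ** B (t, l))"
    using B unfolding A_equation_solution_def by blast
  have cx: "continuous_on quadrant Dx" and cl: "continuous_on quadrant Dl"
    and d: "\<And>p. p \<in> quadrant \<Longrightarrow> (B has_derivative (\<lambda>h. fst h *\<^sub>R Dx p + snd h *\<^sub>R Dl p)) (at p within quadrant)"
    using D unfolding C1_quadrant_with_def by auto
  have cB: "continuous_on quadrant B"
    using d by (meson continuous_on_eq_continuous_within has_derivative_continuous)
  \<comment> \<open>\<open>mild\<close> speaks of continuity on the plane, while \<open>B\<close> is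
    controlled on the quadrant only; clamping both arguments supplies a continuous
    representative.\<close>
  define A where "A p = B (max 0 (fst p), max 0 (snd p))" for p
  have AB: "A p = B p" if "p \<in> quadrant" for p using that by (cases p) (auto simp: A_def quadrant_def)
  have cA: "continuous_on UNIV A" unfolding A_def
    by (intro continuous_on_compose2[OF cB] continuous_intros) (auto simp: quadrant_def)
  have path: "((\<lambda>s. B (\<gamma> s)) has_vector_derivative fst g *\<^sub>R Dx (\<gamma> s) + snd g *\<^sub>R Dl (\<gamma> s)) (at s within S)"
    if g: "(\<gamma> has_vector_derivative g) (at s within S)" and im: "\<gamma> ` S \<subseteq> quadrant" and s: "s \<in> S" for \<gamma> g s S
  proof -
    have "(B has_derivative (\<lambda>h. fst h *\<^sub>R Dx (\<gamma> s) + snd h *\<^sub>R Dl (\<gamma> s))) (at (\<gamma> s) within \<gamma> ` S)"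
      by (rule has_derivative_subset[OF d im]) (use im s in auto)
    from diff_chain_within[OF g[unfolded has_vector_derivative_def] this]
    show ?thesis by (simp add: has_vector_derivative_def o_def scaleR_add_right)
  qed
  have "mild A" unfolding mild_def
  proof (intro conjI cA allI impI)
    fix x l :: real assume xl: "x \<ge> 0" "l \<ge> 0"
    have "((\<lambda>u. - quad_term A u (x + l - u)) has_integral B (x, x + l - x) - B (0, x + l - 0)) {0..x}"
    proof (rule fundamental_theorem_of_calculus)
      fix u assume u: "u \<in> {0..x}"
      have "((\<lambda>u. x + l - u) has_vector_derivative 0 - 1) (at u within {0..x})"
        by (intro has_vector_derivative_diff has_vector_derivative_const has_vector_derivative_id)
      then have 1: "((\<lambda>u. (u, x + l - u)) has_vector_derivative (1, -1)) (at u within {0..x})"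
        by (intro has_vector_derivative_Pair has_vector_derivative_id) simp
      have "(\<lambda>u. (u, x + l - u)) ` {0..x} \<subseteq> quadrant" using xl by (auto simp: quadrant_def)
      from path[OF 1 this u] have "((\<lambda>u. B (u, x + l - u)) has_vector_derivative Dx (u, x + l - u) - Dl (u, x + l - u)) (at u within {0..x})"
        by simp
      moreover have "quad_term A u (x + l - u) = integral {0..u} (\<lambda>t. B (u - t, x + l - u) ** madj (B (0, x + l - u)) ** B (t, x + l - u))"
        unfolding quad_term_def by (rule integral_cong) (use u xl in \<open>auto simp: AB quadrant_def\<close>)
      ultimately show "((\<lambda>u. B (u, x + l - u)) has_vector_derivative - quad_term A u (x + l - u)) (at u within {0..x})"
        using e[of u "x + l - u"] u xl by simp
    qed (use xl in simp)
    then have "integral {0..x} (\<lambda>u. - quad_term A u (x + l - u)) = B (x, x + l - x) - B (0, x + l - 0)"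
      by (rule integral_unique)
    then have "- integral {0..x} (\<lambda>u. quad_term A u (x + l - u)) = B (x, l) - B (0, x + l)" by simp
    from this[symmetric] have "B (x, l) = - integral {0..x} (\<lambda>u. quad_term A u (x + l - u)) + B (0, x + l)"
      unfolding diff_eq_eq .
    then show "A (x, l) = A (0, x + l) - integral {0..x} (\<lambda>u. quad_term A u (x + l - u))"
      using xl by (simp add: AB quadrant_def)
  qed
  moreover have "C1_nonneg (\<lambda>l. B (0, l))" unfolding C1_nonneg_def
  proof (intro exI conjI allI impI)
    show "((\<lambda>l. B (0, l)) has_vector_derivative Dl (0, l)) (at l within {0..})" if "l \<ge> 0" for l
    proof -
      have 1: "((\<lambda>l::real. (0::real, l)) has_vector_derivative (0, 1)) (at l within {0..})"
        by (intro has_vector_derivative_Pair has_vector_derivative_id has_vector_derivative_const)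
      have "(\<lambda>l::real. (0::real, l)) ` {0..} \<subseteq> quadrant" by (auto simp: quadrant_def)
      from path[OF 1 this] that show ?thesis by simp
    qed
    show "continuous_on {0..} (\<lambda>l. Dl (0, l))"
      by (intro continuous_on_compose2[OF cl] continuous_intros) (auto simp: quadrant_def)
  qed
  moreover have "C1_nonneg (\<lambda>x. B (x, 0))" unfolding C1_nonneg_def
  proof (intro exI conjI allI impI)
    show "((\<lambda>x. B (x, 0)) has_vector_derivative Dx (x, 0)) (at x within {0..})" if "x \<ge> 0" for x
    proof -
      have 1: "((\<lambda>x::real. (x, 0::real)) has_vector_derivative (1, 0)) (at x within {0..})"
        by (intro has_vector_derivative_Pair has_vector_derivative_id has_vector_derivative_const)
      have "(\<lambda>x::real. (x, 0::real)) ` {0..} \<subseteq> quadrant" by (auto simp: quadrant_def)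
      from path[OF 1 this] that show ?thesis by simp
    qed
    show "continuous_on {0..} (\<lambda>x. Dx (x, 0))"
      by (intro continuous_on_compose2[OF cx] continuous_intros) (auto simp: quadrant_def)
  qed
  ultimately show ?thesis using that AB by blast
qed

section \<open>Waves\<close>

text \<open>The time-dependent Dirac system in characteristic coordinates: \<open>P\<close> and \<open>g\<close> are the
  waves travelling to the right and to the left, \<open>s\<close> is the depth and \<open>2\<sigma>\<close> the time elapsed after the
  first arrival.\<close>

definition wave :: "(real \<Rightarrow> complex^'c^'r) \<Rightarrow> real \<Rightarrow> (real \<times> real \<Rightarrow> complex^'k^'c) \<Rightarrow> (real \<times> real \<Rightarrow> complex^'k^'r) \<Rightarrow> bool" where
  "wave a T P g \<longleftrightarrow> continuous_on UNIV P \<and> continuous_on UNIV g \<and>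
     (\<forall>\<sigma> s. 0 \<le> \<sigma> \<longrightarrow> 0 \<le> s \<longrightarrow> \<sigma> + s \<le> T \<longrightarrow>
        ((\<lambda>s. P (\<sigma>, s)) has_vector_derivative - (madj (a s) ** g (\<sigma>, s))) (at s within {0..T - \<sigma>})) \<and>
     (\<forall>y \<sigma>. 0 \<le> \<sigma> \<longrightarrow> \<sigma> \<le> y \<longrightarrow> y \<le> T \<longrightarrow>
        ((\<lambda>\<sigma>. g (\<sigma>, y - \<sigma>)) has_vector_derivative a (y - \<sigma>) ** P (\<sigma>, y - \<sigma>)) (at \<sigma> within {0..y}))"

text \<open>The exchange density \<open>X\<close> is what the pairing of P1 and P2 loses per unit of
  depth and what the pairing of g1 and g2 gains along a characteristic. Integrating \<open>X\<close>
  over the triangle \<open>\<sigma> + s \<le> T\<close> by rows and by diagonals gives the two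
  differences. The form with two waves, instead of one, is needed to compute an adjoint
  later.\<close>

lemma wave_energy:
  fixes a :: "real \<Rightarrow> complex^'c^'r"
  assumes w1: "wave a T P1 g1" and w2: "wave a T P2 g2" and a: "continuous_on UNIV a"
  shows "integral {0..T} (\<lambda>\<sigma>. P1 (\<sigma>, 0) \<bullet> P2 (\<sigma>, 0)) - integral {0..T} (\<lambda>y. g1 (y, 0) \<bullet> g2 (y, 0))
    = integral {0..T} (\<lambda>\<sigma>. P1 (\<sigma>, T - \<sigma>) \<bullet> P2 (\<sigma>, T - \<sigma>)) - integral {0..T} (\<lambda>y. g1 (0, y) \<bullet> g2 (0, y))"
proof -
  \<comment> \<open>The first summand is the derivative of P1 paired with P2 after moving
    \<open>madj (a s)\<close> to the other side; by this duality the same density appears in both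
    conservation laws.\<close>
  define X where "X p = g1 p \<bullet> (a (snd p) ** P2 p) + (a (snd p) ** P1 p) \<bullet> g2 p" for p
  have c: "continuous_on UNIV P1" "continuous_on UNIV P2" "continuous_on UNIV g1" "continuous_on UNIV g2"
    using w1 w2 by (simp_all add: wave_def)
  have ca: "continuous_on UNIV (\<lambda>p::real\<times>real. a (snd p))" by (intro continuous_on_compose2[OF a] continuous_intros) auto
  have cX: "continuous_on UNIV X" unfolding X_def
    by (intro continuous_intros c ca)
  note cc = c[THEN continuous_on_compose2] cX[THEN continuous_on_compose2]
  have row: "integral {0..T - \<sigma>} (\<lambda>s. X (\<sigma>, s)) = P1 (\<sigma>, 0) \<bullet> P2 (\<sigma>, 0) - P1 (\<sigma>, T - \<sigma>) \<bullet> P2 (\<sigma>, T - \<sigma>)"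
    if \<sigma>: "\<sigma> \<in> {0..T}" for \<sigma>
  proof -
    have "((\<lambda>s. - X (\<sigma>, s)) has_integral P1 (\<sigma>, T - \<sigma>) \<bullet> P2 (\<sigma>, T - \<sigma>) - P1 (\<sigma>, 0) \<bullet> P2 (\<sigma>, 0)) {0..T - \<sigma>}"
    proof (rule fundamental_theorem_of_calculus)
      fix s assume s: "s \<in> {0..T - \<sigma>}"
      have "((\<lambda>s. P1 (\<sigma>, s) \<bullet> P2 (\<sigma>, s)) has_vector_derivative
         P1 (\<sigma>, s) \<bullet> (- (madj (a s) ** g2 (\<sigma>, s))) + (- (madj (a s) ** g1 (\<sigma>, s))) \<bullet> P2 (\<sigma>, s)) (at s within {0..T - \<sigma>})"
        by (rule bounded_bilinear.has_vector_derivative[OF bounded_bilinear_inner])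
           (use w1 w2 s \<sigma> in \<open>auto simp: wave_def\<close>)
      moreover have "P1 (\<sigma>, s) \<bullet> (- (madj (a s) ** g2 (\<sigma>, s))) + (- (madj (a s) ** g1 (\<sigma>, s))) \<bullet> P2 (\<sigma>, s) = - X (\<sigma>, s)"
        by (simp add: X_def inner_madj_left inner_madj_right)
      ultimately show "((\<lambda>s. P1 (\<sigma>, s) \<bullet> P2 (\<sigma>, s)) has_vector_derivative - X (\<sigma>, s)) (at s within {0..T - \<sigma>})"
        by (simp only:)
    qed (use \<sigma> in auto)
    then have "integral {0..T - \<sigma>} (\<lambda>s. - X (\<sigma>, s)) = P1 (\<sigma>, T - \<sigma>) \<bullet> P2 (\<sigma>, T - \<sigma>) - P1 (\<sigma>, 0) \<bullet> P2 (\<sigma>, 0)"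
      by (rule integral_unique)
    then show ?thesis by simp
  qed
  have diag: "integral {0..y} (\<lambda>\<sigma>. X (\<sigma>, y - \<sigma>)) = g1 (y, 0) \<bullet> g2 (y, 0) - g1 (0, y) \<bullet> g2 (0, y)"
    if y: "y \<in> {0..T}" for y
  proof -
    have "((\<lambda>\<sigma>. X (\<sigma>, y - \<sigma>)) has_integral g1 (y, y - y) \<bullet> g2 (y, y - y) - g1 (0, y - 0) \<bullet> g2 (0, y - 0)) {0..y}"
    proof (rule fundamental_theorem_of_calculus)
      fix \<sigma> assume \<sigma>: "\<sigma> \<in> {0..y}"
      have "((\<lambda>\<sigma>. g1 (\<sigma>, y - \<sigma>) \<bullet> g2 (\<sigma>, y - \<sigma>)) has_vector_derivative
         g1 (\<sigma>, y - \<sigma>) \<bullet> (a (y - \<sigma>) ** P2 (\<sigma>, y - \<sigma>)) + (a (y - \<sigma>) ** P1 (\<sigma>, y - \<sigma>)) \<bullet> g2 (\<sigma>, y - \<sigma>)) (at \<sigma> within {0..y})"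
        by (rule bounded_bilinear.has_vector_derivative[OF bounded_bilinear_inner])
           (use w1 w2 y \<sigma> in \<open>auto simp: wave_def\<close>)
      then show "((\<lambda>\<sigma>. g1 (\<sigma>, y - \<sigma>) \<bullet> g2 (\<sigma>, y - \<sigma>)) has_vector_derivative X (\<sigma>, y - \<sigma>)) (at \<sigma> within {0..y})"
        by (simp add: X_def)
    qed (use y in auto)
    then show ?thesis by (simp add: integral_unique)
  qed
  have "integral {0..T} (\<lambda>y. g1 (y, 0) \<bullet> g2 (y, 0)) - integral {0..T} (\<lambda>y. g1 (0, y) \<bullet> g2 (0, y))
      = integral {0..T} (\<lambda>y. g1 (y, 0) \<bullet> g2 (y, 0) - g1 (0, y) \<bullet> g2 (0, y))"
    by (rule integral_diff[symmetric]; intro integrable_cont continuous_intros cc; simp)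
  also have "\<dots> = integral {0..T} (\<lambda>y. integral {0..y} (\<lambda>\<sigma>. X (\<sigma>, y - \<sigma>)))"
    by (rule integral_cong) (simp add: diag)
  also have "\<dots> = integral {0..T} (\<lambda>\<sigma>. integral {\<sigma>..T} (\<lambda>y. X (\<sigma>, y - \<sigma>)))"
    by (rule fubini_triangle) (intro cc continuous_intros; simp)
  also have "\<dots> = integral {0..T} (\<lambda>\<sigma>. integral {0..T - \<sigma>} (\<lambda>s. X (\<sigma>, s)))"
  proof (rule integral_cong)
    fix \<sigma> show "integral {\<sigma>..T} (\<lambda>y. X (\<sigma>, y - \<sigma>)) = integral {0..T - \<sigma>} (\<lambda>s. X (\<sigma>, s))"
      using integral_shift_real[of "\<lambda>y. X (\<sigma>, y - \<sigma>)" 0 "T - \<sigma>" \<sigma>]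
      by (simp add: cc continuous_intros)
  qed
  also have "\<dots> = integral {0..T} (\<lambda>\<sigma>. P1 (\<sigma>, 0) \<bullet> P2 (\<sigma>, 0) - P1 (\<sigma>, T - \<sigma>) \<bullet> P2 (\<sigma>, T - \<sigma>))"
    by (rule integral_cong) (simp add: row)
  also have "\<dots> = integral {0..T} (\<lambda>\<sigma>. P1 (\<sigma>, 0) \<bullet> P2 (\<sigma>, 0)) - integral {0..T} (\<lambda>\<sigma>. P1 (\<sigma>, T - \<sigma>) \<bullet> P2 (\<sigma>, T - \<sigma>))"
    by (rule integral_diff; intro integrable_cont continuous_intros cc; simp)
  finally show ?thesis by simp
qed

text \<open>At depth \<open>s\<close> the medium answers the incoming wave \<open>c \<delta> + P(\<cdot>, s)\<close> by convolution with the
  impulse response \<open>A(\<cdot>, s)\<close>.\<close>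

definition reflected_wave :: "(real \<times> real \<Rightarrow> complex^'c^'r) \<Rightarrow> real \<Rightarrow> (real \<times> real \<Rightarrow> complex^'c^'c) \<Rightarrow> real \<times> real \<Rightarrow> complex^'c^'r" where
  "reflected_wave A c P p = c *\<^sub>R A p + conv (\<lambda>x. A (x, snd p)) (\<lambda>t. P (t, snd p)) (fst p)"

lemma continuous_reflected_wave:
  assumes "continuous_on UNIV A" "continuous_on UNIV P"
  shows "continuous_on UNIV (reflected_wave A c P)"
  unfolding reflected_wave_def conv_def
  by (intro continuous_intros continuous_on_compose2[OF assms(1)] continuous_on_compose2[OF assms(2)]) auto

text \<open>For fixed \<open>y\<close> the mild equation reads: a constant minus an antiderivative
  in \<sigma>. So A is differentiable in this direction from continuity alone.\<close>

lemma mild_char: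
  assumes A: "mild A" and \<sigma>: "\<sigma> \<in> {0..y}"
  shows "((\<lambda>\<sigma>. A (\<sigma>, y - \<sigma>)) has_vector_derivative - quad_term A \<sigma> (y - \<sigma>)) (at \<sigma> within {0..y})"
proof -
  have cA: "continuous_on UNIV A" using A by (simp add: mild_def)
  have "((\<lambda>\<sigma>. integral {0..\<sigma>} (\<lambda>u. quad_term A u (y - u))) has_vector_derivative quad_term A \<sigma> (y - \<sigma>)) (at \<sigma> within {0..y})"
    by (rule FTC_within) (use \<sigma> in \<open>auto intro!: continuous_quad_term[OF cA] continuous_intros\<close>)
  from has_vector_derivative_diff[OF has_vector_derivative_const[of "A (0,y)"] this]
  have "((\<lambda>\<sigma>. A (0,y) - integral {0..\<sigma>} (\<lambda>u. quad_term A u (y - u))) has_vector_derivative - quad_term A \<sigma> (y - \<sigma>)) (at \<sigma> within {0..y})"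
    by simp
  then show ?thesis
  proof (rule has_vector_derivative_transform[rotated 2])
    fix \<tau> assume "\<tau> \<in> {0..y}"
    then have "\<tau> \<ge> 0" "y - \<tau> \<ge> 0" by auto
    then have "A (\<tau>, y - \<tau>) = A (0, \<tau> + (y - \<tau>)) - integral {0..\<tau>} (\<lambda>u. quad_term A u (\<tau> + (y - \<tau>) - u))"
      using A unfolding mild_def by blast
    then show "A (\<tau>, y - \<tau>) = A (0, y) - integral {0..\<tau>} (\<lambda>u. quad_term A u (y - u))" by simp
  qed (rule \<sigma>)
qed

lemma has_vector_derivative_reflect:
  assumes "(g has_vector_derivative g') (at (c - x) within T)" "\<And>z. z \<in> S \<Longrightarrow> c - z \<in> T"
  shows "((\<lambda>x. g (c - x)) has_vector_derivative - g') (at (x::real) within S)"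
proof -
  have "((\<lambda>x. c - x) has_vector_derivative 0 - 1) (at x within S)"
    by (intro has_vector_derivative_diff has_vector_derivative_const has_vector_derivative_id)
  then have "((\<lambda>x. c - x) has_vector_derivative -1) (at x within S)" by simp
  moreover have "(g has_vector_derivative g') (at (c - x) within (\<lambda>x. c - x) ` S)"
    by (rule has_vector_derivative_within_subset[OF assms(1)]) (use assms(2) in auto)
  ultimately have "(g \<circ> (\<lambda>x. c - x) has_vector_derivative (-1) *\<^sub>R g') (at x within S)"
    by (rule vector_diff_chain_within)
  then show ?thesis by (simp add: o_def)
qed

text \<open>The relation g = c A + A * P has to be consistent with the transport equation for g.
  Differentiating the convolution along a characteristic produces A * (a* g) from P and -Q * P from
  A; with Q = A * (a* A) and associativity everything cancels except a P. The function
  \<open>h\<close> of \<sigma> is free, so that P may be prescribed at the surface or at the far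
  end.\<close>

lemma wave_of_mild:
  fixes P :: "real \<times> real \<Rightarrow> complex^'c^'c"
  assumes A: "mild A" and cP: "continuous_on UNIV P"
    and eq: "\<And>\<sigma> s. 0 \<le> \<sigma> \<Longrightarrow> 0 \<le> s \<Longrightarrow> \<sigma> + s \<le> T \<Longrightarrow> P (\<sigma>, s) = h \<sigma> - integral {0..s} (\<lambda>s'. madj (A (0, s')) ** reflected_wave A c P (\<sigma>, s'))"
  shows "wave (\<lambda>s. A (0, s)) T P (reflected_wave A c P)"
proof -
  have cA: "continuous_on UNIV A" using A by (simp add: mild_def)
  note cg = continuous_reflected_wave[OF cA cP, of c]
  note cc = cA[THEN continuous_on_compose2] cP[THEN continuous_on_compose2] cg[THEN continuous_on_compose2]
  have dP: "((\<lambda>s. P (\<sigma>, s)) has_vector_derivative - (madj (A (0, s)) ** reflected_wave A c P (\<sigma>, s))) (at s within {0..T - \<sigma>})"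
    if "0 \<le> \<sigma>" "0 \<le> s" "\<sigma> + s \<le> T" for \<sigma> s
  proof -
    have "((\<lambda>s. integral {0..s} (\<lambda>s'. madj (A (0, s')) ** reflected_wave A c P (\<sigma>, s'))) has_vector_derivative madj (A (0, s)) ** reflected_wave A c P (\<sigma>, s)) (at s within {0..T - \<sigma>})"
      by (rule FTC_within) (use that in \<open>auto intro!: continuous_intros cc\<close>)
    from has_vector_derivative_diff[OF has_vector_derivative_const[of "h \<sigma>"] this]
    have "((\<lambda>s. h \<sigma> - integral {0..s} (\<lambda>s'. madj (A (0, s')) ** reflected_wave A c P (\<sigma>, s'))) has_vector_derivative - (madj (A (0, s)) ** reflected_wave A c P (\<sigma>, s))) (at s within {0..T - \<sigma>})"
      by simp
    then show ?thesis
      by (rule has_vector_derivative_transform[rotated 2]) (use eq that in auto)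
  qed
  have dg: "((\<lambda>\<sigma>. reflected_wave A c P (\<sigma>, y - \<sigma>)) has_vector_derivative A (0, y - \<sigma>) ** P (\<sigma>, y - \<sigma>)) (at \<sigma> within {0..y})"
    if \<sigma>: "0 \<le> \<sigma>" "\<sigma> \<le> y" "y \<le> T" for y \<sigma>
  proof -
    define k where "k x t = A (x - t, y - x) ** P (t, y - x)" for x t
    define k' where "k' x t = A (x - t, y - x) ** (madj (A (0, y - x)) ** reflected_wave A c P (t, y - x)) + (- quad_term A (x - t) (y - x)) ** P (t, y - x)" for x t
    have "((\<lambda>x. integral {0..x} (k x)) has_vector_derivative k \<sigma> \<sigma> + integral {0..\<sigma>} (k' \<sigma>)) (at \<sigma> within {0..y})"
    proof (rule leibniz_upto)
      show "continuous_on UNIV (\<lambda>p. k (fst p) (snd p))"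
        unfolding k_def by (intro continuous_intros cc) auto
      show "continuous_on UNIV (\<lambda>p. k' (fst p) (snd p))"
        unfolding k'_def by (intro continuous_intros continuous_quad_term[OF cA] cc) auto
      fix t x assume tx: "0 \<le> t" "t \<le> x" "x \<le> y"
      have "((\<lambda>x. A (x + (- t), (y - t) - (x + (- t)))) has_vector_derivative - quad_term A (x + (- t)) ((y - t) - (x + (- t)))) (at x within {t..y})"
        by (rule has_vector_derivative_shift[OF mild_char[OF A]]) (use tx in auto)
      then have 1: "((\<lambda>x. A (x - t, y - x)) has_vector_derivative - quad_term A (x - t) (y - x)) (at x within {t..y})"
        by simp
      have "((\<lambda>x. P (t, y - x)) has_vector_derivative - (- (madj (A (0, y - x)) ** reflected_wave A c P (t, y - x)))) (at x within {t..y})"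
        by (rule has_vector_derivative_reflect[OF dP]) (use tx that in auto)
      then have 2: "((\<lambda>x. P (t, y - x)) has_vector_derivative madj (A (0, y - x)) ** reflected_wave A c P (t, y - x)) (at x within {t..y})"
        by simp
      show "((\<lambda>x. k x t) has_vector_derivative k' x t) (at x within {t..y})"
        unfolding k_def k'_def by (rule mm.has_vector_derivative[OF 1 2])
    qed (use \<sigma> in auto)
    moreover have "((\<lambda>\<sigma>. c *\<^sub>R A (\<sigma>, y - \<sigma>)) has_vector_derivative c *\<^sub>R (- quad_term A \<sigma> (y - \<sigma>))) (at \<sigma> within {0..y})"
      by (rule bounded_linear.has_vector_derivative[OF bounded_linear_scaleR_right mild_char[OF A]]) (use \<sigma> in auto)
    ultimately have "((\<lambda>x. c *\<^sub>R A (x, y - x) + integral {0..x} (k x)) has_vector_derivative c *\<^sub>R (- quad_term A \<sigma> (y - \<sigma>)) + (k \<sigma> \<sigma> + integral {0..\<sigma>} (k' \<sigma>))) (at \<sigma> within {0..y})"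
      by (intro has_vector_derivative_add)
    moreover have "(\<lambda>x. reflected_wave A c P (x, y - x)) = (\<lambda>x. c *\<^sub>R A (x, y - x) + integral {0..x} (k x))"
      by (simp add: reflected_wave_def conv_def k_def[abs_def])
    \<comment> \<open>Here the cancellation happens: A * (a* c A) = c Q removes the derivative of
      the term c A, and A * (a* A * P) - Q * P vanishes by \<open>conv_assoc\<close>.\<close>
    moreover have "c *\<^sub>R (- quad_term A \<sigma> (y - \<sigma>)) + (k \<sigma> \<sigma> + integral {0..\<sigma>} (k' \<sigma>)) = A (0, y - \<sigma>) ** P (\<sigma>, y - \<sigma>)"
    proof -
      define s where "s = y - \<sigma>"
      define As Ps b where "As x = A (x, s)" and "Ps x = P (x, s)" and "b = madj (A (0, s))" for x
      have cs: "continuous_on UNIV As" "continuous_on UNIV Ps" unfolding As_def Ps_def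
        by (intro cc continuous_intros; simp)+
      have cbA: "continuous_on UNIV (\<lambda>t. b ** As t)" by (intro continuous_intros cs)
      have cQ: "continuous_on UNIV (conv As (\<lambda>t. b ** As t))" by (intro continuous_intros cs cbA)
      have bA: "madj (As 0) = b" by (simp add: As_def b_def)
      have Q: "quad_term A x s = conv As (\<lambda>t. b ** As t) x" for x
        by (simp add: quad_term_def conv_def As_def b_def matrix_mul_assoc)
      have bconv: "conv (\<lambda>t. b ** As t) Ps t = b ** conv As Ps t" for t
        unfolding conv_def matrix_mul_assoc[symmetric]
        by (rule integral_mult_mat_left) (intro integrable_cont continuous_intros continuous_on_compose2[OF cs(1)] cs; simp)
      have "integral {0..\<sigma>} (k' \<sigma>) = integral {0..\<sigma>} (\<lambda>t. c *\<^sub>R (As (\<sigma> - t) ** (b ** As t)) + (As (\<sigma> - t) ** (conv (\<lambda>t. b ** As t) Ps t) - conv As (\<lambda>t. b ** As t) (\<sigma> - t) ** Ps t))"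
        by (rule integral_cong)
           (simp add: k'_def s_def[symmetric] Q reflected_wave_def As_def[symmetric] Ps_def[symmetric] bA bconv
              mm.add_right mm.scaleR_right mm.minus_left)
      also have "\<dots> = c *\<^sub>R conv As (\<lambda>t. b ** As t) \<sigma> + (conv As (conv (\<lambda>t. b ** As t) Ps) \<sigma> - conv (conv As (\<lambda>t. b ** As t)) Ps \<sigma>)"
        unfolding conv_def[of As "conv _ _"] conv_def[of "conv _ _" Ps] conv_def[of As "\<lambda>t. b ** As t" \<sigma>]
        by (subst integral_add integral_diff integral_cmul;
            (intro integrable_cont continuous_intros continuous_on_compose2[OF cs(1)] continuous_on_compose2[OF cQ] cs cbA; simp)?)+ simp
      also have "\<dots> = c *\<^sub>R quad_term A \<sigma> s" unfolding conv_assoc[OF cs(1) cbA cs(2)] Q by simp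
      finally show ?thesis by (simp add: s_def k_def)
    qed
    ultimately show ?thesis by simp
  qed
  show ?thesis unfolding wave_def using cP cg dP dg by auto
qed

lemma compact_norm_bound:
  fixes F :: "'a::t2_space \<Rightarrow> 'b::real_normed_vector"
  assumes "continuous_on UNIV F" "compact S"
  obtains M where "M \<ge> 1" "\<And>p. p \<in> S \<Longrightarrow> norm (F p) \<le> M"
proof -
  have "bounded (F ` S)"
    by (intro compact_imp_bounded compact_continuous_image continuous_on_subset[OF assms(1)] assms(2)) auto
  then obtain B where "\<And>p. p \<in> S \<Longrightarrow> norm (F p) \<le> B" unfolding bounded_iff by blast
  then show ?thesis using that[of "max 1 B"] by (meson max.cobounded1 max.coboundedI2)
qed

text \<open>The parameter \<open>c\<close> selects two situations. For c = 0 there is no impulse and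
  P starts at the surface with the input f. For c = 1 and f = 0 an impulse enters, and the second
  integral is the value that makes P vanish on the far edge \<open>\<sigma> + s = T\<close>. The
  constant K is uniform in T, since the solutions for different T are compared by Gronwall's
  inequality later.\<close>

lemma wave_exists:
  fixes A :: "real \<times> real \<Rightarrow> complex^'c^'r" and f :: "real \<Rightarrow> complex^'c^'c"
  assumes A: "mild A" and f: "continuous_on UNIV f" and c: "\<bar>c\<bar> \<le> 1" and T0: "T0 \<ge> 0"
  shows "\<exists>K. \<forall>T. 0 \<le> T \<longrightarrow> T \<le> T0 \<longrightarrow> (\<exists>P. wave (\<lambda>s. A (0,s)) T P (reflected_wave A c P) \<and>
     (\<forall>\<sigma> s. 0 \<le> \<sigma> \<longrightarrow> 0 \<le> s \<longrightarrow> \<sigma> + s \<le> T \<longrightarrow> norm (P (\<sigma>, s)) \<le> K \<and> norm (reflected_wave A c P (\<sigma>, s)) \<le> K \<and>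
       P (\<sigma>, s) = f \<sigma> - integral {0..s} (\<lambda>s'. madj (A (0, s')) ** reflected_wave A c P (\<sigma>, s'))
         + c *\<^sub>R integral {0..T - \<sigma>} (\<lambda>s'. madj (A (0, s')) ** reflected_wave A c P (\<sigma>, s'))))"
proof -
  have cA: "continuous_on UNIV A" using A by (simp add: mild_def)
  obtain M where M: "M \<ge> 1" and MA: "\<And>p. p \<in> cbox (0,0) (T0,T0) \<Longrightarrow> norm (A p) \<le> M"
    using compact_norm_bound[OF cA compact_cbox] by blast
  obtain Mf where Mf: "Mf \<ge> 1" "\<And>x. x \<in> {0..T0} \<Longrightarrow> norm (f x) \<le> Mf"
    using compact_norm_bound[OF f compact_Icc] by blast
  \<comment> \<open>The integrals in s run to either end and gain nothing; the factor 1/k comes from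
    the convolution in \<sigma>. Two integrals of size T0 M (M/k) give 2 T0 M^2 / k, which this
    choice keeps below 1/2. \<open>K0\<close> is twice the bound for the image of 0.\<close>
  define k where "k = 4 * T0 * M\<^sup>2 + 1"
  define K0 where "K0 = 2 * (Mf + 2 * T0 * M\<^sup>2)"
  have k: "k > 0" unfolding k_def using T0 by (intro add_nonneg_pos) auto
  have K0: "K0 \<ge> 0" unfolding K0_def using T0 Mf by auto
  define K1 where "K1 = K0 * exp (k * T0)"
  define K where "K = max K1 (M + M * K1 * T0)"
  have "\<exists>P. wave (\<lambda>s. A (0,s)) T P (reflected_wave A c P) \<and>
     (\<forall>\<sigma> s. 0 \<le> \<sigma> \<longrightarrow> 0 \<le> s \<longrightarrow> \<sigma> + s \<le> T \<longrightarrow> norm (P (\<sigma>, s)) \<le> K \<and> norm (reflected_wave A c P (\<sigma>, s)) \<le> K \<and>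
       P (\<sigma>, s) = f \<sigma> - integral {0..s} (\<lambda>s'. madj (A (0, s')) ** reflected_wave A c P (\<sigma>, s'))
         + c *\<^sub>R integral {0..T - \<sigma>} (\<lambda>s'. madj (A (0, s')) ** reflected_wave A c P (\<sigma>, s')))"
    if T: "0 \<le> T" "T \<le> T0" for T
  proof -
    \<comment> \<open>A continuous retraction of the plane onto the triangle
      \<open>\<sigma> + s \<le> T\<close>; it permits working with functions continuous on
      \<open>UNIV\<close>.\<close>
    define S1 S2 where "S1 p = min (max 0 (fst p)) T" and "S2 p = min (max 0 (snd p)) (T - min (max 0 (fst p)) T)" for p :: "real \<times> real"
    have S: "0 \<le> S1 p" "0 \<le> S2 p" "S1 p + S2 p \<le> T" for p using T by (auto simp: S1_def S2_def)
    have Sid: "S1 (\<sigma>,s) = \<sigma>" "S2 (\<sigma>,s) = s" if "0 \<le> \<sigma>" "0 \<le> s" "\<sigma> + s \<le> T" for \<sigma> s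
      using that by (auto simp: S1_def S2_def)
    have cS: "continuous_on UNIV S1" "continuous_on UNIV S2"
      unfolding S1_def[abs_def] S2_def[abs_def] by (intro continuous_intros)+
    define I where "I P \<sigma> r = integral {0..r} (\<lambda>s'. madj (A (0, s')) ** reflected_wave A c P (\<sigma>, s'))" for P \<sigma> r
    define F where "F P p = f (S1 p) - I P (S1 p) (S2 p) + c *\<^sub>R I P (S1 p) (T - S1 p)" for P p
    have cI: "continuous_on UNIV (\<lambda>p::real\<times>real. I P (u p) (v p))" if "continuous_on UNIV P" "continuous_on UNIV u" "continuous_on UNIV v" for P u v
      unfolding I_def
      by (intro continuous_intros that continuous_on_compose2[OF cA] continuous_on_compose2[OF continuous_reflected_wave[OF cA that(1)]] continuous_on_compose2[OF that(2)]) auto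
    have cF: "continuous_on UNIV (F P)" if "continuous_on UNIV P" for P
      unfolding F_def
      by (intro continuous_intros cI that cS continuous_on_compose2[OF f]) auto
    have iI: "(\<lambda>s'. madj (A (0, s')) ** reflected_wave A c P (\<sigma>, s')) integrable_on {0..r}" if "continuous_on UNIV P" for P \<sigma> r
      by (intro integrable_cont continuous_intros continuous_on_compose2[OF cA] continuous_on_compose2[OF continuous_reflected_wave[OF cA that]]) auto
    have wgd: "norm (reflected_wave A c P (\<sigma>, s') - reflected_wave A c P' (\<sigma>, s')) \<le> M * d * (exp (k * \<sigma>) / k)"
      if cP: "continuous_on UNIV P" "continuous_on UNIV P'" and d: "d \<ge> 0" and b: "\<And>p. norm (P p - P' p) \<le> d * exp (k * S1 p)"
        and \<sigma>: "0 \<le> \<sigma>" "0 \<le> s'" "\<sigma> + s' \<le> T" for P P' d \<sigma> s'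
    proof -
      have i: "(\<lambda>t. A (\<sigma> - t, s') ** P (t, s')) integrable_on {0..\<sigma>}" if "continuous_on UNIV P" for P
        by (intro integrable_cont continuous_intros continuous_on_compose2[OF cA] continuous_on_compose2[OF that]) auto
      have "norm (reflected_wave A c P (\<sigma>, s') - reflected_wave A c P' (\<sigma>, s')) = norm (integral {0..\<sigma>} (\<lambda>t. A (\<sigma> - t, s') ** (P (t, s') - P' (t, s'))))"
        by (simp add: reflected_wave_def conv_def mm.diff_right integral_diff[OF i i] cP)
      also have "\<dots> \<le> integral {0..\<sigma>} (\<lambda>t. (M * d) * exp (k * t))"
      proof (rule integral_norm_bound_integral)
        show "(\<lambda>t. A (\<sigma> - t, s') ** (P (t, s') - P' (t, s'))) integrable_on {0..\<sigma>}"
          by (intro integrable_cont continuous_intros continuous_on_compose2[OF cA] continuous_on_compose2[OF cP(1)] continuous_on_compose2[OF cP(2)]) auto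
        show "(\<lambda>t. (M * d) * exp (k * t)) integrable_on {0..\<sigma>}" by (intro integrable_cont continuous_intros)
        fix t assume t: "t \<in> {0..\<sigma>}"
        have "norm (A (\<sigma> - t, s') ** (P (t, s') - P' (t, s'))) \<le> norm (A (\<sigma> - t, s')) * norm (P (t, s') - P' (t, s'))"
          by (rule norm_matrix_mult)
        also have "\<dots> \<le> M * (d * exp (k * t))"
          using b[of "(t,s')"] Sid[of t s'] t \<sigma> T M by (intro mult_mono MA) (auto simp: cbox_Pair_eq)
        finally show "norm (A (\<sigma> - t, s') ** (P (t, s') - P' (t, s'))) \<le> (M * d) * exp (k * t)" by (simp add: mult.assoc)
      qed
      also have "\<dots> = M * d * ((exp (k * \<sigma>) - 1) / k)" using integral_exp_real[of k \<sigma>] k \<sigma> by simp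
      also have "\<dots> \<le> M * d * (exp (k * \<sigma>) / k)"
        by (intro mult_left_mono divide_right_mono) (use k M d in auto)
      finally show ?thesis .
    qed
    have Ib: "norm (I P \<sigma> r - I P' \<sigma> r) \<le> T0 * M * B"
      if cP: "continuous_on UNIV P" "continuous_on UNIV P'" and r: "0 \<le> r" "0 \<le> \<sigma>" "\<sigma> + r \<le> T" and B0: "B \<ge> 0"
        and B: "\<And>s'. 0 \<le> s' \<Longrightarrow> s' \<le> r \<Longrightarrow> norm (reflected_wave A c P (\<sigma>, s') - reflected_wave A c P' (\<sigma>, s')) \<le> B" for P P' \<sigma> r B
    proof -
      have "norm (I P \<sigma> r - I P' \<sigma> r) = norm (integral {0..r} (\<lambda>s'. madj (A (0, s')) ** (reflected_wave A c P (\<sigma>, s') - reflected_wave A c P' (\<sigma>, s'))))"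
        unfolding I_def by (simp add: mm.diff_right integral_diff[OF iI iI] cP)
      also have "\<dots> \<le> (M * B) * (r - 0)"
      proof (rule integral_bound)
        show "continuous_on {0..r} (\<lambda>s'. madj (A (0, s')) ** (reflected_wave A c P (\<sigma>, s') - reflected_wave A c P' (\<sigma>, s')))"
          by (intro continuous_intros continuous_on_compose2[OF cA] continuous_on_compose2[OF continuous_reflected_wave[OF cA cP(1)]] continuous_on_compose2[OF continuous_reflected_wave[OF cA cP(2)]]) auto
        fix t assume t: "t \<in> {0..r}"
        have "norm (madj (A (0, t)) ** (reflected_wave A c P (\<sigma>, t) - reflected_wave A c P' (\<sigma>, t))) \<le> norm (madj (A (0, t))) * norm (reflected_wave A c P (\<sigma>, t) - reflected_wave A c P' (\<sigma>, t))"
          by (rule norm_matrix_mult)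
        also have "\<dots> \<le> M * B" using t r T M B unfolding norm_madj by (intro mult_mono MA) (auto simp: cbox_Pair_eq)
        finally show "norm (madj (A (0, t)) ** (reflected_wave A c P (\<sigma>, t) - reflected_wave A c P' (\<sigma>, t))) \<le> M * B" .
      qed (use r in auto)
      also have "\<dots> \<le> (M * B) * T0" by (rule mult_left_mono) (use r T M B0 in auto)
      finally show ?thesis by (simp add: mult_ac)
    qed
    have contr: "norm (F P p - F P' p) \<le> d / 2 * exp (k * S1 p)"
      if cP: "continuous_on UNIV P" "continuous_on UNIV P'" and d: "d \<ge> 0" and b: "\<And>p. norm (P p - P' p) \<le> d * exp (k * S1 p)" for P P' d p
    proof -
      let ?B = "M * d * (exp (k * S1 p) / k)"
      have B0: "?B \<ge> 0" using M d k by simp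
      have 1: "norm (I P (S1 p) (S2 p) - I P' (S1 p) (S2 p)) \<le> T0 * M * ?B"
        by (rule Ib[OF cP _ _ _ B0 wgd[OF cP d b]]) (use S[of p] in auto)
      have 2: "norm (I P (S1 p) (T - S1 p) - I P' (S1 p) (T - S1 p)) \<le> T0 * M * ?B"
        by (rule Ib[OF cP _ _ _ B0 wgd[OF cP d b]]) (use S[of p] in auto)
      have "F P p - F P' p = c *\<^sub>R (I P (S1 p) (T - S1 p) - I P' (S1 p) (T - S1 p)) - (I P (S1 p) (S2 p) - I P' (S1 p) (S2 p))"
        by (simp add: F_def algebra_simps)
      then have "norm (F P p - F P' p) \<le> \<bar>c\<bar> * norm (I P (S1 p) (T - S1 p) - I P' (S1 p) (T - S1 p)) + norm (I P (S1 p) (S2 p) - I P' (S1 p) (S2 p))"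
        by (metis norm_triangle_ineq4 norm_scaleR)
      also have "\<dots> \<le> 1 * (T0 * M * ?B) + T0 * M * ?B"
        by (intro add_mono mult_mono 1 2 c) auto
      also have "\<dots> = (4 * T0 * M\<^sup>2 / k) * (d / 2 * exp (k * S1 p))" by (simp add: power2_eq_square)
      also have "\<dots> \<le> 1 * (d / 2 * exp (k * S1 p))"
        by (rule mult_right_mono) (use k d in \<open>auto simp: k_def divide_le_eq\<close>)
      finally show ?thesis by simp
    qed
    have F0: "norm (F (\<lambda>p. 0) p) \<le> K0 / 2 * exp (k * S1 p)" for p
    proof -
      have z: "I (\<lambda>p. 0) \<sigma> r = integral {0..r} (\<lambda>s'. madj (A (0, s')) ** (c *\<^sub>R A (\<sigma>, s')))" for \<sigma> r
        by (simp add: I_def reflected_wave_def conv_def)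
      have zb: "norm (I (\<lambda>p. 0) \<sigma> r) \<le> T0 * M * M" if r: "0 \<le> r" "0 \<le> \<sigma>" "\<sigma> + r \<le> T" for \<sigma> r
      proof -
        have "norm (I (\<lambda>p. 0) \<sigma> r) \<le> (M * M) * (r - 0)" unfolding z
        proof (rule integral_bound)
          show "continuous_on {0..r} (\<lambda>s'. madj (A (0, s')) ** (c *\<^sub>R A (\<sigma>, s')))"
            by (intro continuous_intros continuous_on_compose2[OF cA]) auto
          fix t assume t: "t \<in> {0..r}"
          have "norm (madj (A (0, t)) ** (c *\<^sub>R A (\<sigma>, t))) \<le> norm (madj (A (0, t))) * norm (c *\<^sub>R A (\<sigma>, t))"
            by (rule norm_matrix_mult)
          also have "\<dots> \<le> M * (1 * M)" using t r T M c unfolding norm_madj norm_scaleR by (intro mult_mono MA) (auto simp: cbox_Pair_eq)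
          finally show "norm (madj (A (0, t)) ** (c *\<^sub>R A (\<sigma>, t))) \<le> M * M" by simp
        qed (use r in auto)
        also have "\<dots> \<le> (M * M) * T0" by (rule mult_left_mono) (use r T M in auto)
        finally show ?thesis by (simp add: mult_ac)
      qed
      have "norm (F (\<lambda>p. 0) p) \<le> norm (f (S1 p)) + norm (I (\<lambda>p. 0) (S1 p) (S2 p)) + norm (c *\<^sub>R I (\<lambda>p. 0) (S1 p) (T - S1 p))"
        unfolding F_def by (rule order_trans[OF norm_triangle_ineq add_right_mono[OF norm_triangle_ineq4]])
      also have "\<dots> \<le> Mf + T0 * M * M + 1 * (T0 * M * M)"
        unfolding norm_scaleR using S[of p] T c T0 M by (intro add_mono mult_mono zb Mf) auto
      also have "\<dots> = K0 / 2 * 1" by (simp add: K0_def power2_eq_square)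
      also have "\<dots> \<le> K0 / 2 * exp (k * S1 p)" by (rule mult_left_mono) (use K0 k S[of p] in auto)
      finally show ?thesis .
    qed
    define G where "G = {P :: real \<times> real \<Rightarrow> complex^'c^'c. continuous_on UNIV P \<and> (\<forall>p. norm (P p) \<le> K0 * exp (k * S1 p))}"
    obtain P where P: "P \<in> G" "\<And>p. p \<in> UNIV \<Longrightarrow> F P p = P p"
    proof (rule weighted_fixpoint[where F = F and G = G and S = UNIV and w = "\<lambda>p. exp (k * S1 p)" and ?f0.0 = "\<lambda>p. 0" and ?c0.0 = "K0 / 2"])
      fix P assume P: "P \<in> G"
      have "norm (F P p) \<le> K0 * exp (k * S1 p)" for p
      proof -
        have "norm (F P p - F (\<lambda>p. 0) p) \<le> K0 / 2 * exp (k * S1 p)"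
          by (rule contr) (use P K0 in \<open>auto simp: G_def\<close>)
        then show ?thesis using F0[of p] norm_triangle_ineq2[of "F P p" "F (\<lambda>p. 0) p"] by simp
      qed
      then show "F P \<in> G" using cF P by (simp add: G_def)
    next
      fix P P' d p assume "P \<in> G" "P' \<in> G" "d \<ge> 0" "\<And>p. p \<in> UNIV \<Longrightarrow> norm (P p - P' p) \<le> d * exp (k * S1 p)"
      then show "norm (F P p - F P' p) \<le> d / 2 * exp (k * S1 p)"
        by (intro contr) (simp_all add: G_def)
    next
      show "(\<lambda>p. 0) \<in> G" using K0 by (simp add: G_def)
      show "norm (F (\<lambda>p. 0) p - 0) \<le> K0 / 2 * exp (k * S1 p)" for p using F0 by simp
      show "K0 / 2 \<ge> 0" using K0 by simp
    next
      fix h P and C :: real assume h: "\<And>n::nat. h n \<in> G" and b: "\<And>n p. p \<in> UNIV \<Longrightarrow> norm (h n p - P p) \<le> C * (1/2)^n * exp (k * S1 p)"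
      have hc: "continuous_on UNIV (h n)" for n using h by (simp add: G_def)
      have "continuous_on UNIV P"
      proof (rule continuous_weighted_limit[OF hc b])
        fix p :: "real \<times> real"
        have "\<forall>q. exp (k * S1 q) \<le> exp (k * T)" using k S[of _] by (auto intro!: mult_left_mono) (meson S add_increasing2 le_add_same_cancel1 order_trans)
        then show "\<exists>U W. open U \<and> p \<in> U \<and> (\<forall>q\<in>U \<inter> UNIV. exp (k * S1 q) \<le> W)" by blast
      qed auto
      moreover have "norm (P p) \<le> K0 * exp (k * S1 p)" for p
      proof -
        have "norm (P p) \<le> K0 * exp (k * S1 p) + C * (1/2)^n * exp (k * S1 p)" for n
        proof -
          have "norm (h n p) \<le> K0 * exp (k * S1 p)" using h[of n] unfolding G_def by blast
          then show ?thesis using norm_triangle_ineq3[of "h n p" "P p"] b[of p n] by simp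
        qed
        moreover have "(\<lambda>n. K0 * exp (k * S1 p) + C * (1/2)^n * exp (k * S1 p)) \<longlonglongrightarrow> K0 * exp (k * S1 p) + C * 0 * exp (k * S1 p)"
          by (intro tendsto_intros LIMSEQ_power_zero) auto
        ultimately have "norm (P p) \<le> K0 * exp (k * S1 p) + C * 0 * exp (k * S1 p)"
          by (intro LIMSEQ_le_const[of _ "K0 * exp (k * S1 p) + C * 0 * exp (k * S1 p)"]) auto
        then show ?thesis by simp
      qed
      ultimately show "P \<in> G" by (simp add: G_def)
    qed auto
    have cP: "continuous_on UNIV P" using P by (simp add: G_def)
    have eq: "P (\<sigma>, s) = f \<sigma> - I P \<sigma> s + c *\<^sub>R I P \<sigma> (T - \<sigma>)" if "0 \<le> \<sigma>" "0 \<le> s" "\<sigma> + s \<le> T" for \<sigma> s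
      using P(2)[of "(\<sigma>,s)"] by (simp add: F_def Sid[OF that])
    have "wave (\<lambda>s. A (0,s)) T P (reflected_wave A c P)"
      by (rule wave_of_mild[OF A cP, where h = "\<lambda>\<sigma>. f \<sigma> + c *\<^sub>R I P \<sigma> (T - \<sigma>)"])
         (use eq in \<open>simp add: I_def\<close>)
    moreover have PK1: "norm (P (\<sigma>, s)) \<le> K1" if "0 \<le> \<sigma>" "0 \<le> s" "\<sigma> + s \<le> T" for \<sigma> s
    proof -
      have "norm (P (\<sigma>, s)) \<le> K0 * exp (k * S1 (\<sigma>, s))" using P(1) unfolding G_def by blast
      also have "\<dots> = K0 * exp (k * \<sigma>)" using Sid[OF that] by simp
      also have "\<dots> \<le> K1" unfolding K1_def using K0 k that T by (intro mult_left_mono) auto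
      finally show ?thesis .
    qed
    moreover have "norm (reflected_wave A c P (\<sigma>, s)) \<le> M + M * K1 * T0" if p: "0 \<le> \<sigma>" "0 \<le> s" "\<sigma> + s \<le> T" for \<sigma> s
    proof -
      have K10: "K1 \<ge> 0" using K0 by (simp add: K1_def)
      have "norm (conv (\<lambda>x. A (x, s)) (\<lambda>t. P (t, s)) \<sigma>) \<le> (M * K1) * (\<sigma> - 0)"
        unfolding conv_def
      proof (rule integral_bound)
        show "continuous_on {0..\<sigma>} (\<lambda>t. A (\<sigma> - t, s) ** P (t, s))"
          by (intro continuous_intros continuous_on_compose2[OF cA] continuous_on_compose2[OF cP]) auto
        fix t assume t: "t \<in> {0..\<sigma>}"
        have "norm (A (\<sigma> - t, s) ** P (t, s)) \<le> norm (A (\<sigma> - t, s)) * norm (P (t, s))" by (rule norm_matrix_mult)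
        also have "\<dots> \<le> M * K1" using t p T M by (intro mult_mono MA PK1) (auto simp: cbox_Pair_eq)
        finally show "norm (A (\<sigma> - t, s) ** P (t, s)) \<le> M * K1" .
      qed (use p in auto)
      also have "\<dots> \<le> (M * K1) * T0" by (rule mult_left_mono) (use p T M K10 in auto)
      finally have 1: "norm (conv (\<lambda>x. A (x, s)) (\<lambda>t. P (t, s)) \<sigma>) \<le> M * K1 * T0" .
      have "norm (c *\<^sub>R A (\<sigma>, s)) \<le> 1 * M"
        unfolding norm_scaleR using c p T M by (intro mult_mono MA) (auto simp: cbox_Pair_eq)
      with 1 show ?thesis unfolding reflected_wave_def by (simp add: norm_triangle_mono)
    qed
    ultimately show ?thesis using eq unfolding I_def K_def by (intro exI[of _ P]) (auto simp: le_max_iff_disj)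
  qed
  then show ?thesis by blast
qed

lemma wave_restrict:
  assumes "wave a T P g" "T' \<le> T"
  shows "wave a T' P g"
  unfolding wave_def
proof (intro conjI allI impI)
  show "continuous_on UNIV P" "continuous_on UNIV g" using assms by (simp_all add: wave_def)
  fix \<sigma> s :: real assume s: "0 \<le> \<sigma>" "0 \<le> s" "\<sigma> + s \<le> T'"
  have "((\<lambda>s. P (\<sigma>, s)) has_vector_derivative - (madj (a s) ** g (\<sigma>, s))) (at s within {0..T - \<sigma>})"
    using assms s unfolding wave_def by auto
  then show "((\<lambda>s. P (\<sigma>, s)) has_vector_derivative - (madj (a s) ** g (\<sigma>, s))) (at s within {0..T' - \<sigma>})"
    by (rule has_vector_derivative_within_subset) (use assms in auto)
next
  fix y \<sigma> :: real assume "0 \<le> \<sigma>" "\<sigma> \<le> y" "y \<le> T'"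
  then show "((\<lambda>\<sigma>. g (\<sigma>, y - \<sigma>)) has_vector_derivative a (y - \<sigma>) ** P (\<sigma>, y - \<sigma>)) (at \<sigma> within {0..y})"
    using assms unfolding wave_def by auto
qed

lemma wave_shift:
  assumes w: "wave a T P g" and s0: "0 \<le> s0"
  shows "wave (\<lambda>s. a (s + s0)) (T - s0) (\<lambda>p. P (fst p, snd p + s0)) (\<lambda>p. g (fst p, snd p + s0))"
  unfolding wave_def fst_conv snd_conv
proof (intro conjI allI impI)
  have c: "continuous_on UNIV P" "continuous_on UNIV g" using w by (simp_all add: wave_def)
  show "continuous_on UNIV (\<lambda>p. P (fst p, snd p + s0))" "continuous_on UNIV (\<lambda>p. g (fst p, snd p + s0))"
    by (intro c[THEN continuous_on_compose2] continuous_intros; simp)+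
  fix \<sigma> s :: real assume s: "0 \<le> \<sigma>" "0 \<le> s" "\<sigma> + s \<le> T - s0"
  have "((\<lambda>s. P (\<sigma>, s)) has_vector_derivative - (madj (a (s + s0)) ** g (\<sigma>, s + s0))) (at (s + s0) within {0..T - \<sigma>})"
    using w s s0 unfolding wave_def by auto
  then show "((\<lambda>s. P (\<sigma>, s + s0)) has_vector_derivative - (madj (a (s + s0)) ** g (\<sigma>, s + s0))) (at s within {0..T - s0 - \<sigma>})"
    by (rule has_vector_derivative_shift) (use s0 in auto)
next
  fix y \<sigma> :: real assume y: "0 \<le> \<sigma>" "\<sigma> \<le> y" "y \<le> T - s0"
  have "((\<lambda>\<sigma>. g (\<sigma>, y + s0 - \<sigma>)) has_vector_derivative a (y + s0 - \<sigma>) ** P (\<sigma>, y + s0 - \<sigma>)) (at \<sigma> within {0..y + s0})"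
    using w y s0 unfolding wave_def by auto
  then have "((\<lambda>\<sigma>. g (\<sigma>, y + s0 - \<sigma>)) has_vector_derivative a (y + s0 - \<sigma>) ** P (\<sigma>, y + s0 - \<sigma>)) (at \<sigma> within {0..y})"
    by (rule has_vector_derivative_within_subset) (use s0 in auto)
  then show "((\<lambda>\<sigma>. g (\<sigma>, y - \<sigma> + s0)) has_vector_derivative a (y - \<sigma> + s0) ** P (\<sigma>, y - \<sigma> + s0)) (at \<sigma> within {0..y})"
    by (simp add: algebra_simps)
qed

lemma wave_energy_0:
  assumes w: "wave a T P g" and a: "continuous_on UNIV a" and g0: "\<And>s. g (0, s) = 0"
  shows "integral {0..T} (\<lambda>\<sigma>. (norm (P (\<sigma>, 0)))\<^sup>2) - integral {0..T} (\<lambda>y. (norm (g (y, 0)))\<^sup>2)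
    = integral {0..T} (\<lambda>\<sigma>. (norm (P (\<sigma>, T - \<sigma>)))\<^sup>2)"
  using wave_energy[OF w w a] by (simp add: g0 power2_norm_eq_inner)

lemma integral_norm_power2_nonneg: "0 \<le> integral S (\<lambda>x::real. (norm (f x))\<^sup>2)"
proof (cases "(\<lambda>x. (norm (f x))\<^sup>2) integrable_on S")
  case True then show ?thesis by (rule integral_nonneg) simp
qed (simp add: not_integrable_integral)

lemma wave_energy_diagonal:
  assumes w: "wave a T P g" and a: "continuous_on UNIV a" and g0: "\<And>s. g (0, s) = 0" and y: "y \<le> T"
  shows "integral {0..y} (\<lambda>\<sigma>. (norm (P (\<sigma>, y - \<sigma>)))\<^sup>2) \<le> integral {0..y} (\<lambda>\<sigma>. (norm (P (\<sigma>, 0)))\<^sup>2)"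
  using wave_energy_0[OF wave_restrict[OF w y] a g0] integral_norm_power2_nonneg[of "{0..y}" "\<lambda>y. g (y, 0)"] by simp

text \<open>With depth \<open>s\<close> as the new surface, the energy identity says that in every
  initial time interval the medium below returns at most the energy it has received; the remainder
  is the energy on the far edge of the shifted triangle.\<close>

lemma wave_energy_level:
  assumes w: "wave a T P g" and a: "continuous_on UNIV a" and g0: "\<And>s. g (0, s) = 0" and s: "0 \<le> s" "x \<le> T - s"
  shows "integral {0..x} (\<lambda>\<sigma>. (norm (g (\<sigma>, s)))\<^sup>2) \<le> integral {0..x} (\<lambda>\<sigma>. (norm (P (\<sigma>, s)))\<^sup>2)"
proof -
  have "continuous_on UNIV (\<lambda>t. a (t + s))" by (intro continuous_on_compose2[OF a] continuous_intros) auto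
  from wave_energy_0[OF wave_restrict[OF wave_shift[OF w s(1)] s(2)] this]
  have "integral {0..x} (\<lambda>\<sigma>. (norm (P (\<sigma>, s)))\<^sup>2) - integral {0..x} (\<lambda>y. (norm (g (y, s)))\<^sup>2)
    = integral {0..x} (\<lambda>\<sigma>. (norm (P (\<sigma>, x - \<sigma> + s)))\<^sup>2)" by (simp add: g0)
  then show ?thesis using integral_norm_power2_nonneg[of "{0..x}" "\<lambda>\<sigma>. P (\<sigma>, x - \<sigma> + s)"] by simp
qed

lemma wave_with_input:
  fixes A :: "real \<times> real \<Rightarrow> complex^'c^'r" and f :: "real \<Rightarrow> complex^'c^'c"
  assumes A: "mild A" and f: "continuous_on UNIV f" and T: "T \<ge> 0"
  obtains P g where "wave (\<lambda>s. A (0,s)) T P g" "\<And>\<sigma>. \<sigma> \<in> {0..T} \<Longrightarrow> P (\<sigma>, 0) = f \<sigma>"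
    "\<And>s. g (0, s) = 0" "\<And>y. y \<in> {0..T} \<Longrightarrow> g (y, 0) = conv (\<lambda>x. A (x, 0)) f y"
proof -
  have c0: "\<bar>0::real\<bar> \<le> 1" by simp
  obtain P where w: "wave (\<lambda>s. A (0,s)) T P (reflected_wave A 0 P)" and
     P: "\<And>\<sigma> s. 0 \<le> \<sigma> \<Longrightarrow> 0 \<le> s \<Longrightarrow> \<sigma> + s \<le> T \<Longrightarrow> P (\<sigma>, s) = f \<sigma> - integral {0..s} (\<lambda>s'. madj (A (0, s')) ** reflected_wave A 0 P (\<sigma>, s'))
         + 0 *\<^sub>R integral {0..T - \<sigma>} (\<lambda>s'. madj (A (0, s')) ** reflected_wave A 0 P (\<sigma>, s'))"
    using wave_exists[OF A f c0 T] T by blast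
  have P0: "P (\<sigma>, 0) = f \<sigma>" if "\<sigma> \<in> {0..T}" for \<sigma> using P[of \<sigma> 0] that by simp
  have "reflected_wave A 0 P (y, 0) = conv (\<lambda>x. A (x, 0)) f y" if y: "y \<in> {0..T}" for y
  proof -
    have "integral {0..y} (\<lambda>t. A (y - t, 0) ** P (t, 0)) = integral {0..y} (\<lambda>t. A (y - t, 0) ** f t)"
      by (rule integral_cong) (use y P0 in simp)
    then show ?thesis by (simp add: reflected_wave_def conv_def)
  qed
  moreover have "reflected_wave A 0 P (0, s) = 0" for s by (simp add: reflected_wave_def conv_def)
  ultimately show ?thesis using that[OF w P0] by blast
qed

text \<open>Convolution with A (., 0) sends an incoming wave to the reflected one. Energy
  conservation thus bounds it by 1 in L^2 on every interval, however large the potential is; the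
  Laplace transforms depend on this.\<close>

lemma mild_contraction:
  fixes A :: "real \<times> real \<Rightarrow> complex^'c^'r" and f :: "real \<Rightarrow> complex^'c^'c"
  assumes A: "mild A" and f: "continuous_on UNIV f" and T: "T \<ge> 0"
  shows "integral {0..T} (\<lambda>y. (norm (conv (\<lambda>x. A (x, 0)) f y))\<^sup>2) \<le> integral {0..T} (\<lambda>y. (norm (f y))\<^sup>2)"
proof -
  have "continuous_on UNIV A" using A by (simp add: mild_def)
  then have cA: "continuous_on UNIV (\<lambda>s. A (0,s))"
    by (rule continuous_on_compose2) (auto intro!: continuous_intros)
  obtain P g where w: "wave (\<lambda>s. A (0,s)) T P g" and P: "\<And>\<sigma>. \<sigma> \<in> {0..T} \<Longrightarrow> P (\<sigma>, 0) = f \<sigma>"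
    and g0: "\<And>s. g (0, s) = 0" and g: "\<And>y. y \<in> {0..T} \<Longrightarrow> g (y, 0) = conv (\<lambda>x. A (x, 0)) f y"
    using wave_with_input[OF A f T] by blast
  have "integral {0..T} (\<lambda>y. (norm (conv (\<lambda>x. A (x, 0)) f y))\<^sup>2) = integral {0..T} (\<lambda>y. (norm (g (y, 0)))\<^sup>2)"
    by (rule integral_cong) (simp add: g)
  also have "\<dots> \<le> integral {0..T} (\<lambda>\<sigma>. (norm (P (\<sigma>, 0)))\<^sup>2)"
    using wave_energy_level[OF w cA g0, of 0 T] by simp
  also have "\<dots> = integral {0..T} (\<lambda>y. (norm (f y))\<^sup>2)"
    by (rule integral_cong) (simp add: P)
  finally show ?thesis .
qed

lemma integral_combine_cont:
  fixes F :: "real \<Rightarrow> 'a::banach"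
  assumes "continuous_on UNIV F" "a \<le> b" "b \<le> c"
  shows "integral {a..c} F = integral {a..b} F + integral {b..c} F"
  by (rule Henstock_Kurzweil_Integration.integral_combine[symmetric]) (use assms integrable_cont in auto)

text \<open>The region 0 <= \<xi> <= x, \<xi> <= t <= T is cut at t = x into a triangle and a
  rectangle; \<open>min x t\<close> merges the two inner limits again.\<close>

lemma fubini_trapezoid:
  fixes F :: "real \<Rightarrow> real \<Rightarrow> 'a::euclidean_space"
  assumes F: "continuous_on UNIV (\<lambda>p. F (fst p) (snd p))" and x: "0 \<le> x" "x \<le> T"
  shows "integral {0..x} (\<lambda>\<xi>. integral {\<xi>..T} (F \<xi>)) = integral {0..T} (\<lambda>t. integral {0..min x t} (\<lambda>\<xi>. F \<xi> t))"
proof -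
  have F1: "continuous_on X (F \<xi>)" for X \<xi> by (intro continuous_on_uncurry[OF F] continuous_intros)
  have F2: "continuous_on X (\<lambda>\<xi>. F \<xi> t)" for X t by (intro continuous_on_uncurry[OF F] continuous_intros)
  have F': "continuous_on UNIV (\<lambda>p. F (snd p) (fst p))" by (intro continuous_on_uncurry[OF F] continuous_intros)
  have e: "integral {a..b} (\<lambda>t. F \<xi> t) = integral {0..b-a} (\<lambda>t. F \<xi> (t + a))" for \<xi> a b
    using integral_shift_real[OF F1, of 0 "b - a" \<xi> a] by simp
  have c1: "continuous_on UNIV (\<lambda>\<xi>. integral {\<xi>..x} (F \<xi>))" "continuous_on UNIV (\<lambda>\<xi>. integral {x..T} (F \<xi>))"
    unfolding e by (intro continuous_intros continuous_on_uncurry[OF F])+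
  have c2: "continuous_on UNIV (\<lambda>t. integral {0..min x t} (\<lambda>\<xi>. F \<xi> t))"
    by (intro continuous_intros continuous_on_uncurry[OF F])
  have "integral {0..x} (\<lambda>\<xi>. integral {\<xi>..T} (F \<xi>)) = integral {0..x} (\<lambda>\<xi>. integral {\<xi>..x} (F \<xi>) + integral {x..T} (F \<xi>))"
    by (rule integral_cong) (use x in \<open>auto intro!: integral_combine_cont F1\<close>)
  also have "\<dots> = integral {0..x} (\<lambda>\<xi>. integral {\<xi>..x} (F \<xi>)) + integral {0..x} (\<lambda>\<xi>. integral {x..T} (F \<xi>))"
    by (intro integral_add integrable_cont c1)
  also have "integral {0..x} (\<lambda>\<xi>. integral {\<xi>..x} (F \<xi>)) = integral {0..x} (\<lambda>t. integral {0..t} (\<lambda>\<xi>. F \<xi> t))"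
    using fubini_triangle[OF F'] by simp
  also have "\<dots> = integral {0..x} (\<lambda>t. integral {0..min x t} (\<lambda>\<xi>. F \<xi> t))"
    by (rule integral_cong) simp
  also have "integral {0..x} (\<lambda>\<xi>. integral {x..T} (F \<xi>)) = integral {x..T} (\<lambda>t. integral {0..x} (\<lambda>\<xi>. F \<xi> t))"
    unfolding interval_cbox
    by (rule integral_swap_continuous) (rule continuous_on_subset[OF F[unfolded split_beta'[symmetric]]], simp)
  also have "\<dots> = integral {x..T} (\<lambda>t. integral {0..min x t} (\<lambda>\<xi>. F \<xi> t))"
    by (rule integral_cong) simp
  also have "integral {0..x} (\<lambda>t. integral {0..min x t} (\<lambda>\<xi>. F \<xi> t)) + \<dots> = integral {0..T} (\<lambda>t. integral {0..min x t} (\<lambda>\<xi>. F \<xi> t))"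
    by (rule integral_combine_cont[symmetric]) (use c2 x in auto)
  finally show ?thesis .
qed

lemma integral_norm_power2_eq_0:
  fixes f :: "real \<Rightarrow> 'a::real_normed_vector"
  assumes f: "continuous_on UNIV f" and T: "0 < T" and z: "integral {0..T} (\<lambda>x. (norm (f x))\<^sup>2) = 0" and x: "x \<in> {0..T}"
  shows "f x = 0"
proof -
  have "((\<lambda>x. (norm (f x))\<^sup>2) has_integral 0) (cbox 0 T)"
  proof -
    have "continuous_on UNIV (\<lambda>x. (norm (f x))\<^sup>2)" by (intro continuous_intros f)
    from integrable_integral[OF integrable_cont[OF this, of 0 T]] z show ?thesis by simp
  qed
  moreover have "continuous_on (cbox 0 T) (\<lambda>x. (norm (f x))\<^sup>2)"
    by (intro continuous_intros continuous_on_subset[OF f]) auto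
  ultimately have "(norm (f x))\<^sup>2 = 0"
    using has_integral_0_cbox_imp_0[of 0 T "\<lambda>x. (norm (f x))\<^sup>2" x] T x by auto
  then show ?thesis by simp
qed

text \<open>The wave with an incoming impulse that leaves nothing behind at the far end is reflected into
  a solution of the integral equation for \<open>S\<^sub>T\<close>; here the energy identity identifies
  the incoming wave with the adjoint convolution applied to the reflected one.\<close>

lemma mild_S_equation:
  fixes A :: "real \<times> real \<Rightarrow> complex^'c^'r"
  assumes A: "mild A" and T0: "T0 \<ge> 0"
  obtains K where "\<And>T. 0 \<le> T \<Longrightarrow> T \<le> T0 \<Longrightarrow> \<exists>g. continuous_on UNIV g \<and> g T = A (0, T) \<and> (\<forall>x\<in>{0..T}. norm (g x) \<le> K) \<and>
     (\<forall>x\<in>{0..T}. g x - integral {0..T} (\<lambda>t. s_kernel (\<lambda>x. A (x, 0)) x t ** g t) = A (x, 0))"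
proof -
  have c1: "\<bar>1::real\<bar> \<le> 1" by simp
  have cA: "continuous_on UNIV A" using A by (simp add: mild_def)
  have ca: "continuous_on UNIV (\<lambda>s. A (0,s))" and cA0: "continuous_on UNIV (\<lambda>x. A (x,0))"
    by (intro continuous_on_compose2[OF cA] continuous_intros; simp)+
  define A0 where "A0 x = A (x, 0)" for x
  have cA0: "continuous_on UNIV A0" unfolding A0_def by (rule cA0)
  obtain K where K: "\<forall>T. 0 \<le> T \<longrightarrow> T \<le> T0 \<longrightarrow> (\<exists>P. wave (\<lambda>s. A (0,s)) T P (reflected_wave A 1 P) \<and>
     (\<forall>\<sigma> s. 0 \<le> \<sigma> \<longrightarrow> 0 \<le> s \<longrightarrow> \<sigma> + s \<le> T \<longrightarrow> norm (P (\<sigma>, s)) \<le> K \<and> norm (reflected_wave A 1 P (\<sigma>, s)) \<le> K \<and>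
       P (\<sigma>, s) = (\<lambda>\<sigma>. 0) \<sigma> - integral {0..s} (\<lambda>s'. madj (A (0, s')) ** reflected_wave A 1 P (\<sigma>, s'))
         + 1 *\<^sub>R integral {0..T - \<sigma>} (\<lambda>s'. madj (A (0, s')) ** reflected_wave A 1 P (\<sigma>, s'))))"
    using wave_exists[OF A continuous_on_const c1 T0] by blast
  have "\<exists>g. continuous_on UNIV g \<and> g T = A (0, T) \<and> (\<forall>x\<in>{0..T}. norm (g x) \<le> K) \<and>
     (\<forall>x\<in>{0..T}. g x - integral {0..T} (\<lambda>t. s_kernel A0 x t ** g t) = A0 x)" if T: "0 \<le> T" "T \<le> T0" for T
  proof -
    obtain P where w: "wave (\<lambda>s. A (0,s)) T P (reflected_wave A 1 P)" and
      Pb: "\<And>\<sigma> s. 0 \<le> \<sigma> \<Longrightarrow> 0 \<le> s \<Longrightarrow> \<sigma> + s \<le> T \<Longrightarrow> norm (reflected_wave A 1 P (\<sigma>, s)) \<le> K" and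
      P: "\<And>\<sigma> s. 0 \<le> \<sigma> \<Longrightarrow> 0 \<le> s \<Longrightarrow> \<sigma> + s \<le> T \<Longrightarrow> P (\<sigma>, s) = 0 - integral {0..s} (\<lambda>s'. madj (A (0, s')) ** reflected_wave A 1 P (\<sigma>, s'))
         + 1 *\<^sub>R integral {0..T - \<sigma>} (\<lambda>s'. madj (A (0, s')) ** reflected_wave A 1 P (\<sigma>, s'))"
      using K T by blast
    have cP: "continuous_on UNIV P" using w by (simp add: wave_def)
    \<comment> \<open>On the far edge the two integrals of the representation of P coincide, since c
      = 1 and the input is 0.\<close>
    have Pend: "P (\<sigma>, T - \<sigma>) = 0" if "\<sigma> \<in> {0..T}" for \<sigma> using P[of \<sigma> "T - \<sigma>"] that by simp
    define g where "g x = reflected_wave A 1 P (x, 0)" for x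
    define p where "p x = P (x, 0)" for x
    have cg: "continuous_on UNIV g" unfolding g_def
      by (intro continuous_on_compose2[OF continuous_reflected_wave[OF cA cP]] continuous_intros) auto
    have cp: "continuous_on UNIV p" unfolding p_def
      by (intro continuous_on_compose2[OF cP] continuous_intros) auto
    \<comment> \<open>Along the last characteristic P vanishes, so the reflected wave is constant
      there: its value at the surface equals its value at depth T and time 0, where only the impulse
      term A (0, T) is present.\<close>
    have gT: "g T = A (0, T)"
    proof -
      have "((\<lambda>\<sigma>. 0) has_integral reflected_wave A 1 P (T, T - T) - reflected_wave A 1 P (0, T - 0)) {0..T}"
      proof (rule fundamental_theorem_of_calculus)
        fix \<sigma> assume \<sigma>: "\<sigma> \<in> {0..T}"
        have "((\<lambda>\<sigma>. reflected_wave A 1 P (\<sigma>, T - \<sigma>)) has_vector_derivative A (0, T - \<sigma>) ** P (\<sigma>, T - \<sigma>)) (at \<sigma> within {0..T})"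
          using w \<sigma> unfolding wave_def by auto
        then show "((\<lambda>\<sigma>. reflected_wave A 1 P (\<sigma>, T - \<sigma>)) has_vector_derivative 0) (at \<sigma> within {0..T})"
          by (simp add: Pend[OF \<sigma>] mm.zero_right)
      qed (rule T(1))
      then have "reflected_wave A 1 P (T, 0) - reflected_wave A 1 P (0, T) = 0" by (simp add: has_integral_0_eq)
      then show ?thesis by (simp add: g_def reflected_wave_def conv_def)
    qed
    define q where "q \<sigma> = integral {\<sigma>..T} (\<lambda>t. madj (A0 (t - \<sigma>)) ** g t)" for \<sigma>
    have q': "q \<sigma> = integral {0..T - \<sigma>} (\<lambda>t. madj (A0 t) ** g (t + \<sigma>))" for \<sigma>
    proof -
      have "continuous_on UNIV (\<lambda>t. madj (A0 (t - \<sigma>)) ** g t)"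
        by (intro continuous_intros continuous_on_compose2[OF cA0] cg) auto
      from integral_shift_real[OF this, of 0 "T - \<sigma>" \<sigma>] show ?thesis by (simp add: q_def)
    qed
    have cq: "continuous_on UNIV q" unfolding q'
      by (intro continuous_intros continuous_on_compose2[OF cA0] continuous_on_compose2[OF cg]) auto
    \<comment> \<open>Claim p = K* g, with K the convolution by \<open>A0\<close>. A wave with input
      f = p - q and no impulse is paired with the given one: the far edge contributes nothing as P =
      0 there, so <f, p> = <K f, g> = <f, q>, whence the norm of f is 0.\<close>
    have pq: "p \<sigma> = q \<sigma>" if \<sigma>: "\<sigma> \<in> {0..T}" and Tp: "T > 0" for \<sigma>
    proof -
      define f where "f \<sigma> = p \<sigma> - q \<sigma>" for \<sigma>
      have cf: "continuous_on UNIV f" unfolding f_def by (intro continuous_intros cp cq)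
      obtain P' g' where w': "wave (\<lambda>s. A (0,s)) T P' g'" and P': "\<And>\<sigma>. \<sigma> \<in> {0..T} \<Longrightarrow> P' (\<sigma>, 0) = f \<sigma>"
        and g0': "\<And>s. g' (0, s) = 0" and g': "\<And>y. y \<in> {0..T} \<Longrightarrow> g' (y, 0) = conv (\<lambda>x. A (x, 0)) f y"
        using wave_with_input[OF A cf T(1)] by blast
      have z: "integral {0..T} (\<lambda>\<sigma>. P' (\<sigma>, T - \<sigma>) \<bullet> P (\<sigma>, T - \<sigma>)) = 0"
      proof -
        have "integral {0..T} (\<lambda>\<sigma>. P' (\<sigma>, T - \<sigma>) \<bullet> P (\<sigma>, T - \<sigma>)) = integral {0..T} (\<lambda>\<sigma>. 0)"
          by (rule integral_cong) (simp add: Pend)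
        then show ?thesis by simp
      qed
      have "integral {0..T} (\<lambda>\<sigma>. f \<sigma> \<bullet> p \<sigma>) = integral {0..T} (\<lambda>\<sigma>. P' (\<sigma>, 0) \<bullet> P (\<sigma>, 0))"
        by (rule integral_cong) (simp add: P' p_def)
      also have "\<dots> = integral {0..T} (\<lambda>y. g' (y, 0) \<bullet> reflected_wave A 1 P (y, 0))"
        using wave_energy[OF w' w ca] z by (simp add: g0')
      also have "\<dots> = integral {0..T} (\<lambda>y. conv A0 f y \<bullet> g y)"
        by (rule integral_cong) (simp add: g' g_def A0_def[abs_def])
      also have "\<dots> = integral {0..T} (\<lambda>y. integral {0..y} (\<lambda>\<sigma>. f \<sigma> \<bullet> (madj (A0 (y - \<sigma>)) ** g y)))"
      proof (rule integral_cong)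
        fix y
        have "(\<lambda>\<sigma>. A0 (y - \<sigma>) ** f \<sigma>) integrable_on {0..y}"
          by (intro integrable_cont continuous_intros continuous_on_compose2[OF cA0] cf) auto
        from integral_linear[OF this bounded_linear_inner_left[of "g y"]]
        show "conv A0 f y \<bullet> g y = integral {0..y} (\<lambda>\<sigma>. f \<sigma> \<bullet> (madj (A0 (y - \<sigma>)) ** g y))"
          by (simp add: conv_def o_def inner_madj_right)
      qed
      also have "\<dots> = integral {0..T} (\<lambda>\<sigma>. integral {\<sigma>..T} (\<lambda>y. f \<sigma> \<bullet> (madj (A0 (y - \<sigma>)) ** g y)))"
        by (rule fubini_triangle) (intro continuous_intros continuous_on_compose2[OF cA0] continuous_on_compose2[OF cf] continuous_on_compose2[OF cg]; simp)
      also have "\<dots> = integral {0..T} (\<lambda>\<sigma>. f \<sigma> \<bullet> q \<sigma>)"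
      proof (rule integral_cong)
        fix \<sigma>
        have "(\<lambda>y. madj (A0 (y - \<sigma>)) ** g y) integrable_on {\<sigma>..T}"
          by (intro integrable_cont continuous_intros continuous_on_compose2[OF cA0] cg) auto
        from integral_linear[OF this bounded_linear_inner_right[of "f \<sigma>"]]
        show "integral {\<sigma>..T} (\<lambda>y. f \<sigma> \<bullet> (madj (A0 (y - \<sigma>)) ** g y)) = f \<sigma> \<bullet> q \<sigma>"
          by (simp add: q_def o_def)
      qed
      finally have "integral {0..T} (\<lambda>\<sigma>. f \<sigma> \<bullet> p \<sigma>) - integral {0..T} (\<lambda>\<sigma>. f \<sigma> \<bullet> q \<sigma>) = 0" by simp
      moreover have "integral {0..T} (\<lambda>\<sigma>. f \<sigma> \<bullet> p \<sigma> - f \<sigma> \<bullet> q \<sigma>) = integral {0..T} (\<lambda>\<sigma>. f \<sigma> \<bullet> p \<sigma>) - integral {0..T} (\<lambda>\<sigma>. f \<sigma> \<bullet> q \<sigma>)"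
        by (intro integral_diff integrable_cont continuous_intros cf cp cq)
      ultimately have "integral {0..T} (\<lambda>\<sigma>. (norm (f \<sigma>))\<^sup>2) = 0"
        by (simp add: power2_norm_eq_inner inner_diff_right[symmetric] f_def)
      from integral_norm_power2_eq_0[OF cf Tp this \<sigma>] show ?thesis by (simp add: f_def)
    qed
    have "g x - integral {0..T} (\<lambda>t. s_kernel A0 x t ** g t) = A0 x" if x: "x \<in> {0..T}" for x
    proof (cases "T = 0")
      case True
      then show ?thesis using x by (simp add: g_def reflected_wave_def conv_def A0_def)
    next
      case False
      then have Tp: "T > 0" using T by simp
      \<comment> \<open>Inserting p = K* g into g = A0 + K p gives g - K K* g = A0; the kernel of K
        K* is \<open>s_kernel A0\<close>.\<close>
      have "conv A0 p x = integral {0..x} (\<lambda>\<xi>. A0 (x - \<xi>) ** q \<xi>)"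
        unfolding conv_def by (rule integral_cong) (use x Tp in \<open>simp add: pq\<close>)
      also have "\<dots> = integral {0..x} (\<lambda>\<xi>. integral {\<xi>..T} (\<lambda>t. A0 (x - \<xi>) ** (madj (A0 (t - \<xi>)) ** g t)))"
        unfolding q_def
        by (subst integral_mult_mat_left; (intro integrable_cont continuous_intros continuous_on_compose2[OF cA0] cg; simp)?) simp
      also have "\<dots> = integral {0..T} (\<lambda>t. integral {0..min x t} (\<lambda>\<xi>. A0 (x - \<xi>) ** (madj (A0 (t - \<xi>)) ** g t)))"
        by (rule fubini_trapezoid) (intro continuous_intros continuous_on_compose2[OF cA0] continuous_on_compose2[OF cg] | use x in simp)+
      also have "\<dots> = integral {0..T} (\<lambda>t. s_kernel A0 x t ** g t)"
        unfolding s_kernel_def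
        by (subst integral_mult_mat_right[symmetric]; (intro integrable_cont continuous_intros continuous_on_compose2[OF cA0]; simp)?)
           (simp add: matrix_mul_assoc)
      finally have "conv A0 p x = integral {0..T} (\<lambda>t. s_kernel A0 x t ** g t)" .
      then show ?thesis by (simp add: g_def reflected_wave_def A0_def[abs_def] p_def[abs_def])
    qed
    moreover have "norm (g x) \<le> K" if "x \<in> {0..T}" for x using Pb[of x 0] that by (simp add: g_def)
    ultimately show ?thesis using cg gT by blast
  qed
  then show ?thesis using that[of K] unfolding A0_def by blast
qed

section \<open>Laplace transforms\<close>

text \<open>Integration by parts shifts the decreasing weight onto the primitive, which is
  nonnegative. In this way energy inequalities valid on all initial intervals become exponentially
  weighted ones.\<close>

lemma exp_weighted_integral_nonneg:
  fixes h :: "real \<Rightarrow> real"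
  assumes h: "continuous_on UNIV h" and pos: "\<And>\<tau>. 0 \<le> \<tau> \<Longrightarrow> \<tau> \<le> X \<Longrightarrow> 0 \<le> integral {0..\<tau>} h"
    and c: "c \<ge> 0" and X: "X \<ge> 0"
  shows "0 \<le> integral {0..X} (\<lambda>\<sigma>. exp (- (c * \<sigma>)) * h \<sigma>)"
proof -
  define J where "J \<tau> = integral {0..\<tau>} h" for \<tau>
  have cJ: "continuous_on UNIV J" unfolding J_def
    by (intro continuous_intros continuous_on_compose2[OF h]) auto
  have "((\<lambda>\<sigma>. exp (- (c * \<sigma>)) * h \<sigma> - c * (exp (- (c * \<sigma>)) * J \<sigma>)) has_integral exp (- (c * X)) * J X - exp (- (c * 0)) * J 0) {0..X}"
  proof (rule fundamental_theorem_of_calculus)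
    fix \<sigma> assume \<sigma>: "\<sigma> \<in> {0..X}"
    have J: "(J has_real_derivative h \<sigma>) (at \<sigma> within {0..X})"
      using FTC_within[OF h \<sigma>] unfolding J_def by (simp add: has_real_derivative_iff_has_vector_derivative)
    have "((\<lambda>\<sigma>. exp (- (c * \<sigma>)) * J \<sigma>) has_real_derivative exp (- (c * \<sigma>)) * h \<sigma> - c * (exp (- (c * \<sigma>)) * J \<sigma>)) (at \<sigma> within {0..X})"
      by (auto intro!: derivative_eq_intros J)
    then show "((\<lambda>\<sigma>. exp (- (c * \<sigma>)) * J \<sigma>) has_vector_derivative exp (- (c * \<sigma>)) * h \<sigma> - c * (exp (- (c * \<sigma>)) * J \<sigma>)) (at \<sigma> within {0..X})"
      by (simp add: has_real_derivative_iff_has_vector_derivative)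
  qed (rule X)
  then have "integral {0..X} (\<lambda>\<sigma>. exp (- (c * \<sigma>)) * h \<sigma> - c * (exp (- (c * \<sigma>)) * J \<sigma>)) = exp (- (c * X)) * J X"
    by (simp add: integral_unique J_def)
  moreover have "integral {0..X} (\<lambda>\<sigma>. exp (- (c * \<sigma>)) * h \<sigma> - c * (exp (- (c * \<sigma>)) * J \<sigma>))
     = integral {0..X} (\<lambda>\<sigma>. exp (- (c * \<sigma>)) * h \<sigma>) - integral {0..X} (\<lambda>\<sigma>. c * (exp (- (c * \<sigma>)) * J \<sigma>))"
    by (intro integral_diff integrable_cont continuous_intros h cJ)
  moreover have "0 \<le> integral {0..X} (\<lambda>\<sigma>. c * (exp (- (c * \<sigma>)) * J \<sigma>))"
    by (intro integral_nonneg integrable_cont continuous_intros cJ mult_nonneg_nonneg c) (auto simp: J_def intro: pos)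
  moreover have "exp (- (c * X)) * J X \<ge> 0" using pos[OF X order_refl] by (simp add: J_def)
  ultimately show ?thesis by linarith
qed

lemma integrable_atLeast_bounded:
  fixes f :: "real \<Rightarrow> real"
  assumes f: "continuous_on {a..} f" and nn: "\<And>x. x \<ge> a \<Longrightarrow> f x \<ge> 0" and B: "\<And>T. T \<ge> a \<Longrightarrow> integral {a..T} f \<le> B"
  shows "f integrable_on {a..}"
proof -
  have int: "f integrable_on {a..y}" for y
    by (intro integrable_continuous_real continuous_on_subset[OF f]) auto
  have mono: "integral {a..x} f \<le> integral {a..y} f" if "x \<le> y" for x y
    by (rule integral_subset_le) (use that int nn in auto)
  define l where "l = (SUP y. integral {a..y} f)"
  have bdd: "bdd_above (range (\<lambda>y. integral {a..y} f))"
  proof (rule bdd_aboveI2)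
    fix y show "integral {a..y} f \<le> max 0 B"
    proof (cases "y \<ge> a")
      case True then show ?thesis using B[of y] by simp
    qed simp
  qed
  have "((\<lambda>y. integral {a..y} f) \<longlongrightarrow> l) at_top"
  proof (rule order_tendstoI)
    fix b assume "b < l"
    then obtain y where y: "b < integral {a..y} f" unfolding l_def using less_cSUP_iff[OF _ bdd] by auto
    show "\<forall>\<^sub>F x in at_top. b < integral {a..x} f"
      using eventually_ge_at_top[of y] by eventually_elim (use y mono in \<open>meson less_le_trans\<close>)
  next
    fix b assume b: "l < b"
    have "integral {a..x} f \<le> l" for x unfolding l_def by (rule cSUP_upper[OF _ bdd]) simp
    then show "\<forall>\<^sub>F x in at_top. integral {a..x} f < b" using b by (meson always_eventually le_less_trans)
  qed
  then show ?thesis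
    using has_integral_to_inf[OF int _ nn] by blast
qed

text \<open>Valid for conditionally convergent integrals too. This matters for the uniqueness of
  \<open>Phi\<close>, where a competitor is known to have a gauge integral and nothing more.\<close>

lemma has_integral_atLeast_tendsto:
  fixes f :: "real \<Rightarrow> 'a::banach"
  assumes f: "(f has_integral I) {0..}"
  shows "((\<lambda>T. integral {0..T} f) \<longlongrightarrow> I) at_top"
proof (rule tendstoI)
  fix e :: real assume e: "e > 0"
  have "\<not> (\<exists>a b. {0::real..} = cbox a b)"
  proof
    assume "\<exists>a b. {0::real..} = cbox a b"
    then obtain a b :: real where "{0..} = cbox a b" by blast
    then have "max 0 (b + 1) \<in> cbox a b" by (metis atLeast_iff max.cobounded1)
    then show False by simp
  qed
  from has_integral_altD[OF f this e] obtain B where B: "B > 0"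
    "\<And>a b. ball 0 B \<subseteq> cbox a b \<Longrightarrow> \<exists>z. ((\<lambda>x. if x \<in> {0..} then f x else 0) has_integral z) (cbox a b) \<and> norm (z - I) < e"
    by blast
  show "\<forall>\<^sub>F T in at_top. dist (integral {0..T} f) I < e"
    using eventually_ge_at_top[of B]
  proof eventually_elim
    case (elim T)
    have "ball 0 B \<subseteq> cbox (- T) T" using elim by (auto simp: dist_real_def)
    from B(2)[OF this] obtain z where z: "((\<lambda>x. if x \<in> {0..} then f x else 0) has_integral z) (cbox (- T) T)" "norm (z - I) < e"
      by blast
    have "{0..} \<inter> cbox (- T) T = {0..T}" using B(1) elim by auto
    with z(1) have "(f has_integral z) {0..T}" unfolding has_integral_restrict_Int by (simp only:)
    then show ?case using z(2) by (simp add: integral_unique dist_norm)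
  qed
qed

text \<open>Lerch's theorem: after one integration by parts the substitution \<open>u = e\<^sup>-\<^sup>t\<close> reduces it to
  the Weierstrass approximation theorem on \<open>[0, 1]\<close>.\<close>

lemma lerch_real:
  fixes g :: "real \<Rightarrow> real"
  assumes g: "continuous_on UNIV g" and z: "\<And>s. s > 0 \<Longrightarrow> ((\<lambda>x. exp (- (s * x)) * g x) has_integral 0) {0..}" and x: "x \<ge> 0"
  shows "g x = 0"
proof -
  \<comment> \<open>The primitive of e^(-t) g is bounded and tends to 0 at infinity, while nothing
    is known about the growth of g itself.\<close>
  define G where "G T = integral {0..T} (\<lambda>t. exp (- (1 * t)) * g t)" for T
  have ceg: "continuous_on UNIV (\<lambda>t. exp (- (s * t)) * g t)" for s by (intro continuous_intros g)
  have cG: "continuous_on UNIV G" unfolding G_def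
    by (intro continuous_intros continuous_on_compose2[OF g]) auto
  have G0: "(G \<longlongrightarrow> 0) at_top" unfolding G_def by (rule has_integral_atLeast_tendsto[OF z]) simp
  have dG: "(G has_real_derivative exp (- t) * g t) (at t within {0..T})" if "t \<in> {0..T}" for t T
    using FTC_within[OF ceg[of 1] that] unfolding G_def by (simp add: has_real_derivative_iff_has_vector_derivative)
  obtain Bd where Bd: "Bd > 0" "\<And>t. t \<ge> 0 \<Longrightarrow> \<bar>G t\<bar> \<le> Bd"
  proof -
    have "\<forall>\<^sub>F t in at_top. \<bar>G t\<bar> < 1" using tendstoD[OF G0, of 1] by simp
    then obtain T1 where T1: "\<And>t. t \<ge> T1 \<Longrightarrow> \<bar>G t\<bar> < 1" by (auto simp: eventually_at_top_linorder)
    obtain M where M: "M \<ge> 1" "\<And>t. t \<in> {0..T1} \<Longrightarrow> norm (G t) \<le> M"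
      using compact_norm_bound[OF cG compact_Icc] by blast
    have "\<bar>G t\<bar> \<le> M" if "t \<ge> 0" for t
      using T1[of t] M(1) M(2)[of t] that by (cases "t \<ge> T1") auto
    then show ?thesis using that[of M] M(1) by simp
  qed
  \<comment> \<open>Integrating by parts expresses the n-th moment of \<open>G\<close> by the
    hypothesis at s = n + 1 and a boundary term that vanishes at infinity; the division by n is the
    reason for n >= 1.\<close>
  have mom: "((\<lambda>T. integral {0..T} (\<lambda>t. exp (- (real n * t)) * G t)) \<longlongrightarrow> 0) at_top" if n: "n \<ge> 1" for n
  proof -
    have eq: "integral {0..T} (\<lambda>t. exp (- (real n * t)) * G t) = (integral {0..T} (\<lambda>t. exp (- (real (n + 1) * t)) * g t) - exp (- (real n * T)) * G T) / real n"
      if T: "T \<ge> 0" for T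
    proof -
      have "((\<lambda>t. exp (- (real (n + 1) * t)) * g t - real n * (exp (- (real n * t)) * G t)) has_integral exp (- (real n * T)) * G T - exp (- (real n * 0)) * G 0) {0..T}"
      proof (rule fundamental_theorem_of_calculus)
        fix t assume t: "t \<in> {0..T}"
        have e: "exp (- (real (n + 1) * t)) = exp (- (real n * t)) * exp (- t)"
          by (simp add: exp_add[symmetric] algebra_simps)
        have "((\<lambda>t. exp (- (real n * t)) * G t) has_real_derivative exp (- (real (n + 1) * t)) * g t - real n * (exp (- (real n * t)) * G t)) (at t within {0..T})"
          unfolding e by (auto intro!: derivative_eq_intros dG[OF t] simp: algebra_simps)
        then show "((\<lambda>t. exp (- (real n * t)) * G t) has_vector_derivative exp (- (real (n + 1) * t)) * g t - real n * (exp (- (real n * t)) * G t)) (at t within {0..T})"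
          by (simp only: has_real_derivative_iff_has_vector_derivative)
      qed (rule T)
      then have "integral {0..T} (\<lambda>t. exp (- (real (n + 1) * t)) * g t - real n * (exp (- (real n * t)) * G t)) = exp (- (real n * T)) * G T"
        by (simp add: integral_unique G_def)
      moreover have "integral {0..T} (\<lambda>t. exp (- (real (n + 1) * t)) * g t - real n * (exp (- (real n * t)) * G t))
        = integral {0..T} (\<lambda>t. exp (- (real (n + 1) * t)) * g t) - real n * integral {0..T} (\<lambda>t. exp (- (real n * t)) * G t)"
        by (subst integral_diff; (intro integrable_cont continuous_intros g cG)?) simp
      ultimately show ?thesis using n by (simp add: field_simps)
    qed
    have 1: "((\<lambda>T. integral {0..T} (\<lambda>t. exp (- (real (n + 1) * t)) * g t)) \<longlongrightarrow> 0) at_top"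
      by (rule has_integral_atLeast_tendsto[OF z]) simp
    have 2: "((\<lambda>T. exp (- (real n * T)) * G T) \<longlongrightarrow> 0) at_top"
    proof (rule Lim_null_comparison[OF _ tendsto_rabs_zero[OF G0]])
      show "\<forall>\<^sub>F T in at_top. norm (exp (- (real n * T)) * G T) \<le> \<bar>G T\<bar>"
        using eventually_ge_at_top[of 0] by eventually_elim (simp add: abs_mult mult_left_le_one_le)
    qed
    have "((\<lambda>T. (integral {0..T} (\<lambda>t. exp (- (real (n + 1) * t)) * g t) - exp (- (real n * T)) * G T) / real n) \<longlongrightarrow> (0 - 0) / real n) at_top"
      by (intro tendsto_divide tendsto_diff 1 2 tendsto_const) (use n in auto)
    then have "((\<lambda>T. (integral {0..T} (\<lambda>t. exp (- (real (n + 1) * t)) * g t) - exp (- (real n * T)) * G T) / real n) \<longlongrightarrow> 0) at_top" by simp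
    moreover have "\<forall>\<^sub>F T in at_top. (integral {0..T} (\<lambda>t. exp (- (real (n + 1) * t)) * g t) - exp (- (real n * T)) * G T) / real n
       = integral {0..T} (\<lambda>t. exp (- (real n * t)) * G t)"
      using eventually_ge_at_top[of 0] by eventually_elim (simp only: eq)
    ultimately show ?thesis by (rule Lim_transform_eventually)
  qed
  \<comment> \<open>The substitution u = e^(-t). Because \<open>G\<close> tends to 0 at infinity,
    the value 0 at u = 0 makes \<open>h\<close> continuous on [0, 1].\<close>
  define h where "h u = (if u \<le> 0 then 0 else G (- ln u))" for u
  have ch: "continuous_on {0..1} h"
  proof -
    have "continuous (at u within {0..1}) h" if u: "u \<in> {0..1}" for u
    proof (cases "u = 0")
      case True
      have "(h \<longlongrightarrow> 0) (at 0 within {0..1})"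
      proof (rule tendstoI)
        fix e :: real assume e: "e > 0"
        have "\<forall>\<^sub>F t in at_top. \<bar>G t\<bar> < e" using tendstoD[OF G0 e] by simp
        then obtain T1 where T1: "\<And>t. t \<ge> T1 \<Longrightarrow> \<bar>G t\<bar> < e" by (auto simp: eventually_at_top_linorder)
        have "dist (h v) 0 < e" if "v < exp (- T1)" for v
        proof (cases "v \<le> 0")
          case False
          then have "ln v \<le> ln (exp (- T1))" using that by (subst ln_le_cancel_iff) auto
          then show ?thesis using T1[of "- ln v"] False by (simp add: h_def)
        qed (use e in \<open>simp add: h_def\<close>)
        then show "\<forall>\<^sub>F v in at 0 within {0..1}. dist (h v) 0 < e"
          unfolding eventually_at by (intro exI[of _ "exp (- T1)"]) (auto simp: dist_real_def)
      qed
      then show ?thesis using True by (simp add: continuous_within h_def)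
    next
      case False
      then have u0: "u > 0" using u by simp
      have 1: "isCont (\<lambda>v. - ln v) u" using u0 by (intro isCont_minus isCont_ln) simp
      have 2: "isCont G (- ln u)" using cG by (simp add: continuous_on_eq_continuous_at)
      have "isCont (\<lambda>v. G (- ln v)) u" by (rule isCont_o2[OF 1 2])
      moreover have "\<forall>\<^sub>F v in nhds u. h v = G (- ln v)"
      proof -
        have "\<forall>\<^sub>F v in nhds u. v \<in> {0<..}" by (rule eventually_nhds_in_open) (use u0 in auto)
        then show ?thesis by eventually_elim (simp add: h_def)
      qed
      ultimately have "isCont h u" using isCont_cong[of h "\<lambda>v. G (- ln v)" u] by simp
      then show ?thesis by (rule continuous_at_imp_continuous_at_within)
    qed
    then show ?thesis by (simp add: continuous_on_eq_continuous_within)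
  qed
  have Gz: "G t = 0" if t: "t \<ge> 0" for t
  proof -
    \<comment> \<open>With a polynomial q within e of \<open>h\<close>, one splits G^2 = G (G - Q) +
      G Q under the weight e^(-t). The first part is at most e Bd; the second is a combination of
      moments of order i + 1 >= 1, the weight supplying the shift by one, and so becomes small as T
      grows.\<close>
    have small: "integral {0..T0} (\<lambda>t. exp (- t) * (G t)\<^sup>2) \<le> e * Bd + e" if e: "e > 0" and T0: "T0 \<ge> 0" for e T0
    proof -
      obtain q where q: "real_polynomial_function q" "\<And>u. u \<in> {0..1} \<Longrightarrow> \<bar>h u - q u\<bar> < e"
        using Stone_Weierstrass_real_polynomial_function[OF _ ch e] by (metis compact_Icc)
      then obtain a n where qa: "q = (\<lambda>u. \<Sum>i\<le>n. a i * u ^ i)" unfolding real_polynomial_function_iff_sum by blast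
      define Q where "Q t = q (exp (- t))" for t
      have cQ: "continuous_on UNIV Q" unfolding Q_def qa by (intro continuous_intros)
      have GQ: "\<bar>G t - Q t\<bar> \<le> e" if "t \<ge> 0" for t
        using q(2)[of "exp (- t)"] that by (simp add: h_def Q_def)
      have I2: "integral {0..T} (\<lambda>t. exp (- t) * G t * Q t) = (\<Sum>i\<le>n. a i * integral {0..T} (\<lambda>t. exp (- (real (i + 1) * t)) * G t))" for T
      proof -
        have "exp (- t) * G t * Q t = (\<Sum>i\<le>n. a i * (exp (- (real (i + 1) * t)) * G t))" for t
        proof -
          have "exp (- t) * exp (- t) ^ i = exp (- (real (i + 1) * t))" for i
            by (simp add: exp_of_nat_mult[symmetric] exp_add[symmetric] algebra_simps)
          then show ?thesis unfolding Q_def qa sum_distrib_left by (intro sum.cong) (auto simp: algebra_simps)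
        qed
        then show ?thesis
          by (simp only:) (subst integral_sum; (intro integrable_cont continuous_intros cG finite_atMost)?; simp)
      qed
      have "((\<lambda>T. integral {0..T} (\<lambda>t. exp (- t) * G t * Q t)) \<longlongrightarrow> (\<Sum>i\<le>n. a i * 0)) at_top"
        unfolding I2 by (intro tendsto_sum tendsto_mult tendsto_const mom) simp
      then have "((\<lambda>T. integral {0..T} (\<lambda>t. exp (- t) * G t * Q t)) \<longlongrightarrow> 0) at_top" by simp
      from order_tendstoD(2)[OF this e] have "\<forall>\<^sub>F T in at_top. integral {0..T} (\<lambda>t. exp (- t) * G t * Q t) < e" .
      then obtain T where T: "T \<ge> T0" "integral {0..T} (\<lambda>t. exp (- t) * G t * Q t) < e"
        by (metis (no_types, lifting) eventually_at_top_linorder le_cases)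
      have "integral {0..T0} (\<lambda>t. exp (- t) * (G t)\<^sup>2) \<le> integral {0..T} (\<lambda>t. exp (- t) * (G t)\<^sup>2)"
        by (rule integral_subset_le) (use T in \<open>auto intro!: integrable_cont continuous_intros cG\<close>)
      also have "\<dots> = integral {0..T} (\<lambda>t. exp (- t) * G t * (G t - Q t)) + integral {0..T} (\<lambda>t. exp (- t) * G t * Q t)"
        by (subst integral_add[symmetric]; (intro integrable_cont continuous_intros cG cQ)?) (simp add: power2_eq_square algebra_simps)
      also have "integral {0..T} (\<lambda>t. exp (- t) * G t * (G t - Q t)) \<le> integral {0..T} (\<lambda>t. Bd * e * exp (- 1 * t))"
      proof (rule integral_le)
        fix t assume t: "t \<in> {0..T}"
        have "exp (- t) * (G t * (G t - Q t)) \<le> exp (- t) * (Bd * e)"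
        proof (rule mult_left_mono)
          have "\<bar>G t * (G t - Q t)\<bar> \<le> Bd * e" unfolding abs_mult
            by (intro mult_mono Bd GQ) (use t Bd in auto)
          then show "G t * (G t - Q t) \<le> Bd * e" by linarith
        qed simp
        then show "exp (- t) * G t * (G t - Q t) \<le> Bd * e * exp (- 1 * t)" by (simp add: mult_ac)
      qed (intro integrable_cont continuous_intros cG cQ)+
      also have "\<dots> = Bd * e * ((exp (- 1 * T) - 1) / (- 1))"
        using integral_exp_real[of "- 1" T] T T0 by simp
      also have "\<dots> \<le> Bd * e * 1" using Bd e by (intro mult_left_mono) auto
      finally show ?thesis using T(2) by (simp add: mult.commute)
    qed
    have z: "integral {0..T0} (\<lambda>t. (norm (exp (- t / 2) * G t))\<^sup>2) = 0" if T0: "T0 \<ge> 0" for T0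
    proof -
      have sq: "(norm (exp (- t / 2) * G t))\<^sup>2 = exp (- t) * (G t)\<^sup>2" for t
        by (simp add: power_mult_distrib power2_eq_square exp_add[symmetric] abs_mult mult_ac)
      have "integral {0..T0} (\<lambda>t. exp (- t) * (G t)\<^sup>2) \<le> 0"
      proof (rule field_le_epsilon)
        fix d :: real assume d: "d > 0"
        define e where "e = d / (Bd + 1)"
        have "e > 0" using d Bd by (simp add: e_def)
        moreover have "e * Bd + e = d"
        proof -
          have "e * Bd + e = e * (Bd + 1)" by (simp add: distrib_left)
          then show ?thesis using Bd(1) by (simp add: e_def)
        qed
        ultimately show "integral {0..T0} (\<lambda>t. exp (- t) * (G t)\<^sup>2) \<le> 0 + d" using small[of e T0] T0 by simp
      qed
      moreover have "integral {0..T0} (\<lambda>t. (norm (exp (- t / 2) * G t))\<^sup>2) \<ge> 0" by (rule integral_norm_power2_nonneg)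
      ultimately show ?thesis unfolding sq by linarith
    qed
    have "exp (- t / 2) * G t = 0"
      by (rule integral_norm_power2_eq_0[OF _ _ z, of "t + 1"]) (use t in \<open>auto intro!: continuous_intros cG\<close>)
    then show ?thesis by simp
  qed
  \<comment> \<open>\<open>G\<close> vanishes identically on the half-line, so its derivative e^(-x)
    g x is that of the zero function.\<close>
  have "((\<lambda>t. 0) has_real_derivative exp (- x) * g x) (at x within {0..x+1})"
    by (rule has_field_derivative_transform_within[OF dG zero_less_one]) (use x Gz in auto)
  moreover have "((\<lambda>t. 0) has_real_derivative 0) (at x within {0..x+1})" by simp
  moreover have "at x within {0..x+1} \<noteq> bot"
    using x by (simp add: trivial_limit_within islimpt_Icc)
  ultimately have "exp (- x) * g x = 0"
    using has_field_derivative_unique by blast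
  then show ?thesis by simp
qed

lemma integrable_atLeast_dominated:
  fixes f :: "real \<Rightarrow> 'b::euclidean_space"
  assumes f: "continuous_on UNIV f" and g: "g integrable_on {a..}" and le: "\<And>x. x \<ge> a \<Longrightarrow> norm (f x) \<le> g x"
  shows "f integrable_on {a..}"
proof (rule measurable_bounded_by_integrable_imp_integrable[OF _ g])
  show "f \<in> borel_measurable (lebesgue_on {a..})"
    by (intro continuous_imp_measurable_on_sets_lebesgue continuous_on_subset[OF f]) auto
qed (use le in auto)

section \<open>The step response: growth and exponential integrability\<close>

definition Phi_of :: "(real \<times> real \<Rightarrow> complex^'c^'r) \<Rightarrow> real \<Rightarrow> complex^'c^'r" where
  "Phi_of A x = integral {0..x} (\<lambda>t. A (t, 0))"

lemma continuous_Phi_of: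
  assumes "continuous_on UNIV A" shows "continuous_on UNIV (Phi_of A)"
  unfolding Phi_of_def by (intro continuous_intros continuous_on_compose2[OF assms]) auto

lemma conv_mat_1:
  assumes A: "continuous_on UNIV A"
  shows "conv (\<lambda>x. A (x, 0)) (\<lambda>_. mat 1) = Phi_of A"
proof
  fix x
  have "continuous_on UNIV (\<lambda>t. A (t, 0))" by (intro continuous_on_compose2[OF A] continuous_intros) auto
  from integral_flip[OF this] show "conv (\<lambda>x. A (x, 0)) (\<lambda>_. mat 1) x = Phi_of A x"
    by (simp add: conv_def Phi_of_def)
qed

text \<open>\<open>Phi_of A\<close> is the response to the unit step, whose energy on [0, T] is
  proportional to T. By the contraction property its own energy grows no faster, which makes the
  Laplace integral converge in the whole upper half-plane.\<close>

lemma Phi_of_L2: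
  fixes A :: "real \<times> real \<Rightarrow> complex^'c^'r"
  assumes A: "mild A" and T: "T \<ge> 0"
  shows "integral {0..T} (\<lambda>y. (norm (Phi_of A y))\<^sup>2) \<le> T * (norm (mat 1 :: complex^'c^'c))\<^sup>2"
  using mild_contraction[OF A continuous_on_const T, of "mat 1"] conv_mat_1[of A] A T by (simp add: mild_def)

lemma exp_weighted_le:
  fixes f h :: "real \<Rightarrow> real"
  assumes f: "continuous_on UNIV f" and h: "continuous_on UNIV h"
    and le: "\<And>\<tau>. 0 \<le> \<tau> \<Longrightarrow> \<tau> \<le> X \<Longrightarrow> integral {0..\<tau>} f \<le> integral {0..\<tau>} h"
    and c: "c \<ge> 0" and X: "X \<ge> 0"
  shows "integral {0..X} (\<lambda>\<sigma>. exp (- (c * \<sigma>)) * f \<sigma>) \<le> integral {0..X} (\<lambda>\<sigma>. exp (- (c * \<sigma>)) * h \<sigma>)"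
proof -
  have "0 \<le> integral {0..X} (\<lambda>\<sigma>. exp (- (c * \<sigma>)) * (h \<sigma> - f \<sigma>))"
  proof (rule exp_weighted_integral_nonneg[OF _ _ c X])
    show "0 \<le> integral {0..\<tau>} (\<lambda>\<sigma>. h \<sigma> - f \<sigma>)" if "0 \<le> \<tau>" "\<tau> \<le> X" for \<tau>
      using le[OF that] by (subst integral_diff) (auto intro: integrable_cont f h)
  qed (intro continuous_intros f h)
  also have "integral {0..X} (\<lambda>\<sigma>. exp (- (c * \<sigma>)) * (h \<sigma> - f \<sigma>)) = integral {0..X} (\<lambda>\<sigma>. exp (- (c * \<sigma>)) * h \<sigma>) - integral {0..X} (\<lambda>\<sigma>. exp (- (c * \<sigma>)) * f \<sigma>)"
    by (subst integral_diff[symmetric]; (intro integrable_cont continuous_intros f h)?) (simp add: algebra_simps)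
  finally show ?thesis by simp
qed

lemma exp_integral_le: "c > 0 \<Longrightarrow> T \<ge> 0 \<Longrightarrow> integral {0..T} (\<lambda>x. exp (- (c * x))) \<le> 1 / (c::real)"
  using integral_exp_real[of "- c" T] by (simp add: divide_le_cancel diff_divide_distrib)

text \<open>The inequality r <= 1 + r^2 passes from the norm to its square. The energy bound for the
  square holds on every initial interval, hence also under an exponential weight.\<close>

lemma Phi_of_exp_integrable:
  assumes A: "mild A" and c: "c > 0"
  shows "(\<lambda>x. exp (- (c * x)) * norm (Phi_of A x)) integrable_on {0..}"
proof (rule integrable_atLeast_bounded)
  have cA: "continuous_on UNIV A" using A by (simp add: mild_def)
  note cP = continuous_Phi_of[OF cA]
  show "continuous_on {0..} (\<lambda>x. exp (- (c * x)) * norm (Phi_of A x))"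
    by (intro continuous_intros continuous_on_subset[OF cP]) auto
  define m where "m = (norm (mat 1 :: complex^'a^'a))\<^sup>2"
  fix T :: real assume T: "T \<ge> 0"
  have "integral {0..T} (\<lambda>x. exp (- (c * x)) * norm (Phi_of A x)) \<le> integral {0..T} (\<lambda>x. exp (- (c * x)) * (1 + (norm (Phi_of A x))\<^sup>2))"
  proof (rule integral_le)
    fix x
    have "norm (Phi_of A x) \<le> 1 + (norm (Phi_of A x))\<^sup>2"
      using sum_squares_bound[of 1 "norm (Phi_of A x)"] by (simp add: power2_eq_square) (smt (verit) norm_ge_zero)
    then show "exp (- (c * x)) * norm (Phi_of A x) \<le> exp (- (c * x)) * (1 + (norm (Phi_of A x))\<^sup>2)" by simp
  qed (intro integrable_cont continuous_intros cP)+
  also have "\<dots> \<le> integral {0..T} (\<lambda>x. exp (- (c * x)) * (1 + m))"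
  proof (rule exp_weighted_le[OF _ _ _ _ T])
    show "integral {0..\<tau>} (\<lambda>x. 1 + (norm (Phi_of A x))\<^sup>2) \<le> integral {0..\<tau>} (\<lambda>x. 1 + m)" if "0 \<le> \<tau>" for \<tau>
    proof -
      have "integral {0..\<tau>} (\<lambda>x. 1 + (norm (Phi_of A x))\<^sup>2) = integral {0..\<tau>} (\<lambda>x. 1) + integral {0..\<tau>} (\<lambda>x. (norm (Phi_of A x))\<^sup>2)"
        by (intro integral_add integrable_cont continuous_intros cP)
      also have "\<dots> \<le> \<tau> + \<tau> * m" using Phi_of_L2[OF A that] that by (simp add: m_def)
      finally show ?thesis using that by (simp add: algebra_simps)
    qed
  qed (intro continuous_intros cP | use c in simp)+
  also have "\<dots> = integral {0..T} (\<lambda>x. exp (- (c * x))) * (1 + m)" by simp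
  also have "\<dots> \<le> 1 / c * (1 + m)" by (intro mult_right_mono exp_integral_le c T) (simp add: m_def)
  finally show "integral {0..T} (\<lambda>x. exp (- (c * x)) * norm (Phi_of A x)) \<le> 1 / c * (1 + m)" .
qed auto

text \<open>The difference of two integrals from 0 is an oriented integral between \<open>l\<close>
  and \<open>x\<close>, which treats both sides of the initial point at once. Integrating the weight
  exp (k |s - l|) away from \<open>l\<close> gains 1/k.\<close>

lemma ode_integral_estimate:
  fixes D :: "real \<Rightarrow> 'b::banach"
  assumes D: "continuous_on UNIV D" and xl: "0 \<le> x" "0 \<le> l" and B: "B \<ge> 0" and k: "k > 0"
    and b: "\<And>s. min x l \<le> s \<Longrightarrow> s \<le> max x l \<Longrightarrow> norm (D s) \<le> B * exp (k * \<bar>s - l\<bar>)"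
  shows "norm (integral {0..x} D - integral {0..l} D) \<le> B * exp (k * \<bar>x - l\<bar>) / k"
proof (cases "l \<le> x")
  case True
  have "integral {0..x} D - integral {0..l} D = integral {l..x} D"
    using integral_combine_cont[OF D xl(2) True] by simp
  also have "norm \<dots> \<le> integral {l..x} (\<lambda>s. B * exp (k * (s - l)))"
    by (rule integral_norm_bound_integral) (use b True in \<open>auto intro!: integrable_cont D continuous_intros\<close>)
  also have "\<dots> = B * exp (k * (x - l)) / k - B * exp (k * (l - l)) / k"
  proof (rule integral_unique, rule fundamental_theorem_of_calculus[OF True])
    fix s assume "s \<in> {l..x}"
    have "((\<lambda>s. B * exp (k * (s - l)) / k) has_real_derivative B * exp (k * (s - l))) (at s within {l..x})"
      using k by (auto intro!: derivative_eq_intros)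
    then show "((\<lambda>s. B * exp (k * (s - l)) / k) has_vector_derivative B * exp (k * (s - l))) (at s within {l..x})"
      by (simp add: has_real_derivative_iff_has_vector_derivative)
  qed
  finally show ?thesis using True k B by (simp add: algebra_simps) (smt (verit) divide_nonneg_pos)
next
  case False
  then have xl': "x \<le> l" by simp
  have "norm (integral {0..x} D - integral {0..l} D) = norm (integral {x..l} D)"
    using integral_combine_cont[OF D xl(1) xl'] by simp
  also have "\<dots> \<le> integral {x..l} (\<lambda>s. B * exp (k * (l - s)))"
    by (rule integral_norm_bound_integral) (use b xl' in \<open>auto intro!: integrable_cont D continuous_intros\<close>)
  also have "\<dots> = - B * exp (k * (l - l)) / k - (- B * exp (k * (l - x)) / k)"
  proof (rule integral_unique, rule fundamental_theorem_of_calculus[OF xl'])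
    fix s assume "s \<in> {x..l}"
    have "((\<lambda>s. - B * exp (k * (l - s)) / k) has_real_derivative B * exp (k * (l - s))) (at s within {x..l})"
      using k by (auto intro!: derivative_eq_intros)
    then show "((\<lambda>s. - B * exp (k * (l - s)) / k) has_vector_derivative B * exp (k * (l - s))) (at s within {x..l})"
      by (simp add: has_real_derivative_iff_has_vector_derivative)
  qed
  finally show ?thesis using False k B by (simp add: algebra_simps) (smt (verit) divide_nonneg_pos)
qed

text \<open>The integral equation based at \<open>l\<close> halves every bound in the weight exp (2
  M |s - l|), where M bounds the coefficient on the interval up to the larger of \<open>x\<close>
  and \<open>l\<close>.\<close>

lemma linear_ode_unique:
  fixes C :: "real \<Rightarrow> complex^'n^'n" and y :: "real \<Rightarrow> complex^'k^'n"
  assumes C: "continuous_on {0..} C" and y: "\<And>x. x \<ge> 0 \<Longrightarrow> (y has_vector_derivative C x ** y x) (at x within {0..})"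
    and l: "l \<ge> 0" "y l = 0" and x: "x \<ge> 0"
  shows "y x = 0"
proof -
  define X where "X = max x l"
  define C' y' where "C' s = C (max 0 s)" and "y' s = y (max 0 s)" for s
  have cy: "continuous_on {0..} y"
    using y by (meson atLeast_iff continuous_on_eq_continuous_within has_vector_derivative_continuous)
  have cC': "continuous_on UNIV C'" and cy': "continuous_on UNIV y'" unfolding C'_def y'_def
    by (auto intro!: continuous_on_compose2[OF C] continuous_on_compose2[OF cy] continuous_intros)
  have eq: "y s = integral {0..s} (\<lambda>s. C' s ** y' s) - integral {0..l} (\<lambda>s. C' s ** y' s)" if s: "s \<ge> 0" for s
  proof -
    have i: "integral {0..s} (\<lambda>s. C' s ** y' s) = y s - y 0" if s: "s \<ge> 0" for s
    proof (rule integral_unique, rule fundamental_theorem_of_calculus[OF s])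
      fix t assume t: "t \<in> {0..s}"
      have "(y has_vector_derivative C t ** y t) (at t within {0..s})"
        by (rule has_vector_derivative_within_subset[OF y]) (use t in auto)
      then show "(y has_vector_derivative C' t ** y' t) (at t within {0..s})" using t by (simp add: C'_def y'_def)
    qed
    show ?thesis using i[OF s] i[OF l(1)] l(2) by simp
  qed
  obtain M where M: "M \<ge> 1" "\<And>s. s \<in> {0..X} \<Longrightarrow> norm (C' s) \<le> M"
    using compact_norm_bound[OF cC' compact_Icc] by blast
  obtain B where B: "B \<ge> 1" "\<And>s. s \<in> {0..X} \<Longrightarrow> norm (y' s) \<le> B"
    using compact_norm_bound[OF cy' compact_Icc] by blast
  define k where "k = 2 * M"
  have k: "k > 0" using M by (simp add: k_def)
  have "norm (y x) \<le> 0"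
  proof (rule halving_zero[where S = "{0..X}" and d = "\<lambda>s. norm (y s)" and p = x and w = "\<lambda>s. exp (k * \<bar>s - l\<bar>)" and ?c0.0 = B])
    fix c s assume c: "c \<ge> 0" and b: "\<And>s. s \<in> {0..X} \<Longrightarrow> norm (y s) \<le> c * exp (k * \<bar>s - l\<bar>)" and s: "s \<in> {0..X}"
    have "norm (integral {0..s} (\<lambda>s. C' s ** y' s) - integral {0..l} (\<lambda>s. C' s ** y' s)) \<le> (M * c) * exp (k * \<bar>s - l\<bar>) / k"
    proof (rule ode_integral_estimate)
      fix t assume t: "min s l \<le> t" "t \<le> max s l"
      then have tX: "t \<in> {0..X}" using s l unfolding X_def by auto
      have "norm (C' t ** y' t) \<le> norm (C' t) * norm (y' t)" by (rule norm_matrix_mult)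
      also have "\<dots> \<le> M * (c * exp (k * \<bar>t - l\<bar>))"
        using b[OF tX] tX M by (intro mult_mono M) (auto simp: y'_def)
      finally show "norm (C' t ** y' t) \<le> M * c * exp (k * \<bar>t - l\<bar>)" by (simp add: mult.assoc)
    qed (use s l M c k in \<open>auto intro!: continuous_intros cC' cy'\<close>)
    also have "\<dots> = c / 2 * exp (k * \<bar>s - l\<bar>)" using M by (simp add: k_def)
    finally show "norm (y s) \<le> c / 2 * exp (k * \<bar>s - l\<bar>)" using eq[of s] s by simp
  next
    fix s assume s: "s \<in> {0..X}"
    have "norm (y s) \<le> B * 1" using B(2)[OF s] s by (simp add: y'_def)
    also have "\<dots> \<le> B * exp (k * \<bar>s - l\<bar>)" by (rule mult_left_mono) (use B k in auto)
    finally show "norm (y s) \<le> B * exp (k * \<bar>s - l\<bar>)" .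
  qed (use B x in \<open>auto simp: X_def\<close>)
  then show ?thesis by simp
qed

text \<open>One fixed point argument covers the half-line, as the rate of the weight is allowed to
  grow with the coefficient.\<close>

lemma linear_ode_exists:
  fixes C :: "real \<Rightarrow> complex^'n^'n" and y0 :: "complex^'k^'n"
  assumes C: "continuous_on {0..} C" and l: "l \<ge> 0"
  obtains y where "\<And>x. x \<ge> 0 \<Longrightarrow> (y has_vector_derivative C x ** y x) (at x within {0..})" "y l = y0"
proof -
  define C' where "C' s = C (max 0 s)" for s
  have cC': "continuous_on UNIV C'" unfolding C'_def
    by (auto intro!: continuous_on_compose2[OF C] continuous_intros)
  have "continuous_on {0..} (\<lambda>s. norm (C' s))" by (intro continuous_intros continuous_on_subset[OF cC']) auto
  then obtain M where M1: "\<And>y. M y \<ge> 1" and Mm: "\<And>y y'. 0 \<le> y \<Longrightarrow> y \<le> y' \<Longrightarrow> M y \<le> M y'"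
    and Mb: "\<And>t y. 0 \<le> t \<Longrightarrow> t \<le> y \<Longrightarrow> norm (C' t) \<le> M y" using continuous_majorant by blast
  define X where "X x = max (max 0 x) l" for x
  have M0: "M s \<ge> 0" for s using M1[of s] by linarith
  \<comment> \<open>\<open>X x\<close> is the right end of the interval spanned by 0,
    \<open>x\<close> and \<open>l\<close>; twice the bound of the coefficient up to there yields the
    contraction factor 1/2.\<close>
  define w where "w x = exp (2 * M (X x) * \<bar>max 0 x - l\<bar>)" for x
  define F where "F u x = y0 + (integral {0..max 0 x} (\<lambda>s. C' s ** u s) - integral {0..l} (\<lambda>s. C' s ** u s))" for u x
  define G where "G = {u :: real \<Rightarrow> complex^'k^'n. continuous_on UNIV u}"
  have est: "norm (integral {0..max 0 x} (\<lambda>s. C' s ** u s) - integral {0..l} (\<lambda>s. C' s ** u s)) \<le> c / 2 * w x"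
    if u: "continuous_on UNIV u" and c: "c \<ge> 0" and b: "\<And>s. norm (u s) \<le> c * w s" for u :: "real \<Rightarrow> complex^'k^'n" and c x
  proof -
    have "norm (integral {0..max 0 x} (\<lambda>s. C' s ** u s) - integral {0..l} (\<lambda>s. C' s ** u s)) \<le> (M (X x) * c) * exp (2 * M (X x) * \<bar>max 0 x - l\<bar>) / (2 * M (X x))"
    proof (rule ode_integral_estimate)
      fix t assume t: "min (max 0 x) l \<le> t" "t \<le> max (max 0 x) l"
      then have t0: "t \<ge> 0" "t \<le> X x" "X t \<le> X x" "0 \<le> X t" using l by (auto simp: X_def)
      have "norm (C' t ** u t) \<le> norm (C' t) * norm (u t)" by (rule norm_matrix_mult)
      also have "\<dots> \<le> M (X x) * (c * exp (2 * M (X x) * \<bar>t - l\<bar>))"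
      proof (intro mult_mono Mb t0 M0)
        have "norm (u t) \<le> c * w t" by (rule b)
        also have "\<dots> \<le> c * exp (2 * M (X x) * \<bar>t - l\<bar>)"
          using Mm[OF t0(4,3)] t0(1) c unfolding w_def by (intro mult_left_mono) (auto intro!: mult_right_mono)
        finally show "norm (u t) \<le> c * exp (2 * M (X x) * \<bar>t - l\<bar>)" .
      qed auto
      finally show "norm (C' t ** u t) \<le> M (X x) * c * exp (2 * M (X x) * \<bar>t - l\<bar>)" by (simp add: mult.assoc)
    next
      show "0 < 2 * M (X x)" using M1[of "X x"] by linarith
      show "0 \<le> M (X x) * c" using M0 c by simp
    qed (use l in \<open>auto intro!: continuous_intros cC' u\<close>)
    also have "\<dots> = c / 2 * w x" using M1[of "X x"] by (simp add: w_def)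
    finally show ?thesis .
  qed
  have w1: "w x \<ge> 1" for x unfolding w_def using M0[of "X x"] by simp
  obtain u where u: "u \<in> G" "\<And>x. x \<in> UNIV \<Longrightarrow> F u x = u x"
  proof (rule weighted_fixpoint[where F = F and G = G and S = UNIV and w = w and ?f0.0 = "\<lambda>p. 0" and ?c0.0 = "norm y0"])
    show "F u \<in> G" if "u \<in> G" for u
      using that unfolding G_def F_def
      by (auto intro!: continuous_intros cC' continuous_on_compose2[OF cC'] elim: continuous_on_compose2)
  next
    fix f g c x assume fg: "f \<in> G" "g \<in> G" and c: "c \<ge> 0" and b: "\<And>p. p \<in> UNIV \<Longrightarrow> norm (f p - g p) \<le> c * w p"
    have cfg: "continuous_on UNIV f" "continuous_on UNIV g" using fg by (auto simp: G_def)
    have i: "(\<lambda>s. C' s ** u s) integrable_on {0..r}" if "continuous_on UNIV u" for u :: "real \<Rightarrow> complex^'k^'n" and r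
      by (intro integrable_cont continuous_intros cC' that)
    have "F f x - F g x = integral {0..max 0 x} (\<lambda>s. C' s ** (f s - g s)) - integral {0..l} (\<lambda>s. C' s ** (f s - g s))"
      by (simp add: F_def mm.diff_right integral_diff[OF i i] cfg)
    then show "norm (F f x - F g x) \<le> c / 2 * w x"
      using est[of "\<lambda>s. f s - g s" c x] c b cfg by (auto intro!: continuous_intros)
  next
    show "norm (F (\<lambda>p. 0) p - 0) \<le> norm y0 * w p" for p
      using mult_left_mono[OF w1[of p] norm_ge_zero[of y0]] by (simp add: F_def mm.zero_right)
  next
    fix h f and C :: real assume h: "\<And>n::nat. h n \<in> G" and b: "\<And>n p. p \<in> UNIV \<Longrightarrow> norm (h n p - f p) \<le> C * (1/2)^n * w p"
    have hc: "continuous_on UNIV (h n)" for n using h by (simp add: G_def)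
    have "continuous_on UNIV f"
    proof (rule continuous_weighted_limit[OF hc b])
      fix p :: real
      have "w q \<le> exp (2 * M (X (p + 1)) * (max 0 (p + 1) + l))" if "q < p + 1" for q
      proof -
        have "M (X q) \<le> M (X (p + 1))" using that l by (intro Mm) (auto simp: X_def)
        moreover have "\<bar>max 0 q - l\<bar> \<le> max 0 (p + 1) + l" using that l by auto
        ultimately show ?thesis unfolding w_def using M0 by (auto intro!: mult_mono)
      qed
      then show "\<exists>U W. open U \<and> p \<in> U \<and> (\<forall>q\<in>U \<inter> UNIV. w q \<le> W)"
        by (intro exI[of _ "{..<p + 1}"]) auto
    next
      show "0 \<le> w p" for p using w1[of p] by linarith
    qed auto
    then show "f \<in> G" by (simp add: G_def)
  next
    show "0 \<le> w p" for p using w1[of p] by linarith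
  qed (auto simp: G_def)
  have cu: "continuous_on UNIV u" using u by (simp add: G_def)
  have "(u has_vector_derivative C x ** u x) (at x within {0..})" if x: "x \<ge> 0" for x
  proof -
    have cCu: "continuous_on UNIV (\<lambda>s. C' s ** u s)" by (intro continuous_intros cC' cu)
    have "((\<lambda>x. integral {0..x} (\<lambda>s. C' s ** u s)) has_vector_derivative C' x ** u x) (at x within {0..})"
      by (rule FTC_within[OF cCu]) (use x in auto)
    from has_vector_derivative_add[OF has_vector_derivative_const[of "y0 - integral {0..l} (\<lambda>s. C' s ** u s)"] this]
    have "((\<lambda>x. y0 - integral {0..l} (\<lambda>s. C' s ** u s) + integral {0..x} (\<lambda>s. C' s ** u s)) has_vector_derivative C x ** u x) (at x within {0..})"
      using x by (simp add: C'_def)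
    then show ?thesis
    proof (rule has_vector_derivative_transform[rotated 2])
      fix t :: real assume "t \<in> {0..}"
      then have "F u t = y0 - integral {0..l} (\<lambda>s. C' s ** u s) + integral {0..t} (\<lambda>s. C' s ** u s)"
        by (simp add: F_def)
      then show "u t = y0 - integral {0..l} (\<lambda>s. C' s ** u s) + integral {0..t} (\<lambda>s. C' s ** u s)"
        by (simp only: u(2)[OF UNIV_I])
    qed (use x in auto)
  qed
  moreover have "u l = y0" using u(2)[of l] l by (simp add: F_def)
  ultimately show ?thesis using that by blast
qed

section \<open>The Dirac system and its Weyl function\<close>

definition top_block :: "complex^'k^('m1::finite + 'm2::finite) \<Rightarrow> complex^'k^'m1" where
  "top_block Y = (\<chi> i j. Y $ Inl i $ j)"

definition bot_block :: "complex^'k^('m1::finite + 'm2::finite) \<Rightarrow> complex^'k^'m2" where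
  "bot_block Y = (\<chi> i j. Y $ Inr i $ j)"

lemma sum_UNIV_sum: "(\<Sum>k\<in>(UNIV :: ('a::finite + 'b::finite) set). f k) = (\<Sum>a\<in>UNIV. f (Inl a)) + (\<Sum>b\<in>UNIV. f (Inr b))"
  unfolding UNIV_Plus_UNIV[symmetric] by (subst sum.Plus) auto

lemma norm_blocks: "(norm Y)\<^sup>2 = (norm (top_block Y))\<^sup>2 + (norm (bot_block Y))\<^sup>2"
  by (simp add: norm_mat_power2 sum_UNIV_sum top_block_def bot_block_def)

lemma bounded_linear_top_block: "bounded_linear (top_block :: complex^'k^('m1::finite + 'm2::finite) \<Rightarrow> _)"
  by (intro linear_conv_bounded_linear[THEN iffD1] linearI) (auto simp: top_block_def vec_eq_iff)

lemma bounded_linear_bot_block: "bounded_linear (bot_block :: complex^'k^('m1::finite + 'm2::finite) \<Rightarrow> _)"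
  by (intro linear_conv_bounded_linear[THEN iffD1] linearI) (auto simp: bot_block_def vec_eq_iff)

lemma bounded_linear_Vmat: "bounded_linear (Vmat :: complex^'m2^'m1 \<Rightarrow> complex^('m1::finite + 'm2::finite)^('m1 + 'm2))"
  by (intro linear_conv_bounded_linear[THEN iffD1] linearI) (auto simp: Vmat_def vec_eq_iff split: sum.split)

lemma dirac_coeff_nth:
  fixes v :: "real \<Rightarrow> complex^'m2::finite^'m1::finite"
  shows "dirac_coeff v z x $ Inl a $ Inl a' = (if a = a' then \<i> * z else 0)"
    "dirac_coeff v z x $ Inl a $ Inr b = \<i> * v x $ a $ b"
    "dirac_coeff v z x $ Inr b $ Inl a = - \<i> * cnj (v x $ a $ b)"
    "dirac_coeff v z x $ Inr b $ Inr b' = (if b = b' then - \<i> * z else 0)"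
  by (auto simp: dirac_coeff_def matrix_matrix_mult_def sum_UNIV_sum Jmat_def Vmat_def if_distrib[of "\<lambda>x. x * _"] cong: if_cong)

lemma top_dirac:
  fixes v :: "real \<Rightarrow> complex^'m2::finite^'m1::finite"
  shows "top_block (dirac_coeff v z x ** Y) = mscale (\<i> * z) (top_block Y) + mscale \<i> (v x) ** bot_block Y"
  by (auto simp: vec_eq_iff top_block_def bot_block_def matrix_matrix_mult_def sum_UNIV_sum dirac_coeff_nth
      if_distrib[of "\<lambda>x. x * _"] cong: if_cong)

lemma bot_dirac:
  fixes v :: "real \<Rightarrow> complex^'m2::finite^'m1::finite"
  shows "bot_block (dirac_coeff v z x ** Y) = mscale (- \<i>) (madj (v x)) ** top_block Y + mscale (- (\<i> * z)) (bot_block Y)"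
  by (auto simp: vec_eq_iff top_block_def bot_block_def matrix_matrix_mult_def sum_UNIV_sum dirac_coeff_nth
      if_distrib[of "\<lambda>x. x * _"] cong: if_cong)

lemma top_stack: "top_block (stack_I p) = mat 1"
  and bot_stack: "bot_block (stack_I p) = p"
  by (auto simp: vec_eq_iff top_block_def bot_block_def stack_I_def mat_def)

lemma C1_nonneg_continuous: "C1_nonneg f \<Longrightarrow> continuous_on {0..} f"
  unfolding C1_nonneg_def
  by (meson atLeast_iff continuous_on_eq_continuous_within has_vector_derivative_continuous)

lemma continuous_dirac_coeff:
  fixes v :: "real \<Rightarrow> complex^'m2::finite^'m1::finite"
  assumes "continuous_on {0..} v"
  shows "continuous_on {0..} (dirac_coeff v z)"
  unfolding dirac_coeff_def
  by (intro continuous_intros bounded_linear.continuous_on[OF bounded_linear_Vmat] assms)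

text \<open>Justifies the definite description: the prescribed value 0 for negative arguments turns
  uniqueness on the half-line into equality of functions.\<close>

lemma fund_sol:
  fixes v :: "real \<Rightarrow> complex^'m2::finite^'m1::finite"
  assumes v: "continuous_on {0..} v" and l: "l \<ge> 0"
  shows "is_fund_sol v l z (fund_sol v l z)"
proof -
  note cD = continuous_dirac_coeff[OF v, of z]
  obtain y where y: "\<And>x. x \<ge> 0 \<Longrightarrow> (y has_vector_derivative dirac_coeff v z x ** y x) (at x within {0..})" "y l = mat 1"
    using linear_ode_exists[OF cD l] by blast
  define u where "u x = (if x < 0 then 0 else y x)" for x
  have "is_fund_sol v l z u" unfolding is_fund_sol_def
  proof (intro conjI allI impI)
    fix x :: real assume x: "0 \<le> x"
    have "(u has_vector_derivative dirac_coeff v z x ** y x) (at x within {0..})"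
      by (rule has_vector_derivative_transform[OF _ _ y(1)[OF x]]) (use x in \<open>auto simp: u_def\<close>)
    then show "(u has_vector_derivative dirac_coeff v z x ** u x) (at x within {0..})" using x by (simp add: u_def)
  qed (use y l in \<open>auto simp: u_def\<close>)
  then show ?thesis unfolding fund_sol_def
  proof (rule theI[of "is_fund_sol v l z" u])
    fix w assume w: "is_fund_sol v l z w"
    show "w = u"
    proof
      fix x
      show "w x = u x"
      proof (cases "x < 0")
        case False
        have "(\<lambda>x. w x - u x) x = 0"
        proof (rule linear_ode_unique[OF cD _ l])
          fix x :: real assume x: "x \<ge> 0"
          show "((\<lambda>x. w x - u x) has_vector_derivative dirac_coeff v z x ** (w x - u x)) (at x within {0..})"
            unfolding mm.diff_right
            using w \<open>is_fund_sol v l z u\<close> x unfolding is_fund_sol_def by (intro has_vector_derivative_diff) auto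
        qed (use w \<open>is_fund_sol v l z u\<close> False in \<open>auto simp: is_fund_sol_def\<close>)
        then show ?thesis by simp
      qed (use w \<open>is_fund_sol v l z u\<close> in \<open>auto simp: is_fund_sol_def\<close>)
    qed
  qed
qed

lemma fund_sol_column:
  fixes v :: "real \<Rightarrow> complex^'m2::finite^'m1::finite"
  assumes v: "continuous_on {0..} v" and l: "l \<ge> 0"
  shows "\<And>x. x \<ge> 0 \<Longrightarrow> ((\<lambda>x. fund_sol v l z x ** K) has_vector_derivative dirac_coeff v z x ** (fund_sol v l z x ** K)) (at x within {0..})"
    and "fund_sol v l z l ** K = K"
    and "continuous_on {0..} (\<lambda>x. fund_sol v l z x ** K)"
proof -
  show 1: "((\<lambda>x. fund_sol v l z x ** K) has_vector_derivative dirac_coeff v z x ** (fund_sol v l z x ** K)) (at x within {0..})" if "x \<ge> 0" for x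
    unfolding matrix_mul_assoc
    by (rule bounded_linear.has_vector_derivative[OF mm.bounded_linear_left])
       (use fund_sol[OF v l, of z] that in \<open>auto simp: is_fund_sol_def\<close>)
  show "fund_sol v l z l ** K = K" using fund_sol[OF v l, of z] by (simp add: is_fund_sol_def)
  show "continuous_on {0..} (\<lambda>x. fund_sol v l z x ** K)"
    using 1 by (meson atLeast_iff continuous_on_eq_continuous_within has_vector_derivative_continuous)
qed

lemma inner_mscale_self: "M \<bullet> mscale c M = Re c * (norm (M :: complex^'c^'r))\<^sup>2"
proof -
  have "M $ i $ j \<bullet> (c * M $ i $ j) = Re c * (M $ i $ j \<bullet> M $ i $ j)" for i j
    by (simp add: inner_complex_def algebra_simps)
  then show ?thesis by (simp add: power2_norm_eq_inner inner_vec_def sum_distrib_left)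
qed

lemma inner_mscale_i: "X \<bullet> mscale \<i> Y = - (mscale \<i> X \<bullet> (Y :: complex^'c^'r))"
  by (simp add: inner_vec_def inner_complex_def sum_negf[symmetric])

text \<open>The potential enters the derivatives of the two squared block norms with terms that
  cancel in their difference, so the growth of the flux is governed by Im z alone.\<close>

lemma dirac_flux:
  fixes v :: "real \<Rightarrow> complex^'m2::finite^'m1::finite"
  assumes Y: "(Y has_vector_derivative dirac_coeff v z x ** Y x) (at x within S)"
  shows "((\<lambda>x. (norm (bot_block (Y x)))\<^sup>2 - (norm (top_block (Y x)))\<^sup>2) has_vector_derivative 2 * Im z * (norm (Y x))\<^sup>2) (at x within S)"
proof -
  let ?t = "top_block (Y x)" and ?b = "bot_block (Y x)"
  note dt = bounded_linear.has_vector_derivative[OF bounded_linear_top_block Y]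
  note db = bounded_linear.has_vector_derivative[OF bounded_linear_bot_block Y]
  have 1: "((\<lambda>x. (norm (bot_block (Y x)))\<^sup>2 - (norm (top_block (Y x)))\<^sup>2) has_vector_derivative
     (?b \<bullet> bot_block (dirac_coeff v z x ** Y x) + bot_block (dirac_coeff v z x ** Y x) \<bullet> ?b)
     - (?t \<bullet> top_block (dirac_coeff v z x ** Y x) + top_block (dirac_coeff v z x ** Y x) \<bullet> ?t)) (at x within S)"
    unfolding power2_norm_eq_inner
    by (intro has_vector_derivative_diff bounded_bilinear.has_vector_derivative[OF bounded_bilinear_inner] dt db)
  have b: "?b \<bullet> bot_block (dirac_coeff v z x ** Y x) = Im z * (norm ?b)\<^sup>2 - ?b \<bullet> mscale \<i> (madj (v x) ** ?t)"
    unfolding bot_dirac by (simp add: inner_add_right inner_diff_right inner_mscale_self mscale_mult_left ms.minus_left mm.minus_left)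
  have t: "?t \<bullet> top_block (dirac_coeff v z x ** Y x) = - Im z * (norm ?t)\<^sup>2 + ?t \<bullet> mscale \<i> (v x ** ?b)"
    unfolding top_dirac by (simp add: inner_add_right inner_mscale_self mscale_mult_left)
  have c: "?b \<bullet> mscale \<i> (madj (v x) ** ?t) = - (?t \<bullet> mscale \<i> (v x ** ?b))"
    unfolding inner_mscale_i[of ?b] inner_madj_right mscale_mult_right by (simp add: inner_commute)
  have "(?b \<bullet> bot_block (dirac_coeff v z x ** Y x) + bot_block (dirac_coeff v z x ** Y x) \<bullet> ?b)
     - (?t \<bullet> top_block (dirac_coeff v z x ** Y x) + top_block (dirac_coeff v z x ** Y x) \<bullet> ?t) = 2 * Im z * (norm (Y x))\<^sup>2"
    unfolding inner_commute[of "bot_block (dirac_coeff v z x ** Y x)"] inner_commute[of "top_block (dirac_coeff v z x ** Y x)"] b t c norm_blocks[of "Y x"]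
    by (simp add: algebra_simps)
  with 1 show ?thesis by simp
qed

text \<open>Two square integrable columns with the same top block differ by a solution whose flux at
  \<open>l\<close> is the squared norm of p - q. The flux increases for Im z > 0, so the solution
  stays bounded away from 0 and cannot be square integrable unless p = q.\<close>

lemma weyl_value_unique:
  fixes v :: "real \<Rightarrow> complex^'m2::finite^'m1::finite" and p q :: "complex^'m1^'m2"
  assumes v: "continuous_on {0..} v" and l: "l \<ge> 0" and z: "Im z > 0"
    and p: "\<And>i j. (\<lambda>x. (cmod ((fund_sol v l z x ** stack_I p) $ i $ j))\<^sup>2) integrable_on {l<..}"
    and q: "\<And>i j. (\<lambda>x. (cmod ((fund_sol v l z x ** stack_I q) $ i $ j))\<^sup>2) integrable_on {l<..}"
  shows "p = q"
proof (rule ccontr)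
  assume ne: "p \<noteq> q"
  define Y where "Y x = fund_sol v l z x ** (stack_I p - stack_I q)" for x
  define d where "d = (norm (p - q))\<^sup>2"
  have d: "d > 0" using ne by (simp add: d_def)
  note fs = fund_sol_column[OF v l]
  have Yl: "Y l = stack_I p - stack_I q" unfolding Y_def by (rule fs(2))
  have Yd: "d \<le> (norm (Y x))\<^sup>2" if x: "x \<ge> l" for x
  proof -
    have "((\<lambda>x. 2 * Im z * (norm (Y x))\<^sup>2) has_integral
       ((norm (bot_block (Y x)))\<^sup>2 - (norm (top_block (Y x)))\<^sup>2) - ((norm (bot_block (Y l)))\<^sup>2 - (norm (top_block (Y l)))\<^sup>2)) {l..x}"
    proof (rule fundamental_theorem_of_calculus[OF x])
      fix t assume t: "t \<in> {l..x}"
      have "(Y has_vector_derivative dirac_coeff v z t ** Y t) (at t within {0..})"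
        unfolding Y_def by (rule fs(1)) (use t l in auto)
      then have "(Y has_vector_derivative dirac_coeff v z t ** Y t) (at t within {l..x})"
        by (rule has_vector_derivative_within_subset) (use l in auto)
      then show "((\<lambda>x. (norm (bot_block (Y x)))\<^sup>2 - (norm (top_block (Y x)))\<^sup>2) has_vector_derivative 2 * Im z * (norm (Y t))\<^sup>2) (at t within {l..x})"
        by (rule dirac_flux)
    qed
    then have "0 \<le> ((norm (bot_block (Y x)))\<^sup>2 - (norm (top_block (Y x)))\<^sup>2) - ((norm (bot_block (Y l)))\<^sup>2 - (norm (top_block (Y l)))\<^sup>2)"
      by (rule has_integral_nonneg) (use z in auto)
    moreover have "top_block (Y l) = 0" "bot_block (Y l) = p - q"
      unfolding Yl by (simp_all add: linear_diff[OF bounded_linear.linear[OF bounded_linear_top_block]]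
          linear_diff[OF bounded_linear.linear[OF bounded_linear_bot_block]] top_stack bot_stack)
    ultimately have "d \<le> (norm (bot_block (Y x)))\<^sup>2 - (norm (top_block (Y x)))\<^sup>2" by (simp add: d_def)
    then show ?thesis unfolding norm_blocks[of "Y x"] using zero_le_power2[of "norm (top_block (Y x))"] by linarith
  qed
  define Yp Yq where "Yp x = fund_sol v l z x ** stack_I p" and "Yq x = fund_sol v l z x ** stack_I q" for x
  define h where "h x = 2 * ((norm (Yp x))\<^sup>2 + (norm (Yq x))\<^sup>2)" for x
  have Yh: "(norm (Y x))\<^sup>2 \<le> h x" for x
  proof -
    have "norm (Y x) \<le> norm (Yp x) + norm (Yq x)" unfolding Y_def Yp_def Yq_def mm.diff_right by (rule norm_triangle_ineq4)
    then have "(norm (Y x))\<^sup>2 \<le> (norm (Yp x) + norm (Yq x))\<^sup>2" by (simp add: power_mono)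
    also have "\<dots> \<le> h x" unfolding h_def using sum_squares_bound[of "norm (Yp x)" "norm (Yq x)"]
      by (simp add: power2_sum)
    finally show ?thesis .
  qed
  have "(\<lambda>x. \<Sum>i\<in>UNIV. \<Sum>j\<in>UNIV. (cmod (Yp x $ i $ j))\<^sup>2) integrable_on {l<..}" "(\<lambda>x. \<Sum>i\<in>UNIV. \<Sum>j\<in>UNIV. (cmod (Yq x $ i $ j))\<^sup>2) integrable_on {l<..}"
    unfolding Yp_def Yq_def by (intro integrable_sum finite p q)+
  then have hi: "h integrable_on {l<..}" unfolding h_def norm_mat_power2
    by (intro integrable_on_mult_right integrable_add)
  have h0: "h x \<ge> 0" for x by (simp add: h_def)
  have bound: "d * T \<le> integral {l<..} h" if T: "T \<ge> 0" for T
  proof -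
    \<comment> \<open>The interval starts at \<open>l + 1\<close> in order to lie inside the open
      half-line on which integrability is assumed.\<close>
    have sub: "{l+1..l+1+T} \<subseteq> {l<..}" by auto
    have ch: "continuous_on {l+1..l+1+T} h" unfolding h_def Yp_def Yq_def
      by (intro continuous_intros continuous_on_subset[OF fs(3)]) (use l in auto)
    have "d * T = integral {l+1..l+1+T} (\<lambda>x. d)" using T by simp
    also have "\<dots> \<le> integral {l+1..l+1+T} h"
      by (rule integral_le) (use order_trans[OF Yd Yh] in \<open>auto intro: integrable_continuous_real ch\<close>)
    also have "\<dots> \<le> integral {l<..} h"
      by (rule integral_subset_le[OF sub integrable_continuous_real[OF ch] hi]) (simp add: h0)
    finally show ?thesis .
  qed
  have "0 \<le> integral {l<..} h" using bound[of 0] by simp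
  \<comment> \<open>This length turns the linear lower bound into I + 1 <= I.\<close>
  then have "d * ((integral {l<..} h + 1) / d) \<le> integral {l<..} h" using d by (intro bound) simp
  then show False using d by simp
qed

section \<open>Laplace transforms of waves in the time variable\<close>

lemma wave_derivative_g:
  assumes "wave a T P g" "0 \<le> \<sigma>" "\<sigma> \<le> y" "y \<le> T"
  shows "((\<lambda>\<sigma>. g (\<sigma>, y - \<sigma>)) has_vector_derivative a (y - \<sigma>) ** P (\<sigma>, y - \<sigma>)) (at \<sigma> within {0..y})"
  using assms unfolding wave_def by blast

lemma fubini_antidiagonal:
  fixes X :: "real \<times> real \<Rightarrow> real"
  assumes X: "continuous_on UNIV X"
  shows "integral {0..T} (\<lambda>s. integral {0..T - s} (\<lambda>\<sigma>. X (\<sigma>, s))) = integral {0..T} (\<lambda>y. integral {0..y} (\<lambda>\<sigma>. X (\<sigma>, y - \<sigma>)))"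
proof -
  note cX = continuous_on_compose2[OF X]
  have "integral {0..T} (\<lambda>s. integral {0..T - s} (\<lambda>\<sigma>. X (\<sigma>, s))) = integral {0..T} (\<lambda>s. integral {s..T} (\<lambda>y. X (y - s, s)))"
  proof (rule integral_cong)
    fix s
    have "continuous_on UNIV (\<lambda>y. X (y - s, s))" by (intro cX continuous_intros) auto
    from integral_shift_real[OF this, of 0 "T - s" s]
    show "integral {0..T - s} (\<lambda>\<sigma>. X (\<sigma>, s)) = integral {s..T} (\<lambda>y. X (y - s, s))" by simp
  qed
  also have "\<dots> = integral {0..T} (\<lambda>y. integral {0..y} (\<lambda>s. X (y - s, s)))"
    by (rule fubini_triangle[symmetric]) (intro cX continuous_intros; simp)
  also have "\<dots> = integral {0..T} (\<lambda>y. integral {0..y} (\<lambda>\<sigma>. X (\<sigma>, y - \<sigma>)))"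
  proof (rule integral_cong)
    fix y
    have "continuous_on UNIV (\<lambda>\<sigma>. X (\<sigma>, y - \<sigma>))" by (intro cX continuous_intros) auto
    from integral_flip[OF this, of y]
    show "integral {0..y} (\<lambda>s. X (y - s, s)) = integral {0..y} (\<lambda>\<sigma>. X (\<sigma>, y - \<sigma>))" by simp
  qed
  finally show ?thesis .
qed

text \<open>The exponential weights at depth \<open>s\<close> and time \<open>\<sigma>\<close> combine to a weight in \<open>\<sigma> + s\<close>,
  so the energy that crosses each line \<open>\<sigma> + s = y\<close> controls the double integral.\<close>

lemma wave_weighted_L2:
  fixes P :: "real \<times> real \<Rightarrow> complex^'k^'c" and g :: "real \<times> real \<Rightarrow> complex^'k^'r"
  assumes w: "wave a T P g" and a: "continuous_on UNIV a" and g0: "\<And>s. g (0, s) = 0"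
    and P0: "\<And>\<sigma>. \<sigma> \<in> {0..T} \<Longrightarrow> norm (P (\<sigma>, 0)) \<le> m" and \<eta>: "\<eta> > 0" and T: "T \<ge> 0"
  shows "integral {0..T} (\<lambda>s. exp (- (2 * \<eta> * s)) * integral {0..T - s} (\<lambda>\<sigma>. exp (- (2 * \<eta> * \<sigma>)) * (norm (P (\<sigma>, s)))\<^sup>2)) \<le> m\<^sup>2 / \<eta>\<^sup>2"
proof -
  have cP: "continuous_on UNIV P" using w by (simp add: wave_def)
  note cPc = continuous_on_compose2[OF cP]
  define X where "X p = exp (- (2 * \<eta> * snd p)) * (exp (- (2 * \<eta> * fst p)) * (norm (P p))\<^sup>2)" for p
  have cX: "continuous_on UNIV X" unfolding X_def by (intro continuous_intros cP)
  have "integral {0..T} (\<lambda>s. exp (- (2 * \<eta> * s)) * integral {0..T - s} (\<lambda>\<sigma>. exp (- (2 * \<eta> * \<sigma>)) * (norm (P (\<sigma>, s)))\<^sup>2))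
     = integral {0..T} (\<lambda>s. integral {0..T - s} (\<lambda>\<sigma>. X (\<sigma>, s)))" by (simp add: X_def)
  also have "\<dots> = integral {0..T} (\<lambda>y. integral {0..y} (\<lambda>\<sigma>. X (\<sigma>, y - \<sigma>)))" by (rule fubini_antidiagonal[OF cX])
  also have "\<dots> \<le> integral {0..T} (\<lambda>y. m\<^sup>2 / \<eta> * exp (- (\<eta> * y)))"
  proof (rule integral_le)
    show "(\<lambda>y. integral {0..y} (\<lambda>\<sigma>. X (\<sigma>, y - \<sigma>))) integrable_on {0..T}"
      by (intro integrable_cont continuous_intros continuous_on_compose2[OF cX]) auto
    show "(\<lambda>y. m\<^sup>2 / \<eta> * exp (- (\<eta> * y))) integrable_on {0..T}"
      by (intro integrable_cont continuous_intros)
    fix y assume y: "y \<in> {0..T}"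
    have e: "exp (- (2 * \<eta> * (y - \<sigma>))) * exp (- (2 * \<eta> * \<sigma>)) = exp (- (2 * \<eta> * y))" for \<sigma>
      by (simp add: exp_add[symmetric] algebra_simps)
    have "integral {0..y} (\<lambda>\<sigma>. X (\<sigma>, y - \<sigma>)) = exp (- (2 * \<eta> * y)) * integral {0..y} (\<lambda>\<sigma>. (norm (P (\<sigma>, y - \<sigma>)))\<^sup>2)"
      unfolding X_def fst_conv snd_conv mult.assoc[symmetric] e by (rule integral_mult_right)
    also have "\<dots> \<le> exp (- (2 * \<eta> * y)) * (m\<^sup>2 * y)"
    proof (rule mult_left_mono)
      have "integral {0..y} (\<lambda>\<sigma>. (norm (P (\<sigma>, y - \<sigma>)))\<^sup>2) \<le> integral {0..y} (\<lambda>\<sigma>. (norm (P (\<sigma>, 0)))\<^sup>2)"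
        by (rule wave_energy_diagonal[OF w a g0]) (use y in simp)
      also have "\<dots> \<le> integral {0..y} (\<lambda>\<sigma>. m\<^sup>2)"
        by (rule integral_le) (use y P0 in \<open>auto intro!: integrable_cont continuous_intros cPc power_mono\<close>)
      finally show "integral {0..y} (\<lambda>\<sigma>. (norm (P (\<sigma>, y - \<sigma>)))\<^sup>2) \<le> m\<^sup>2 * y" using y by (simp add: mult.commute)
    qed simp
    also have "\<dots> \<le> m\<^sup>2 / \<eta> * exp (- (\<eta> * y))"
    proof -
      have "\<eta> * y \<le> exp (\<eta> * y)" using exp_ge_add_one_self[of "\<eta> * y"] by linarith
      then have "exp (- (2 * \<eta> * y)) * (\<eta> * y) \<le> exp (- (2 * \<eta> * y)) * exp (\<eta> * y)" by (rule mult_left_mono) simp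
      also have "\<dots> = exp (- (\<eta> * y))" by (simp add: exp_add[symmetric] algebra_simps)
      finally have "m\<^sup>2 / \<eta> * (exp (- (2 * \<eta> * y)) * (\<eta> * y)) \<le> m\<^sup>2 / \<eta> * exp (- (\<eta> * y))"
        by (rule mult_left_mono) (use \<eta> in simp)
      then show ?thesis using \<eta> by (simp add: mult_ac)
    qed
    finally show "integral {0..y} (\<lambda>\<sigma>. X (\<sigma>, y - \<sigma>)) \<le> m\<^sup>2 / \<eta> * exp (- (\<eta> * y))" .
  qed
  also have "\<dots> = m\<^sup>2 / \<eta> * integral {0..T} (\<lambda>y. exp (- (\<eta> * y)))" by (rule integral_mult_right)
  also have "\<dots> \<le> m\<^sup>2 / \<eta> * (1 / \<eta>)" by (intro mult_left_mono exp_integral_le \<eta> T) (use \<eta> in simp)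
  finally show ?thesis by (simp add: power2_eq_square)
qed

text \<open>Here \<open>x = T - s\<close> is both the distance to the far end of the triangle \<open>\<sigma> + s \<le> T\<close> and the
  length of the time interval in it at depth \<open>s\<close>.\<close>

definition wave_laplace :: "complex \<Rightarrow> real \<Rightarrow> (real \<times> real \<Rightarrow> complex^'c^'r) \<Rightarrow> real \<Rightarrow> complex^'c^'r" where
  "wave_laplace z T F x = integral {0..x} (\<lambda>\<sigma>. mscale (exp (2 * \<i> * z * of_real \<sigma>)) (F (\<sigma>, T - x)))"

lemma continuous_wave_laplace:
  assumes "continuous_on UNIV F" shows "continuous_on UNIV (wave_laplace z T F)"
  unfolding wave_laplace_def by (intro continuous_intros continuous_on_compose2[OF assms]) auto

lemma norm_exp_2iz: "cmod (exp (2 * \<i> * z * of_real \<sigma>)) = exp (- (2 * Im z * \<sigma>))"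
  by (simp add: norm_exp_eq_Re)

text \<open>Cauchy-Schwarz for the measure exp (- 2 Im z \<sigma>) d\<sigma>, whose total mass is at
  most 1 / (2 Im z).\<close>

lemma norm_wave_laplace_power2_le:
  assumes F: "continuous_on UNIV F" and z: "Im z > 0" and x: "x \<ge> 0"
  shows "(norm (wave_laplace z T F x))\<^sup>2 \<le> 1 / (2 * Im z) * integral {0..x} (\<lambda>\<sigma>. exp (- (2 * Im z * \<sigma>)) * (norm (F (\<sigma>, T - x)))\<^sup>2)"
proof -
  note cF = continuous_on_compose2[OF F]
  have cFx: "continuous_on S (\<lambda>\<sigma>. F (\<sigma>, T - x))" for S by (intro cF continuous_intros) auto
  have "norm (wave_laplace z T F x) \<le> integral {0..x} (\<lambda>\<sigma>. exp (- (2 * Im z * \<sigma>)) * norm (F (\<sigma>, T - x)))"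
    unfolding wave_laplace_def
    by (rule integral_norm_bound_integral)
       (auto simp: norm_mscale norm_exp_2iz intro!: integrable_cont continuous_intros cFx)
  then have "(norm (wave_laplace z T F x))\<^sup>2 \<le> (integral {0..x} (\<lambda>\<sigma>. exp (- (2 * Im z * \<sigma>)) * norm (F (\<sigma>, T - x))))\<^sup>2"
    by (rule power_mono) simp
  also have "\<dots> \<le> integral {0..x} (\<lambda>\<sigma>. exp (- (2 * Im z * \<sigma>))) * integral {0..x} (\<lambda>\<sigma>. exp (- (2 * Im z * \<sigma>)) * (norm (F (\<sigma>, T - x)))\<^sup>2)"
    by (rule integral_Cauchy_Schwarz) (auto intro!: continuous_intros cFx)
  also have "\<dots> \<le> 1 / (2 * Im z) * integral {0..x} (\<lambda>\<sigma>. exp (- (2 * Im z * \<sigma>)) * (norm (F (\<sigma>, T - x)))\<^sup>2)"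
    by (intro mult_right_mono exp_integral_le integral_nonneg integrable_cont continuous_intros cFx) (use z x in auto)
  finally show ?thesis .
qed

lemma has_vector_derivative_exp_complex:
  fixes w b :: complex
  shows "((\<lambda>x. exp (w * of_real x + b)) has_vector_derivative w * exp (w * of_real x + b)) (at x within S)"
proof -
  have "((\<lambda>x. exp (w * x + b)) has_field_derivative w * exp (w * of_real x + b)) (at (of_real x))"
    by (auto intro!: derivative_eq_intros)
  from has_vector_derivative_real_field[OF this] show ?thesis
    by (rule has_vector_derivative_at_within)
qed

text \<open>As x = T - s grows, the time limit and the depth move together. The limit contributes
  the boundary value of P on the far edge, that is, the part of the signal cut off by the finite
  recording; the depth contributes the coupling with g.\<close>

lemma wave_laplace_P_derivative:
  fixes P :: "real \<times> real \<Rightarrow> complex^'k^'c" and g :: "real \<times> real \<Rightarrow> complex^'k^'r"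
  assumes w: "wave a T P g" and a: "continuous_on UNIV a" and x: "x \<in> {0..T}"
  shows "(wave_laplace z T P has_vector_derivative mscale (exp (2 * \<i> * z * of_real x)) (P (x, T - x)) + madj (a (T - x)) ** wave_laplace z T g x) (at x within {0..T})"
proof -
  have cP: "continuous_on UNIV P" and cg: "continuous_on UNIV g" using w by (simp_all add: wave_def)
  define E where "E \<sigma> = exp (2 * \<i> * z * of_real \<sigma>)" for \<sigma>
  have cE: "continuous_on S E" for S unfolding E_def by (intro continuous_intros)
  have "((\<lambda>x. integral {0..x} (\<lambda>\<sigma>. mscale (E \<sigma>) (P (\<sigma>, T - x)))) has_vector_derivative
     mscale (E x) (P (x, T - x)) + integral {0..x} (\<lambda>\<sigma>. mscale (E \<sigma>) (madj (a (T - x)) ** g (\<sigma>, T - x)))) (at x within {0..T})"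
  proof (rule leibniz_upto)
    show "continuous_on UNIV (\<lambda>p. mscale (E (snd p)) (P (snd p, T - fst p)))"
      by (intro continuous_intros continuous_on_compose2[OF cP] continuous_on_compose2[OF cE]) auto
    show "continuous_on UNIV (\<lambda>p. mscale (E (snd p)) (madj (a (T - fst p)) ** g (snd p, T - fst p)))"
      by (intro continuous_intros continuous_on_compose2[OF cg] continuous_on_compose2[OF a] continuous_on_compose2[OF cE]) auto
    fix \<sigma> x assume s: "0 \<le> \<sigma>" "\<sigma> \<le> x" "x \<le> T"
    have "((\<lambda>x. P (\<sigma>, T - x)) has_vector_derivative - (- (madj (a (T - x)) ** g (\<sigma>, T - x)))) (at x within {\<sigma>..T})"
      by (rule has_vector_derivative_reflect[of "\<lambda>s. P (\<sigma>, s)" _ _ _ "{0..T - \<sigma>}"]) (use w s in \<open>auto simp: wave_def\<close>)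
    then have "((\<lambda>x. P (\<sigma>, T - x)) has_vector_derivative madj (a (T - x)) ** g (\<sigma>, T - x)) (at x within {\<sigma>..T})" by simp
    then show "((\<lambda>x. mscale (E \<sigma>) (P (\<sigma>, T - x))) has_vector_derivative mscale (E \<sigma>) (madj (a (T - x)) ** g (\<sigma>, T - x))) (at x within {\<sigma>..T})"
      by (rule bounded_linear.has_vector_derivative[OF ms.bounded_linear_right])
  qed (rule x)
  moreover have "integral {0..x} (\<lambda>\<sigma>. mscale (E \<sigma>) (madj (a (T - x)) ** g (\<sigma>, T - x))) = madj (a (T - x)) ** wave_laplace z T g x"
    unfolding wave_laplace_def E_def[symmetric]
    by (subst integral_mult_mat_left[symmetric]; (intro integrable_cont continuous_intros continuous_on_compose2[OF cg] cE; simp)?)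
       (simp add: mscale_mult_right)
  ultimately show ?thesis by (simp add: wave_laplace_def[abs_def] E_def)
qed

lemma wave_laplace_g_derivative:
  fixes P :: "real \<times> real \<Rightarrow> complex^'k^'c" and g :: "real \<times> real \<Rightarrow> complex^'k^'r"
  assumes w: "wave a T P g" and a: "continuous_on UNIV a" and g0: "\<And>s. g (0, s) = 0" and x: "x \<in> {0..T}"
  shows "(wave_laplace z T g has_vector_derivative mscale (2 * \<i> * z) (wave_laplace z T g x) + a (T - x) ** wave_laplace z T P x) (at x within {0..T})"
proof -
  have cP: "continuous_on UNIV P" and cg: "continuous_on UNIV g" using w by (simp_all add: wave_def)
  define E where "E \<sigma> = exp (2 * \<i> * z * of_real \<sigma>)" for \<sigma>
  have cE: "continuous_on S E" for S unfolding E_def by (intro continuous_intros)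
  \<comment> \<open>g is known to be differentiable along characteristics only. Reversing time by
    \<sigma> = x - \<tau> lets the point (x - \<tau>, T - x) run along the characteristic
    \<open>\<sigma> + s = T - \<tau>\<close> for fixed \<tau>; the exponential is then
    differentiated as well, which is the source of the term with 2iz. The boundary term contains g
    (0, .) = 0.\<close>
  have flip: "wave_laplace z T F x = integral {0..x} (\<lambda>\<tau>. mscale (E (x - \<tau>)) (F (x - \<tau>, T - x)))" if "continuous_on UNIV F" for F :: "real \<times> real \<Rightarrow> complex^'k^'q" and x
  proof -
    have "continuous_on UNIV (\<lambda>\<sigma>. mscale (E \<sigma>) (F (\<sigma>, T - x)))"
      by (intro continuous_intros continuous_on_compose2[OF that] cE) auto
    from integral_flip[OF this, of x] show ?thesis by (simp add: wave_laplace_def E_def)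
  qed
  define k' where "k' x \<tau> = mscale (E (x - \<tau>)) (a (T - x) ** P (x - \<tau>, T - x)) + mscale (2 * \<i> * z * E (x - \<tau>)) (g (x - \<tau>, T - x))" for x \<tau>
  have "((\<lambda>x. integral {0..x} (\<lambda>\<tau>. mscale (E (x - \<tau>)) (g (x - \<tau>, T - x)))) has_vector_derivative
     mscale (E (x - x)) (g (x - x, T - x)) + integral {0..x} (k' x)) (at x within {0..T})"
  proof (rule leibniz_upto)
    show "continuous_on UNIV (\<lambda>p. mscale (E (fst p - snd p)) (g (fst p - snd p, T - fst p)))"
      by (intro continuous_intros continuous_on_compose2[OF cg] continuous_on_compose2[OF cE]) auto
    show "continuous_on UNIV (\<lambda>p. k' (fst p) (snd p))" unfolding k'_def
      by (intro continuous_intros continuous_on_compose2[OF cg] continuous_on_compose2[OF cP] continuous_on_compose2[OF a] continuous_on_compose2[OF cE]) auto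
    fix \<tau> x assume s: "0 \<le> \<tau>" "\<tau> \<le> x" "x \<le> T"
    have "((\<lambda>\<sigma>. g (\<sigma>, (T - \<tau>) - \<sigma>)) has_vector_derivative a ((T - \<tau>) - (x + - \<tau>)) ** P (x + - \<tau>, (T - \<tau>) - (x + - \<tau>))) (at (x + - \<tau>) within {0..T - \<tau>})"
      by (rule wave_derivative_g[OF w]) (use s in auto)
    from has_vector_derivative_shift[OF this, of "{\<tau>..T}"]
    have 1: "((\<lambda>x. g (x - \<tau>, T - x)) has_vector_derivative a (T - x) ** P (x - \<tau>, T - x)) (at x within {\<tau>..T})" by simp
    have "((\<lambda>x. exp ((2 * \<i> * z) * of_real x + - (2 * \<i> * z * of_real \<tau>))) has_vector_derivative (2 * \<i> * z) * exp ((2 * \<i> * z) * of_real x + - (2 * \<i> * z * of_real \<tau>))) (at x within {\<tau>..T})"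
      by (rule has_vector_derivative_exp_complex)
    then have 2: "((\<lambda>x. E (x - \<tau>)) has_vector_derivative 2 * \<i> * z * E (x - \<tau>)) (at x within {\<tau>..T})"
      by (simp add: E_def algebra_simps)
    show "((\<lambda>x. mscale (E (x - \<tau>)) (g (x - \<tau>, T - x))) has_vector_derivative k' x \<tau>) (at x within {\<tau>..T})"
      unfolding k'_def by (rule ms.has_vector_derivative[OF 2 1])
  qed (rule x)
  moreover have "integral {0..x} (k' x) = mscale (2 * \<i> * z) (wave_laplace z T g x) + a (T - x) ** wave_laplace z T P x"
  proof -
    have i: "(\<lambda>\<tau>. mscale (E (x - \<tau>)) (F (x - \<tau>, T - x))) integrable_on {0..x}" if "continuous_on UNIV F" for F :: "real \<times> real \<Rightarrow> complex^'k^'q"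
      by (intro integrable_cont continuous_intros continuous_on_compose2[OF that] continuous_on_compose2[OF cE]) auto
    have "k' x = (\<lambda>\<tau>. a (T - x) ** mscale (E (x - \<tau>)) (P (x - \<tau>, T - x)) + mscale (2 * \<i> * z) (mscale (E (x - \<tau>)) (g (x - \<tau>, T - x))))"
      by (rule ext) (simp add: k'_def mscale_mult_right)
    moreover have "integral {0..x} \<dots> = a (T - x) ** wave_laplace z T P x + mscale (2 * \<i> * z) (wave_laplace z T g x)"
      unfolding flip[OF cP] flip[OF cg]
      using integral_linear[OF i[OF cP] mm.bounded_linear_right[of "a (T - x)"]] integral_linear[OF i[OF cg] ms.bounded_linear_right[of "2 * \<i> * z"]]
        integrable_linear[OF i[OF cP] mm.bounded_linear_right[of "a (T - x)"]] integrable_linear[OF i[OF cg] ms.bounded_linear_right[of "2 * \<i> * z"]]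
      by (simp add: o_def integral_add)
    ultimately show ?thesis by (simp add: add.commute)
  qed
  moreover have "(\<lambda>x. integral {0..x} (\<lambda>\<tau>. mscale (E (x - \<tau>)) (g (x - \<tau>, T - x)))) = wave_laplace z T g"
    using flip[OF cg] by auto
  ultimately show ?thesis by (simp add: g0 ms.zero_right)
qed

lemma laplace_Phi_of:
  fixes A :: "real \<times> real \<Rightarrow> complex^'c^'r"
  assumes A: "mild A" and z: "Im z > 0"
  shows "(\<lambda>x. mscale (exp (2 * \<i> * z * of_real x)) (Phi_of A x)) integrable_on {0..}"
proof -
  have cA: "continuous_on UNIV A" using A by (simp add: mild_def)
  have "(\<lambda>x. exp (- (2 * Im z * x)) * norm (Phi_of A x)) integrable_on {0..}"
    by (rule Phi_of_exp_integrable[OF A]) (use z in simp)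
  then show ?thesis
    by (rule integrable_atLeast_dominated[rotated])
       (auto simp: norm_mscale norm_exp_2iz intro!: continuous_intros continuous_Phi_of[OF cA])
qed

definition weyl_of :: "(real \<times> real \<Rightarrow> complex^'c^'r) \<Rightarrow> complex \<Rightarrow> complex^'c^'r" where
  "weyl_of A z = mscale (2 * \<i> * z) (integral {0..} (\<lambda>x. mscale (exp (2 * \<i> * z * of_real x)) (Phi_of A x)))"

lemma tendsto_scaled_nat:
  assumes "c > (0::real)"
  shows "(\<lambda>n. (a + b * real n) * exp (- (c * real n))) \<longlonglongrightarrow> 0"
  using assms by real_asymp

lemma norm_power2_le_diff: "(norm p)\<^sup>2 \<le> 2 * (norm q)\<^sup>2 + 2 * (norm (p - q))\<^sup>2"
proof -
  have "norm p \<le> norm q + norm (p - q)" using norm_triangle_ineq[of q "p - q"] by simp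
  then have "(norm p)\<^sup>2 \<le> (norm q + norm (p - q))\<^sup>2" by (simp add: power_mono)
  also have "\<dots> \<le> 2 * (norm q)\<^sup>2 + 2 * (norm (p - q))\<^sup>2"
    using sum_squares_bound[of "norm q" "norm (p - q)"] by (simp add: power2_sum)
  finally show ?thesis .
qed

lemma le_one_plus_power2: "(x::real) \<le> 1 + x\<^sup>2"
proof -
  have "2 * x \<le> x\<^sup>2 + 1" using zero_le_power2[of "x - 1"] by (simp add: power2_diff)
  with zero_le_power2[of x] show ?thesis by linarith
qed

text \<open>The Laplace transforms in time of the waves generated by a unit step solve the Dirac system
  up to the signal that has not been recorded at time \<open>2T\<close>. As \<open>T\<close> grows they converge to the
  Weyl solution.\<close>

lemma weyl_solution_L2:
  fixes v :: "real \<Rightarrow> complex^'m2::finite^'m1::finite" and A :: "real \<times> real \<Rightarrow> complex^'m1^'m2"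
  assumes v: "continuous_on {0..} v" and A: "mild A" and l: "l \<ge> 0" and z: "Im z > 0"
    and Av: "\<And>s. s \<ge> 0 \<Longrightarrow> A (0, s) = mscale (- \<i>) (madj (v (s + l)))"
  obtains B where "\<And>S. S \<ge> 0 \<Longrightarrow> integral {0..S} (\<lambda>s. (norm (fund_sol v l z (s + l) ** stack_I (weyl_of A z)))\<^sup>2) \<le> B"
proof -
  have cA: "continuous_on UNIV A" using A by (simp add: mild_def)
  define a where "a s = A (0, s)" for s
  have ca: "continuous_on UNIV a" unfolding a_def by (intro continuous_on_compose2[OF cA] continuous_intros) auto
  have va: "mscale \<i> (v (s + l)) = madj (a s)" if "s \<ge> 0" for s
    unfolding a_def Av[OF that] by (simp add: vec_eq_iff)
  define \<eta> where "\<eta> = Im z"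
  have \<eta>: "\<eta> > 0" using z by (simp add: \<eta>_def)
  have z0: "z \<noteq> 0" using z by auto
  \<comment> \<open>The Laplace transform of the unit step over the half-line is -1 / (2iz); this
    factor normalizes the top block to the identity at depth 0.\<close>
  define \<kappa> where "\<kappa> = - (2 * \<i> * z)"
  define m where "m = norm (mat 1 :: complex^'m1^'m1)"
  define Y where "Y s = fund_sol v l z (max 0 s + l) ** stack_I (weyl_of A z)" for s
  note fs = fund_sol_column[OF v l]
  have cY: "continuous_on UNIV Y" unfolding Y_def
    by (rule continuous_on_compose2[OF fs(3)]) (use l in \<open>auto intro!: continuous_intros\<close>)
  have dY: "(Y has_vector_derivative dirac_coeff v z (s + l) ** Y s) (at s within {0..})" if s: "s \<ge> 0" for s
  proof -
    have "((\<lambda>s. fund_sol v l z (s + l) ** stack_I (weyl_of A z)) has_vector_derivative dirac_coeff v z (s + l) ** (fund_sol v l z (s + l) ** stack_I (weyl_of A z))) (at s within {0..})"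
      by (rule has_vector_derivative_shift[OF fs(1)]) (use s l in auto)
    then have "((\<lambda>s. fund_sol v l z (s + l) ** stack_I (weyl_of A z)) has_vector_derivative dirac_coeff v z (s + l) ** Y s) (at s within {0..})"
      using s by (simp add: Y_def)
    then show ?thesis by (rule has_vector_derivative_transform[rotated 2]) (use s in \<open>auto simp: Y_def\<close>)
  qed
  have Y0: "Y 0 = stack_I (weyl_of A z)" by (simp add: Y_def fs(2))
  \<comment> \<open>In depth the transforms of P and g carry the free exponents 0 and -2iz; the
    common factor exp (izs) shifts them to iz and -iz, those of the Dirac system.\<close>
  define E where "E s = exp (\<i> * z * of_real s)" for s :: real
  have nE: "cmod (E s) = exp (- (\<eta> * s))" for s by (simp add: E_def \<eta>_def norm_exp_eq_Re)
  have cE: "continuous_on U E" for U unfolding E_def by (intro continuous_intros)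
  have dE0: "((\<lambda>s. w * E s) has_vector_derivative w * ((\<i> * z) * E s)) (at s within X)" for w s X
  proof -
    have "((\<lambda>s. exp ((\<i> * z) * of_real s + 0)) has_vector_derivative (\<i> * z) * exp ((\<i> * z) * of_real s + 0)) (at s within X)"
      by (rule has_vector_derivative_exp_complex)
    then have "(E has_vector_derivative (\<i> * z) * E s) (at s within X)" by (simp add: E_def[abs_def])
    then show ?thesis
      by (rule bounded_linear.has_vector_derivative[OF bounded_linear_mult_right])
  qed
  \<comment> \<open>With a unit step as input the reflected wave at the surface is the step
    response, by \<open>conv_mat_1\<close>.\<close>
  have waves: "\<exists>P g. wave a T P g \<and> (\<forall>\<sigma>\<in>{0..T}. P (\<sigma>, 0) = mat 1) \<and> (\<forall>s. g (0, s) = 0) \<and> (\<forall>y\<in>{0..T}. g (y, 0) = Phi_of A y)" if T: "T \<ge> 0" for T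
  proof -
    obtain P g where "wave (\<lambda>s. A (0,s)) T P g" "\<And>\<sigma>. \<sigma> \<in> {0..T} \<Longrightarrow> P (\<sigma>, 0) = mat 1"
      "\<And>s. g (0, s) = 0" "\<And>y. y \<in> {0..T} \<Longrightarrow> g (y, 0) = conv (\<lambda>x. A (x, 0)) (\<lambda>_. mat 1) y"
      using wave_with_input[OF A continuous_on_const[of UNIV "mat 1"] T] by blast
    then show ?thesis unfolding a_def[abs_def] conv_mat_1[OF cA] by blast
  qed
  define W where "W T = (SOME Pg. wave a T (fst Pg) (snd Pg) \<and> (\<forall>\<sigma>\<in>{0..T}. fst Pg (\<sigma>, 0) = mat 1) \<and> (\<forall>s. snd Pg (0, s) = 0) \<and> (\<forall>y\<in>{0..T}. snd Pg (y, 0) = Phi_of A y))" for T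
  define P g where "P T = fst (W T)" and "g T = snd (W T)" for T
  have Wp: "wave a T (P T) (g T) \<and> (\<forall>\<sigma>\<in>{0..T}. P T (\<sigma>, 0) = mat 1) \<and> (\<forall>s. g T (0, s) = 0) \<and> (\<forall>y\<in>{0..T}. g T (y, 0) = Phi_of A y)" if T: "T \<ge> 0" for T
  proof -
    obtain P' g' where "wave a T (fst (P', g')) (snd (P', g')) \<and> (\<forall>\<sigma>\<in>{0..T}. fst (P', g') (\<sigma>, 0) = mat 1) \<and> (\<forall>s. snd (P', g') (0, s) = 0) \<and> (\<forall>y\<in>{0..T}. snd (P', g') (y, 0) = Phi_of A y)"
      using waves[OF T] by auto
    then show ?thesis unfolding P_def g_def W_def by (rule someI)
  qed
  have w: "wave a T (P T) (g T)" and P1: "\<And>\<sigma>. \<sigma> \<in> {0..T} \<Longrightarrow> P T (\<sigma>, 0) = mat 1"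
    and g0: "\<And>s. g T (0, s) = 0" and gP: "\<And>y. y \<in> {0..T} \<Longrightarrow> g T (y, 0) = Phi_of A y" if "T \<ge> 0" for T
    using Wp[OF that] by blast+
  have cP: "continuous_on UNIV (P T)" and cg: "continuous_on UNIV (g T)" if "T \<ge> 0" for T
    using w[OF that] by (simp_all add: wave_def)
  define Y1 where "Y1 T s = mscale (\<kappa> * E s) (wave_laplace z T (P T) (T - s))" for T s
  define Y2 where "Y2 T s = mscale (- \<kappa> * E s) (wave_laplace z T (g T) (T - s))" for T s
  \<comment> \<open>The boundary term of the truncated transform of P. With it as forcing,
    \<open>Y1\<close> and \<open>Y2\<close> satisfy the Dirac system exactly.\<close>
  define err where "err T s = mscale (\<kappa> * E s * exp (2 * \<i> * z * of_real (T - s))) (P T (T - s, s))" for T s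
  have cY1: "continuous_on UNIV (Y1 T)" if T: "T \<ge> 0" for T
    unfolding Y1_def
    by (intro continuous_intros cE continuous_on_compose2[OF continuous_wave_laplace[OF cP[OF T]]]) auto
  have cY2: "continuous_on UNIV (Y2 T)" if T: "T \<ge> 0" for T
    unfolding Y2_def
    by (intro continuous_intros cE continuous_on_compose2[OF continuous_wave_laplace[OF cg[OF T]]]) auto
  have cerr: "continuous_on UNIV (err T)" if T: "T \<ge> 0" for T
    unfolding err_def
    by (intro continuous_intros cE continuous_on_compose2[OF cP[OF T]]) auto
  have dY1: "(Y1 T has_vector_derivative mscale (\<i> * z) (Y1 T s) + madj (a s) ** Y2 T s - err T s) (at s within {0..T})" if s: "s \<in> {0..T}" for T s
  proof -
    have T: "T \<ge> 0" "T - s \<in> {0..T}" using s by auto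
    have 1: "((\<lambda>s. wave_laplace z T (P T) (T - s)) has_vector_derivative - (mscale (exp (2 * \<i> * z * of_real (T - s))) (P T (T - s, T - (T - s))) + madj (a (T - (T - s))) ** wave_laplace z T (g T) (T - s))) (at s within {0..T})"
      by (rule has_vector_derivative_reflect[OF wave_laplace_P_derivative[OF w[OF T(1)] ca T(2)]]) auto
    have alg: "mscale e (- (mscale d X + b ** G)) + mscale (\<kappa> * ((\<i> * z) * E s)) U
       = mscale (\<i> * z) (mscale (\<kappa> * E s) U) + b ** mscale (- e) G - mscale (e * d) X" if "e = \<kappa> * E s" for e d X b G U
      unfolding that by (simp add: mscale_mult_right vec_eq_iff algebra_simps)
    show ?thesis
      using ms.has_vector_derivative[OF dE0[of \<kappa> s] 1] unfolding alg[OF refl]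
      by (simp add: Y1_def[abs_def] Y2_def err_def)
  qed
  have dY2: "(Y2 T has_vector_derivative a s ** Y1 T s + mscale (- (\<i> * z)) (Y2 T s)) (at s within {0..T})" if s: "s \<in> {0..T}" for T s
  proof -
    have T: "T \<ge> 0" "T - s \<in> {0..T}" using s by auto
    have 1: "((\<lambda>s. wave_laplace z T (g T) (T - s)) has_vector_derivative - (mscale (2 * \<i> * z) (wave_laplace z T (g T) (T - s)) + a (T - (T - s)) ** wave_laplace z T (P T) (T - s))) (at s within {0..T})"
      by (rule has_vector_derivative_reflect[OF wave_laplace_g_derivative[OF w[OF T(1)] ca g0[OF T(1)] T(2)]]) auto
    have alg: "mscale (- \<kappa> * E s) (- (mscale (2 * \<i> * z) G + b ** U)) + mscale (- \<kappa> * ((\<i> * z) * E s)) G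
        = b ** mscale (\<kappa> * E s) U + mscale (- (\<i> * z)) (mscale (- \<kappa> * E s) G)" for G U b
      by (simp add: mscale_mult_right vec_eq_iff algebra_simps)
    show ?thesis
      using ms.has_vector_derivative[OF dE0[of "- \<kappa>" s] 1] unfolding alg
      by (simp add: Y2_def[abs_def] Y1_def)
  qed
  define D1 D2 where "D1 T s = top_block (Y s) - Y1 T s" and "D2 T s = bot_block (Y s) - Y2 T s" for T s
  have cD1: "continuous_on UNIV (D1 T)" if T: "T \<ge> 0" for T
    unfolding D1_def[abs_def]
    by (intro continuous_on_diff cY1[OF T] bounded_linear.continuous_on[OF bounded_linear_top_block cY])
  have cD2: "continuous_on UNIV (D2 T)" if T: "T \<ge> 0" for T
    unfolding D2_def[abs_def]
    by (intro continuous_on_diff cY2[OF T] bounded_linear.continuous_on[OF bounded_linear_bot_block cY])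
  have dYT: "(Y has_vector_derivative dirac_coeff v z (s + l) ** Y s) (at s within {0..T})" if s: "s \<in> {0..T}" for T s
    by (rule has_vector_derivative_within_subset[OF dY]) (use s in auto)
  have dD1: "(D1 T has_vector_derivative mscale (\<i> * z) (D1 T s) + madj (a s) ** D2 T s + err T s) (at s within {0..T})" if s: "s \<in> {0..T}" for T s
  proof -
    have s0: "s \<ge> 0" using s by simp
    note dt = bounded_linear.has_vector_derivative[OF bounded_linear_top_block dYT[OF s]]
    show ?thesis
      using has_vector_derivative_diff[OF dt dY1[OF s]] unfolding top_dirac va[OF s0] D1_def[abs_def] D2_def
      by (simp add: ms.diff_right mm.diff_right algebra_simps)
  qed
  have dD2: "(D2 T has_vector_derivative a s ** D1 T s + mscale (- (\<i> * z)) (D2 T s)) (at s within {0..T})" if s: "s \<in> {0..T}" for T s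
  proof -
    have s0: "s \<ge> 0" using s by simp
    note dt = bounded_linear.has_vector_derivative[OF bounded_linear_bot_block dYT[OF s]]
    show ?thesis
      using has_vector_derivative_diff[OF dt dY2[OF s]] unfolding bot_dirac Av[OF s0, symmetric] a_def[symmetric] D1_def D2_def[abs_def]
      by (simp add: ms.diff_right mm.diff_right algebra_simps)
  qed
  \<comment> \<open>Everything that separates the truncated transforms from the true solution on
    [0, S]: the two deviations at depth 0 and the accumulated forcing.\<close>
  define \<delta> where "\<delta> S n = norm (D1 (real n) 0) + norm (D2 (real n) 0) + integral {0..S} (\<lambda>s. norm (err (real n) s))" for S n
  have D10: "(\<lambda>n. norm (D1 (real n) 0)) \<longlonglongrightarrow> 0"
  proof -
    have "D1 (real n) 0 = mscale (exp (2 * \<i> * z * of_real (real n))) (mat 1)" for n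
    proof -
      have "wave_laplace z (real n) (P (real n)) (real n) = integral {0..real n} (\<lambda>\<sigma>. mscale (exp (2 * \<i> * z * of_real \<sigma>)) (mat 1))"
        unfolding wave_laplace_def by (rule integral_cong) (simp add: P1)
      also have "\<dots> = mscale (exp (2 * \<i> * z * of_real (real n)) / (2 * \<i> * z)) (mat 1) - mscale (exp (2 * \<i> * z * of_real 0) / (2 * \<i> * z)) (mat 1)"
      proof (rule integral_unique, rule fundamental_theorem_of_calculus)
        fix \<sigma> assume "\<sigma> \<in> {0..real n}"
        have "((\<lambda>s. exp ((2 * \<i> * z) * of_real s + 0)) has_vector_derivative (2 * \<i> * z) * exp ((2 * \<i> * z) * of_real \<sigma> + 0)) (at \<sigma> within {0..real n})"
          by (rule has_vector_derivative_exp_complex)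
        from bounded_linear.has_vector_derivative[OF bounded_linear_divide[of "2 * \<i> * z"] this]
        have "((\<lambda>s. exp (2 * \<i> * z * of_real s) / (2 * \<i> * z)) has_vector_derivative exp (2 * \<i> * z * of_real \<sigma>)) (at \<sigma> within {0..real n})"
          using z0 by simp
        then show "((\<lambda>s. mscale (exp (2 * \<i> * z * of_real s) / (2 * \<i> * z)) (mat 1)) has_vector_derivative mscale (exp (2 * \<i> * z * of_real \<sigma>)) (mat 1)) (at \<sigma> within {0..real n})"
          by (rule bounded_linear.has_vector_derivative[OF ms.bounded_linear_left])
      qed simp
      finally show ?thesis
        using z0 by (simp add: D1_def Y1_def Y0 top_stack E_def \<kappa>_def ms.diff_right ms.minus_left)
    qed
    then have "norm (D1 (real n) 0) = (m + 0 * real n) * exp (- ((2 * \<eta>) * real n))" for n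
      by (simp only: norm_mscale norm_exp_2iz) (simp add: m_def \<eta>_def)
    then show ?thesis using tendsto_scaled_nat[of "2 * \<eta>" m 0] \<eta> by simp
  qed
  have D20: "(\<lambda>n. norm (D2 (real n) 0)) \<longlonglongrightarrow> 0"
  proof -
    define L where "L = integral {0..} (\<lambda>x. mscale (exp (2 * \<i> * z * of_real x)) (Phi_of A x))"
    have lim: "((\<lambda>T. integral {0..T} (\<lambda>x. mscale (exp (2 * \<i> * z * of_real x)) (Phi_of A x))) \<longlongrightarrow> L) at_top"
      unfolding L_def by (rule has_integral_atLeast_tendsto[OF integrable_integral[OF laplace_Phi_of[OF A z]]])
    have "(\<lambda>n. integral {0..real n} (\<lambda>x. mscale (exp (2 * \<i> * z * of_real x)) (Phi_of A x))) \<longlonglongrightarrow> L"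
      by (rule filterlim_compose[OF lim filterlim_real_sequentially])
    from tendsto_diff[OF tendsto_const[of "mscale (2 * \<i> * z) L"] bounded_linear.tendsto[OF ms.bounded_linear_right[of "2 * \<i> * z"] this]]
    have "(\<lambda>n. mscale (2 * \<i> * z) L - mscale (2 * \<i> * z) (integral {0..real n} (\<lambda>x. mscale (exp (2 * \<i> * z * of_real x)) (Phi_of A x)))) \<longlonglongrightarrow> 0" by simp
    moreover have "D2 (real n) 0 = mscale (2 * \<i> * z) L - mscale (2 * \<i> * z) (integral {0..real n} (\<lambda>x. mscale (exp (2 * \<i> * z * of_real x)) (Phi_of A x)))" for n
    proof -
      have "wave_laplace z (real n) (g (real n)) (real n) = integral {0..real n} (\<lambda>x. mscale (exp (2 * \<i> * z * of_real x)) (Phi_of A x))"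
        unfolding wave_laplace_def by (rule integral_cong) (simp add: gP)
      then show ?thesis by (simp add: D2_def Y2_def Y0 bot_stack E_def \<kappa>_def weyl_of_def L_def)
    qed
    ultimately show ?thesis by (simp add: tendsto_norm_zero)
  qed
  have P2: "integral {0..T} (\<lambda>\<sigma>. (norm (P T (\<sigma>, T - \<sigma>)))\<^sup>2) \<le> T * m\<^sup>2" if T: "T \<ge> 0" for T
  proof -
    have "integral {0..T} (\<lambda>\<sigma>. (norm (P T (\<sigma>, T - \<sigma>)))\<^sup>2) \<le> integral {0..T} (\<lambda>\<sigma>. (norm (P T (\<sigma>, 0)))\<^sup>2)"
      by (rule wave_energy_diagonal[OF w[OF T] ca g0[OF T]]) simp
    also have "\<dots> = integral {0..T} (\<lambda>\<sigma>. m\<^sup>2)" by (rule integral_cong) (use P1[OF T] in \<open>simp add: m_def\<close>)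
    finally show ?thesis using T by simp
  qed
  \<comment> \<open>The forcing is of size e^(\<eta> s) e^(-2 \<eta> T) times P on the far edge,
    whose energy is at most T m^2. The exponential in T wins against this linear growth.\<close>
  have errn: "integral {0..S} (\<lambda>s. norm (err T s)) \<le> cmod \<kappa> * exp (\<eta> * S) * ((S + m\<^sup>2 * T) * exp (- (2 * \<eta> * T)))"
    if S: "0 \<le> S" "S \<le> T" for S T
  proof -
    have T: "T \<ge> 0" using S by simp
    define c where "c = cmod \<kappa> * exp (\<eta> * S) * exp (- (2 * \<eta> * T))"
    have cPd: "continuous_on U (\<lambda>s. P T (T - s, s))" for U by (intro continuous_on_compose2[OF cP[OF T]] continuous_intros) auto
    have "integral {0..S} (\<lambda>s. norm (err T s)) \<le> integral {0..S} (\<lambda>s. c * (1 + (norm (P T (T - s, s)))\<^sup>2))"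
    proof (rule integral_le)
      show "(\<lambda>s. norm (err T s)) integrable_on {0..S}" by (intro integrable_cont continuous_intros cerr[OF T])
      show "(\<lambda>s. c * (1 + (norm (P T (T - s, s)))\<^sup>2)) integrable_on {0..S}" by (intro integrable_cont continuous_intros cPd)
      fix s assume s: "s \<in> {0..S}"
      have "norm (err T s) = cmod \<kappa> * (exp (- (\<eta> * s)) * exp (- (2 * \<eta> * (T - s)))) * norm (P T (T - s, s))"
        unfolding err_def norm_mscale norm_mult nE norm_exp_2iz \<eta>_def by simp
      also have "exp (- (\<eta> * s)) * exp (- (2 * \<eta> * (T - s))) = exp (\<eta> * s) * exp (- (2 * \<eta> * T))"
        by (simp add: exp_add[symmetric] algebra_simps)
      also have "cmod \<kappa> * (exp (\<eta> * s) * exp (- (2 * \<eta> * T))) * norm (P T (T - s, s)) \<le> c * (1 + (norm (P T (T - s, s)))\<^sup>2)"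
      proof (rule mult_mono)
        show "cmod \<kappa> * (exp (\<eta> * s) * exp (- (2 * \<eta> * T))) \<le> c"
          unfolding c_def mult.assoc using s \<eta> by (intro mult_left_mono mult_right_mono) auto
        show "norm (P T (T - s, s)) \<le> 1 + (norm (P T (T - s, s)))\<^sup>2" by (rule le_one_plus_power2)
      qed (auto simp: c_def)
      finally show "norm (err T s) \<le> c * (1 + (norm (P T (T - s, s)))\<^sup>2)" .
    qed
    also have "\<dots> = c * (integral {0..S} (\<lambda>s. 1) + integral {0..S} (\<lambda>s. (norm (P T (T - s, s)))\<^sup>2))"
      unfolding integral_mult_right by (subst integral_add) (auto intro!: integrable_cont continuous_intros cPd)
    also have "\<dots> \<le> c * (S + m\<^sup>2 * T)"
    proof (intro mult_left_mono add_mono)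
      have "integral {0..S} (\<lambda>s. (norm (P T (T - s, s)))\<^sup>2) \<le> integral {0..T} (\<lambda>s. (norm (P T (T - s, s)))\<^sup>2)"
        by (rule integral_subset_le) (use S in \<open>auto intro!: integrable_cont continuous_intros cPd\<close>)
      also have "\<dots> = integral {0..T} (\<lambda>\<sigma>. (norm (P T (\<sigma>, T - \<sigma>)))\<^sup>2)"
      proof -
        have "continuous_on UNIV (\<lambda>\<sigma>. (norm (P T (\<sigma>, T - \<sigma>)))\<^sup>2)" by (intro continuous_intros continuous_on_compose2[OF cP[OF T]]) auto
        from integral_flip[OF this, of T] show ?thesis by simp
      qed
      also have "\<dots> \<le> m\<^sup>2 * T" using P2[OF T] by (simp add: mult.commute)
      finally show "integral {0..S} (\<lambda>s. (norm (P T (T - s, s)))\<^sup>2) \<le> m\<^sup>2 * T" .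
    qed (use S in \<open>simp_all add: c_def\<close>)
    finally show ?thesis by (simp add: c_def mult_ac)
  qed
  have \<delta>0: "(\<lambda>n. \<delta> S n) \<longlonglongrightarrow> 0" if S: "S \<ge> 0" for S
  proof -
    have "(\<lambda>n. integral {0..S} (\<lambda>s. norm (err (real n) s))) \<longlonglongrightarrow> 0"
    proof (rule Lim_null_comparison)
      show "\<forall>\<^sub>F n in sequentially. norm (integral {0..S} (\<lambda>s. norm (err (real n) s))) \<le> cmod \<kappa> * exp (\<eta> * S) * ((S + m\<^sup>2 * real n) * exp (- (2 * \<eta> * real n)))"
      proof (rule eventually_sequentiallyI[of "nat \<lceil>S\<rceil>"])
        fix n assume "nat \<lceil>S\<rceil> \<le> n"
        then have n: "S \<le> real n" by linarith
        have "0 \<le> integral {0..S} (\<lambda>s. norm (err (real n) s))" by (intro integral_nonneg integrable_cont continuous_intros cerr) auto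
        then show "norm (integral {0..S} (\<lambda>s. norm (err (real n) s))) \<le> cmod \<kappa> * exp (\<eta> * S) * ((S + m\<^sup>2 * real n) * exp (- (2 * \<eta> * real n)))"
          using errn[OF S n] by simp
      qed
      show "(\<lambda>n. cmod \<kappa> * exp (\<eta> * S) * ((S + m\<^sup>2 * real n) * exp (- (2 * \<eta> * real n)))) \<longlonglongrightarrow> 0"
        using tendsto_mult[OF tendsto_const[of "cmod \<kappa> * exp (\<eta> * S)"] tendsto_scaled_nat[of "2 * \<eta>" S "m\<^sup>2"]] \<eta> by simp
    qed
    from tendsto_add[OF tendsto_add[OF D10 D20] this] show ?thesis by (simp add: \<delta>_def)
  qed
  \<comment> \<open>Gronwall's inequality for the sum of the two block norms, with the rate |z| plus
    a bound of \<open>a\<close> on [0, S]. That rate may be large, as S stays fixed while n tends to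
    infinity.\<close>
  have growth: "norm (D1 (real n) s) + norm (D2 (real n) s) \<le> \<delta> S n * exp (C * s)"
    if S: "0 \<le> s" "s \<le> S" "S \<le> real n" and C: "\<And>s. s \<in> {0..S} \<Longrightarrow> cmod z + norm (a s) \<le> C" "C > 0" for s S n C
  proof -
    let ?T = "real n"
    have T: "?T \<ge> 0" by simp
    define \<phi> where "\<phi> s = norm (D1 ?T s) + norm (D2 ?T s)" for s
    have c\<phi>: "continuous_on UNIV \<phi>" unfolding \<phi>_def by (intro continuous_intros cD1 cD2 T)
    have "\<phi> s \<le> \<delta> S n * exp (C * s)"
    proof (rule gronwall[OF c\<phi> _ C(2) S(1,2)])
      fix r assume r: "0 \<le> r" "r \<le> S"
      define F1 F2 where "F1 s = mscale (\<i> * z) (D1 ?T s) + madj (a s) ** D2 ?T s + err ?T s" and "F2 s = a s ** D1 ?T s + mscale (- (\<i> * z)) (D2 ?T s)" for s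
      have cF1: "continuous_on UNIV F1" unfolding F1_def
        by (intro continuous_intros cD1 cD2 T ca cerr)
      have cF2: "continuous_on UNIV F2" unfolding F2_def
        by (intro continuous_intros cD1 cD2 T ca)
      have i1: "integral {0..r} F1 = D1 ?T r - D1 ?T 0"
      proof (rule integral_unique, rule fundamental_theorem_of_calculus[OF r(1)])
        fix t assume "t \<in> {0..r}"
        then show "(D1 ?T has_vector_derivative F1 t) (at t within {0..r})"
          unfolding F1_def by (intro has_vector_derivative_within_subset[OF dD1]) (use r S in auto)
      qed
      have i2: "integral {0..r} F2 = D2 ?T r - D2 ?T 0"
      proof (rule integral_unique, rule fundamental_theorem_of_calculus[OF r(1)])
        fix t assume "t \<in> {0..r}"
        then show "(D2 ?T has_vector_derivative F2 t) (at t within {0..r})"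
          unfolding F2_def by (intro has_vector_derivative_within_subset[OF dD2]) (use r S in auto)
      qed
      have n1: "norm (F1 s) \<le> cmod z * norm (D1 ?T s) + norm (a s) * norm (D2 ?T s) + norm (err ?T s)" for s
      proof -
        have "norm (F1 s) \<le> norm (mscale (\<i> * z) (D1 ?T s)) + norm (madj (a s) ** D2 ?T s) + norm (err ?T s)"
          unfolding F1_def by (intro order_trans[OF norm_triangle_ineq] add_right_mono norm_triangle_ineq)
        then show ?thesis using norm_matrix_mult[of "madj (a s)" "D2 ?T s"] by (simp add: norm_mscale norm_mult)
      qed
      have n2: "norm (F2 s) \<le> norm (a s) * norm (D1 ?T s) + cmod z * norm (D2 ?T s)" for s
      proof -
        have "norm (F2 s) \<le> norm (a s ** D1 ?T s) + norm (mscale (- (\<i> * z)) (D2 ?T s))"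
          unfolding F2_def by (rule norm_triangle_ineq)
        then show ?thesis using norm_matrix_mult[of "a s" "D1 ?T s"] by (simp add: norm_mscale norm_mult)
      qed
      have "\<phi> r \<le> norm (D1 ?T 0) + norm (D2 ?T 0) + (norm (integral {0..r} F1) + norm (integral {0..r} F2))"
        unfolding \<phi>_def using norm_triangle_ineq[of "D1 ?T 0" "integral {0..r} F1"] norm_triangle_ineq[of "D2 ?T 0" "integral {0..r} F2"]
        by (simp add: i1 i2)
      also have "norm (integral {0..r} F1) + norm (integral {0..r} F2) \<le> integral {0..r} (\<lambda>s. norm (F1 s)) + integral {0..r} (\<lambda>s. norm (F2 s))"
        by (intro add_mono integral_norm_bound_integral integrable_cont continuous_intros cF1 cF2) auto
      also have "\<dots> = integral {0..r} (\<lambda>s. norm (F1 s) + norm (F2 s))"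
        by (intro integral_add[symmetric] integrable_cont continuous_intros cF1 cF2)
      also have "\<dots> \<le> integral {0..r} (\<lambda>s. norm (err ?T s) + C * \<phi> s)"
      proof (rule integral_le)
        fix s assume s: "s \<in> {0..r}"
        have "norm (F1 s) + norm (F2 s) \<le> norm (err ?T s) + (cmod z + norm (a s)) * \<phi> s"
          using n1[of s] n2[of s] by (simp add: \<phi>_def algebra_simps)
        also have "\<dots> \<le> norm (err ?T s) + C * \<phi> s"
          by (intro add_left_mono mult_right_mono C) (use s r in \<open>auto simp: \<phi>_def\<close>)
        finally show "norm (F1 s) + norm (F2 s) \<le> norm (err ?T s) + C * \<phi> s" .
      qed (intro integrable_cont continuous_intros cF1 cF2 c\<phi> cerr T)+
      also have "\<dots> = integral {0..r} (\<lambda>s. norm (err ?T s)) + C * integral {0..r} \<phi>"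
        by (subst integral_add; (intro integrable_cont continuous_intros c\<phi> cerr T)?) simp
      also have "integral {0..r} (\<lambda>s. norm (err ?T s)) \<le> integral {0..S} (\<lambda>s. norm (err ?T s))"
        by (rule integral_subset_le) (use r in \<open>auto intro!: integrable_cont continuous_intros cerr\<close>)
      finally show "\<phi> r \<le> \<delta> S n + C * integral {0..r} \<phi>" by (simp add: \<delta>_def)
    qed
    then show ?thesis by (simp add: \<phi>_def)
  qed
  \<comment> \<open>The three factors stem from the normalization \<kappa>, from Cauchy-Schwarz for
    the Laplace transform and from the weighted energy of P; none of them depends on T.\<close>
  define B0 where "B0 = (cmod \<kappa>)\<^sup>2 * (1 / (2 * \<eta>)) * (m\<^sup>2 / \<eta>\<^sup>2)"
  have L2: "integral {0..T} (\<lambda>s. (norm (Y1 T s))\<^sup>2) \<le> B0 \<and> integral {0..T} (\<lambda>s. (norm (Y2 T s))\<^sup>2) \<le> B0" if T: "T \<ge> 0" for T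
  proof -
    define N where "N s = integral {0..T - s} (\<lambda>\<sigma>. exp (- (2 * \<eta> * \<sigma>)) * (norm (P T (\<sigma>, s)))\<^sup>2)" for s
    have cN: "continuous_on UNIV N" unfolding N_def
      by (intro continuous_intros continuous_on_compose2[OF cP[OF T]]) auto
    have NB: "integral {0..T} (\<lambda>s. exp (- (2 * \<eta> * s)) * N s) \<le> m\<^sup>2 / \<eta>\<^sup>2"
      unfolding N_def by (rule wave_weighted_L2[OF w[OF T] ca g0[OF T] _ \<eta> T]) (simp add: P1[OF T] m_def)
    have E2: "(exp (- (\<eta> * s)))\<^sup>2 = exp (- (2 * \<eta> * s))" for s by (simp add: power2_eq_square exp_add[symmetric])
    have LF: "integral {0..T} f \<le> B0"
      if cF: "continuous_on UNIV f" and F: "\<And>s. s \<in> {0..T} \<Longrightarrow> f s \<le> (cmod \<kappa> * exp (- (\<eta> * s)))\<^sup>2 * (1 / (2 * \<eta>) * N s)" for f :: "real \<Rightarrow> real"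
    proof -
      have "integral {0..T} f \<le> integral {0..T} (\<lambda>s. ((cmod \<kappa>)\<^sup>2 * (1 / (2 * \<eta>))) * (exp (- (2 * \<eta> * s)) * N s))"
      proof (rule integral_le)
        fix s assume "s \<in> {0..T}"
        from F[OF this] show "f s \<le> ((cmod \<kappa>)\<^sup>2 * (1 / (2 * \<eta>))) * (exp (- (2 * \<eta> * s)) * N s)"
          unfolding power_mult_distrib E2 by (simp add: mult_ac)
      qed (intro integrable_cont continuous_intros cF cN)+
      also have "\<dots> = ((cmod \<kappa>)\<^sup>2 * (1 / (2 * \<eta>))) * integral {0..T} (\<lambda>s. exp (- (2 * \<eta> * s)) * N s)" by (rule integral_mult_right)
      also have "\<dots> \<le> B0" unfolding B0_def by (rule mult_left_mono[OF NB]) (use \<eta> in auto)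
      finally show ?thesis .
    qed
    have wP: "(norm (wave_laplace z T (P T) (T - s)))\<^sup>2 \<le> 1 / (2 * \<eta>) * N s" if "s \<in> {0..T}" for s
      using norm_wave_laplace_power2_le[OF cP[OF T] z, of "T - s" T] that by (simp add: N_def \<eta>_def)
    \<comment> \<open>The transform of g is controlled through P: at equal depth g carries no more
      energy than P on every initial time interval, hence also in the weighted sense.\<close>
    have wG: "(norm (wave_laplace z T (g T) (T - s)))\<^sup>2 \<le> 1 / (2 * \<eta>) * N s" if s: "s \<in> {0..T}" for s
    proof -
      have c1: "continuous_on UNIV (\<lambda>\<sigma>. (norm (g T (\<sigma>, s)))\<^sup>2)"
        by (intro continuous_intros continuous_on_compose2[OF cg[OF T]]) auto
      have c2: "continuous_on UNIV (\<lambda>\<sigma>. (norm (P T (\<sigma>, s)))\<^sup>2)"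
        by (intro continuous_intros continuous_on_compose2[OF cP[OF T]]) auto
      have "(norm (wave_laplace z T (g T) (T - s)))\<^sup>2 \<le> 1 / (2 * \<eta>) * integral {0..T - s} (\<lambda>\<sigma>. exp (- (2 * \<eta> * \<sigma>)) * (norm (g T (\<sigma>, s)))\<^sup>2)"
        using norm_wave_laplace_power2_le[OF cg[OF T] z, of "T - s" T] s by (simp add: \<eta>_def)
      also have "\<dots> \<le> 1 / (2 * \<eta>) * N s"
        unfolding N_def
      proof (intro mult_left_mono exp_weighted_le[OF c1 c2])
        fix \<tau> assume "0 \<le> \<tau>" "\<tau> \<le> T - s"
        then show "integral {0..\<tau>} (\<lambda>\<sigma>. (norm (g T (\<sigma>, s)))\<^sup>2) \<le> integral {0..\<tau>} (\<lambda>\<sigma>. (norm (P T (\<sigma>, s)))\<^sup>2)"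
          by (intro wave_energy_level[OF w[OF T] ca g0[OF T]]) (use s in auto)
      qed (use s \<eta> in auto)
      finally show ?thesis .
    qed
    show ?thesis
    proof
      show "integral {0..T} (\<lambda>s. (norm (Y1 T s))\<^sup>2) \<le> B0"
      proof (rule LF)
        fix s assume s: "s \<in> {0..T}"
        show "(norm (Y1 T s))\<^sup>2 \<le> (cmod \<kappa> * exp (- (\<eta> * s)))\<^sup>2 * (1 / (2 * \<eta>) * N s)"
          unfolding Y1_def norm_mscale norm_mult nE power_mult_distrib[of "cmod \<kappa> * exp (- (\<eta> * s))"]
          by (rule mult_left_mono[OF wP[OF s]]) simp
      qed (intro continuous_intros cY1 T)
      show "integral {0..T} (\<lambda>s. (norm (Y2 T s))\<^sup>2) \<le> B0"
      proof (rule LF)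
        fix s assume s: "s \<in> {0..T}"
        show "(norm (Y2 T s))\<^sup>2 \<le> (cmod \<kappa> * exp (- (\<eta> * s)))\<^sup>2 * (1 / (2 * \<eta>) * N s)"
          unfolding Y2_def norm_mscale norm_mult nE norm_minus_cancel power_mult_distrib[of "cmod \<kappa> * exp (- (\<eta> * s))"]
          by (rule mult_left_mono[OF wG[OF s]]) simp
      qed (intro continuous_intros cY2 T)
    qed
  qed
  have "integral {0..S} (\<lambda>s. (norm (fund_sol v l z (s + l) ** stack_I (weyl_of A z)))\<^sup>2) \<le> 4 * B0 + 2" if S: "S \<ge> 0" for S
  proof -
    have "compact {0..S}" by simp
    then obtain M where M: "M \<ge> 1" "\<And>s. s \<in> {0..S} \<Longrightarrow> norm (a s) \<le> M" using compact_norm_bound[OF ca] by blast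
    define C where "C = cmod z + M"
    have C: "C > 0" unfolding C_def using M by (intro add_nonneg_pos) auto
    have "(\<lambda>n. \<delta> S n * exp (C * S)) \<longlonglongrightarrow> 0 * exp (C * S)" by (intro tendsto_mult \<delta>0 S tendsto_const)
    \<comment> \<open>With accuracy 1 / (S + 1) on all of [0, S] the squared error integrates to at
      most 1, so that the final bound \<open>4 * B0 + 2\<close> is the same for every S.\<close>
    from order_tendstoD(2)[OF this, of "1 / (S + 1)"] S
    have "\<forall>\<^sub>F n in sequentially. \<delta> S n * exp (C * S) < 1 / (S + 1)" by simp
    moreover have "\<forall>\<^sub>F n in sequentially. S \<le> real n"
    proof (rule eventually_sequentiallyI[of "nat \<lceil>S\<rceil>"])
      fix n assume "nat \<lceil>S\<rceil> \<le> n" then show "S \<le> real n" by linarith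
    qed
    ultimately have "\<forall>\<^sub>F n in sequentially. \<delta> S n * exp (C * S) < 1 / (S + 1) \<and> S \<le> real n" by (rule eventually_conj)
    then obtain n where n: "\<delta> S n * exp (C * S) < 1 / (S + 1)" "S \<le> real n"
      by (auto simp: eventually_sequentially)
    let ?T = "real n"
    have \<delta>n: "\<delta> S n \<ge> 0" unfolding \<delta>_def
      by (intro add_nonneg_nonneg integral_nonneg integrable_cont continuous_intros cerr) auto
    define q where "q = (1 / (S + 1))\<^sup>2"
    have pt: "(norm (Y s))\<^sup>2 \<le> 2 * ((norm (Y1 ?T s))\<^sup>2 + (norm (Y2 ?T s))\<^sup>2) + 2 * q" if s: "s \<in> {0..S}" for s
    proof -
      have "norm (D1 ?T s) + norm (D2 ?T s) \<le> \<delta> S n * exp (C * s)"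
        by (rule growth) (use s n C M in \<open>auto simp: C_def\<close>)
      also have "\<dots> \<le> \<delta> S n * exp (C * S)" using s C \<delta>n by (intro mult_left_mono) auto
      finally have D: "norm (D1 ?T s) + norm (D2 ?T s) \<le> 1 / (S + 1)" using n(1) by linarith
      have "(norm (D1 ?T s))\<^sup>2 + (norm (D2 ?T s))\<^sup>2 \<le> (norm (D1 ?T s) + norm (D2 ?T s))\<^sup>2"
        by (simp add: power2_sum)
      also have "\<dots> \<le> (1 / (S + 1))\<^sup>2" using D by (intro power_mono) auto
      finally have "(norm (D1 ?T s))\<^sup>2 + (norm (D2 ?T s))\<^sup>2 \<le> q" unfolding q_def .
      note Dq = this[unfolded D1_def D2_def]
      have ar: "t + b \<le> 2 * (y1 + y2) + 2 * q" if "d1 + d2 \<le> q" "t \<le> 2 * y1 + 2 * d1" "b \<le> 2 * y2 + 2 * d2" for t b y1 y2 d1 d2 :: real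
      proof -
        have "t + b \<le> (2 * y1 + 2 * d1) + (2 * y2 + 2 * d2)" by (rule add_mono[OF that(2,3)])
        also have "\<dots> = 2 * (y1 + y2) + 2 * (d1 + d2)" by (simp add: distrib_left)
        also have "\<dots> \<le> 2 * (y1 + y2) + 2 * q" using that(1) by simp
        finally show ?thesis .
      qed
      show ?thesis unfolding norm_blocks[of "Y s"]
        by (rule ar[OF Dq norm_power2_le_diff norm_power2_le_diff])
    qed
    have T: "?T \<ge> 0" by simp
    have s1: "integral {0..S} (\<lambda>s. (norm (Y1 ?T s))\<^sup>2) \<le> integral {0..?T} (\<lambda>s. (norm (Y1 ?T s))\<^sup>2)"
      by (rule integral_subset_le; (intro integrable_cont continuous_intros cY1 T)?) (use n in auto)
    have s2: "integral {0..S} (\<lambda>s. (norm (Y2 ?T s))\<^sup>2) \<le> integral {0..?T} (\<lambda>s. (norm (Y2 ?T s))\<^sup>2)"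
      by (rule integral_subset_le; (intro integrable_cont continuous_intros cY2 T)?) (use n in auto)
    have "integral {0..S} (\<lambda>s. (norm (fund_sol v l z (s + l) ** stack_I (weyl_of A z)))\<^sup>2) = integral {0..S} (\<lambda>s. (norm (Y s))\<^sup>2)"
      by (rule integral_cong) (simp add: Y_def)
    also have "\<dots> \<le> integral {0..S} (\<lambda>s. 2 * ((norm (Y1 ?T s))\<^sup>2 + (norm (Y2 ?T s))\<^sup>2) + 2 * q)"
      by (rule integral_le[OF _ _ pt]) (intro integrable_cont continuous_intros cY cY1 cY2 T; assumption)+
    also have "\<dots> = 2 * (integral {0..S} (\<lambda>s. (norm (Y1 ?T s))\<^sup>2) + integral {0..S} (\<lambda>s. (norm (Y2 ?T s))\<^sup>2)) + integral {0..S} (\<lambda>s. 2 * q)"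
      by (subst integral_add; (intro integrable_cont continuous_intros cY1 cY2 T)?)
         (subst integral_mult_right, subst integral_add; (intro integrable_cont continuous_intros cY1 cY2 T)?; simp)
    also have "\<dots> \<le> 2 * (B0 + B0) + 2"
    proof (intro add_mono mult_left_mono)
      show "integral {0..S} (\<lambda>s. (norm (Y1 ?T s))\<^sup>2) \<le> B0" "integral {0..S} (\<lambda>s. (norm (Y2 ?T s))\<^sup>2) \<le> B0"
        using s1 s2 L2[OF T] by linarith+
      have "S \<le> (S + 1)\<^sup>2" using S by (simp add: power2_eq_square algebra_simps)
      then show "integral {0..S} (\<lambda>s. 2 * q) \<le> 2" using S by (simp add: q_def power_divide divide_le_eq)
    qed simp
    finally show ?thesis by simp
  qed
  then show ?thesis using that by blast
qed

section \<open>Identification of the Weyl function, of \<open>Phi\<close> and of the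
  A-function\<close>

lemma integral_atLeast_tail:
  fixes f :: "real \<Rightarrow> 'b::euclidean_space" and g :: "real \<Rightarrow> real"
  assumes f: "continuous_on UNIV f" and g: "continuous_on UNIV g" "g integrable_on {0..}"
    and le: "\<And>x. x \<ge> 0 \<Longrightarrow> norm (f x) \<le> g x" and T: "T \<ge> 0"
  shows "norm (integral {0..} f - integral {0..T} f) \<le> integral {0..} g - integral {0..T} g"
proof -
  have fi: "f integrable_on {0..}" by (rule integrable_atLeast_dominated[OF f g(2) le])
  have "((\<lambda>y. norm (integral {0..y} f - integral {0..T} f)) \<longlongrightarrow> norm (integral {0..} f - integral {0..T} f)) at_top"
    by (intro tendsto_intros has_integral_atLeast_tendsto integrable_integral fi)
  moreover have "((\<lambda>y. integral {0..y} g - integral {0..T} g) \<longlongrightarrow> integral {0..} g - integral {0..T} g) at_top"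
    by (intro tendsto_intros has_integral_atLeast_tendsto integrable_integral g)
  moreover have "\<forall>\<^sub>F y in at_top. norm (integral {0..y} f - integral {0..T} f) \<le> integral {0..y} g - integral {0..T} g"
    using eventually_ge_at_top[of T]
  proof eventually_elim
    case (elim y)
    have "norm (integral {0..y} f - integral {0..T} f) = norm (integral {T..y} f)"
      using integral_combine_cont[OF f T elim] by simp
    also have "\<dots> \<le> integral {T..y} g"
      by (rule integral_norm_bound_integral) (use T in \<open>auto intro: integrable_cont f g le\<close>)
    also have "\<dots> = integral {0..y} g - integral {0..T} g"
      using integral_combine_cont[OF g(1) T elim] by simp
    finally show ?case .
  qed
  ultimately show ?thesis by (intro tendsto_le[OF trivial_limit_at_top_linorder])
qed

lemma bounded_linear_mat_nth: "bounded_linear (\<lambda>M :: complex^'c^'r. M $ i $ j)"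
  using bounded_linear_compose[OF bounded_linear_vec_nth[of j] bounded_linear_vec_nth[of i]] by (simp add: o_def)

lemma norm_mat_nth_le: "cmod (M $ i $ j) \<le> norm M" for M :: "complex^'c^'r"
  by (rule order_trans[OF Finite_Cartesian_Product.norm_nth_le Finite_Cartesian_Product.norm_nth_le])

text \<open>The equation is invariant under translations in depth; the system on [l, oo) is thereby
  reduced to the case of the surface.\<close>

lemma mild_shift:
  assumes A: "mild A" and l: "l \<ge> 0"
  shows "mild (\<lambda>p. A (fst p, snd p + l))"
  unfolding mild_def
proof (intro conjI allI impI)
  have cA: "continuous_on UNIV A" using A by (simp add: mild_def)
  show "continuous_on UNIV (\<lambda>p. A (fst p, snd p + l))"
    by (intro continuous_on_compose2[OF cA] continuous_intros) auto
  fix x s :: real assume xs: "0 \<le> x" "0 \<le> s"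
  have "A (x, s + l) = A (0, x + (s + l)) - integral {0..x} (\<lambda>u. quad_term A u (x + (s + l) - u))"
    using A xs l unfolding mild_def by (meson add_nonneg_nonneg)
  then show "A (fst (x, s), snd (x, s) + l) = A (fst (0, x + s), snd (0, x + s) + l)
       - integral {0..x} (\<lambda>u. quad_term (\<lambda>p. A (fst p, snd p + l)) u (x + s - u))"
    by (simp add: quad_term_def algebra_simps)
qed

text \<open>The integrals over bounded intervals are holomorphic by differentiation under the
  integral, and they converge locally uniformly because one exponentially weighted majorant serves a
  whole disc.\<close>

lemma holomorphic_weyl_of:
  assumes A: "mild A"
  shows "(\<lambda>z. weyl_of A z $ i $ j) holomorphic_on {z. Im z > 0}"
proof -
  have cA: "continuous_on UNIV A" using A by (simp add: mild_def)
  note cP = continuous_Phi_of[OF cA]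
  define \<phi> where "\<phi> x = Phi_of A x $ i $ j" for x
  have c\<phi>: "continuous_on U \<phi>" for U unfolding \<phi>_def
    by (rule continuous_on_subset[OF bounded_linear.continuous_on[OF bounded_linear_mat_nth cP]]) simp
  have n\<phi>: "cmod (\<phi> x) \<le> norm (Phi_of A x)" for x unfolding \<phi>_def
    by (rule norm_mat_nth_le)
  define F where "F z = integral {0..} (\<lambda>x. exp (2 * \<i> * z * of_real x) * \<phi> x)" for z
  have entry: "weyl_of A z $ i $ j = 2 * \<i> * z * F z" if z: "Im z > 0" for z
    using integral_linear[OF laplace_Phi_of[OF A z] bounded_linear_mat_nth[of i j]]
    by (simp add: weyl_of_def F_def o_def \<phi>_def)
  have "F holomorphic_on {z. Im z > 0}"
  proof (rule holomorphic_uniform_sequence)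
    show "open {z. Im z > 0}" by (rule open_halfspace_Im_gt)
    show "(\<lambda>z. integral {0..real n} (\<lambda>x. exp (2 * \<i> * z * of_real x) * \<phi> x)) holomorphic_on {z. Im z > 0}" for n
      unfolding interval_cbox
    proof (rule leibniz_rule_holomorphic)
      fix z x
      show "((\<lambda>z. exp (2 * \<i> * z * of_real x) * \<phi> x) has_field_derivative 2 * \<i> * of_real x * exp (2 * \<i> * z * of_real x) * \<phi> x) (at z within {z. Im z > 0})"
        by (auto intro!: derivative_eq_intros simp: mult_ac)
    next
      fix z :: complex
      show "(\<lambda>x. exp (2 * \<i> * z * of_real x) * \<phi> x) integrable_on cbox 0 (real n)"
        unfolding interval_cbox[symmetric] by (intro integrable_cont continuous_intros c\<phi>)
    next
      show "continuous_on ({z. Im z > 0} \<times> cbox 0 (real n)) (\<lambda>(z, x). 2 * \<i> * of_real x * exp (2 * \<i> * z * of_real x) * \<phi> x)"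
        unfolding split_beta by (intro continuous_intros continuous_on_compose2[OF c\<phi>[of UNIV]]) auto
      show "convex {z. Im z > 0}" by (rule convex_halfspace_Im_gt)
    qed
    fix z0 :: complex assume z0: "z0 \<in> {z. Im z > 0}"
    \<comment> \<open>Half the distance to the real axis is both the radius of the disc and a lower
      bound for Im z on it.\<close>
    define \<eta> where "\<eta> = Im z0 / 2"
    have \<eta>: "\<eta> > 0" using z0 by (simp add: \<eta>_def)
    have Imz: "Im z \<ge> \<eta>" if "z \<in> cball z0 \<eta>" for z
    proof -
      have "\<bar>Im (z0 - z)\<bar> \<le> cmod (z0 - z)" by (rule abs_Im_le_cmod)
      then show ?thesis using that by (simp add: dist_norm \<eta>_def)
    qed
    define g where "g x = exp (- (2 * \<eta> * x)) * norm (Phi_of A x)" for x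
    have cg: "continuous_on UNIV g" unfolding g_def by (intro continuous_intros cP)
    have gi: "g integrable_on {0..}" unfolding g_def by (rule Phi_of_exp_integrable[OF A]) (use \<eta> in simp)
    have lim: "(\<lambda>n. integral {0..real n} g) \<longlonglongrightarrow> integral {0..} g"
      by (rule filterlim_compose[OF has_integral_atLeast_tendsto[OF integrable_integral[OF gi]] filterlim_real_sequentially])
    have "uniform_limit (cball z0 \<eta>) (\<lambda>n z. integral {0..real n} (\<lambda>x. exp (2 * \<i> * z * of_real x) * \<phi> x)) F sequentially"
    proof (rule uniform_limitI)
      fix e :: real assume e: "e > 0"
      from tendstoD[OF lim e] show "\<forall>\<^sub>F n in sequentially. \<forall>z\<in>cball z0 \<eta>. dist (integral {0..real n} (\<lambda>x. exp (2 * \<i> * z * of_real x) * \<phi> x)) (F z) < e"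
      proof eventually_elim
        case (elim n)
        show ?case
        proof
          fix z assume z: "z \<in> cball z0 \<eta>"
          have "norm (F z - integral {0..real n} (\<lambda>x. exp (2 * \<i> * z * of_real x) * \<phi> x)) \<le> integral {0..} g - integral {0..real n} g"
            unfolding F_def
          proof (rule integral_atLeast_tail[OF _ cg gi])
            fix x :: real assume x: "x \<ge> 0"
            show "norm (exp (2 * \<i> * z * of_real x) * \<phi> x) \<le> g x"
              unfolding norm_mult norm_exp_2iz g_def
              by (rule mult_mono) (use Imz[OF z] x n\<phi> in \<open>auto intro: mult_right_mono\<close>)
          qed (auto intro!: continuous_intros c\<phi>)
          also have "\<dots> < e" using elim by (simp add: dist_real_def)
          finally show "dist (integral {0..real n} (\<lambda>x. exp (2 * \<i> * z * of_real x) * \<phi> x)) (F z) < e"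
            by (simp add: dist_norm norm_minus_commute)
        qed
      qed
    qed
    moreover have "cball z0 \<eta> \<subseteq> {z. Im z > 0}" using Imz \<eta> by force
    ultimately show "\<exists>d>0. cball z0 d \<subseteq> {z. Im z > 0} \<and> uniform_limit (cball z0 d) (\<lambda>n z. integral {0..real n} (\<lambda>x. exp (2 * \<i> * z * of_real x) * \<phi> x)) F sequentially"
      using \<eta> by blast
  qed
  then have "(\<lambda>z. 2 * \<i> * z * F z) holomorphic_on {z. Im z > 0}" by (intro holomorphic_intros)
  then show ?thesis by (rule holomorphic_transform) (simp add: entry)
qed

text \<open>The square integrable solution built from the waves shows that \<open>weyl_of A\<close>
  qualifies, and \<open>weyl_value_unique\<close> excludes any other candidate; the convention of
  the value 0 off the upper half-plane settles the remaining points.\<close>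

lemma weyl_eq:
  fixes v :: "real \<Rightarrow> complex^'m2::finite^'m1::finite" and A :: "real \<times> real \<Rightarrow> complex^'m1^'m2"
  assumes v: "continuous_on {0..} v" and A: "mild A" and l: "l \<ge> 0"
    and Av: "\<And>s. s \<ge> 0 \<Longrightarrow> A (0, s) = mscale (- \<i>) (madj (v (s + l)))"
  shows "weyl v l z = (if Im z > 0 then weyl_of A z else 0)"
proof -
  define \<psi> where "\<psi> z = (if Im z > 0 then weyl_of A z else 0)" for z
  have "is_weyl v l \<psi>" unfolding is_weyl_def
  proof (intro conjI allI impI)
    show "(\<lambda>z. \<psi> z $ i $ j) holomorphic_on {z. 0 < Im z}" for i j
      using holomorphic_weyl_of[OF A, of i j] by (rule holomorphic_transform) (simp add: \<psi>_def)
    show "\<psi> z = 0" if "Im z \<le> 0" for z using that by (simp add: \<psi>_def)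
    fix z i j assume z: "0 < Im z"
    define Y where "Y x = fund_sol v l z x ** stack_I (weyl_of A z)" for x
    define Y' where "Y' x = Y (max 0 x)" for x
    have cY: "continuous_on {0..} Y" unfolding Y_def by (rule fund_sol_column(3)[OF v l])
    have cY': "continuous_on UNIV Y'" unfolding Y'_def
      by (rule continuous_on_compose2[OF cY]) (auto intro!: continuous_intros)
    obtain B where B: "\<And>S. S \<ge> 0 \<Longrightarrow> integral {0..S} (\<lambda>s. (norm (Y (s + l)))\<^sup>2) \<le> B"
      unfolding Y_def using weyl_solution_L2[OF v A l z Av] by blast
    have "(\<lambda>x. (cmod (Y x $ i $ j))\<^sup>2) integrable_on {l..}"
    proof (rule integrable_atLeast_bounded)
      show "continuous_on {l..} (\<lambda>x. (cmod (Y x $ i $ j))\<^sup>2)"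
        by (intro continuous_intros continuous_on_subset[OF cY]) (use l in auto)
      fix T assume T: "T \<ge> l"
      have "integral {l..T} (\<lambda>x. (cmod (Y x $ i $ j))\<^sup>2) \<le> integral {l..T} (\<lambda>x. (norm (Y' x))\<^sup>2)"
      proof (rule integral_le)
        show "(\<lambda>x. (cmod (Y x $ i $ j))\<^sup>2) integrable_on {l..T}"
          by (intro integrable_continuous_real continuous_intros continuous_on_subset[OF cY]) (use l in auto)
        show "(\<lambda>x. (norm (Y' x))\<^sup>2) integrable_on {l..T}" by (intro integrable_cont continuous_intros cY')
        fix x assume x: "x \<in> {l..T}"
        have "cmod (Y x $ i $ j) \<le> norm (Y x)" by (rule norm_mat_nth_le)
        then show "(cmod (Y x $ i $ j))\<^sup>2 \<le> (norm (Y' x))\<^sup>2" using x l by (simp add: Y'_def power_mono)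
      qed
      also have "\<dots> = integral {0..T - l} (\<lambda>s. (norm (Y' (s + l)))\<^sup>2)"
      proof -
        have "continuous_on UNIV (\<lambda>x. (norm (Y' x))\<^sup>2)" by (intro continuous_intros cY')
        from integral_shift_real[OF this, of 0 "T - l" l] show ?thesis by simp
      qed
      also have "\<dots> = integral {0..T - l} (\<lambda>s. (norm (Y (s + l)))\<^sup>2)"
        by (rule integral_cong) (use l in \<open>simp add: Y'_def\<close>)
      also have "\<dots> \<le> B" using B[of "T - l"] T by simp
      finally show "integral {l..T} (\<lambda>x. (cmod (Y x $ i $ j))\<^sup>2) \<le> B" .
    qed simp
    then have "(\<lambda>x. (cmod (Y x $ i $ j))\<^sup>2) integrable_on {l<..}"
    proof (rule integrable_spike_set)
      show "negligible {x \<in> {l..} - {l<..}. (cmod (Y x $ i $ j))\<^sup>2 \<noteq> 0}"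
        by (rule negligible_subset[OF negligible_sing[of l]]) auto
      show "negligible {x \<in> {l<..} - {l..}. (cmod (Y x $ i $ j))\<^sup>2 \<noteq> 0}"
        by (rule negligible_subset[OF negligible_sing[of l]]) auto
    qed
    then show "(\<lambda>x. (cmod ((fund_sol v l z x ** stack_I (\<psi> z)) $ i $ j))\<^sup>2) integrable_on {l<..}"
      using z by (simp add: Y_def \<psi>_def)
  qed
  moreover have "\<psi>' = \<psi>" if \<psi>': "is_weyl v l \<psi>'" for \<psi>'
  proof
    fix z
    show "\<psi>' z = \<psi> z"
    proof (cases "Im z > 0")
      case True
      show ?thesis
        by (rule weyl_value_unique[OF v l True]) (use True \<psi>' \<open>is_weyl v l \<psi>\<close> in \<open>simp_all add: is_weyl_def\<close>)
    next
      case False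
      then have "Im z \<le> 0" by simp
      then show ?thesis using \<psi>' \<open>is_weyl v l \<psi>\<close> unfolding is_weyl_def by metis
    qed
  qed
  ultimately have "weyl v l = \<psi>" unfolding weyl_def by (rule the_equality)
  then show ?thesis by (simp add: \<psi>_def)
qed

lemma solution_slice_C1:
  assumes B: "A_equation_solution B" and l: "l \<ge> 0"
  shows "C1_nonneg (\<lambda>x. B (x, l))"
proof -
  obtain Dx Dl where D: "C1_quadrant_with B Dx Dl" using B unfolding A_equation_solution_def by blast
  show ?thesis unfolding C1_nonneg_def
  proof (intro exI conjI allI impI)
    fix x :: real assume x: "x \<ge> 0"
    have 1: "((\<lambda>x. (x, l)) has_derivative (\<lambda>h. (h, 0))) (at x within {0..})"
      by (intro has_derivative_Pair has_derivative_ident has_derivative_const)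
    have "(B has_derivative (\<lambda>h. fst h *\<^sub>R Dx (x, l) + snd h *\<^sub>R Dl (x, l))) (at (x, l) within quadrant)"
      using D x l unfolding C1_quadrant_with_def by (auto simp: quadrant_def)
    then have "(B has_derivative (\<lambda>h. fst h *\<^sub>R Dx (x, l) + snd h *\<^sub>R Dl (x, l))) (at (x, l) within (\<lambda>x. (x, l)) ` {0..})"
      by (rule has_derivative_subset) (use l in \<open>auto simp: quadrant_def\<close>)
    from diff_chain_within[OF 1 this] show "((\<lambda>x. B (x, l)) has_vector_derivative Dx (x, l)) (at x within {0..})"
      by (simp add: has_vector_derivative_def o_def)
  next
    have "continuous_on quadrant Dx" using D by (simp add: C1_quadrant_with_def)
    then show "continuous_on {0..} (\<lambda>x. Dx (x, l))"
      by (rule continuous_on_compose2) (use l in \<open>auto simp: quadrant_def intro!: continuous_intros\<close>)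
  qed
qed

text \<open>Two admissible functions have the same integrals against exp (2ixz), because the factor
  2iz can be cancelled. Lerch's theorem, applied to the real and imaginary parts of each entry,
  makes them equal.\<close>

lemma Phi_eq:
  fixes v :: "real \<Rightarrow> complex^'m2::finite^'m1::finite" and A :: "real \<times> real \<Rightarrow> complex^'m1^'m2"
  assumes v: "continuous_on {0..} v" and A: "mild A" and l: "l \<ge> 0" and C1: "C1_nonneg (\<lambda>x. A (x, 0))"
    and Av: "\<And>s. s \<ge> 0 \<Longrightarrow> A (0, s) = mscale (- \<i>) (madj (v (s + l)))"
  shows "Phi v l = Phi_of A"
proof -
  have cA: "continuous_on UNIV A" using A by (simp add: mild_def)
  have cA0: "continuous_on UNIV (\<lambda>x. A (x, 0))" by (intro continuous_on_compose2[OF cA] continuous_intros) auto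
  note cP = continuous_Phi_of[OF cA]
  have isPhi: "is_Phi v l (Phi_of A)" unfolding is_Phi_def
  proof (intro conjI allI impI)
    obtain D2 where D2: "\<And>x. x \<ge> 0 \<Longrightarrow> ((\<lambda>x. A (x, 0)) has_vector_derivative D2 x) (at x within {0..})" "continuous_on {0..} D2"
      using C1 unfolding C1_nonneg_def by blast
    have D1: "(Phi_of A has_vector_derivative A (x, 0)) (at x within {0..})" if "x \<ge> 0" for x
      unfolding Phi_of_def[abs_def] by (rule FTC_within[OF cA0]) (use that in auto)
    show "C2_nonneg (Phi_of A)" unfolding C2_nonneg_def
      by (intro exI[of _ "\<lambda>x. A (x, 0)"] exI[of _ D2] conjI allI impI D1 D2)
    show "Phi_of A x = 0" if "x < 0" for x using that by (simp add: Phi_of_def)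
    fix z i j assume z: "0 < Im z"
    define I where "I = integral {0..} (\<lambda>x. mscale (exp (2 * \<i> * z * of_real x)) (Phi_of A x))"
    have "((\<lambda>x. mscale (exp (2 * \<i> * z * of_real x)) (Phi_of A x)) has_integral I) {0..}"
      unfolding I_def by (rule integrable_integral[OF laplace_Phi_of[OF A z]])
    from has_integral_linear[OF this bounded_linear_mat_nth[of i j]]
    have "((\<lambda>x. exp (2 * \<i> * complex_of_real x * z) * Phi_of A x $ i $ j) has_integral I $ i $ j) {0..}"
      by (simp add: o_def mult_ac)
    moreover have "weyl v l z $ i $ j = 2 * \<i> * z * I $ i $ j"
    proof -
      have "weyl v l z = (if Im z > 0 then weyl_of A z else 0)" by (rule weyl_eq[OF v A l Av])
      then have "weyl v l z = weyl_of A z" using z by (simp only: if_True)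
      then show ?thesis by (simp add: weyl_of_def I_def mscale_def)
    qed
    ultimately show "\<exists>I. ((\<lambda>x. exp (2 * \<i> * complex_of_real x * z) * Phi_of A x $ i $ j) has_integral I) {0..} \<and> weyl v l z $ i $ j = 2 * \<i> * z * I"
      by blast
  qed
  moreover have "\<Phi> = Phi_of A" if \<Phi>: "is_Phi v l \<Phi>" for \<Phi>
  proof
    fix x
    show "\<Phi> x = Phi_of A x"
    proof (cases "x < 0")
      case True
      then show ?thesis using \<Phi> isPhi by (simp add: is_Phi_def)
    next
      case False
      then have x: "x \<ge> 0" by simp
      have c\<Phi>: "continuous_on {0..} \<Phi>"
        using \<Phi> unfolding is_Phi_def C2_nonneg_def
        by (meson atLeast_iff continuous_on_eq_continuous_within has_vector_derivative_continuous)
      define d where "d x = \<Phi> (max 0 x) - Phi_of A (max 0 x)" for x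
      have cd: "continuous_on UNIV d" unfolding d_def
        by (intro continuous_on_diff continuous_on_compose2[OF c\<Phi>] continuous_on_compose2[OF cP] continuous_intros) auto
      have zero: "((\<lambda>x. of_real (exp (- (s * x))) * d x $ i $ j) has_integral 0) {0..}" if s: "s > 0" for s i j
      proof -
        \<comment> \<open>On the imaginary axis the kernel exp (2ixz) becomes the real exponential
          exp (-s x).\<close>
        define z where "z = \<i> * of_real (s / 2)"
        have z: "Im z > 0" "z \<noteq> 0" using s by (auto simp: z_def)
        have e: "exp (2 * \<i> * complex_of_real x * z) = of_real (exp (- (s * x)))" for x
        proof -
          have "2 * \<i> * complex_of_real x * z = of_real (- (s * x))" by (simp add: z_def mult_ac)
          then show ?thesis by (simp only: exp_of_real)
        qed
        obtain I1 where I1: "((\<lambda>x. exp (2 * \<i> * complex_of_real x * z) * \<Phi> x $ i $ j) has_integral I1) {0..}" "weyl v l z $ i $ j = 2 * \<i> * z * I1"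
          using \<Phi> z unfolding is_Phi_def by blast
        obtain I2 where I2: "((\<lambda>x. exp (2 * \<i> * complex_of_real x * z) * Phi_of A x $ i $ j) has_integral I2) {0..}" "weyl v l z $ i $ j = 2 * \<i> * z * I2"
          using isPhi z unfolding is_Phi_def by blast
        have "I1 = I2" using I1(2) I2(2) z by simp
        then have "((\<lambda>x. exp (2 * \<i> * complex_of_real x * z) * \<Phi> x $ i $ j - exp (2 * \<i> * complex_of_real x * z) * Phi_of A x $ i $ j) has_integral 0) {0..}"
          using has_integral_diff[OF I1(1) I2(1)] by simp
        then show ?thesis
          by (rule has_integral_eq[rotated]) (simp add: e d_def right_diff_distrib)
      qed
      have "d x $ i $ j = 0" for i j
      proof (rule complex_eqI)
        have cij: "continuous_on UNIV (\<lambda>x. d x $ i $ j)" by (rule bounded_linear.continuous_on[OF bounded_linear_mat_nth cd])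
        have "Re (d x $ i $ j) = 0"
        proof (rule lerch_real[OF _ _ x])
          show "continuous_on UNIV (\<lambda>x. Re (d x $ i $ j))" by (intro continuous_intros cij)
          show "((\<lambda>x. exp (- (s * x)) * Re (d x $ i $ j)) has_integral 0) {0..}" if "s > 0" for s
            using has_integral_linear[OF zero[OF that] bounded_linear_Re] by (simp add: o_def)
        qed
        moreover have "Im (d x $ i $ j) = 0"
        proof (rule lerch_real[OF _ _ x])
          show "continuous_on UNIV (\<lambda>x. Im (d x $ i $ j))" by (intro continuous_intros cij)
          show "((\<lambda>x. exp (- (s * x)) * Im (d x $ i $ j)) has_integral 0) {0..}" if "s > 0" for s
            using has_integral_linear[OF zero[OF that] bounded_linear_Im] by (simp add: o_def)
        qed
        ultimately show "Re (d x $ i $ j) = Re 0" "Im (d x $ i $ j) = Im 0" by simp_all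
      qed
      then have "d x = 0" by (simp add: vec_eq_iff)
      then show ?thesis using x by (simp add: d_def)
    qed
  qed
  ultimately show ?thesis unfolding Phi_def by (rule the_equality)
qed

text \<open>Translating by \<open>l\<close> places the half-line [l, oo) at the surface, where
  \<open>Phi\<close> is the primitive of A (., l); the vector derivative in the definition is unique
  since x is a limit point of the half-line.\<close>

lemma A_fun_eq:
  fixes v :: "real \<Rightarrow> complex^'m2::finite^'m1::finite" and A :: "real \<times> real \<Rightarrow> complex^'m1^'m2"
  assumes v: "C1_nonneg v" and A: "mild A" "A_equation_solution A"
    and Av: "\<And>l. l \<ge> 0 \<Longrightarrow> A (0, l) = mscale (- \<i>) (madj (v l))"
    and x: "x \<ge> 0" and l: "l \<ge> 0"
  shows "A_fun v x l = A (x, l)"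
proof -
  have cA: "continuous_on UNIV A" using A by (simp add: mild_def)
  define Al where "Al p = A (fst p, snd p + l)" for p
  have mAl: "mild Al" unfolding Al_def by (rule mild_shift[OF A(1) l])
  have "Phi v l = Phi_of Al"
  proof (rule Phi_eq[OF C1_nonneg_continuous[OF v] mAl l])
    show "C1_nonneg (\<lambda>x. Al (x, 0))" using solution_slice_C1[OF A(2) l] by (simp add: Al_def)
    show "Al (0, s) = mscale (- \<i>) (madj (v (s + l)))" if "s \<ge> 0" for s using Av[of "s + l"] that l by (simp add: Al_def)
  qed
  moreover have "(Phi_of Al has_vector_derivative Al (x, 0)) (at x within {0..})"
  proof -
    have "continuous_on UNIV (\<lambda>t. Al (t, 0))" unfolding Al_def by (intro continuous_on_compose2[OF cA] continuous_intros) auto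
    from FTC_within[OF this] show ?thesis unfolding Phi_of_def[abs_def] using x by auto
  qed
  moreover have "at x within {0..} \<noteq> bot"
  proof -
    have "at x within {0..x+1} \<noteq> bot" using x by (simp add: trivial_limit_within islimpt_Icc)
    moreover have "at x within {0..x+1} = at x within {0..}" by (rule at_within_nhd[of x "{..<x+1}"]) auto
    ultimately show ?thesis by simp
  qed
  ultimately show ?thesis unfolding A_fun_def by (simp add: vector_derivative_within Al_def)
qed

lemma C1_nonneg_mscale_madj:
  fixes v :: "real \<Rightarrow> complex^'c^'r"
  assumes v: "C1_nonneg v"
  shows "C1_nonneg (\<lambda>l. mscale (- \<i>) (madj (v l)))"
proof -
  obtain v' where v': "\<And>x. x \<ge> 0 \<Longrightarrow> (v has_vector_derivative v' x) (at x within {0..})" "continuous_on {0..} v'"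
    using v unfolding C1_nonneg_def by blast
  have bl: "bounded_linear (\<lambda>w :: complex^'c^'r. mscale (- \<i>) (madj w))"
    by (rule bounded_linear_compose[OF ms.bounded_linear_right bounded_linear_madj])
  show ?thesis unfolding C1_nonneg_def
    by (intro exI conjI allI impI) (rule bounded_linear.has_vector_derivative[OF bl v'(1)], assumption, rule bounded_linear.continuous_on[OF bl v'(2)])
qed

lemma A_fun_solution:
  fixes v :: "real \<Rightarrow> complex^'m2::finite^'m1::finite"
  assumes v: "C1_nonneg v"
  shows "A_equation_solution (\<lambda>p. A_fun v (fst p) (snd p))"
proof -
  obtain A where A: "mild A" "A_equation_solution A" "\<And>l. l \<ge> 0 \<Longrightarrow> A (0, l) = mscale (- \<i>) (madj (v l))"
    by (rule mild_solution_exists[OF C1_nonneg_mscale_madj[OF v]]) blast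
  show ?thesis
  proof (rule A_equation_solution_cong[OF A(2)])
    fix p assume p: "p \<in> quadrant"
    have "A_fun v (fst p) (snd p) = A (fst p, snd p)"
      by (rule A_fun_eq[OF v A]) (use p in \<open>simp_all only: quadrant_def mem_Collect_eq\<close>)
    then show "A_fun v (fst p) (snd p) = A p" by simp
  qed
qed

section \<open>Positivity of the operators \<open>S\<^sub>T\<close>\<close>

lemma s_kernel_cong:
  assumes "\<And>x. x \<ge> 0 \<Longrightarrow> \<alpha> x = \<beta> x"
  shows "s_kernel \<alpha> x t = s_kernel \<beta> x t"
  unfolding s_kernel_def by (rule integral_cong) (simp add: assms)

lemma continuous_s_kernel:
  fixes \<alpha> :: "real \<Rightarrow> complex^'m1^'m2"
  assumes "continuous_on UNIV \<alpha>" "continuous_on UNIV f" "continuous_on UNIV g"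
  shows "continuous_on UNIV (\<lambda>p. s_kernel \<alpha> (f p) (g p))"
  unfolding s_kernel_def
  by (intro continuous_intros continuous_mm continuous_on_madj continuous_on_compose2[OF assms(1)]
      continuous_on_compose2[OF assms(2)] continuous_on_compose2[OF assms(3)]) auto

lemma continuous_matrix_vector_mult:
  fixes A :: "'a::topological_space \<Rightarrow> complex^'c^'r"
  assumes "continuous_on S A" "continuous_on S f"
  shows "continuous_on S (\<lambda>x. A x *v f x)"
  unfolding matrix_vector_mult_def
  by (intro continuous_on_vec_lambda continuous_intros continuous_on_component assms)

text \<open>Cutting off with 0 mediates between the Lebesgue integrals over [0, T] in
  \<open>S_op\<close> and the gauge integrals over [0, l] of the rest of the development.\<close>

lemma set_integral_restrict:
  fixes f :: "real \<Rightarrow> 'a::euclidean_space"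
  assumes f: "continuous_on UNIV f" and l: "l \<le> T"
  shows "(LINT x:{0..T}|lborel. (if x \<in> {0..l} then f x else 0)) = integral {0..l} f"
    and "set_integrable lborel {0..T} (\<lambda>x. if x \<in> {0..l} then f x else 0)"
proof -
  have e: "indicator {0..T} x *\<^sub>R (if x \<in> {0..l} then f x else 0) = indicator {0..l} x *\<^sub>R f x" for x
    using l by (auto simp: indicator_def)
  have i: "set_integrable lborel {0..l} f"
    by (rule borel_integrable_atLeastAtMost'[OF continuous_on_subset[OF f]]) simp
  show "(LINT x:{0..T}|lborel. (if x \<in> {0..l} then f x else 0)) = integral {0..l} f"
    using set_borel_integral_eq_integral(2)[OF i] unfolding set_lebesgue_integral_def e .
  show "set_integrable lborel {0..T} (\<lambda>x. if x \<in> {0..l} then f x else 0)"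
    using i unfolding set_integrable_def e .
qed

lemma Re_cinner: "Re (cinner u w) = u \<bullet> w"
  by (simp add: cinner_def inner_vec_def inner_complex_def)

text \<open>For functions vanishing beyond \<open>l\<close> the quadratic form of S_T is that of
  S_l, so a single \<epsilon> works for all l <= T. Lowering it to at most 1 prepares the homotopy
  from the identity to S_l.\<close>

lemma S_positive_vec:
  fixes \<alpha> :: "real \<Rightarrow> complex^'m1^'m2"
  assumes \<alpha>: "continuous_on UNIV \<alpha>" and S: "S_strictly_positive \<alpha>" and T: "T > 0"
  obtains \<epsilon> where "\<epsilon> > 0" "\<epsilon> \<le> 1" "\<And>l f. \<lbrakk>0 \<le> l; l \<le> T; continuous_on UNIV f\<rbrakk> \<Longrightarrow>
     \<epsilon> * integral {0..l} (\<lambda>x. (norm (f x))\<^sup>2)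
       \<le> integral {0..l} (\<lambda>x. f x \<bullet> (f x - integral {0..l} (\<lambda>t. s_kernel \<alpha> x t *v f t)))"
proof -
  obtain \<epsilon> where \<epsilon>: "\<epsilon> > 0" and pos: "\<And>f. L2_on T f \<Longrightarrow>
      \<epsilon> * (LINT x:{0..T}|lborel. (norm (f x))\<^sup>2) \<le> Re (LINT x:{0..T}|lborel. cinner (S_op \<alpha> T f x) (f x))"
    using S T unfolding S_strictly_positive_def by blast
  have main: "\<epsilon> * integral {0..l} (\<lambda>x. (norm (f x))\<^sup>2)
       \<le> integral {0..l} (\<lambda>x. f x \<bullet> (f x - integral {0..l} (\<lambda>t. s_kernel \<alpha> x t *v f t)))"
    if l: "0 \<le> l" "l \<le> T" and f: "continuous_on UNIV f" for l f
  proof -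
    define F where "F x = (if x \<in> {0..l} then f x else 0)" for x
    have cs: "continuous_on UNIV (\<lambda>t. s_kernel \<alpha> x t *v f t)" for x
      by (intro continuous_matrix_vector_mult continuous_s_kernel \<alpha> f continuous_intros)
    define g where "g x = f x - integral {0..l} (\<lambda>t. s_kernel \<alpha> x t *v f t)" for x
    have cg: "continuous_on UNIV g" unfolding g_def
      by (intro continuous_intros f continuous_matrix_vector_mult continuous_s_kernel \<alpha> continuous_on_compose2[OF f]) auto
    have Sop: "S_op \<alpha> T F x = F x - integral {0..l} (\<lambda>t. s_kernel \<alpha> x t *v f t)" for x
    proof -
      have "(LINT t:{0..T}|lborel. s_kernel \<alpha> x t *v F t) = (LINT t:{0..T}|lborel. (if t \<in> {0..l} then s_kernel \<alpha> x t *v f t else 0))"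
        by (rule arg_cong[of _ _ "set_lebesgue_integral lborel {0..T}"]) (auto simp: F_def)
      then show ?thesis unfolding S_op_def using set_integral_restrict(1)[OF cs l(2)] by simp
    qed
    have n: "(norm (F x))\<^sup>2 = (if x \<in> {0..l} then (norm (f x))\<^sup>2 else 0)" for x by (simp add: F_def)
    have cn: "continuous_on UNIV (\<lambda>x. (norm (f x))\<^sup>2)" by (intro continuous_intros f)
    have "F \<in> borel_measurable lborel"
    proof -
      have "F = (\<lambda>x. indicator {0..l} x *\<^sub>R f x)" by (auto simp: F_def)
      moreover have "(\<lambda>x. indicator {0..l} x *\<^sub>R f x) \<in> borel_measurable borel"
        by (intro borel_measurable_scaleR borel_measurable_indicator borel_measurable_continuous_onI f) auto
      ultimately show ?thesis by simp
    qed
    then have L2: "L2_on T F" unfolding L2_on_def n using set_integral_restrict(2)[OF cn l(2)] by simp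
    have c: "cinner (S_op \<alpha> T F x) (F x) = (if x \<in> {0..l} then cinner (g x) (f x) else 0)" for x
      by (simp add: Sop F_def g_def cinner_def)
    have cc: "continuous_on UNIV (\<lambda>x. cinner (g x) (f x))" unfolding cinner_def
      by (intro continuous_intros continuous_on_component f cg)
    have "Re (integral {0..l} (\<lambda>x. cinner (g x) (f x))) = integral {0..l} (\<lambda>x. f x \<bullet> g x)"
      using integral_linear[OF integrable_cont[OF cc] bounded_linear_Re, of 0 l]
      by (simp add: o_def Re_cinner inner_commute)
    then show ?thesis
      using pos[OF L2] unfolding n c set_integral_restrict(1)[OF cn l(2)] set_integral_restrict(1)[OF cc l(2)]
      by (simp add: g_def)
  qed
  show thesis
  proof (rule that[of "min 1 \<epsilon>"])
    fix l f assume a: "0 \<le> l" "l \<le> T" "continuous_on UNIV (f :: real \<Rightarrow> complex^'m2)"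
    have "min 1 \<epsilon> * integral {0..l} (\<lambda>x. (norm (f x))\<^sup>2) \<le> \<epsilon> * integral {0..l} (\<lambda>x. (norm (f x))\<^sup>2)"
      by (rule mult_right_mono) (auto simp: integral_norm_power2_nonneg)
    also note main[OF a]
    finally show "min 1 \<epsilon> * integral {0..l} (\<lambda>x. (norm (f x))\<^sup>2)
       \<le> integral {0..l} (\<lambda>x. f x \<bullet> (f x - integral {0..l} (\<lambda>t. s_kernel \<alpha> x t *v f t)))" .
  qed (use \<epsilon> in auto)
qed

lemma inner_columns: "M \<bullet> N = (\<Sum>j\<in>UNIV. column j M \<bullet> column j (N :: complex^'c^'r))"
  by (simp add: inner_vec_def column_def) (rule sum.swap)

lemma bounded_linear_column: "bounded_linear (\<lambda>M :: complex^'c^'r. column j M)"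
proof (rule bounded_linear_intro[of _ 1])
  fix M :: "complex^'c^'r"
  have "(norm (column j M))\<^sup>2 \<le> (norm M)\<^sup>2"
    unfolding power2_norm_eq_inner inner_columns[of M]
    by (rule member_le_sum) auto
  then show "norm (column j M) \<le> norm M * 1" by simp
qed (auto simp: column_def vec_eq_iff)

text \<open>The operator acts on each column of a matrix function separately; the vector inequality
  is summed over the columns.\<close>

lemma S_positive_mat:
  fixes \<alpha> :: "real \<Rightarrow> complex^'m1^'m2"
  assumes \<alpha>: "continuous_on UNIV \<alpha>" and S: "S_strictly_positive \<alpha>" and T: "T > 0"
  obtains \<epsilon> where "\<epsilon> > 0" "\<epsilon> \<le> 1" "\<And>l (f :: real \<Rightarrow> complex^'m1^'m2). \<lbrakk>0 \<le> l; l \<le> T; continuous_on UNIV f\<rbrakk> \<Longrightarrow>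
     \<epsilon> * integral {0..l} (\<lambda>x. (norm (f x))\<^sup>2)
       \<le> integral {0..l} (\<lambda>x. f x \<bullet> (f x - integral {0..l} (\<lambda>t. s_kernel \<alpha> x t ** f t)))"
proof -
  obtain \<epsilon> where \<epsilon>: "\<epsilon> > 0" "\<epsilon> \<le> 1" and pos: "\<And>l f. \<lbrakk>0 \<le> l; l \<le> T; continuous_on UNIV f\<rbrakk> \<Longrightarrow>
     \<epsilon> * integral {0..l} (\<lambda>x. (norm (f x))\<^sup>2)
       \<le> integral {0..l} (\<lambda>x. f x \<bullet> (f x - integral {0..l} (\<lambda>t. s_kernel \<alpha> x t *v f t)))"
    by (rule S_positive_vec[OF assms]) blast
  have "\<epsilon> * integral {0..l} (\<lambda>x. (norm (f x))\<^sup>2)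
       \<le> integral {0..l} (\<lambda>x. f x \<bullet> (f x - integral {0..l} (\<lambda>t. s_kernel \<alpha> x t ** f t)))"
    if l: "0 \<le> l" "l \<le> T" and f: "continuous_on UNIV f" for l and f :: "real \<Rightarrow> complex^'m1^'m2"
  proof -
    define F where "F j x = column j (f x)" for j x
    have cF: "continuous_on UNIV (F j)" for j
      unfolding F_def by (rule bounded_linear.continuous_on[OF bounded_linear_column f])
    have ck: "continuous_on UNIV (\<lambda>t. s_kernel \<alpha> x t ** f t)" for x
      by (intro continuous_mm continuous_s_kernel \<alpha> f continuous_intros)
    have cv: "continuous_on UNIV (\<lambda>x. integral {0..l} (\<lambda>t. s_kernel \<alpha> x t *v F j t))" for j
      by (intro continuous_intros continuous_matrix_vector_mult continuous_s_kernel \<alpha> continuous_on_compose2[OF cF]) auto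
    have col: "column j (integral {0..l} (\<lambda>t. s_kernel \<alpha> x t ** f t)) = integral {0..l} (\<lambda>t. s_kernel \<alpha> x t *v F j t)" for j x
    proof -
      have "column j (M ** N) = M *v column j N" for M :: "complex^'m2^'m2" and N :: "complex^'m1^'m2"
        by (simp add: vec_eq_iff column_def matrix_matrix_mult_def matrix_vector_mult_def)
      then show ?thesis
        using integral_linear[OF integrable_cont[OF ck[of x]] bounded_linear_column[of j], of 0 l] by (simp add: o_def F_def)
    qed
    have "\<epsilon> * integral {0..l} (\<lambda>x. (norm (f x))\<^sup>2) = (\<Sum>j\<in>UNIV. \<epsilon> * integral {0..l} (\<lambda>x. (norm (F j x))\<^sup>2))"
      unfolding sum_distrib_left[symmetric] power2_norm_eq_inner inner_columns[of "f _"] F_def[symmetric]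
      by (subst integral_sum) (auto intro!: integrable_cont continuous_intros cF)
    also have "\<dots> \<le> (\<Sum>j\<in>UNIV. integral {0..l} (\<lambda>x. F j x \<bullet> (F j x - integral {0..l} (\<lambda>t. s_kernel \<alpha> x t *v F j t))))"
      by (rule sum_mono) (rule pos[OF l cF])
    also have "\<dots> = integral {0..l} (\<lambda>x. \<Sum>j\<in>UNIV. F j x \<bullet> (F j x - integral {0..l} (\<lambda>t. s_kernel \<alpha> x t *v F j t)))"
      by (subst integral_sum) (auto intro!: integrable_cont continuous_intros cF cv)
    also have "\<dots> = integral {0..l} (\<lambda>x. f x \<bullet> (f x - integral {0..l} (\<lambda>t. s_kernel \<alpha> x t ** f t)))"
      unfolding inner_columns[of "f _"] linear_diff[OF bounded_linear.linear[OF bounded_linear_column]] col F_def ..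
    finally show ?thesis .
  qed
  then show thesis using \<epsilon> that by blast
qed

text \<open>I - \<theta> K is the convex combination (1 - \<theta>) I + \<theta> S_l and hence
  bounded below by \<epsilon> <= 1. Testing with f bounds its integral norm by T H / \<epsilon>;
  since K maps L^1 into bounded functions, f = (f - \<theta> K f) + \<theta> K f is bounded
  pointwise. The bound is uniform in l and \<theta>, and so is everything derived from it.\<close>

lemma S_apriori:
  fixes \<alpha> :: "real \<Rightarrow> complex^'m1^'m2"
  assumes \<alpha>: "continuous_on UNIV \<alpha>" and S: "S_strictly_positive \<alpha>" and T: "T > 0"
  obtains C where "C \<ge> 1" "\<And>l \<theta> H x (f :: real \<Rightarrow> complex^'m1^'m2). \<lbrakk>0 \<le> l; l \<le> T; continuous_on UNIV f; 0 \<le> \<theta>; \<theta> \<le> 1;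
      \<And>x. x \<in> {0..l} \<Longrightarrow> norm (f x - \<theta> *\<^sub>R integral {0..l} (\<lambda>t. s_kernel \<alpha> x t ** f t)) \<le> H; x \<in> {0..l}\<rbrakk>
      \<Longrightarrow> norm (f x) \<le> C * H"
proof -
  obtain \<epsilon> where \<epsilon>: "\<epsilon> > 0" "\<epsilon> \<le> 1" and pos: "\<And>l (f :: real \<Rightarrow> complex^'m1^'m2). \<lbrakk>0 \<le> l; l \<le> T; continuous_on UNIV f\<rbrakk> \<Longrightarrow>
     \<epsilon> * integral {0..l} (\<lambda>x. (norm (f x))\<^sup>2)
       \<le> integral {0..l} (\<lambda>x. f x \<bullet> (f x - integral {0..l} (\<lambda>t. s_kernel \<alpha> x t ** f t)))"
    by (rule S_positive_mat[OF assms]) blast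
  obtain M where M: "M \<ge> 1" "\<And>p. p \<in> {0..T} \<times> {0..T} \<Longrightarrow> norm (s_kernel \<alpha> (fst p) (snd p)) \<le> M"
    by (rule compact_norm_bound[OF continuous_s_kernel[OF \<alpha>, of fst snd], of "{0..T} \<times> {0..T}"])
       (auto intro!: continuous_intros compact_Times)
  have "norm (f x) \<le> (1 + M * (T / \<epsilon>)) * H"
    if l: "0 \<le> l" "l \<le> T" and f: "continuous_on UNIV f" and \<theta>: "0 \<le> \<theta>" "\<theta> \<le> 1"
     and H: "\<And>x. x \<in> {0..l} \<Longrightarrow> norm (f x - \<theta> *\<^sub>R integral {0..l} (\<lambda>t. s_kernel \<alpha> x t ** f t)) \<le> H" and x: "x \<in> {0..l}"
    for l \<theta> H x and f :: "real \<Rightarrow> complex^'m1^'m2"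
  proof -
    define K where "K x = integral {0..l} (\<lambda>t. s_kernel \<alpha> x t ** f t)" for x
    define N where "N = integral {0..l} (\<lambda>x. norm (f x))"
    define E where "E = integral {0..l} (\<lambda>x. (norm (f x))\<^sup>2)"
    have cK: "continuous_on UNIV K" unfolding K_def
      by (intro continuous_intros continuous_mm continuous_s_kernel \<alpha> continuous_on_compose2[OF f]) auto
    have N0: "N \<ge> 0" unfolding N_def by (rule integral_nonneg) (auto intro!: integrable_cont continuous_intros f)
    have H0: "H \<ge> 0" using H[OF x] norm_ge_zero order_trans by blast
    have E0: "E \<ge> 0" unfolding E_def by (rule integral_norm_power2_nonneg)
    have iE: "(\<lambda>x. (norm (f x))\<^sup>2) integrable_on {0..l}" by (intro integrable_cont continuous_intros f)
    have iK: "(\<lambda>x. f x \<bullet> (f x - K x)) integrable_on {0..l}" by (intro integrable_cont continuous_intros f cK)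
    \<comment> \<open>Convexity in \<theta>: both endpoint operators are bounded below by
      \<epsilon>.\<close>
    have "\<epsilon> * E \<le> (1 - \<theta>) * E + \<theta> * (\<epsilon> * E)"
    proof -
      have "(1 - \<theta>) * (1 - \<epsilon>) * E \<ge> 0" using \<theta> \<epsilon> E0 by simp
      then show ?thesis by (simp add: algebra_simps)
    qed
    also have "\<dots> \<le> (1 - \<theta>) * E + \<theta> * integral {0..l} (\<lambda>x. f x \<bullet> (f x - K x))"
      using mult_left_mono[OF pos[OF l f] \<theta>(1)] by (simp add: K_def E_def)
    also have "\<dots> = integral {0..l} (\<lambda>x. (1 - \<theta>) * (norm (f x))\<^sup>2 + \<theta> * (f x \<bullet> (f x - K x)))"
      using integral_add[OF integrable_cmul[OF iE, of "1 - \<theta>"] integrable_cmul[OF iK, of \<theta>]] by (simp add: E_def)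
    also have "\<dots> = integral {0..l} (\<lambda>x. f x \<bullet> (f x - \<theta> *\<^sub>R K x))"
      by (rule integral_cong) (simp add: power2_norm_eq_inner algebra_simps)
    also have "\<dots> \<le> integral {0..l} (\<lambda>x. H * norm (f x))"
    proof (rule integral_le)
      fix x assume x: "x \<in> {0..l}"
      have "f x \<bullet> (f x - \<theta> *\<^sub>R K x) \<le> norm (f x) * norm (f x - \<theta> *\<^sub>R K x)" by (rule norm_cauchy_schwarz)
      also have "\<dots> \<le> norm (f x) * H" by (rule mult_left_mono) (use H[OF x] in \<open>simp_all add: K_def\<close>)
      finally show "f x \<bullet> (f x - \<theta> *\<^sub>R K x) \<le> H * norm (f x)" by (simp add: mult.commute)
    qed (intro integrable_cont continuous_intros f cK)+
    also have "\<dots> = H * N" by (simp add: N_def)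
    finally have E: "\<epsilon> * E \<le> H * N" .
    \<comment> \<open>Cauchy-Schwarz against the constant 1 gives N^2 <= l E; with \<epsilon> E <= H
      N one power of N cancels.\<close>
    have "N\<^sup>2 \<le> l * E"
      using integral_Cauchy_Schwarz[of 0 l "\<lambda>x. norm (f x)" "\<lambda>_. 1"] l continuous_on_subset[OF f]
      by (simp add: N_def E_def continuous_on_norm)
    then have "\<epsilon> * N\<^sup>2 \<le> l * (\<epsilon> * E)" using \<epsilon> by (simp add: mult.left_commute)
    also have "\<dots> \<le> l * (H * N)" by (rule mult_left_mono[OF E l(1)])
    also have "\<dots> \<le> T * (H * N)" by (rule mult_right_mono[OF l(2)]) (use H0 N0 in simp)
    finally have "(\<epsilon> * N) * N \<le> (T * H) * N" by (simp add: power2_eq_square mult_ac)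
    then have "\<epsilon> * N \<le> T * H"
    proof (cases "N = 0")
      case True then show ?thesis using T H0 by simp
    next
      case False
      then show ?thesis using \<open>(\<epsilon> * N) * N \<le> (T * H) * N\<close> N0 mult_right_le_imp_le[of "\<epsilon> * N" N "T * H"] by simp
    qed
    then have NH: "N \<le> T * H / \<epsilon>" using \<epsilon> by (simp add: pos_le_divide_eq mult.commute)
    have "norm (K x) \<le> integral {0..l} (\<lambda>t. M * norm (f t))" unfolding K_def
    proof (rule integral_norm_bound_integral)
      show "(\<lambda>t. s_kernel \<alpha> x t ** f t) integrable_on {0..l}"
        by (intro integrable_cont continuous_mm continuous_s_kernel \<alpha> f continuous_intros)
      show "(\<lambda>t. M * norm (f t)) integrable_on {0..l}" by (intro integrable_cont continuous_intros f)
      fix t assume t: "t \<in> {0..l}"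
      have "norm (s_kernel \<alpha> x t ** f t) \<le> norm (s_kernel \<alpha> x t) * norm (f t)" by (rule norm_matrix_mult)
      also have "\<dots> \<le> M * norm (f t)" by (rule mult_right_mono) (use M(2)[of "(x, t)"] x t l in auto)
      finally show "norm (s_kernel \<alpha> x t ** f t) \<le> M * norm (f t)" .
    qed
    also have "\<dots> = M * N" by (simp add: N_def)
    also have "\<dots> \<le> M * (T * H / \<epsilon>)" by (rule mult_left_mono[OF NH]) (use M in simp)
    finally have Kx: "norm (K x) \<le> M * (T * H / \<epsilon>)" .
    have "norm (\<theta> *\<^sub>R K x) \<le> norm (K x)" using \<theta> by (simp add: mult_left_le_one_le)
    then have "norm (\<theta> *\<^sub>R K x) \<le> M * (T * H / \<epsilon>)" using Kx by (rule order_trans)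
    moreover have "norm (f x) \<le> norm (f x - \<theta> *\<^sub>R K x) + norm (\<theta> *\<^sub>R K x)" by (metis diff_add_cancel norm_triangle_ineq)
    ultimately have "norm (f x) \<le> H + M * (T * H / \<epsilon>)" using H[OF x] unfolding K_def[symmetric] by linarith
    then show ?thesis by (simp add: algebra_simps)
  qed
  moreover have "1 + M * (T / \<epsilon>) \<ge> 1" using M T \<epsilon> by simp
  ultimately show thesis using that by blast
qed

section \<open>Integral equations depending on a parameter\<close>

lemma continuous_clamp:
  fixes f :: "real \<Rightarrow> 'a::topological_space"
  assumes "continuous_on {0..b} f" "b \<ge> 0"
  shows "continuous_on UNIV (\<lambda>t. f (max 0 (min b t)))"
  by (rule continuous_on_compose2[OF assms(1)]) (use assms(2) in \<open>auto intro!: continuous_intros\<close>)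

lemma norm_kernel_integral_le:
  fixes k :: "real \<Rightarrow> real \<Rightarrow> complex^'m2^'m2" and f :: "real \<Rightarrow> complex^'m1^'m2"
  assumes k: "continuous_on UNIV (\<lambda>p. k (fst p) (snd p))" and f: "continuous_on UNIV f"
    and M: "\<And>t. t \<in> {0..1} \<Longrightarrow> norm (k y t) \<le> M" and c: "\<And>t. t \<in> {0..1} \<Longrightarrow> norm (f t) \<le> c"
  shows "norm (integral {0..1} (\<lambda>t. k y t ** f t)) \<le> M * c"
proof -
  have "norm (integral {0..1} (\<lambda>t. k y t ** f t)) \<le> integral {0..1::real} (\<lambda>t. M * c)"
  proof (rule integral_norm_bound_integral)
    show "(\<lambda>t. k y t ** f t) integrable_on {0..1}"
      by (intro integrable_cont continuous_mm f continuous_on_uncurry[OF k] continuous_intros)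
    fix t :: real assume t: "t \<in> {0..1}"
    have "M \<ge> 0" using M[OF t] norm_ge_zero order_trans by blast
    then show "norm (k y t ** f t) \<le> M * c"
      by (rule order_trans[OF norm_matrix_mult mult_mono[OF M[OF t] c[OF t]]]) simp
  qed (intro integrable_cont continuous_intros)
  then show ?thesis by simp
qed

lemma continuous_kernel_integral:
  fixes k :: "real \<Rightarrow> real \<Rightarrow> complex^'m2^'m2" and f :: "real \<Rightarrow> complex^'m1^'m2"
  assumes k: "continuous_on UNIV (\<lambda>p. k (fst p) (snd p))" and f: "continuous_on UNIV f"
  shows "continuous_on UNIV (\<lambda>y. integral {0..1} (\<lambda>t. k y t ** f t))"
  by (intro continuous_integral_upto' continuous_intros continuous_mm k continuous_on_compose2[OF f]) auto

lemma kernel_integral_diff: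
  fixes k :: "real \<Rightarrow> real \<Rightarrow> complex^'m2^'m2" and f :: "real \<Rightarrow> complex^'m1^'m2"
  assumes k: "continuous_on UNIV (\<lambda>p. k (fst p) (snd p))" and f: "continuous_on UNIV f" and g: "continuous_on UNIV g"
  shows "integral {0..1} (\<lambda>t. k y t ** (f t - g t)) = integral {0..1} (\<lambda>t. k y t ** f t) - integral {0..1} (\<lambda>t. k y t ** g t)"
  unfolding mm.diff_right
  by (rule integral_diff; intro integrable_cont continuous_mm f g continuous_on_uncurry[OF k] continuous_intros)

text \<open>Method of continuity: the a priori bound is uniform in the homotopy parameter \<open>\<theta>\<close>,
  so a fixed number of contraction steps of length \<open>1/n\<close> leads from \<open>\<theta> = 0\<close> to \<open>\<theta> = 1\<close>.\<close>
lemma fredholm_exists: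
  fixes k :: "real \<Rightarrow> real \<Rightarrow> complex^'m2^'m2" and h :: "real \<Rightarrow> complex^'m1^'m2"
  assumes k: "continuous_on UNIV (\<lambda>p. k (fst p) (snd p))" and h: "continuous_on UNIV h"
    and C: "C \<ge> 1" and apriori: "\<And>\<theta> H x (f :: real \<Rightarrow> complex^'m1^'m2). \<lbrakk>continuous_on UNIV f; 0 \<le> \<theta>; \<theta> \<le> 1;
      \<And>y. y \<in> {0..1} \<Longrightarrow> norm (f y - \<theta> *\<^sub>R integral {0..1} (\<lambda>t. k y t ** f t)) \<le> H; x \<in> {0..1}\<rbrakk> \<Longrightarrow> norm (f x) \<le> C * H"
  shows "\<exists>f. continuous_on UNIV f \<and> (\<forall>y. f y - integral {0..1} (\<lambda>t. k y t ** f t) = h y)"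
proof -
  obtain M where M: "M \<ge> 1" "\<And>p. p \<in> {0..1} \<times> {0..1} \<Longrightarrow> norm (k (fst p) (snd p)) \<le> M"
    by (rule compact_norm_bound[OF k, of "{0..1} \<times> {0..1}"]) (auto intro: compact_Times)
  have Mk: "norm (k y t) \<le> M" if "y \<in> {0..1}" "t \<in> {0..1}" for y t using M(2)[of "(y, t)"] that by auto
  define Kf where "Kf f y = integral {0..1} (\<lambda>t. k y t ** f t)" for f :: "real \<Rightarrow> complex^'m1^'m2" and y
  have cK: "continuous_on UNIV (Kf f)" if "continuous_on UNIV f" for f
    unfolding Kf_def by (rule continuous_kernel_integral[OF k that])
  have Kdiff: "Kf (\<lambda>t. f t - g t) y = Kf f y - Kf g y" if "continuous_on UNIV f" "continuous_on UNIV g" for f g y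
    unfolding Kf_def by (rule kernel_integral_diff[OF k that])
  have Kcong: "Kf f y = Kf g y" if "\<And>t. t \<in> {0..1} \<Longrightarrow> f t = g t" for f g y
    unfolding Kf_def by (rule integral_cong) (simp add: that)
  note apr = apriori[folded Kf_def]
  \<comment> \<open>A step of length 1/n in \<theta> perturbs the equation by an operator of norm
    M/n, and solving costs a factor C; the composition contracts with factor 1/2 once n >= 2 C
    M.\<close>
  obtain n :: nat where n: "real n \<ge> 2 * C * M" using real_arch_simple by blast
  have "2 * C * M > 0" using C M by simp
  then have n0: "n > 0" using n by (cases n) auto
  have "\<forall>h. continuous_on UNIV h \<longrightarrow> (\<exists>f. continuous_on UNIV f \<and> (\<forall>y. f y - (real j / real n) *\<^sub>R Kf f y = h y))"
    if "j \<le> n" for j using that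
  proof (induction j)
    case 0
    then show ?case by auto
  next
    case (Suc j)
    define \<theta> where "\<theta> = real j / real n"
    have \<theta>: "0 \<le> \<theta>" "\<theta> \<le> 1" using Suc.prems by (auto simp: \<theta>_def divide_le_eq_1)
    \<comment> \<open>The solution operator at the parameter already reached, chosen from the
      induction hypothesis.\<close>
    define R where "R h = (SOME f. continuous_on UNIV f \<and> (\<forall>y. f y - \<theta> *\<^sub>R Kf f y = h y))" for h
    have "continuous_on UNIV (R h) \<and> (\<forall>y. R h y - \<theta> *\<^sub>R Kf (R h) y = h y)" if "continuous_on UNIV h" for h
    proof -
      have "\<exists>f. continuous_on UNIV f \<and> (\<forall>y. f y - \<theta> *\<^sub>R Kf f y = h y)"
        using Suc.IH[OF Suc_leD[OF Suc.prems]] that unfolding \<theta>_def by blast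
      from someI_ex[OF this] show ?thesis unfolding R_def .
    qed
    then have cR: "\<And>h. continuous_on UNIV h \<Longrightarrow> continuous_on UNIV (R h)"
      and R: "\<And>h y. continuous_on UNIV h \<Longrightarrow> R h y - \<theta> *\<^sub>R Kf (R h) y = h y" by blast+
    show ?case
    proof (intro allI impI)
      fix h :: "real \<Rightarrow> complex^'m1^'m2" assume h: "continuous_on UNIV h"
      \<comment> \<open>The integral operator sees values on [0, 1] only. The fixed point is taken
        in the continuous functions on this interval, and clamping extends them to the line for use
        under the operator.\<close>
      define cl where "cl f t = f (max 0 (min 1 t))" for f :: "real \<Rightarrow> complex^'m1^'m2" and t
      have ccl: "continuous_on UNIV (cl f)" if "continuous_on {0..1} f" for f
        unfolding cl_def by (rule continuous_clamp[OF that]) simp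
      define r where "r f y = h y + (1 / real n) *\<^sub>R Kf (cl f) y" for f y
      have cr: "continuous_on UNIV (r f)" if "continuous_on {0..1} f" for f
        unfolding r_def by (intro continuous_intros h cK ccl that)
      define F where "F f = R (r f)" for f
      have cF: "continuous_on UNIV (F f)" if "continuous_on {0..1} f" for f unfolding F_def by (rule cR[OF cr[OF that]])
      obtain c0 where c0: "c0 \<ge> 1" "\<And>y. y \<in> {0..1} \<Longrightarrow> norm (F h y - h y) \<le> c0"
        by (rule compact_norm_bound[OF continuous_on_diff[OF cF[OF continuous_on_subset[OF h subset_UNIV]] h] compact_Icc[of 0 1]]) blast
      obtain f where f: "f \<in> {f. continuous_on {0..1} f}" "\<And>y. y \<in> {0..1} \<Longrightarrow> F f y = f y"
      proof (rule weighted_fixpoint[of "{f. continuous_on {0..1} f}" F "{0..1}" "\<lambda>_. 1" h c0])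
        show "F f \<in> {f. continuous_on {0..1} f}" if "f \<in> {f. continuous_on {0..1} f}" for f :: "real \<Rightarrow> complex^'m1^'m2"
          using that cF[of f] continuous_on_subset by blast
        show "h \<in> {f. continuous_on {0..1} f}" using h continuous_on_subset by blast
        show "norm (F h y - h y) \<le> c0 * 1" if "y \<in> {0..1}" for y using c0(2)[OF that] by simp
        show "c0 \<ge> 0" using c0 by simp
        show "f \<in> {f. continuous_on {0..1} f}"
          if 1: "\<And>n. hh n \<in> {f. continuous_on {0..1} f}" and 2: "\<And>n y. y \<in> {0..1} \<Longrightarrow> norm (hh n y - f y) \<le> C * (1/2)^n * 1" for hh and f :: "real \<Rightarrow> complex^'m1^'m2" and C
        proof -
          have "continuous_on {0..1} f"
            by (rule continuous_weighted_limit[of "{0..1}" hh f C "\<lambda>_. 1"]) (use 1 2 in auto)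
          then show ?thesis by simp
        qed
        fix f g :: "real \<Rightarrow> complex^'m1^'m2" and c x
        assume f: "f \<in> {f. continuous_on {0..1} f}" and g: "g \<in> {f. continuous_on {0..1} f}" and c: "c \<ge> (0::real)"
          and d: "\<And>p. p \<in> {0..1} \<Longrightarrow> norm (f p - g p) \<le> c * 1" and x: "x \<in> {0..1::real}"
        have cf: "continuous_on {0..1} f" and cg: "continuous_on {0..1} g" using f g by auto
        have "norm (F f x - F g x) \<le> C * (M * c / real n)"
        proof (rule apr[OF _ \<theta> _ x])
          show "continuous_on UNIV (\<lambda>x. F f x - F g x)" by (intro continuous_intros cF cf cg)
          fix y :: real assume y: "y \<in> {0..1}"
          have "F f y - F g y - \<theta> *\<^sub>R Kf (\<lambda>x. F f x - F g x) y = r f y - r g y"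
          proof -
            have "F f y - \<theta> *\<^sub>R Kf (F f) y = r f y" "F g y - \<theta> *\<^sub>R Kf (F g) y = r g y"
              unfolding F_def by (rule R[OF cr[OF cf]], rule R[OF cr[OF cg]])
            moreover have "Kf (\<lambda>x. F f x - F g x) y = Kf (F f) y - Kf (F g) y"
              by (rule Kdiff[OF cF[OF cf] cF[OF cg]])
            moreover have "F f y - F g y - (\<theta> *\<^sub>R Kf (F f) y - \<theta> *\<^sub>R Kf (F g) y)
                = (F f y - \<theta> *\<^sub>R Kf (F f) y) - (F g y - \<theta> *\<^sub>R Kf (F g) y)" by simp
            ultimately show ?thesis by (simp only: scaleR_diff_right)
          qed
          also have "\<dots> = (1 / real n) *\<^sub>R Kf (\<lambda>t. cl f t - cl g t) y"
            unfolding Kdiff[OF ccl[OF cf] ccl[OF cg]] by (simp add: r_def scaleR_diff_right)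
          finally have "norm (F f y - F g y - \<theta> *\<^sub>R Kf (\<lambda>x. F f x - F g x) y) = norm (Kf (\<lambda>t. cl f t - cl g t) y) / real n"
            by simp
          also have "\<dots> \<le> M * c / real n"
          proof (rule divide_right_mono)
            show "norm (Kf (\<lambda>t. cl f t - cl g t) y) \<le> M * c" unfolding Kf_def
              by (rule norm_kernel_integral_le[OF k]) (use Mk[OF y] d in \<open>auto simp: cl_def intro!: continuous_intros ccl[OF cf, unfolded cl_def] ccl[OF cg, unfolded cl_def]\<close>)
          qed simp
          finally show "norm (F f y - F g y - \<theta> *\<^sub>R Kf (\<lambda>x. F f x - F g x) y) \<le> M * c / real n" .
        qed
        also have "\<dots> \<le> c / 2 * 1"
        proof -
          have "(2 * C * M) * c \<le> real n * c" by (rule mult_right_mono[OF n c])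
          then show ?thesis using n0 by (simp add: field_simps)
        qed
        finally show "norm (F f x - F g x) \<le> c / 2 * 1" .
      next
        fix f :: "real \<Rightarrow> complex^'m1^'m2" assume "f \<in> {f. continuous_on {0..1} f}" "\<And>p. p \<in> {0..1} \<Longrightarrow> F f p = f p"
        then show thesis by (rule that)
      qed auto
      then have cf: "continuous_on {0..1} f" by simp
      have "F f y - (real (Suc j) / real n) *\<^sub>R Kf (F f) y = h y" for y
      proof -
        have "Kf (cl f) y = Kf (F f) y" by (rule Kcong) (simp add: cl_def f(2))
        then have "F f y - \<theta> *\<^sub>R Kf (F f) y = h y + (1 / real n) *\<^sub>R Kf (F f) y"
          using R[OF cr[OF cf], of y] by (simp add: F_def r_def)
        then show ?thesis by (simp add: \<theta>_def add_divide_distrib algebra_simps)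
      qed
      then show "\<exists>f. continuous_on UNIV f \<and> (\<forall>y. f y - (real (Suc j) / real n) *\<^sub>R Kf f y = h y)"
        using cF[OF cf] by blast
    qed
  qed
  from this[OF order_refl] h n0 show ?thesis unfolding Kf_def by simp
qed

text \<open>The difference of the solutions for p and p0 solves the equation for p with a residual
  that depends continuously on (p, y) and vanishes at p = p0. Compactness of [0, 1] makes this
  residual uniformly small near p0, and the a priori bound transfers that to the solutions.\<close>

lemma fredholm_continuous:
  fixes k :: "'p::metric_space \<Rightarrow> real \<Rightarrow> real \<Rightarrow> complex^'m2^'m2" and h f :: "'p \<Rightarrow> real \<Rightarrow> complex^'m1^'m2"
  assumes k: "continuous_on UNIV (\<lambda>q. k (fst q) (fst (snd q)) (snd (snd q)))"
    and h: "continuous_on UNIV (\<lambda>q. h (fst q) (snd q))"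
    and C: "C \<ge> 1" and apriori: "\<And>p H x (f :: real \<Rightarrow> complex^'m1^'m2). \<lbrakk>continuous_on UNIV f;
      \<And>y. y \<in> {0..1} \<Longrightarrow> norm (f y - integral {0..1} (\<lambda>t. k p y t ** f t)) \<le> H; x \<in> {0..1}\<rbrakk> \<Longrightarrow> norm (f x) \<le> C * H"
    and f: "\<And>p. continuous_on UNIV (f p)" "\<And>p y. f p y - integral {0..1} (\<lambda>t. k p y t ** f p t) = h p y"
  shows "continuous_on UNIV (\<lambda>q. f (fst q) (snd q))"
proof -
  have k': "continuous_on S (\<lambda>x. k (a x) (b x) (c x))" if "continuous_on S a" "continuous_on S b" "continuous_on S c"
    for S :: "'z::topological_space set" and a b c
    using continuous_on_compose2[OF k continuous_on_Pair[OF that(1) continuous_on_Pair[OF that(2,3)]]] by simp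
  have kp: "continuous_on UNIV (\<lambda>q. k p (fst q) (snd q))" for p by (intro k' continuous_intros)
  define cl where "cl y = max 0 (min 1 y)" for y :: real
  have ccl: "continuous_on U cl" for U unfolding cl_def by (intro continuous_intros)
  have cl01: "cl y \<in> {0..1}" for y by (auto simp: cl_def)
  have cf: "continuous_on UNIV (\<lambda>q. f (fst q) (cl (snd q)))"
  proof (rule continuous_at_imp_continuous_on, intro ballI)
    fix q0 :: "'p \<times> real"
    obtain p0 y0 where q0: "q0 = (p0, y0)" by (cases q0)
    define r where "r p y = h p y - h p0 y + integral {0..1} (\<lambda>t. (k p y t - k p0 y t) ** f p0 t)" for p y
    have cr: "continuous_on UNIV (\<lambda>q. r (fst q) (snd q))" unfolding r_def
      by (intro continuous_intros continuous_on_uncurry[OF h] continuous_mm continuous_integral_upto' k' continuous_on_compose2[OF f(1)]) auto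
    have res: "f p y - f p0 y - integral {0..1} (\<lambda>t. k p y t ** (f p t - f p0 t)) = r p y" for p y
    proof -
      have "integral {0..1} (\<lambda>t. (k p y t - k p0 y t) ** f p0 t) = integral {0..1} (\<lambda>t. k p y t ** f p0 t) - integral {0..1} (\<lambda>t. k p0 y t ** f p0 t)"
        unfolding mm.diff_left
        by (rule integral_diff; intro integrable_cont continuous_mm f k' continuous_intros)
      then show ?thesis unfolding r_def kernel_integral_diff[OF kp f(1) f(1)] f(2)[symmetric] by simp
    qed
    have r0: "r p0 y = 0" for y by (simp add: r_def)
    have "((\<lambda>q. f (fst q) (cl (snd q)) - f p0 (cl (snd q))) \<longlongrightarrow> 0) (at q0)"
    proof (rule tendstoI)
      fix e :: real assume e: "e > 0"
      have "e / (2 * C) > 0" using e C by simp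
      from continuous_on_prod_compactE[OF continuous_on_subset[OF cr subset_UNIV, of "UNIV \<times> {0..1}"] compact_Icc UNIV_I[of p0] this]
      obtain X0 where X0: "p0 \<in> X0" "open X0" "\<forall>p\<in>X0 \<inter> UNIV. \<forall>y\<in>{0..1}. dist (r (fst (p, y)) (snd (p, y))) (r (fst (p0, y)) (snd (p0, y))) \<le> e / (2 * C)"
        by blast
      have "norm (f p y - f p0 y) < e" if p: "p \<in> X0" and y: "y \<in> {0..1}" for p y
      proof -
        have "norm (f p y - f p0 y) \<le> C * (e / (2 * C))"
        proof (rule apriori[OF _ _ y, of "\<lambda>y. f p y - f p0 y" p])
          show "continuous_on UNIV (\<lambda>y. f p y - f p0 y)" by (intro continuous_intros f)
          show "norm (f p y - f p0 y - integral {0..1} (\<lambda>t. k p y t ** (f p t - f p0 t))) \<le> e / (2 * C)" if "y \<in> {0..1}" for y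
            unfolding res using X0(3) p that r0 by (simp add: dist_norm)
        qed
        also have "\<dots> < e" using e C by simp
        finally show ?thesis .
      qed
      then have *: "dist (f (fst q) (cl (snd q)) - f p0 (cl (snd q))) 0 < e" if "fst q \<in> X0" for q
        using that cl01 by simp
      have "\<forall>\<^sub>F q in at q0. fst q \<in> X0"
        by (rule topological_tendstoD[OF tendsto_fst[OF tendsto_ident_at]]) (use X0 q0 in auto)
      then show "\<forall>\<^sub>F q in at q0. dist (f (fst q) (cl (snd q)) - f p0 (cl (snd q))) 0 < e"
        by (rule eventually_mono) (rule *)
    qed
    moreover have "((\<lambda>q. f p0 (cl (snd q))) \<longlongrightarrow> f p0 (cl (snd q0))) (at q0)"
    proof -
      have "continuous_on UNIV (\<lambda>q::'p \<times> real. f p0 (cl (snd q)))"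
        by (intro continuous_on_compose2[OF f(1)] continuous_on_compose2[OF ccl] continuous_intros) auto
      then show ?thesis by (metis UNIV_I continuous_on_def)
    qed
    ultimately have "((\<lambda>q. f (fst q) (cl (snd q)) - f p0 (cl (snd q)) + f p0 (cl (snd q))) \<longlongrightarrow> 0 + f p0 (cl (snd q0))) (at q0)"
      by (rule tendsto_add)
    then show "isCont (\<lambda>q. f (fst q) (cl (snd q))) q0" unfolding isCont_def by (simp add: q0)
  qed
  \<comment> \<open>Outside [0, 1] there is no a priori bound; there the equation itself expresses f
    p by its values on [0, 1].\<close>
  have eq: "f p y = h p y + integral {0..1} (\<lambda>t. k p y t ** f p (cl t))" for p y
  proof -
    have "integral {0..1} (\<lambda>t. k p y t ** f p (cl t)) = integral {0..1} (\<lambda>t. k p y t ** f p t)"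
      by (rule integral_cong) (simp add: cl_def)
    then show ?thesis using f(2)[of p y] by (simp add: algebra_simps)
  qed
  have "continuous_on UNIV (\<lambda>x :: ('p \<times> real) \<times> real. f (fst (fst x)) (cl (snd x)))"
  proof -
    have "continuous_on UNIV (\<lambda>x :: ('p \<times> real) \<times> real. (fst (fst x), snd x))" by (intro continuous_intros)
    from continuous_on_compose2[OF cf this subset_UNIV] show ?thesis by simp
  qed
  then have "continuous_on UNIV (\<lambda>q. h (fst q) (snd q) + integral {0..1} (\<lambda>t. k (fst q) (snd q) t ** f (fst q) (cl t)))"
    by (intro continuous_intros h continuous_integral_upto' continuous_mm k')
  then show ?thesis unfolding eq[symmetric] .
qed

text \<open>The kernel of \<open>S\<^sub>l\<close> rescaled to \<open>[0, 1]\<close>; the factor \<open>l * l\<close> comes from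
  scaling both the integration variable of the operator and that of the kernel.\<close>

definition scaled_kernel :: "(real \<Rightarrow> complex^'c^'r) \<Rightarrow> real \<Rightarrow> real \<Rightarrow> real \<Rightarrow> complex^'r^'r" where
  "scaled_kernel \<alpha> l y t = (l * l) *\<^sub>R integral {0..min y t} (\<lambda>\<eta>. \<alpha> (l * (y - \<eta>)) ** madj (\<alpha> (l * (t - \<eta>))))"

lemma continuous_scaled_kernel:
  fixes \<alpha> :: "real \<Rightarrow> complex^'c^'r" and a b c :: "'p::topological_space \<Rightarrow> real"
  assumes \<alpha>: "continuous_on UNIV \<alpha>" and a: "continuous_on UNIV a" and b: "continuous_on UNIV b" and c: "continuous_on UNIV c"
  shows "continuous_on UNIV (\<lambda>x. scaled_kernel \<alpha> (a x) (b x) (c x))"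
  unfolding scaled_kernel_def
  by (intro continuous_intros continuous_mm continuous_on_madj continuous_on_compose2[OF \<alpha>] continuous_on_compose2[OF a]
      continuous_on_compose2[OF b] continuous_on_compose2[OF c] a b c) auto

lemma scaled_kernel_eq:
  fixes \<alpha> :: "real \<Rightarrow> complex^'c^'r"
  assumes \<alpha>: "continuous_on UNIV \<alpha>" and l: "l \<ge> 0" and y: "y \<ge> 0" "t \<ge> 0"
  shows "scaled_kernel \<alpha> l y t = l *\<^sub>R s_kernel \<alpha> (l * y) (l * t)"
proof -
  have m: "min (l * y) (l * t) = l * min y t" using l by (simp add: min_mult_distrib_left)
  have 1: "continuous_on {0..min y t} (\<lambda>\<eta>. \<alpha> (l * (y - \<eta>)) ** madj (\<alpha> (l * (t - \<eta>))))"
    and 2: "continuous_on {0..l * min y t} (\<lambda>\<xi>. \<alpha> (l * y - \<xi>) ** madj (\<alpha> (l * t - \<xi>)))"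
    by (intro continuous_mm continuous_on_madj continuous_on_compose2[OF \<alpha>] continuous_intros; simp)+
  show ?thesis unfolding scaled_kernel_def s_kernel_def m
    using integral_scale[OF 1] integral_scale[OF 2] l y by (simp add: algebra_simps)
qed

lemma scaled_kernel_integral:
  fixes \<alpha> :: "real \<Rightarrow> complex^'c^'r" and f :: "real \<Rightarrow> complex^'d^'r"
  assumes \<alpha>: "continuous_on UNIV \<alpha>" and f: "continuous_on UNIV f" and l: "l > 0" and y: "y \<ge> 0"
  shows "integral {0..l} (\<lambda>t. s_kernel \<alpha> (l * y) t ** f (t / l)) = integral {0..1} (\<lambda>t. scaled_kernel \<alpha> l y t ** f t)"
proof -
  have "continuous_on UNIV (\<lambda>t. s_kernel \<alpha> (l * y) t ** f (t / l))"
    by (intro continuous_mm continuous_s_kernel \<alpha> continuous_on_compose2[OF f] continuous_intros) (use l in auto)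
  then have "continuous_on {0..l} (\<lambda>t. s_kernel \<alpha> (l * y) t ** f (t / l))"
    by (rule continuous_on_subset) simp
  from integral_scale[OF this]
  have "integral {0..l} (\<lambda>t. s_kernel \<alpha> (l * y) t ** f (t / l)) = integral {0..1} (\<lambda>t. l *\<^sub>R (s_kernel \<alpha> (l * y) (l * t) ** f t))"
    using l by simp
  also have "\<dots> = integral {0..1} (\<lambda>t. scaled_kernel \<alpha> l y t ** f t)"
    by (rule integral_cong) (use y l in \<open>simp add: scaled_kernel_eq[OF \<alpha>] mm.scaleR_left\<close>)
  finally show ?thesis .
qed

text \<open>Dilation by \<open>l\<close> carries the estimate over to [0, 1] with the same constant.
  At l = 0 the rescaled kernel is 0 and C >= 1 suffices, so the family of equations extends
  regularly to l = 0.\<close>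

lemma S_apriori_scaled:
  fixes \<alpha> :: "real \<Rightarrow> complex^'m1^'m2"
  assumes \<alpha>: "continuous_on UNIV \<alpha>" and S: "S_strictly_positive \<alpha>" and T: "T > 0"
  obtains C where "C \<ge> 1" "\<And>l \<theta> H x (f :: real \<Rightarrow> complex^'m1^'m2). \<lbrakk>0 \<le> l; l \<le> T; continuous_on UNIV f; 0 \<le> \<theta>; \<theta> \<le> 1;
      \<And>y. y \<in> {0..1} \<Longrightarrow> norm (f y - \<theta> *\<^sub>R integral {0..1} (\<lambda>t. scaled_kernel \<alpha> l y t ** f t)) \<le> H; x \<in> {0..1}\<rbrakk>
      \<Longrightarrow> norm (f x) \<le> C * H"
proof -
  obtain C where C: "C \<ge> 1" and ap: "\<And>l \<theta> H x (f :: real \<Rightarrow> complex^'m1^'m2). \<lbrakk>0 \<le> l; l \<le> T; continuous_on UNIV f; 0 \<le> \<theta>; \<theta> \<le> 1;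
      \<And>x. x \<in> {0..l} \<Longrightarrow> norm (f x - \<theta> *\<^sub>R integral {0..l} (\<lambda>t. s_kernel \<alpha> x t ** f t)) \<le> H; x \<in> {0..l}\<rbrakk>
      \<Longrightarrow> norm (f x) \<le> C * H"
    by (rule S_apriori[OF assms]) blast
  have "norm (f x) \<le> C * H"
    if l: "0 \<le> l" "l \<le> T" and f: "continuous_on UNIV f" and \<theta>: "0 \<le> \<theta>" "\<theta> \<le> 1"
      and H: "\<And>y. y \<in> {0..1} \<Longrightarrow> norm (f y - \<theta> *\<^sub>R integral {0..1} (\<lambda>t. scaled_kernel \<alpha> l y t ** f t)) \<le> H" and x: "x \<in> {0..1}"
    for l \<theta> H x and f :: "real \<Rightarrow> complex^'m1^'m2"
  proof (cases "l = 0")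
    case True
    have "norm (f x) \<le> H" using H[OF x] by (simp add: True scaled_kernel_def)
    moreover have "1 * H \<le> C * H" by (rule mult_right_mono[OF C]) (use \<open>norm (f x) \<le> H\<close> norm_ge_zero order_trans in blast)
    ultimately show ?thesis by simp
  next
    case False
    then have l0: "l > 0" using l by simp
    define g where "g x = f (x / l)" for x
    have cg: "continuous_on UNIV g" unfolding g_def
      by (intro continuous_on_compose2[OF f] continuous_intros) (use l0 in auto)
    have "norm (g (l * x)) \<le> C * H"
    proof (rule ap[OF l cg \<theta>])
      show "l * x \<in> {0..l}" using x l0 by (auto simp: mult_left_le)
      fix \<xi> assume \<xi>: "\<xi> \<in> {0..l}"
      define y where "y = \<xi> / l"
      have y: "y \<in> {0..1}" "\<xi> = l * y" using \<xi> l0 by (auto simp: y_def)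
      have "integral {0..l} (\<lambda>t. s_kernel \<alpha> \<xi> t ** g t) = integral {0..1} (\<lambda>t. scaled_kernel \<alpha> l y t ** f t)"
        unfolding g_def y(2) by (rule scaled_kernel_integral[OF \<alpha> f l0]) (use y in simp)
      moreover have "g \<xi> = f y" by (simp add: g_def y_def)
      ultimately show "norm (g \<xi> - \<theta> *\<^sub>R integral {0..l} (\<lambda>t. s_kernel \<alpha> \<xi> t ** g t)) \<le> H"
        using H[OF y(1)] by simp
    qed
    then show ?thesis using l0 by (simp add: g_def)
  qed
  then show thesis using C that by blast
qed

text \<open>Hadamard's lemma: the fundamental theorem along the segment from b to a, which stays in
  the half-line, produces a difference quotient that is continuous across a = b.\<close>

lemma slope_integral:
  fixes \<alpha> \<alpha>' :: "real \<Rightarrow> 'a::euclidean_space"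
  assumes d: "\<And>x. x \<ge> 0 \<Longrightarrow> (\<alpha> has_vector_derivative \<alpha>' x) (at x within {0..})"
    and a: "a \<ge> 0" and b: "b \<ge> 0"
  shows "\<alpha> a - \<alpha> b = (a - b) *\<^sub>R integral {0..1} (\<lambda>\<theta>. \<alpha>' (b + \<theta> * (a - b)))"
proof -
  have pos: "b + \<theta> * (a - b) \<ge> 0" if "\<theta> \<in> {0..1}" for \<theta>
  proof -
    have "b + \<theta> * (a - b) = (1 - \<theta>) * b + \<theta> * a" by (simp add: algebra_simps)
    then show ?thesis using that a b by simp
  qed
  have "((\<lambda>\<theta>. (a - b) *\<^sub>R \<alpha>' (b + \<theta> * (a - b))) has_integral \<alpha> (b + 1 * (a - b)) - \<alpha> (b + 0 * (a - b))) {0..1}"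
  proof (rule fundamental_theorem_of_calculus)
    fix \<theta> :: real assume \<theta>: "\<theta> \<in> {0..1}"
    have 1: "((\<lambda>\<theta>. b + \<theta> * (a - b)) has_vector_derivative (a - b)) (at \<theta> within {0..1})"
      unfolding has_real_derivative_iff_has_vector_derivative[symmetric] by (auto intro!: derivative_eq_intros)
    have "(\<alpha> has_vector_derivative \<alpha>' (b + \<theta> * (a - b))) (at (b + \<theta> * (a - b)) within (\<lambda>\<theta>. b + \<theta> * (a - b)) ` {0..1})"
      by (rule has_vector_derivative_within_subset[OF d]) (use pos \<theta> in auto)
    from vector_diff_chain_within[OF 1 this]
    show "((\<lambda>\<theta>. \<alpha> (b + \<theta> * (a - b))) has_vector_derivative (a - b) *\<^sub>R \<alpha>' (b + \<theta> * (a - b))) (at \<theta> within {0..1})"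
      by (simp add: o_def)
  qed simp
  from integral_unique[OF this] show ?thesis by simp
qed

text \<open>Caratheodory's form of the derivative, suited to a difference quotient given as a
  continuous function \<open>q\<close>.\<close>

lemma has_vector_derivative_slope:
  fixes a :: "real \<Rightarrow> 'a::real_normed_vector"
  assumes eq: "\<And>y. y \<in> S \<Longrightarrow> a y - a x = (y - x) *\<^sub>R q y" and q: "(q \<longlongrightarrow> D) (at x within S)"
  shows "(a has_vector_derivative D) (at x within S)"
  unfolding has_vector_derivative_def has_derivative_iff_norm
proof
  show "bounded_linear (\<lambda>t. t *\<^sub>R D)" by (rule bounded_linear_scaleR_left)
  have "((\<lambda>y. norm (q y - D)) \<longlongrightarrow> 0) (at x within S)"
    using tendsto_norm_zero[OF LIM_zero[OF q]] by simp
  then show "((\<lambda>y. norm (a y - a x - (y - x) *\<^sub>R D) / norm (y - x)) \<longlongrightarrow> 0) (at x within S)"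
  proof (rule Lim_transform_eventually)
    show "\<forall>\<^sub>F y in at x within S. norm (q y - D) = norm (a y - a x - (y - x) *\<^sub>R D) / norm (y - x)"
      unfolding eventually_at_filter
    proof (intro always_eventually allI impI)
      fix y assume "y \<noteq> x" "y \<in> S"
      have "a y - a x - (y - x) *\<^sub>R D = (y - x) *\<^sub>R (q y - D)"
        using eq[OF \<open>y \<in> S\<close>] by (simp add: scaleR_diff_right)
      then show "norm (q y - D) = norm (a y - a x - (y - x) *\<^sub>R D) / norm (y - x)" using \<open>y \<noteq> x\<close> by simp
    qed
  qed
qed

text \<open>The difference quotient of the rescaled kernel in \<open>l\<close>, where \<open>\<beta>\<close> is that of
  \<open>\<alpha>\<close>; unlike the quotient itself it is defined and continuous at \<open>l' = l\<close>.\<close>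

definition scaled_kernel_slope :: "(real \<Rightarrow> complex^'c^'r) \<Rightarrow> (real \<Rightarrow> real \<Rightarrow> complex^'c^'r) \<Rightarrow> real \<Rightarrow> real \<Rightarrow> real \<Rightarrow> real \<Rightarrow> complex^'r^'r" where
  "scaled_kernel_slope \<alpha> \<beta> l' l y t =
     (l' + l) *\<^sub>R integral {0..min y t} (\<lambda>\<eta>. \<alpha> (l' * (y - \<eta>)) ** madj (\<alpha> (l' * (t - \<eta>))))
     + (l * l) *\<^sub>R integral {0..min y t} (\<lambda>\<eta>. (y - \<eta>) *\<^sub>R (\<beta> (l' * (y - \<eta>)) (l * (y - \<eta>)) ** madj (\<alpha> (l' * (t - \<eta>))))
          + (t - \<eta>) *\<^sub>R (\<alpha> (l * (y - \<eta>)) ** madj (\<beta> (l' * (t - \<eta>)) (l * (t - \<eta>)))))"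

lemma continuous_scaled_kernel_slope:
  fixes \<alpha> :: "real \<Rightarrow> complex^'c^'r" and a b c d :: "'p::topological_space \<Rightarrow> real"
  assumes \<alpha>: "continuous_on UNIV \<alpha>" and \<beta>: "continuous_on UNIV (\<lambda>p. \<beta> (fst p) (snd p))"
    and a: "continuous_on UNIV a" and b: "continuous_on UNIV b" and c: "continuous_on UNIV c" and d: "continuous_on UNIV d"
  shows "continuous_on UNIV (\<lambda>x. scaled_kernel_slope \<alpha> \<beta> (a x) (b x) (c x) (d x))"
  unfolding scaled_kernel_slope_def
  by (intro continuous_intros continuous_mm continuous_on_madj continuous_on_compose2[OF \<alpha>] continuous_on_uncurry[OF \<beta>]
      continuous_on_compose2[OF a] continuous_on_compose2[OF b] continuous_on_compose2[OF c] continuous_on_compose2[OF d] a b c d) auto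

text \<open>Product rule for difference quotients: the factor \<open>l * l\<close> contributes the
  term with l' + l, and the two occurrences of \<alpha> contribute one Hadamard slope each,
  multiplied by the inner derivatives y - \<eta> and t - \<eta>.\<close>

lemma scaled_kernel_diff:
  fixes \<alpha> :: "real \<Rightarrow> complex^'c^'r"
  assumes \<alpha>: "continuous_on UNIV \<alpha>" and \<beta>: "continuous_on UNIV (\<lambda>p. \<beta> (fst p) (snd p))"
    and sl: "\<And>a b. a \<ge> 0 \<Longrightarrow> b \<ge> 0 \<Longrightarrow> \<alpha> a - \<alpha> b = (a - b) *\<^sub>R \<beta> a b"
    and l: "l' \<ge> 0" "l \<ge> 0"
  shows "scaled_kernel \<alpha> l' y t - scaled_kernel \<alpha> l y t = (l' - l) *\<^sub>R scaled_kernel_slope \<alpha> \<beta> l' l y t"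
proof -
  define F where "F l \<eta> = \<alpha> (l * (y - \<eta>)) ** madj (\<alpha> (l * (t - \<eta>)))" for l \<eta>
  define G where "G \<eta> = (y - \<eta>) *\<^sub>R (\<beta> (l' * (y - \<eta>)) (l * (y - \<eta>)) ** madj (\<alpha> (l' * (t - \<eta>))))
          + (t - \<eta>) *\<^sub>R (\<alpha> (l * (y - \<eta>)) ** madj (\<beta> (l' * (t - \<eta>)) (l * (t - \<eta>))))" for \<eta>
  have cF: "continuous_on UNIV (F l)" for l unfolding F_def
    by (intro continuous_mm continuous_on_madj continuous_on_compose2[OF \<alpha>] continuous_intros) auto
  have FG: "F l' \<eta> - F l \<eta> = (l' - l) *\<^sub>R G \<eta>" if "\<eta> \<in> {0..min y t}" for \<eta>
  proof -
    have d: "\<alpha> (l' * u) - \<alpha> (l * u) = ((l' - l) * u) *\<^sub>R \<beta> (l' * u) (l * u)" if "u \<ge> 0" for u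
      using sl[of "l' * u" "l * u"] l that by (simp add: left_diff_distrib)
    have "F l' \<eta> - F l \<eta> = (\<alpha> (l' * (y - \<eta>)) - \<alpha> (l * (y - \<eta>))) ** madj (\<alpha> (l' * (t - \<eta>)))
        + \<alpha> (l * (y - \<eta>)) ** madj (\<alpha> (l' * (t - \<eta>)) - \<alpha> (l * (t - \<eta>)))"
      by (simp add: F_def madj_diff mm.diff_left mm.diff_right)
    also have "\<dots> = (l' - l) *\<^sub>R G \<eta>"
    proof -
      have u: "y - \<eta> \<ge> 0" "t - \<eta> \<ge> 0" using that by auto
      show ?thesis unfolding d[OF u(1)] d[OF u(2)] G_def
        by (simp add: mm.scaleR_left mm.scaleR_right linear_scale[OF bounded_linear.linear[OF bounded_linear_madj]] scaleR_add_right)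
    qed
    finally show ?thesis .
  qed
  have "integral {0..min y t} (F l') - integral {0..min y t} (F l) = integral {0..min y t} (\<lambda>\<eta>. F l' \<eta> - F l \<eta>)"
    by (rule integral_diff[symmetric]) (intro integrable_cont cF)+
  also have "\<dots> = integral {0..min y t} (\<lambda>\<eta>. (l' - l) *\<^sub>R G \<eta>)" by (rule integral_cong) (rule FG)
  also have "\<dots> = (l' - l) *\<^sub>R integral {0..min y t} G" by simp
  finally have I: "integral {0..min y t} (F l') = integral {0..min y t} (F l) + (l' - l) *\<^sub>R integral {0..min y t} G"
    by (simp add: algebra_simps)
  have "(l' * l') *\<^sub>R X - (l * l) *\<^sub>R Y = (l' - l) *\<^sub>R ((l' + l) *\<^sub>R X + (l * l) *\<^sub>R Z)"
    if "X = Y + (l' - l) *\<^sub>R Z" for X Y Z :: "complex^'r^'r"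
    unfolding that by (simp add: algebra_simps)
  from this[OF I] show ?thesis unfolding scaled_kernel_def scaled_kernel_slope_def F_def G_def .
qed

text \<open>The difference quotient of the solutions in l is itself the solution of an equation at
  l', with a right-hand side made of slopes. That equation is solvable on the diagonal l' = l as
  well and depends continuously on both parameters, so the derivative is the diagonal value; no
  limit of quotients has to be estimated.\<close>

lemma S_family_C1:
  fixes \<alpha> :: "real \<Rightarrow> complex^'m1^'m2" and f :: "real \<Rightarrow> real \<Rightarrow> complex^'m1^'m2"
  assumes \<alpha>: "continuous_on UNIV \<alpha>" and \<alpha>': "continuous_on UNIV \<alpha>'"
    and d: "\<And>x. x \<ge> 0 \<Longrightarrow> (\<alpha> has_vector_derivative \<alpha>' x) (at x within {0..})"
    and S: "S_strictly_positive \<alpha>" and T: "T > 0"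
    and f: "\<And>l. l \<in> {0..T} \<Longrightarrow> continuous_on UNIV (f l)"
      "\<And>l y. l \<in> {0..T} \<Longrightarrow> f l y - integral {0..1} (\<lambda>t. scaled_kernel \<alpha> l y t ** f l t) = \<alpha> (l * y)"
  obtains D where "continuous_on {0..T} D"
    "\<And>l. l \<in> {0..T} \<Longrightarrow> ((\<lambda>l. f l 1) has_vector_derivative D l) (at l within {0..T})"
proof -
  obtain C where C: "C \<ge> 1" and ap: "\<And>l \<theta> H x (f :: real \<Rightarrow> complex^'m1^'m2). \<lbrakk>0 \<le> l; l \<le> T; continuous_on UNIV f; 0 \<le> \<theta>; \<theta> \<le> 1;
      \<And>y. y \<in> {0..1} \<Longrightarrow> norm (f y - \<theta> *\<^sub>R integral {0..1} (\<lambda>t. scaled_kernel \<alpha> l y t ** f t)) \<le> H; x \<in> {0..1}\<rbrakk>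
      \<Longrightarrow> norm (f x) \<le> C * H"
    by (rule S_apriori_scaled[OF \<alpha> S T]) blast
  have ap1: "norm (f x) \<le> C * H" if "0 \<le> l" "l \<le> T" "continuous_on UNIV f"
      "\<And>y. y \<in> {0..1} \<Longrightarrow> norm (f y - integral {0..1} (\<lambda>t. scaled_kernel \<alpha> l y t ** f t)) \<le> H" "x \<in> {0..1}"
    for l H x and f :: "real \<Rightarrow> complex^'m1^'m2"
    by (rule ap[OF that(1-3), of 1 H x]) (use that(4,5) in auto)
  define c where "c l = max 0 (min T l)" for l
  have cc: "continuous_on U c" for U unfolding c_def by (intro continuous_intros)
  have c0: "0 \<le> c l" and cT: "c l \<le> T" and cI: "c l \<in> {0..T}" for l using T by (auto simp: c_def)
  have cid: "c l = l" if "l \<in> {0..T}" for l using that by (auto simp: c_def)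
  have ckap: "continuous_on UNIV (\<lambda>p. scaled_kernel \<alpha> l (fst p) (snd p))" for l by (intro continuous_scaled_kernel \<alpha> continuous_intros)
  define g where "g l = f (c l)" for l
  have cg: "continuous_on UNIV (\<lambda>p. g (fst p) (snd p))"
  proof (rule fredholm_continuous[of "\<lambda>l. scaled_kernel \<alpha> (c l)" "\<lambda>l y. \<alpha> (c l * y)" C g])
    show "continuous_on UNIV (\<lambda>q. scaled_kernel \<alpha> (c (fst q)) (fst (snd q)) (snd (snd q)))"
      by (intro continuous_scaled_kernel \<alpha> continuous_on_compose2[OF cc[of UNIV]] continuous_intros) auto
    show "continuous_on UNIV (\<lambda>q. \<alpha> (c (fst q) * snd q))"
      by (intro continuous_on_compose2[OF \<alpha>] continuous_on_compose2[OF cc[of UNIV]] continuous_intros) auto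
    show "continuous_on UNIV (g p)" "g p y - integral {0..1} (\<lambda>t. scaled_kernel \<alpha> (c p) y t ** g p t) = \<alpha> (c p * y)" for p y
      unfolding g_def by (rule f(1)[OF cI], rule f(2)[OF cI])
  qed (use C ap1[OF c0 cT] in blast)+
  have cg1: "continuous_on UNIV (g l)" for l unfolding g_def by (rule f(1)[OF cI])
  define \<beta> where "\<beta> a b = integral {0..1} (\<lambda>\<theta>. \<alpha>' (b + \<theta> * (a - b)))" for a b
  have c\<beta>: "continuous_on UNIV (\<lambda>p. \<beta> (fst p) (snd p))" unfolding \<beta>_def
    by (intro continuous_integral_upto' continuous_on_compose2[OF \<alpha>'] continuous_intros) auto
  have sl: "\<alpha> a - \<alpha> b = (a - b) *\<^sub>R \<beta> a b" if "a \<ge> 0" "b \<ge> 0" for a b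
    unfolding \<beta>_def by (rule slope_integral[OF d that])
  \<comment> \<open>Subtracting the equations for l' and l and dividing by l' - l leaves the slope
    of \<alpha> (l y) and the kernel slope applied to the solution at l. The clamp \<open>c\<close>
    keeps both parameters in [0, T].\<close>
  define h where "h p y = y *\<^sub>R \<beta> (c (fst p) * y) (c (snd p) * y)
     + integral {0..1} (\<lambda>t. scaled_kernel_slope \<alpha> \<beta> (c (fst p)) (c (snd p)) y t ** g (snd p) t)" for p :: "real \<times> real" and y
  have ch: "continuous_on UNIV (\<lambda>q. h (fst q) (snd q))" unfolding h_def
    by (intro continuous_on_add continuous_on_scaleR continuous_on_uncurry[OF c\<beta>] continuous_on_uncurry[OF cg] continuous_integral_upto' continuous_mm
        continuous_scaled_kernel_slope \<alpha> c\<beta> continuous_on_compose2[OF cc[of UNIV]] continuous_intros subset_UNIV)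
  have ch1: "continuous_on UNIV (h p)" for p
    using continuous_on_compose2[OF ch continuous_on_Pair[OF continuous_on_const[of _ p] continuous_on_id]] by simp
  have "\<forall>p. \<exists>q. continuous_on UNIV q \<and> (\<forall>y. q y - integral {0..1} (\<lambda>t. scaled_kernel \<alpha> (c (fst p)) y t ** q t) = h p y)"
  proof
    fix p :: "real \<times> real"
    show "\<exists>q. continuous_on UNIV q \<and> (\<forall>y. q y - integral {0..1} (\<lambda>t. scaled_kernel \<alpha> (c (fst p)) y t ** q t) = h p y)"
      by (rule fredholm_exists[OF ckap ch1 C]) (rule ap[OF c0 cT])
  qed
  from choice[OF this] obtain q where q: "\<And>p. continuous_on UNIV (q p)"
    "\<And>p y. q p y - integral {0..1} (\<lambda>t. scaled_kernel \<alpha> (c (fst p)) y t ** q p t) = h p y" by blast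
  have cq: "continuous_on UNIV (\<lambda>p. q (fst p) (snd p))"
  proof (rule fredholm_continuous[of "\<lambda>p. scaled_kernel \<alpha> (c (fst p))" h C q])
    show "continuous_on UNIV (\<lambda>q. scaled_kernel \<alpha> (c (fst (fst q))) (fst (snd q)) (snd (snd q)))"
      by (intro continuous_scaled_kernel \<alpha> continuous_on_compose2[OF cc[of UNIV]] continuous_intros) auto
  qed (use ch C q ap1[OF c0 cT] in blast)+
  have slope: "f l' 1 - f l 1 = (l' - l) *\<^sub>R q (l', l) 1" if l': "l' \<in> {0..T}" and l: "l \<in> {0..T}" for l l'
  proof -
    \<comment> \<open>The defect between the true increment and (l' - l) q solves the homogeneous
      equation at l', hence vanishes by the a priori bound with H = 0.\<close>
    define e where "e y = f l' y - f l y - (l' - l) *\<^sub>R q (l', l) y" for y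
    note cf = f(1)[OF l] f(1)[OF l'] q(1)[of "(l', l)"]
    have ii: "(\<lambda>t. scaled_kernel \<alpha> l' y t ** k t) integrable_on {0..1}" if "continuous_on UNIV k" for k y
      by (intro integrable_cont continuous_mm that continuous_on_uncurry[OF ckap] continuous_intros)
    have res: "e y - integral {0..1} (\<lambda>t. scaled_kernel \<alpha> l' y t ** e t) = 0" if y: "y \<in> {0..1}" for y
    proof -
      have gl: "g l = f l" by (simp add: g_def cid[OF l])
      have I: "integral {0..1} (\<lambda>t. scaled_kernel \<alpha> l' y t ** e t) = integral {0..1} (\<lambda>t. scaled_kernel \<alpha> l' y t ** f l' t)
         - integral {0..1} (\<lambda>t. scaled_kernel \<alpha> l' y t ** f l t) - (l' - l) *\<^sub>R integral {0..1} (\<lambda>t. scaled_kernel \<alpha> l' y t ** q (l', l) t)"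
      proof -
        have "integral {0..1} (\<lambda>t. scaled_kernel \<alpha> l' y t ** e t) = integral {0..1} (\<lambda>t. scaled_kernel \<alpha> l' y t ** f l' t - scaled_kernel \<alpha> l' y t ** f l t - (l' - l) *\<^sub>R (scaled_kernel \<alpha> l' y t ** q (l', l) t))"
          by (simp add: e_def mm.diff_right mm.scaleR_right)
        also have "\<dots> = integral {0..1} (\<lambda>t. scaled_kernel \<alpha> l' y t ** f l' t - scaled_kernel \<alpha> l' y t ** f l t) - integral {0..1} (\<lambda>t. (l' - l) *\<^sub>R (scaled_kernel \<alpha> l' y t ** q (l', l) t))"
          by (rule integral_diff[OF integrable_diff[OF ii[OF cf(2)] ii[OF cf(1)]] integrable_cmul[OF ii[OF cf(3)]]])
        also have "\<dots> = integral {0..1} (\<lambda>t. scaled_kernel \<alpha> l' y t ** f l' t) - integral {0..1} (\<lambda>t. scaled_kernel \<alpha> l' y t ** f l t) - (l' - l) *\<^sub>R integral {0..1} (\<lambda>t. scaled_kernel \<alpha> l' y t ** q (l', l) t)"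
          using integral_diff[OF ii[OF cf(2), of y] ii[OF cf(1), of y]] by simp
        finally show ?thesis .
      qed
      have K: "integral {0..1} (\<lambda>t. scaled_kernel \<alpha> l' y t ** f l t) = integral {0..1} (\<lambda>t. scaled_kernel \<alpha> l y t ** f l t)
          + (l' - l) *\<^sub>R integral {0..1} (\<lambda>t. scaled_kernel_slope \<alpha> \<beta> l' l y t ** f l t)"
      proof -
        have i1: "(\<lambda>t. scaled_kernel \<alpha> l y t ** f l t) integrable_on {0..1}"
          by (intro integrable_cont continuous_mm cf continuous_on_uncurry[OF ckap] continuous_intros)
        have i2: "(\<lambda>t. scaled_kernel_slope \<alpha> \<beta> l' l y t ** f l t) integrable_on {0..1}"
          by (intro integrable_cont continuous_mm cf continuous_scaled_kernel_slope \<alpha> c\<beta> continuous_intros)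
        have "scaled_kernel \<alpha> l' y t = scaled_kernel \<alpha> l y t + (l' - l) *\<^sub>R scaled_kernel_slope \<alpha> \<beta> l' l y t" for t
          using scaled_kernel_diff[OF \<alpha> c\<beta> sl, of l' l y t] l l' by (simp add: algebra_simps)
        then show ?thesis
          using integral_add[OF i1 integrable_cmul[OF i2, of "l' - l"]] by (simp add: mm.add_left mm.scaleR_left)
      qed
      have q': "q (l', l) y - integral {0..1} (\<lambda>t. scaled_kernel \<alpha> l' y t ** q (l', l) t)
          = y *\<^sub>R \<beta> (l' * y) (l * y) + integral {0..1} (\<lambda>t. scaled_kernel_slope \<alpha> \<beta> l' l y t ** f l t)"
        using q(2)[of "(l', l)" y] unfolding h_def fst_conv snd_conv cid[OF l'] cid[OF l] gl .
      have s: "\<alpha> (l' * y) - \<alpha> (l * y) = (l' - l) *\<^sub>R (y *\<^sub>R \<beta> (l' * y) (l * y))"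
        using sl[of "l' * y" "l * y"] l l' y by (simp add: left_diff_distrib)
      have "e y - integral {0..1} (\<lambda>t. scaled_kernel \<alpha> l' y t ** e t)
         = (f l' y - integral {0..1} (\<lambda>t. scaled_kernel \<alpha> l' y t ** f l' t)) - (f l y - integral {0..1} (\<lambda>t. scaled_kernel \<alpha> l y t ** f l t))
           + (l' - l) *\<^sub>R integral {0..1} (\<lambda>t. scaled_kernel_slope \<alpha> \<beta> l' l y t ** f l t)
           - (l' - l) *\<^sub>R (q (l', l) y - integral {0..1} (\<lambda>t. scaled_kernel \<alpha> l' y t ** q (l', l) t))"
        unfolding I K e_def[of y] scaleR_diff_right by simp
      also have "\<dots> = 0" unfolding f(2)[OF l] f(2)[OF l'] s q' by (simp add: scaleR_add_right)
      finally show ?thesis .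
    qed
    have "norm (e 1) \<le> C * 0"
      by (rule ap1[of l']) (use l' res in \<open>auto simp: e_def intro!: continuous_intros cf\<close>)
    then show ?thesis by (simp add: e_def)
  qed
  have cq1: "continuous_on UNIV (\<lambda>x. q (a x, b x) 1)" if "continuous_on UNIV a" "continuous_on UNIV b" for a b :: "real \<Rightarrow> real"
    using continuous_on_compose2[OF cq continuous_on_Pair[OF continuous_on_Pair[OF that] continuous_on_const]] by simp
  show thesis
  proof (rule that[of "\<lambda>l. q (l, l) 1"])
    show "continuous_on {0..T} (\<lambda>l. q (l, l) 1)"
      by (rule continuous_on_subset[OF cq1[OF continuous_on_id continuous_on_id]]) simp
    fix l assume l: "l \<in> {0..T}"
    show "((\<lambda>l. f l 1) has_vector_derivative q (l, l) 1) (at l within {0..T})"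
    proof (rule has_vector_derivative_slope[of _ _ _ "\<lambda>y. q (y, l) 1"])
      show "f y 1 - f l 1 = (y - l) *\<^sub>R q (y, l) 1" if "y \<in> {0..T}" for y by (rule slope[OF that l])
      have "continuous_on {0..T} (\<lambda>y. q (y, l) 1)"
        by (rule continuous_on_subset[OF cq1[OF continuous_on_id continuous_on_const]]) simp
      then show "((\<lambda>y. q (y, l) 1) \<longlongrightarrow> q (l, l) 1) (at l within {0..T})"
        using l unfolding continuous_on_def by blast
    qed
  qed
qed

section \<open>Recovering A from the boundary values a\<close>

lemma at_within_Icc_eq_atLeast: "0 \<le> x \<Longrightarrow> x < T \<Longrightarrow> at x within {0..T} = at x within {0..}" for x T :: real
  by (rule at_within_nhd[of x "{..<T}"]) auto

text \<open>Derivatives on different intervals agree by uniqueness at limit points. At a given l the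
  interval [0, l + 1] is used, where l is not the right end and the one-sided filters
  coincide.\<close>

lemma C1_nonneg_local:
  fixes a :: "real \<Rightarrow> 'a::real_normed_vector"
  assumes loc: "\<And>T. T > 0 \<Longrightarrow> \<exists>D. continuous_on {0..T} D \<and> (\<forall>l\<in>{0..T}. (a has_vector_derivative D l) (at l within {0..T}))"
  shows "C1_nonneg a"
proof -
  define D where "D l = vector_derivative a (at l within {0..})" for l
  have D: "(a has_vector_derivative D l) (at l within {0..}) \<and> E l = D l"
    if E: "\<And>l. l \<in> {0..T} \<Longrightarrow> (a has_vector_derivative E l) (at l within {0..T})" and l: "0 \<le> l" "l < T" for E l T
  proof -
    have 1: "(a has_vector_derivative E l) (at l within {0..})"
      using E[of l] l unfolding at_within_Icc_eq_atLeast[OF l] by simp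
    have "at l within {0..} \<noteq> bot"
      unfolding at_within_Icc_eq_atLeast[OF l, symmetric] using l by (simp add: trivial_limit_within islimpt_Icc)
    then have "D l = E l" unfolding D_def by (rule vector_derivative_within[OF _ 1])
    then show ?thesis using 1 by simp
  qed
  show ?thesis unfolding C1_nonneg_def
  proof (intro exI[of _ D] conjI allI impI)
    fix l :: real assume l: "l \<ge> 0"
    then obtain E where "\<forall>x\<in>{0..l+1}. (a has_vector_derivative E x) (at x within {0..l+1})"
      using loc[of "l + 1"] by auto
    then show "(a has_vector_derivative D l) (at l within {0..})" using D[of "l + 1" E l] l by auto
  next
    show "continuous_on {0..} D" unfolding continuous_on_eq_continuous_within
    proof
      fix l :: real assume "l \<in> {0..}"
      then have l: "l \<ge> 0" by simp
      then obtain E where E: "continuous_on {0..l+1} E" "\<forall>x\<in>{0..l+1}. (a has_vector_derivative E x) (at x within {0..l+1})"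
        using loc[of "l + 1"] by auto
      have "continuous_on {0..<l+1} D"
        by (rule continuous_on_eq[OF continuous_on_subset[OF E(1)]]) (use D[of "l + 1" E] E(2) in auto)
      then have "continuous (at l within {0..<l+1}) D" using l by (simp add: continuous_on_eq_continuous_within)
      moreover have "at l within {0..<l+1} = at l within {0..}" by (rule at_within_nhd[of l "{..<l+1}"]) (use l in auto)
      ultimately show "continuous (at l within {0..}) D" by simp
    qed
  qed
qed

text \<open>Changing one factor of the product at a time leaves the integral of |\<alpha> - b| over
  a reflected interval, contained in [0, l]. It matters that the bound involves this L^1 quantity
  and not the maximum, since it is the integral on the right of Gronwall's inequality.\<close>

lemma s_kernel_diff_le:
  fixes \<alpha> b :: "real \<Rightarrow> complex^'c^'r"
  assumes \<alpha>: "continuous_on UNIV \<alpha>" and b: "continuous_on UNIV b"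
    and M: "\<And>x. x \<in> {0..l} \<Longrightarrow> norm (\<alpha> x) \<le> M" "\<And>x. x \<in> {0..l} \<Longrightarrow> norm (b x) \<le> M"
    and x: "x \<in> {0..l}" and t: "t \<in> {0..l}"
  shows "norm (s_kernel \<alpha> x t - s_kernel b x t) \<le> 2 * M * integral {0..l} (\<lambda>x. norm (\<alpha> x - b x))"
proof -
  define \<phi> where "\<phi> x = norm (\<alpha> x - b x)" for x
  define D where "D = integral {0..l} \<phi>"
  have c\<phi>: "continuous_on UNIV \<phi>" unfolding \<phi>_def by (intro continuous_intros \<alpha> b)
  have c\<phi>': "continuous_on UNIV (\<lambda>\<xi>. \<phi> (u - \<xi>))" for u by (intro continuous_on_compose2[OF c\<phi>] continuous_intros) auto
  have M0: "M \<ge> 0" using M(1)[OF x] norm_ge_zero order_trans by blast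
  have part: "integral {0..min x t} (\<lambda>\<xi>. \<phi> (u - \<xi>)) \<le> D" if u: "u \<in> {x, t}" for u
  proof -
    have "integral {0..min x t} (\<lambda>\<xi>. \<phi> (u - \<xi>)) \<le> integral {0..u} (\<lambda>\<xi>. \<phi> (u - \<xi>))"
      by (rule integral_subset_le) (use u integrable_cont[OF c\<phi>'] in \<open>auto simp: \<phi>_def\<close>)
    also have "\<dots> = integral {0..u} \<phi>" by (rule integral_flip[OF c\<phi>])
    also have "\<dots> \<le> D" unfolding D_def
      by (rule integral_subset_le) (use u x t integrable_cont[OF c\<phi>] in \<open>auto simp: \<phi>_def\<close>)
    finally show ?thesis .
  qed
  have ck: "continuous_on UNIV (\<lambda>\<xi>. \<gamma> (x - \<xi>) ** madj (\<gamma> (t - \<xi>)))" if "continuous_on UNIV \<gamma>" for \<gamma> :: "real \<Rightarrow> complex^'c^'r"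
    by (intro continuous_mm continuous_on_madj continuous_on_compose2[OF that] continuous_intros) auto
  have "s_kernel \<alpha> x t - s_kernel b x t = integral {0..min x t} (\<lambda>\<xi>. \<alpha> (x - \<xi>) ** madj (\<alpha> (t - \<xi>)) - b (x - \<xi>) ** madj (b (t - \<xi>)))"
    unfolding s_kernel_def by (rule integral_diff[symmetric]) (intro integrable_cont ck \<alpha> b)+
  also have "norm \<dots> \<le> integral {0..min x t} (\<lambda>\<xi>. M * \<phi> (x - \<xi>) + M * \<phi> (t - \<xi>))"
  proof (rule integral_norm_bound_integral)
    show "(\<lambda>\<xi>. \<alpha> (x - \<xi>) ** madj (\<alpha> (t - \<xi>)) - b (x - \<xi>) ** madj (b (t - \<xi>))) integrable_on {0..min x t}"
      by (intro integrable_diff integrable_cont ck \<alpha> b)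
    show "(\<lambda>\<xi>. M * \<phi> (x - \<xi>) + M * \<phi> (t - \<xi>)) integrable_on {0..min x t}"
      by (intro integrable_cont continuous_intros c\<phi>')
    fix \<xi> assume \<xi>: "\<xi> \<in> {0..min x t}"
    have "\<alpha> (x - \<xi>) ** madj (\<alpha> (t - \<xi>)) - b (x - \<xi>) ** madj (b (t - \<xi>))
        = (\<alpha> (x - \<xi>) - b (x - \<xi>)) ** madj (\<alpha> (t - \<xi>)) + b (x - \<xi>) ** madj (\<alpha> (t - \<xi>) - b (t - \<xi>))"
      by (simp add: madj_diff mm.diff_left mm.diff_right)
    also have "norm \<dots> \<le> \<phi> (x - \<xi>) * M + M * \<phi> (t - \<xi>)"
    proof (rule norm_triangle_le, rule add_mono)
      show "norm ((\<alpha> (x - \<xi>) - b (x - \<xi>)) ** madj (\<alpha> (t - \<xi>))) \<le> \<phi> (x - \<xi>) * M"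
        by (rule order_trans[OF norm_matrix_mult mult_mono]) (use M(1)[of "t - \<xi>"] \<xi> x t in \<open>auto simp: \<phi>_def\<close>)
      show "norm (b (x - \<xi>) ** madj (\<alpha> (t - \<xi>) - b (t - \<xi>))) \<le> M * \<phi> (t - \<xi>)"
        by (rule order_trans[OF norm_matrix_mult mult_mono]) (use M(2)[of "x - \<xi>"] M0 \<xi> x t in \<open>auto simp: \<phi>_def\<close>)
    qed
    finally show "norm (\<alpha> (x - \<xi>) ** madj (\<alpha> (t - \<xi>)) - b (x - \<xi>) ** madj (b (t - \<xi>))) \<le> M * \<phi> (x - \<xi>) + M * \<phi> (t - \<xi>)"
      by (simp add: mult.commute)
  qed
  also have "\<dots> = M * integral {0..min x t} (\<lambda>\<xi>. \<phi> (x - \<xi>)) + M * integral {0..min x t} (\<lambda>\<xi>. \<phi> (t - \<xi>))"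
    using integral_add[OF integrable_cmul[OF integrable_cont[OF c\<phi>'], of M] integrable_cmul[OF integrable_cont[OF c\<phi>'], of M], of 0 "min x t" x t] by simp
  also have "\<dots> \<le> M * D + M * D"
    by (intro add_mono mult_left_mono part M0) auto
  finally show ?thesis by (simp add: D_def \<phi>_def[abs_def])
qed

text \<open>The residual of the difference of the two solutions is only small in \<open>L\<^sup>1\<close>; one application of the
  integral operator turns this into a uniform bound, to which the a priori estimate applies.\<close>
lemma S_solutions_determine:
  fixes \<alpha> b0 :: "real \<Rightarrow> complex^'m1^'m2" and g b :: "real \<Rightarrow> real \<Rightarrow> complex^'m1^'m2"
  assumes \<alpha>: "continuous_on UNIV \<alpha>" and b0: "continuous_on UNIV b0" and S: "S_strictly_positive \<alpha>" and T: "T > 0"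
    and g: "\<And>l. l \<in> {0..T} \<Longrightarrow> continuous_on UNIV (g l)"
      "\<And>l x. l \<in> {0..T} \<Longrightarrow> x \<in> {0..l} \<Longrightarrow> g l x - integral {0..l} (\<lambda>t. s_kernel \<alpha> x t ** g l t) = \<alpha> x"
    and b: "\<And>l. l \<in> {0..T} \<Longrightarrow> continuous_on UNIV (b l)"
      "\<And>l x. l \<in> {0..T} \<Longrightarrow> x \<in> {0..l} \<Longrightarrow> b l x - integral {0..l} (\<lambda>t. s_kernel b0 x t ** b l t) = b0 x"
    and K: "\<And>l x. l \<in> {0..T} \<Longrightarrow> x \<in> {0..l} \<Longrightarrow> norm (b l x) \<le> K"
    and gb: "\<And>l. l \<in> {0..T} \<Longrightarrow> g l l = b l l" and l: "l \<in> {0..T}"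
  shows "\<alpha> l = b0 l"
proof -
  obtain C where C: "C \<ge> 1" and ap: "\<And>l \<theta> H x (f :: real \<Rightarrow> complex^'m1^'m2). \<lbrakk>0 \<le> l; l \<le> T; continuous_on UNIV f; 0 \<le> \<theta>; \<theta> \<le> 1;
      \<And>x. x \<in> {0..l} \<Longrightarrow> norm (f x - \<theta> *\<^sub>R integral {0..l} (\<lambda>t. s_kernel \<alpha> x t ** f t)) \<le> H; x \<in> {0..l}\<rbrakk>
      \<Longrightarrow> norm (f x) \<le> C * H"
    by (rule S_apriori[OF \<alpha> S T]) blast
  obtain M1 where M1: "M1 \<ge> 1" "\<And>x. x \<in> {0..T} \<Longrightarrow> norm (\<alpha> x) \<le> M1" by (rule compact_norm_bound[OF \<alpha> compact_Icc]) blast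
  obtain M2 where M2: "M2 \<ge> 1" "\<And>x. x \<in> {0..T} \<Longrightarrow> norm (b0 x) \<le> M2" by (rule compact_norm_bound[OF b0 compact_Icc]) blast
  define M where "M = max M1 M2"
  have M: "M \<ge> 0" "\<And>x. x \<in> {0..T} \<Longrightarrow> norm (\<alpha> x) \<le> M" "\<And>x. x \<in> {0..T} \<Longrightarrow> norm (b0 x) \<le> M"
    using M1 M2 by (auto simp: M_def max.coboundedI1 max.coboundedI2)
  obtain Ms where Ms: "Ms \<ge> 1" "\<And>p. p \<in> {0..T} \<times> {0..T} \<Longrightarrow> norm (s_kernel \<alpha> (fst p) (snd p)) \<le> Ms"
    by (rule compact_norm_bound[OF continuous_s_kernel[OF \<alpha>, of fst snd], of "{0..T} \<times> {0..T}"])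
       (auto intro!: continuous_intros compact_Times)
  have "0 \<in> {0..T}" "0 \<in> {0..0::real}" using T by auto
  then have K0: "K \<ge> 0" using K norm_ge_zero order_trans by blast
  define \<phi> where "\<phi> x = norm (\<alpha> x - b0 x)" for x
  have c\<phi>: "continuous_on UNIV \<phi>" unfolding \<phi>_def by (intro continuous_intros \<alpha> b0)
  \<comment> \<open>\<open>c1\<close> comes from the kernel difference 2 M D acting on a solution
    bounded by K over a length at most T. The L^1 norm of the residual \<alpha> - b0 + d is then at
    most D + T c1 D = c2 D.\<close>
  define c1 where "c1 = 2 * M * K * T"
  define c2 where "c2 = 1 + c1 * T"
  have c1: "c1 \<ge> 0" and c2: "c2 \<ge> 0" using M K0 T by (auto simp: c1_def c2_def)
  have step: "\<phi> l \<le> (C * Ms * c2 + c1) * integral {0..l} \<phi>" if l: "0 \<le> l" "l \<le> T" for l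
  proof -
    have lT: "l \<in> {0..T}" using l by simp
    define D where "D = integral {0..l} \<phi>"
    have D0: "D \<ge> 0" unfolding D_def by (rule integral_nonneg) (auto intro: integrable_cont c\<phi> simp: \<phi>_def)
    have cs: "continuous_on UNIV (\<lambda>t. s_kernel \<gamma> x t ** k t)" if "continuous_on UNIV \<gamma>" "continuous_on UNIV k"
      for \<gamma> k :: "real \<Rightarrow> complex^'m1^'m2" and x
      by (intro continuous_mm continuous_s_kernel that continuous_intros)
    define e where "e x = g l x - b l x" for x
    define w where "w x = integral {0..l} (\<lambda>t. s_kernel \<alpha> x t ** e t)" for x
    define d where "d x = integral {0..l} (\<lambda>t. (s_kernel \<alpha> x t - s_kernel b0 x t) ** b l t)" for x
    have ce: "continuous_on UNIV e" unfolding e_def by (intro continuous_intros g b lT)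
    have cw: "continuous_on UNIV w" unfolding w_def
      by (intro continuous_integral_upto' continuous_mm continuous_s_kernel \<alpha> continuous_on_compose2[OF ce] continuous_intros) auto
    have w: "w x = integral {0..l} (\<lambda>t. s_kernel \<alpha> x t ** g l t) - integral {0..l} (\<lambda>t. s_kernel \<alpha> x t ** b l t)" for x
      unfolding w_def e_def mm.diff_right by (rule integral_diff) (intro integrable_cont cs \<alpha> g b lT)+
    have d: "d x = integral {0..l} (\<lambda>t. s_kernel \<alpha> x t ** b l t) - integral {0..l} (\<lambda>t. s_kernel b0 x t ** b l t)" for x
      unfolding d_def mm.diff_left by (rule integral_diff) (intro integrable_cont cs \<alpha> b0 b lT)+
    have res: "e x - w x = \<alpha> x - b0 x + d x" if "x \<in> {0..l}" for x
      unfolding w d e_def g(2)[OF lT that, symmetric] b(2)[OF lT that, symmetric] by simp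
    have d1: "norm (d x) \<le> c1 * D" if x: "x \<in> {0..l}" for x
    proof -
      have "norm (d x) \<le> integral {0..l} (\<lambda>t. (2 * M * D) * K)" unfolding d_def
      proof (rule integral_norm_bound_integral)
        show "(\<lambda>t. (s_kernel \<alpha> x t - s_kernel b0 x t) ** b l t) integrable_on {0..l}"
          unfolding mm.diff_left by (intro integrable_diff integrable_cont cs \<alpha> b0 b lT)
        show "(\<lambda>t. (2 * M * D) * K) integrable_on {0..l}" by (intro integrable_cont continuous_intros)
        fix t assume t: "t \<in> {0..l}"
        have "norm (s_kernel \<alpha> x t - s_kernel b0 x t) \<le> 2 * M * D"
          unfolding D_def \<phi>_def by (rule s_kernel_diff_le[OF \<alpha> b0 _ _ x t]) (use M l in auto)
        then show "norm ((s_kernel \<alpha> x t - s_kernel b0 x t) ** b l t) \<le> (2 * M * D) * K"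
          by (rule order_trans[OF norm_matrix_mult mult_mono[OF _ K[OF lT t]]]) (use M D0 in auto)
      qed
      also have "\<dots> = l * (2 * M * D * K)" using l by simp
      also have "\<dots> \<le> T * (2 * M * D * K)" by (rule mult_right_mono[OF l(2)]) (use M D0 K0 in auto)
      finally show ?thesis by (simp add: c1_def mult_ac)
    qed
    \<comment> \<open>w = K e satisfies w - K w = K (e - w); the outer K converts the L^1 bound of
      the residual e - w into the sup bound that the a priori estimate accepts.\<close>
    have wb: "norm (w x) \<le> C * (Ms * (c2 * D))" if "x \<in> {0..l}" for x
    proof (rule ap[OF l cw, of 1, OF _ _ _ that])
      fix x assume x: "x \<in> {0..l}"
      have "w x - integral {0..l} (\<lambda>t. s_kernel \<alpha> x t ** w t) = integral {0..l} (\<lambda>t. s_kernel \<alpha> x t ** (e t - w t))"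
        unfolding mm.diff_right w_def[of x]
        by (rule integral_diff[symmetric]) (intro integrable_cont cs \<alpha> ce cw)+
      also have "norm \<dots> \<le> integral {0..l} (\<lambda>t. Ms * (\<phi> t + c1 * D))"
      proof (rule integral_norm_bound_integral)
        show "(\<lambda>t. s_kernel \<alpha> x t ** (e t - w t)) integrable_on {0..l}"
          by (intro integrable_cont cs \<alpha> continuous_on_diff ce cw)
        show "(\<lambda>t. Ms * (\<phi> t + c1 * D)) integrable_on {0..l}" by (intro integrable_cont continuous_intros c\<phi>)
        fix t assume t: "t \<in> {0..l}"
        have "norm (e t - w t) \<le> \<phi> t + c1 * D"
          unfolding res[OF t] \<phi>_def by (rule norm_triangle_le[OF add_left_mono[OF d1[OF t]]])
        then show "norm (s_kernel \<alpha> x t ** (e t - w t)) \<le> Ms * (\<phi> t + c1 * D)"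
          by (intro order_trans[OF norm_matrix_mult] mult_mono) (use Ms(2)[of "(x, t)"] Ms(1) x t l in auto)
      qed
      also have "\<dots> = Ms * (D + l * (c1 * D))"
      proof -
        have "integral {0..l} (\<lambda>t. \<phi> t + c1 * D) = D + l * (c1 * D)"
          using integral_add[OF integrable_cont[OF c\<phi>, of 0 l] integrable_cont[of "\<lambda>_. c1 * D" 0 l]] l by (simp add: D_def)
        then show ?thesis by simp
      qed
      also have "\<dots> \<le> Ms * (c2 * D)"
      proof -
        have "l * (c1 * D) \<le> T * (c1 * D)" by (rule mult_right_mono[OF l(2)]) (use c1 D0 in simp)
        then have "D + l * (c1 * D) \<le> c2 * D" by (simp add: c2_def algebra_simps)
        then show ?thesis by (rule mult_left_mono) (use Ms in simp)
      qed
      finally show "norm (w x - 1 *\<^sub>R integral {0..l} (\<lambda>t. s_kernel \<alpha> x t ** w t)) \<le> Ms * (c2 * D)" by simp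
    qed simp_all
    have ll: "l \<in> {0..l}" using l by simp
    \<comment> \<open>The only use of the common end values: e vanishes at x = l, so the residual
      identity there expresses \<alpha> - b0 by w and d, both controlled by D.\<close>
    have "\<alpha> l - b0 l = - (w l + d l)" using res[OF ll] gb[OF lT] by (simp add: e_def algebra_simps eq_neg_iff_add_eq_0)
    then have "\<phi> l = norm (w l + d l)" by (simp only: \<phi>_def norm_minus_cancel)
    also have "\<dots> \<le> C * (Ms * (c2 * D)) + c1 * D" by (rule norm_triangle_le[OF add_mono[OF wb[OF ll] d1[OF ll]]])
    finally show ?thesis by (simp add: D_def algebra_simps)
  qed
  \<comment> \<open>The additive constant in Gronwall's inequality is 0; the summand 1 makes the
    rate strictly positive.\<close>
  have "\<phi> l \<le> 0 * exp ((C * Ms * c2 + c1 + 1) * l)"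
  proof (rule gronwall[OF c\<phi>])
    fix l assume l: "0 \<le> l" "l \<le> T"
    have "integral {0..l} \<phi> \<ge> 0" by (rule integral_nonneg) (auto intro: integrable_cont c\<phi> simp: \<phi>_def)
    then show "\<phi> l \<le> 0 + (C * Ms * c2 + c1 + 1) * integral {0..l} \<phi>" using step[OF l] by (simp add: algebra_simps)
  next
    have "C * Ms * c2 \<ge> 0" using C Ms c2 by simp
    then show "C * Ms * c2 + c1 + 1 > 0" using c1 by simp
  qed (use l in auto)
  then show ?thesis by (simp add: \<phi>_def)
qed

lemma C1_nonneg_extension:
  fixes A0 :: "real \<Rightarrow> 'a::real_normed_vector"
  assumes "C1_nonneg A0"
  obtains \<alpha> \<alpha>' where "continuous_on UNIV \<alpha>" "continuous_on UNIV \<alpha>'" "\<And>x. x \<ge> 0 \<Longrightarrow> \<alpha> x = A0 x"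
    "\<And>x. x \<ge> 0 \<Longrightarrow> (\<alpha> has_vector_derivative \<alpha>' x) (at x within {0..})"
proof -
  obtain D where D: "\<And>x. x \<ge> 0 \<Longrightarrow> (A0 has_vector_derivative D x) (at x within {0..})" "continuous_on {0..} D"
    using assms unfolding C1_nonneg_def by blast
  show thesis
  proof (rule that[of "\<lambda>x. A0 (max 0 x)" "\<lambda>x. D (max 0 x)"])
    show "continuous_on UNIV (\<lambda>x. A0 (max 0 x))"
      by (rule continuous_on_compose2[OF C1_nonneg_continuous[OF assms]]) (auto intro!: continuous_intros)
    show "continuous_on UNIV (\<lambda>x. D (max 0 x))"
      by (rule continuous_on_compose2[OF D(2)]) (auto intro!: continuous_intros)
    fix x :: real assume x: "x \<ge> 0"
    show "A0 (max 0 x) = A0 x" using x by simp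
    show "((\<lambda>x. A0 (max 0 x)) has_vector_derivative D (max 0 x)) (at x within {0..})"
      by (rule has_vector_derivative_transform[of x "{0..}" _ A0]) (use D(1)[OF x] x in auto)
  qed
qed

text \<open>The solutions are produced on [0, 1] from the rescaled kernel, where dependence on l is
  a matter of parameters, and transported back to [0, l] for comparison with the waves of the
  constructed A.\<close>

lemma A_equation_inverse:
  fixes A0 :: "real \<Rightarrow> complex^'m1^'m2"
  assumes C1: "C1_nonneg A0" and S0: "S_strictly_positive A0"
  obtains A where "mild A" "A_equation_solution A" "\<And>x. x \<ge> 0 \<Longrightarrow> A (x, 0) = A0 x"
    "C1_nonneg (\<lambda>l. A (0, l))"
    "\<And>B p. \<lbrakk>A_equation_solution B; \<And>x. x \<ge> 0 \<Longrightarrow> B (x, 0) = A0 x; p \<in> quadrant\<rbrakk> \<Longrightarrow> B p = A p"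
proof -
  obtain \<alpha> \<alpha>' where \<alpha>: "continuous_on UNIV \<alpha>" and \<alpha>': "continuous_on UNIV \<alpha>'" and \<alpha>A: "\<And>x. x \<ge> 0 \<Longrightarrow> \<alpha> x = A0 x"
    and d: "\<And>x. x \<ge> 0 \<Longrightarrow> (\<alpha> has_vector_derivative \<alpha>' x) (at x within {0..})"
    by (rule C1_nonneg_extension[OF C1]) blast
  have kA: "s_kernel \<alpha> x t = s_kernel A0 x t" for x t by (rule s_kernel_cong) (rule \<alpha>A)
  have S: "S_strictly_positive \<alpha>" using S0 unfolding S_strictly_positive_def S_op_def kA .
  have "\<forall>l. \<exists>f. l \<ge> 0 \<longrightarrow> continuous_on UNIV f \<and> (\<forall>y. f y - integral {0..1} (\<lambda>t. scaled_kernel \<alpha> l y t ** f t) = \<alpha> (l * y))"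
  proof (intro allI)
    fix l :: real
    show "\<exists>f. l \<ge> 0 \<longrightarrow> continuous_on UNIV f \<and> (\<forall>y. f y - integral {0..1} (\<lambda>t. scaled_kernel \<alpha> l y t ** f t) = \<alpha> (l * y))"
    proof (cases "l \<ge> 0")
      case True
      \<comment> \<open>The a priori estimate asks for a strictly positive horizon;
        \<open>l + 1\<close> covers l = 0 too.\<close>
      then have "l + 1 > 0" "l \<le> l + 1" by auto
      from S_apriori_scaled[OF \<alpha> S this(1)] obtain C where C: "C \<ge> 1"
        and ap: "\<And>l' \<theta> H x (f :: real \<Rightarrow> complex^'m1^'m2). \<lbrakk>0 \<le> l'; l' \<le> l + 1; continuous_on UNIV f; 0 \<le> \<theta>; \<theta> \<le> 1;
          \<And>y. y \<in> {0..1} \<Longrightarrow> norm (f y - \<theta> *\<^sub>R integral {0..1} (\<lambda>t. scaled_kernel \<alpha> l' y t ** f t)) \<le> H; x \<in> {0..1}\<rbrakk>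
          \<Longrightarrow> norm (f x) \<le> C * H" by blast
      have "continuous_on UNIV (\<lambda>y. \<alpha> (l * y))" by (intro continuous_on_compose2[OF \<alpha>] continuous_intros) auto
      have "\<exists>f. continuous_on UNIV f \<and> (\<forall>y. f y - integral {0..1} (\<lambda>t. scaled_kernel \<alpha> l y t ** f t) = \<alpha> (l * y))"
      proof (rule fredholm_exists[OF _ \<open>continuous_on UNIV (\<lambda>y. \<alpha> (l * y))\<close> C])
        show "continuous_on UNIV (\<lambda>p. scaled_kernel \<alpha> l (fst p) (snd p))" by (intro continuous_scaled_kernel \<alpha> continuous_intros)
      qed (rule ap[OF True \<open>l \<le> l + 1\<close>])
      then show ?thesis by blast
    qed blast
  qed
  from choice[OF this] obtain f where f: "\<And>l. l \<ge> 0 \<Longrightarrow> continuous_on UNIV (f l)"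
    "\<And>l y. l \<ge> 0 \<Longrightarrow> f l y - integral {0..1} (\<lambda>t. scaled_kernel \<alpha> l y t ** f l t) = \<alpha> (l * y)" by blast
  define a where "a l = f l 1" for l
  \<comment> \<open>Undoes the rescaling. At l = 0 the interval shrinks to a point and the constant
    a 0 replaces the undefined quotient x / l.\<close>
  define g where "g l x = (if l = 0 then a 0 else f l (x / l))" for l x
  have cg: "continuous_on UNIV (g l)" if l: "l \<ge> 0" for l
  proof (cases "l = 0")
    case False
    then show ?thesis unfolding g_def by (simp, intro continuous_on_compose2[OF f(1)[OF l]] continuous_intros) auto
  qed (simp add: g_def)
  have ga: "g l l = a l" if "l \<ge> 0" for l using that by (simp add: g_def a_def)
  have geq: "g l x - integral {0..l} (\<lambda>t. s_kernel \<alpha> x t ** g l t) = \<alpha> x" if l: "l \<ge> 0" and x: "x \<in> {0..l}" for l x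
  proof (cases "l = 0")
    case True
    then show ?thesis using x f(2)[of 0 1] by (simp add: g_def a_def scaled_kernel_def)
  next
    case False
    then have l0: "l > 0" using l by simp
    have "integral {0..l} (\<lambda>t. s_kernel \<alpha> (l * (x / l)) t ** f l (t / l)) = integral {0..1} (\<lambda>t. scaled_kernel \<alpha> l (x / l) t ** f l t)"
      by (rule scaled_kernel_integral[OF \<alpha> f(1)[OF l] l0]) (use x l0 in simp)
    then show ?thesis using f(2)[OF l, of "x / l"] l0 by (simp add: g_def)
  qed
  have "C1_nonneg a"
  proof (rule C1_nonneg_local)
    fix T :: real assume T: "T > 0"
    obtain D where "continuous_on {0..T} D" "\<And>l. l \<in> {0..T} \<Longrightarrow> ((\<lambda>l. f l 1) has_vector_derivative D l) (at l within {0..T})"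
      by (rule S_family_C1[OF \<alpha> \<alpha>' d S T, of f]) (use f in auto)
    then show "\<exists>D. continuous_on {0..T} D \<and> (\<forall>l\<in>{0..T}. (a has_vector_derivative D l) (at l within {0..T}))"
      unfolding a_def[abs_def] by blast
  qed
  from mild_solution_exists[OF this] obtain A where A: "mild A" "A_equation_solution A" and Aa: "\<And>l. l \<ge> 0 \<Longrightarrow> A (0, l) = a l" by blast
  have cA: "continuous_on UNIV A" using A(1) unfolding mild_def by blast
  have A0: "A (x, 0) = A0 x" if x: "x \<ge> 0" for x
  proof -
    define T where "T = x + 1"
    have T: "T > 0" "T \<ge> 0" "x \<in> {0..T}" using x by (auto simp: T_def)
    obtain K where K: "\<And>l. 0 \<le> l \<Longrightarrow> l \<le> T \<Longrightarrow> \<exists>b. continuous_on UNIV b \<and> b l = A (0, l) \<and> (\<forall>x\<in>{0..l}. norm (b x) \<le> K) \<and>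
     (\<forall>x\<in>{0..l}. b x - integral {0..l} (\<lambda>t. s_kernel (\<lambda>x. A (x, 0)) x t ** b t) = A (x, 0))"
      by (rule mild_S_equation[OF A(1) T(2)]) blast
    define P where "P l b \<longleftrightarrow> continuous_on UNIV b \<and> b l = A (0, l) \<and> (\<forall>x\<in>{0..l}. norm (b x) \<le> K) \<and>
     (\<forall>x\<in>{0..l}. b x - integral {0..l} (\<lambda>t. s_kernel (\<lambda>x. A (x, 0)) x t ** b t) = A (x, 0))" for l b
    have "\<exists>b. P l b" if "l \<in> {0..T}" for l
      unfolding P_def by (rule K) (use that in simp_all)
    then have "\<forall>l. \<exists>b. l \<in> {0..T} \<longrightarrow> P l b" by blast
    from choice[OF this] obtain b where bP: "\<And>l. l \<in> {0..T} \<Longrightarrow> P l (b l)" by blast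
    have b: "\<And>l. l \<in> {0..T} \<Longrightarrow> continuous_on UNIV (b l)" "\<And>l. l \<in> {0..T} \<Longrightarrow> b l l = A (0, l)"
      "\<And>l x. l \<in> {0..T} \<Longrightarrow> x \<in> {0..l} \<Longrightarrow> norm (b l x) \<le> K"
      "\<And>l x. l \<in> {0..T} \<Longrightarrow> x \<in> {0..l} \<Longrightarrow> b l x - integral {0..l} (\<lambda>t. s_kernel (\<lambda>x. A (x, 0)) x t ** b l t) = A (x, 0)"
      using bP unfolding P_def by blast+
    have "\<alpha> x = A (x, 0)"
    proof (rule S_solutions_determine[OF \<alpha> _ S T(1) _ _ b(1) b(4) b(3) _ T(3), of g])
      show "continuous_on UNIV (\<lambda>x. A (x, 0))" by (intro continuous_on_compose2[OF cA] continuous_intros) auto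
      fix l assume l: "l \<in> {0..T}"
      then have l0: "l \<ge> 0" by simp
      show "continuous_on UNIV (g l)" by (rule cg[OF l0])
      show "g l l = b l l" unfolding ga[OF l0] b(2)[OF l] Aa[OF l0] ..
      show "g l x - integral {0..l} (\<lambda>t. s_kernel \<alpha> x t ** g l t) = \<alpha> x" if "x \<in> {0..l}" for x by (rule geq[OF l0 that])
    qed
    then show ?thesis using \<alpha>A[OF x] by simp
  qed
  have uniq: "B p = A p" if B: "A_equation_solution B" and B0: "\<And>x. x \<ge> 0 \<Longrightarrow> B (x, 0) = A0 x" and p: "p \<in> quadrant" for B p
  proof -
    obtain A2 where A2: "mild A2" and A2B: "\<And>p. p \<in> quadrant \<Longrightarrow> A2 p = B p"
      by (rule solution_imp_mild[OF B]) blast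
    have A20: "A2 (x, 0) = \<alpha> x" if "x \<ge> 0" for x
    proof -
      have "A2 (x, 0) = B (x, 0)" by (rule A2B) (use that in \<open>simp add: quadrant_def\<close>)
      then show ?thesis using B0[OF that] \<alpha>A[OF that] by simp
    qed
    have k2: "s_kernel (\<lambda>x. A2 (x, 0)) x t = s_kernel \<alpha> x t" for x t by (rule s_kernel_cong) (rule A20)
    \<comment> \<open>The waves of the competing solution solve the same equation S_l b = \<alpha>
      with end value A2 (0, l); the a priori estimate with H = 0 gives b = g l on [0, l], in
      particular at the end point.\<close>
    have eq0: "A2 (0, l) = A (0, l)" if l: "l \<ge> 0" for l
    proof -
      have l1: "l + 1 > 0" "l \<le> l + 1" "l \<in> {0..l}" using l by auto
      obtain K where K: "\<And>l'. 0 \<le> l' \<Longrightarrow> l' \<le> l \<Longrightarrow> \<exists>b. continuous_on UNIV b \<and> b l' = A2 (0, l') \<and> (\<forall>x\<in>{0..l'}. norm (b x) \<le> K) \<and>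
        (\<forall>x\<in>{0..l'}. b x - integral {0..l'} (\<lambda>t. s_kernel (\<lambda>x. A2 (x, 0)) x t ** b t) = A2 (x, 0))"
        by (rule mild_S_equation[OF A2 l]) blast
      obtain b where b: "continuous_on UNIV b" "b l = A2 (0, l)"
        "\<And>x. x \<in> {0..l} \<Longrightarrow> b x - integral {0..l} (\<lambda>t. s_kernel (\<lambda>x. A2 (x, 0)) x t ** b t) = A2 (x, 0)"
        using K[OF l order_refl] by blast
      obtain C where ap: "\<And>l' \<theta> H x (f :: real \<Rightarrow> complex^'m1^'m2). \<lbrakk>0 \<le> l'; l' \<le> l + 1; continuous_on UNIV f; 0 \<le> \<theta>; \<theta> \<le> 1;
          \<And>x. x \<in> {0..l'} \<Longrightarrow> norm (f x - \<theta> *\<^sub>R integral {0..l'} (\<lambda>t. s_kernel \<alpha> x t ** f t)) \<le> H; x \<in> {0..l'}\<rbrakk>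
          \<Longrightarrow> norm (f x) \<le> C * H"
        by (rule S_apriori[OF \<alpha> S l1(1)]) blast
      have ii: "(\<lambda>t. s_kernel \<alpha> x t ** k t) integrable_on {0..l}" if "continuous_on UNIV k" for k :: "real \<Rightarrow> complex^'m1^'m2" and x
        by (intro integrable_cont continuous_mm continuous_s_kernel \<alpha> that continuous_intros)
      have "norm (g l l - b l) \<le> C * 0"
      proof (rule ap[OF l l1(2) _ _ _ _ l1(3), of "\<lambda>x. g l x - b x" 1 0])
        show "continuous_on UNIV (\<lambda>x. g l x - b x)" by (intro continuous_on_diff cg l b)
        fix x assume x: "x \<in> {0..l}"
        then have "x \<ge> 0" by simp
        have "integral {0..l} (\<lambda>t. s_kernel \<alpha> x t ** (g l t - b t)) = integral {0..l} (\<lambda>t. s_kernel \<alpha> x t ** g l t) - integral {0..l} (\<lambda>t. s_kernel \<alpha> x t ** b t)"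
          unfolding mm.diff_right by (rule integral_diff[OF ii[OF cg[OF l]] ii[OF b(1)]])
        then show "norm (g l x - b x - 1 *\<^sub>R integral {0..l} (\<lambda>t. s_kernel \<alpha> x t ** (g l t - b t))) \<le> 0"
          using geq[OF l x] b(3)[OF x, unfolded k2 A20[OF \<open>x \<ge> 0\<close>]] by (simp add: algebra_simps)
      qed simp_all
      then show ?thesis using ga[OF l] b(2) Aa[OF l] by simp
    qed
    obtain x l where xl: "p = (x, l)" "x \<ge> 0" "l \<ge> 0" using p by (cases p) (simp add: quadrant_def)
    have "A2 (x, l) = A (x, l)" by (rule mild_unique[OF A2 A(1) _ xl(2,3) order_refl]) (rule eq0)
    then show ?thesis using A2B[OF p] xl by simp
  qed
  have "C1_nonneg (\<lambda>l. A (0, l))" by (rule solution_imp_mild[OF A(2)])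
  with A A0 uniq show thesis by (intro that) blast+
qed

theorem theorem1p6:
  shows "(\<forall>v :: real \<Rightarrow> complex^'m2::finite^'m1::finite.
            C1_nonneg v \<longrightarrow> A_equation_solution (\<lambda>p. A_fun v (fst p) (snd p)))
       \<and> (\<forall>A0 :: real \<Rightarrow> complex^'m1^'m2.
            C1_nonneg A0 \<and> S_strictly_positive A0 \<longrightarrow>
            (\<exists>A. A_equation_solution A \<and> (\<forall>x\<ge>0. A (x, 0) = A0 x)
               \<and> (\<forall>B. A_equation_solution B \<and> (\<forall>x\<ge>0. B (x, 0) = A0 x)
                      \<longrightarrow> (\<forall>p\<in>quadrant. B p = A p))
               \<and> (\<exists>v :: real \<Rightarrow> complex^'m2^'m1. C1_nonneg v
                    \<and> (\<forall>l\<ge>0. v l = mscale (- \<i>) (madj (A (0, l))))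
                    \<and> (\<forall>x l. x \<ge> 0 \<longrightarrow> l \<ge> 0 \<longrightarrow> A_fun v x l = A (x, l)))))"
proof (intro conjI allI impI)
  show "A_equation_solution (\<lambda>p. A_fun v (fst p) (snd p))" if "C1_nonneg v" for v :: "real \<Rightarrow> complex^'m2^'m1"
    by (rule A_fun_solution[OF that])
next
  fix A0 :: "real \<Rightarrow> complex^'m1^'m2" assume "C1_nonneg A0 \<and> S_strictly_positive A0"
  then have "C1_nonneg A0" "S_strictly_positive A0" by blast+
  then obtain A where A: "mild A" "A_equation_solution A" and A0: "\<And>x. x \<ge> 0 \<Longrightarrow> A (x, 0) = A0 x"
    and C1: "C1_nonneg (\<lambda>l. A (0, l))"
    and uniq: "\<And>B p. \<lbrakk>A_equation_solution B; \<And>x. x \<ge> 0 \<Longrightarrow> B (x, 0) = A0 x; p \<in> quadrant\<rbrakk> \<Longrightarrow> B p = A p"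
    by (rule A_equation_inverse) blast
  define v where "v l = mscale (- \<i>) (madj (A (0, l)))" for l
  have v: "C1_nonneg v" unfolding v_def by (rule C1_nonneg_mscale_madj[OF C1])
  \<comment> \<open>The map M -> -i M* is its own inverse, so the formula for \<open>v\<close> also
    expresses the boundary value of A by \<open>v\<close>.\<close>
  have "A (0, l) = mscale (- \<i>) (madj (v l))" for l
    by (simp add: v_def vec_eq_iff flip: mult.assoc)
  then have "A_fun v x l = A (x, l)" if "x \<ge> 0" "l \<ge> 0" for x l
    by (intro A_fun_eq[OF v A] that)
  then show "\<exists>A. A_equation_solution A \<and> (\<forall>x\<ge>0. A (x, 0) = A0 x)
               \<and> (\<forall>B. A_equation_solution B \<and> (\<forall>x\<ge>0. B (x, 0) = A0 x) \<longrightarrow> (\<forall>p\<in>quadrant. B p = A p))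
               \<and> (\<exists>v :: real \<Rightarrow> complex^'m2^'m1. C1_nonneg v
                    \<and> (\<forall>l\<ge>0. v l = mscale (- \<i>) (madj (A (0, l))))
                    \<and> (\<forall>x l. x \<ge> 0 \<longrightarrow> l \<ge> 0 \<longrightarrow> A_fun v x l = A (x, l)))"
    using A(2) A0 uniq v v_def by (intro exI[of _ A] exI[of _ v] conjI allI impI ballI) blast+
qed

end
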